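(* Let $\mathcal{C}$ be a small category where every map factors as a split epimorphism followed by a monomorphism. If $\mathcal{C}$ satisfies the ascending chain condition (ACC) then, for any object $X$ in $\widehat{\mathcal{C}}$, the composite $\widehat{\mathcal{C}}/X \to \widehat{\mathcal{C}} \to \mathbf{Set}$ has a level é, and it coincides with $\mathrm{D}X \to \widehat{\mathcal{C}}/X$.
   Context: For a small category $\mathcal{C}$, $\widehat{\mathcal{C}}$ denotes the topos of presheaves on $\mathcal{C}$. For $X$ in $\widehat{\mathcal{C}}$, $\mathcal{C}/X$ denotes the category of elements of $X$: objects are pairs $(x,C)$ with $x\in XC$, and maps $(x,C)\to(y,D)$ are maps $f:C\to D$ in $\mathcal{C}$ with $y\cdot f=x$. One has $\widehat{\mathcal{C}}/X\cong\widehat{\mathcal{C}/X}$. ACC: $\mathcal{C}$ satisfies the ascending chain condition if for every object $C$ and every sequence of monomorphisms $m_n:C_n\to C_{n+1}$ and $i_n:C_n\to C$ ($n\in\mathbb{N}$) with $i_{n+1}m_n=i_n$ for all $n$, there is a $t\in\mathbb{N}$ such that $m_t$ is an isomorphism. A subtopos $l:\mathcal{L}\to\mathcal{E}$ is a level (essential) if the inverse image $l^*$ has a left adjoint $l_!$; levels are ordered by factorization of inclusions. For a full subcategory $\mathcal{B}\to\mathcal{A}$ of a small category, the induced level $\widehat{\mathcal{B}}\to\widehat{\mathcal{A}}$ is the one whose inverse image is restriction along $\mathcal{B}^{\mathrm{op}}\to\mathcal{A}^{\mathrm{op}}$. A geometric morphism $f:\mathcal{F}\to\mathcal{S}$ is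 localic if every object of $\mathcal{F}$ is a subquotient of one of the form $f^*A$ with $A$ in $\mathcal{S}$. A geometric morphism $g:\mathcal{G}\to\mathcal{S}$ is an étendue if there is a well-supported object $G$ in $\mathcal{G}$ (i.e. $G\to1$ is epi) such that the composite $\mathcal{G}/G\to\mathcal{G}\to\mathcal{S}$ is localic. A geometric morphism $f:\mathcal{F}\to\mathcal{S}$ has a level é if $\mathcal{F}$ has a largest level $\mathcal{L}\to\mathcal{F}$ such that $\mathcal{L}\to\mathcal{F}\to\mathcal{S}$ is an étendue; that largest level is level é. An object of a category is minimal if every map with that object as domain is monic; $\mathcal{A}^{\ast}$ denotes the full subcategory of minimal objects of $\mathcal{A}$. For $X$ in $\widehat{\mathcal{C}}$, $\mathrm{D}X:=\widehat{(\mathcal{C}/X)^{\ast}}\to\widehat{\mathcal{C}/X}\cong\widehat{\mathcal{C}}/X$ is the level induced by the full inclusion $(\mathcal{C}/X)^{\ast}\to\mathcal{C}/X$. *)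

theory Defs
  imports "HOL-Library.Equipollence"
begin

section \<open>Categories and functors\<close>

record ('o, 'a) cat =
  Obj :: "'o set"
  Arr :: "'a set"
  Dom :: "'a \<Rightarrow> 'o"
  Cod :: "'a \<Rightarrow> 'o"
  Idn :: "'o \<Rightarrow> 'a"
  Comp :: "'a \<Rightarrow> 'a \<Rightarrow> 'a"  (infixl "\<odot>\<index>" 70)

definition hom :: "('o, 'a) cat \<Rightarrow> 'o \<Rightarrow> 'o \<Rightarrow> 'a set" where
  "hom C a b = {f \<in> Arr C. Dom C f = a \<and> Cod C f = b}"

locale category =
  fixes C :: "('o, 'a) cat" (structure)
  assumes dom_obj: "f \<in> Arr C \<Longrightarrow> Dom C f \<in> Obj C"
    and cod_obj: "f \<in> Arr C \<Longrightarrow> Cod C f \<in> Obj C"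
    and idn_hom: "a \<in> Obj C \<Longrightarrow> Idn C a \<in> hom C a a"
    and comp_hom: "\<lbrakk>f \<in> hom C a b; g \<in> hom C b c\<rbrakk> \<Longrightarrow> g \<odot> f \<in> hom C a c"
    and idn_left: "f \<in> hom C a b \<Longrightarrow> Idn C b \<odot> f = f"
    and idn_right: "f \<in> hom C a b \<Longrightarrow> f \<odot> Idn C a = f"
    and comp_assoc: "\<lbrakk>f \<in> hom C a b; g \<in> hom C b c; h \<in> hom C c d\<rbrakk>
      \<Longrightarrow> h \<odot> (g \<odot> f) = (h \<odot> g) \<odot> f"

definition mono_arr :: "('o, 'a) cat \<Rightarrow> 'a \<Rightarrow> bool" where
  "mono_arr C m \<longleftrightarrow> m \<in> Arr C \<and>
     (\<forall>a. \<forall>u \<in> hom C a (Dom C m). \<forall>v \<in> hom C a (Dom C m).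
        m \<odot>\<^bsub>C\<^esub> u = m \<odot>\<^bsub>C\<^esub> v \<longrightarrow> u = v)"

definition epi_arr :: "('o, 'a) cat \<Rightarrow> 'a \<Rightarrow> bool" where
  "epi_arr C e \<longleftrightarrow> e \<in> Arr C \<and>
     (\<forall>b. \<forall>u \<in> hom C (Cod C e) b. \<forall>v \<in> hom C (Cod C e) b.
        u \<odot>\<^bsub>C\<^esub> e = v \<odot>\<^bsub>C\<^esub> e \<longrightarrow> u = v)"

definition split_epi_arr :: "('o, 'a) cat \<Rightarrow> 'a \<Rightarrow> bool" where
  "split_epi_arr C e \<longleftrightarrow> e \<in> Arr C \<and>
     (\<exists>s \<in> hom C (Cod C e) (Dom C e). e \<odot>\<^bsub>C\<^esub> s = Idn C (Cod C e))"

definition iso_arr :: "('o, 'a) cat \<Rightarrow> 'a \<Rightarrow> bool" where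
  "iso_arr C f \<longleftrightarrow> f \<in> Arr C \<and>
     (\<exists>g \<in> hom C (Cod C f) (Dom C f).
        f \<odot>\<^bsub>C\<^esub> g = Idn C (Cod C f) \<and> g \<odot>\<^bsub>C\<^esub> f = Idn C (Dom C f))"

definition terminal_obj :: "('o, 'a) cat \<Rightarrow> 'o \<Rightarrow> bool" where
  "terminal_obj C t \<longleftrightarrow> t \<in> Obj C \<and> (\<forall>a \<in> Obj C. \<exists>!f. f \<in> hom C a t)"

definition full_subcat :: "('o, 'a) cat \<Rightarrow> 'o set \<Rightarrow> ('o, 'a) cat" where
  "full_subcat C P =
     C\<lparr>Obj := Obj C \<inter> P, Arr := {f \<in> Arr C. Dom C f \<in> P \<and> Cod C f \<in> P}\<rparr>"

record ('o, 'a, 'p, 'b) ftor =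
  on_obj :: "'o \<Rightarrow> 'p"
  on_arr :: "'a \<Rightarrow> 'b"

definition is_functor ::
  "('o, 'a) cat \<Rightarrow> ('p, 'b) cat \<Rightarrow> ('o, 'a, 'p, 'b) ftor \<Rightarrow> bool" where
  "is_functor A B F \<longleftrightarrow> category A \<and> category B \<and>
     (\<forall>a \<in> Obj A. on_obj F a \<in> Obj B) \<and>
     (\<forall>f \<in> Arr A. on_arr F f \<in> hom B (on_obj F (Dom A f)) (on_obj F (Cod A f))) \<and>
     (\<forall>a \<in> Obj A. on_arr F (Idn A a) = Idn B (on_obj F a)) \<and>
     (\<forall>f \<in> Arr A. \<forall>g \<in> Arr A. Cod A f = Dom A g \<longrightarrow>
        on_arr F (g \<odot>\<^bsub>A\<^esub> f) = on_arr F g \<odot>\<^bsub>B\<^esub> on_arr F f)"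

definition id_ftor :: "('o, 'a, 'o, 'a) ftor" where
  "id_ftor = \<lparr>on_obj = id, on_arr = id\<rparr>"

definition comp_ftor ::
  "('p, 'b, 'q, 'c) ftor \<Rightarrow> ('o, 'a, 'p, 'b) ftor \<Rightarrow> ('o, 'a, 'q, 'c) ftor" (infixl "\<circ>\<^sub>F" 65) where
  "G \<circ>\<^sub>F F = \<lparr>on_obj = on_obj G \<circ> on_obj F, on_arr = on_arr G \<circ> on_arr F\<rparr>"

definition full_faithful ::
  "('o, 'a) cat \<Rightarrow> ('p, 'b) cat \<Rightarrow> ('o, 'a, 'p, 'b) ftor \<Rightarrow> bool" where
  "full_faithful A B F \<longleftrightarrow> is_functor A B F \<and>
     (\<forall>a \<in> Obj A. \<forall>b \<in> Obj A.
        bij_betw (on_arr F) (hom A a b) (hom B (on_obj F a) (on_obj F b)))"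

definition nat_trans ::
  "('o, 'a) cat \<Rightarrow> ('p, 'b) cat \<Rightarrow> ('o, 'a, 'p, 'b) ftor \<Rightarrow> ('o, 'a, 'p, 'b) ftor
     \<Rightarrow> ('o \<Rightarrow> 'b) \<Rightarrow> bool" where
  "nat_trans A B F G t \<longleftrightarrow> is_functor A B F \<and> is_functor A B G \<and>
     (\<forall>a \<in> Obj A. t a \<in> hom B (on_obj F a) (on_obj G a)) \<and>
     (\<forall>f \<in> Arr A. t (Cod A f) \<odot>\<^bsub>B\<^esub> on_arr F f = on_arr G f \<odot>\<^bsub>B\<^esub> t (Dom A f))"

definition nat_isomorphic ::
  "('o, 'a) cat \<Rightarrow> ('p, 'b) cat \<Rightarrow> ('o, 'a, 'p, 'b) ftor \<Rightarrow> ('o, 'a, 'p, 'b) ftor \<Rightarrow> bool" where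
  "nat_isomorphic A B F G \<longleftrightarrow>
     (\<exists>t. nat_trans A B F G t \<and> (\<forall>a \<in> Obj A. iso_arr B (t a)))"

text \<open>\<open>adjoint A B L R\<close>: the functor \<open>L : A \<rightarrow> B\<close> is left adjoint to \<open>R : B \<rightarrow> A\<close>.\<close>

definition adjoint ::
  "('o, 'a) cat \<Rightarrow> ('p, 'b) cat \<Rightarrow> ('o, 'a, 'p, 'b) ftor \<Rightarrow> ('p, 'b, 'o, 'a) ftor \<Rightarrow> bool" where
  "adjoint A B L R \<longleftrightarrow> is_functor A B L \<and> is_functor B A R \<and>
     (\<exists>\<eta> \<epsilon>. nat_trans A A id_ftor (R \<circ>\<^sub>F L) \<eta> \<and> nat_trans B B (L \<circ>\<^sub>F R) id_ftor \<epsilon> \<and>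
        (\<forall>a \<in> Obj A. \<epsilon> (on_obj L a) \<odot>\<^bsub>B\<^esub> on_arr L (\<eta> a) = Idn B (on_obj L a)) \<and>
        (\<forall>b \<in> Obj B. on_arr R (\<epsilon> b) \<odot>\<^bsub>A\<^esub> \<eta> (on_obj R b) = Idn A (on_obj R b)))"

definition cone ::
  "('j, 'i) cat \<Rightarrow> ('o, 'a) cat \<Rightarrow> ('j, 'i, 'o, 'a) ftor \<Rightarrow> 'o \<Rightarrow> ('j \<Rightarrow> 'a) \<Rightarrow> bool" where
  "cone J A D c p \<longleftrightarrow> c \<in> Obj A \<and>
     (\<forall>j \<in> Obj J. p j \<in> hom A c (on_obj D j)) \<and>
     (\<forall>u \<in> Arr J. on_arr D u \<odot>\<^bsub>A\<^esub> p (Dom J u) = p (Cod J u))"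

definition limit_cone ::
  "('j, 'i) cat \<Rightarrow> ('o, 'a) cat \<Rightarrow> ('j, 'i, 'o, 'a) ftor \<Rightarrow> 'o \<Rightarrow> ('j \<Rightarrow> 'a) \<Rightarrow> bool" where
  "limit_cone J A D c p \<longleftrightarrow> cone J A D c p \<and>
     (\<forall>d q. cone J A D d q \<longrightarrow>
        (\<exists>!h. h \<in> hom A d c \<and> (\<forall>j \<in> Obj J. p j \<odot>\<^bsub>A\<^esub> h = q j)))"

text \<open>Finite-limit preservation. Every finite category is isomorphic to one whose objects and
  arrows are natural numbers, so it suffices to take diagrams of such shapes.\<close>

definition lex_functor ::
  "('o, 'a) cat \<Rightarrow> ('p, 'b) cat \<Rightarrow> ('o, 'a, 'p, 'b) ftor \<Rightarrow> bool" where
  "lex_functor A B F \<longleftrightarrow> is_functor A B F \<and>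
     (\<forall>(J :: (nat, nat) cat) D c p.
        category J \<and> finite (Obj J) \<and> finite (Arr J) \<and> is_functor J A D \<and> limit_cone J A D c p
        \<longrightarrow> limit_cone J B (F \<circ>\<^sub>F D) (on_obj F c) (on_arr F \<circ> p))"


section \<open>Geometric morphisms, levels and \'etendues\<close>

text \<open>A geometric morphism \<open>f : F \<rightarrow> S\<close> is recorded by its inverse image \<open>S \<rightarrow> F\<close> and its
  direct image \<open>F \<rightarrow> S\<close>. That the two categories are toposes is not built into the predicate.
  It is only ever applied to presheaf toposes, their slices, and the domains of geometric
  inclusions into these (with their slices), and all of those are toposes.\<close>

record ('fo, 'fa, 'so, 'sa) geom =
  inverse_image :: "('so, 'sa, 'fo, 'fa) ftor"
  direct_image :: "('fo, 'fa, 'so, 'sa) ftor"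

definition geometric_morphism ::
  "('fo, 'fa) cat \<Rightarrow> ('so, 'sa) cat \<Rightarrow> ('fo, 'fa, 'so, 'sa) geom \<Rightarrow> bool" where
  "geometric_morphism F S f \<longleftrightarrow>
     adjoint S F (inverse_image f) (direct_image f) \<and> lex_functor S F (inverse_image f)"

definition comp_geom ::
  "('fo, 'fa, 'so, 'sa) geom \<Rightarrow> ('lo, 'la, 'fo, 'fa) geom \<Rightarrow> ('lo, 'la, 'so, 'sa) geom"
  (infixl "\<circ>\<^sub>G" 65) where
  "f \<circ>\<^sub>G l = \<lparr>inverse_image = inverse_image l \<circ>\<^sub>F inverse_image f,
              direct_image = direct_image f \<circ>\<^sub>F direct_image l\<rparr>"

definition subtopos ::
  "('lo, 'la) cat \<Rightarrow> ('fo, 'fa) cat \<Rightarrow> ('lo, 'la, 'fo, 'fa) geom \<Rightarrow> bool" where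
  "subtopos L F l \<longleftrightarrow> geometric_morphism L F l \<and> full_faithful L F (direct_image l)"

definition level ::
  "('lo, 'la) cat \<Rightarrow> ('fo, 'fa) cat \<Rightarrow> ('lo, 'la, 'fo, 'fa) geom \<Rightarrow> bool" where
  "level L F l \<longleftrightarrow> subtopos L F l \<and> (\<exists>l_shriek. adjoint L F l_shriek (inverse_image l))"

text \<open>Geometric morphisms are compared up to natural isomorphism of their inverse images.\<close>

definition factors_through ::
  "('mo, 'ma) cat \<Rightarrow> ('lo, 'la) cat \<Rightarrow> ('fo, 'fa) cat
     \<Rightarrow> ('mo, 'ma, 'fo, 'fa) geom \<Rightarrow> ('lo, 'la, 'fo, 'fa) geom \<Rightarrow> bool" where
  "factors_through M L F m l \<longleftrightarrow>
     (\<exists>k. geometric_morphism M L k \<and>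
          nat_isomorphic F M (inverse_image (l \<circ>\<^sub>G k)) (inverse_image m))"

definition slice :: "('o, 'a) cat \<Rightarrow> 'o \<Rightarrow> ('a, 'a \<times> 'a \<times> 'a) cat" where
  "slice E G = \<lparr>
     Obj = {u \<in> Arr E. Cod E u = G},
     Arr = {(u, h, v). u \<in> Arr E \<and> Cod E u = G \<and> v \<in> Arr E \<and> Cod E v = G \<and>
              h \<in> hom E (Dom E u) (Dom E v) \<and> v \<odot>\<^bsub>E\<^esub> h = u},
     Dom = (\<lambda>(u, h, v). u),
     Cod = (\<lambda>(u, h, v). v),
     Idn = (\<lambda>u. (u, Idn E (Dom E u), u)),
     Comp = (\<lambda>(v', k, w) (u, h, v). (u, k \<odot>\<^bsub>E\<^esub> h, w))\<rparr>"

definition is_product :: "('o, 'a) cat \<Rightarrow> 'o \<Rightarrow> 'o \<Rightarrow> 'o \<Rightarrow> 'a \<Rightarrow> 'a \<Rightarrow> bool" where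
  "is_product E a b P p q \<longleftrightarrow> P \<in> Obj E \<and> p \<in> hom E P a \<and> q \<in> hom E P b \<and>
     (\<forall>c \<in> Obj E. \<forall>u \<in> hom E c a. \<forall>v \<in> hom E c b.
        \<exists>!h. h \<in> hom E c P \<and> p \<odot>\<^bsub>E\<^esub> h = u \<and> q \<odot>\<^bsub>E\<^esub> h = v)"

text \<open>\<open>p\<close> is the canonical geometric morphism \<open>E/G \<rightarrow> E\<close>: its inverse image sends \<open>Y\<close> to a product
  projection \<open>Y \<times> G \<rightarrow> G\<close> and \<open>k\<close> to \<open>k \<times> G\<close>. It depends on a choice of products and of a
  right adjoint, hence is given as a predicate rather than as a function.\<close>

definition slice_geom ::
  "('o, 'a) cat \<Rightarrow> 'o \<Rightarrow> ('a, 'a \<times> 'a \<times> 'a, 'o, 'a) geom \<Rightarrow> bool" where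
  "slice_geom E G p \<longleftrightarrow> G \<in> Obj E \<and> geometric_morphism (slice E G) E p \<and>
     (\<exists>\<pi>. (\<forall>Y \<in> Obj E. let q = on_obj (inverse_image p) Y
              in is_product E Y G (Dom E q) (\<pi> Y) q) \<and>
          (\<forall>k \<in> Arr E. let h = fst (snd (on_arr (inverse_image p) k))
              in \<pi> (Cod E k) \<odot>\<^bsub>E\<^esub> h = k \<odot>\<^bsub>E\<^esub> \<pi> (Dom E k)))"

definition subquotient :: "('o, 'a) cat \<Rightarrow> 'o \<Rightarrow> 'o \<Rightarrow> bool" where
  "subquotient E B A \<longleftrightarrow>
     (\<exists>m e. mono_arr E m \<and> epi_arr E e \<and> Dom E m = Dom E e \<and> Cod E m = A \<and> Cod E e = B)"

definition localic ::
  "('fo, 'fa) cat \<Rightarrow> ('so, 'sa) cat \<Rightarrow> ('fo, 'fa, 'so, 'sa) geom \<Rightarrow> bool" where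
  "localic F S f \<longleftrightarrow> geometric_morphism F S f \<and>
     (\<forall>B \<in> Obj F. \<exists>A \<in> Obj S. subquotient F B (on_obj (inverse_image f) A))"

definition well_supported :: "('o, 'a) cat \<Rightarrow> 'o \<Rightarrow> bool" where
  "well_supported E G \<longleftrightarrow> G \<in> Obj E \<and> (\<exists>t e. terminal_obj E t \<and> e \<in> hom E G t \<and> epi_arr E e)"

definition etendue ::
  "('fo, 'fa) cat \<Rightarrow> ('so, 'sa) cat \<Rightarrow> ('fo, 'fa, 'so, 'sa) geom \<Rightarrow> bool" where
  "etendue F S g \<longleftrightarrow> geometric_morphism F S g \<and>
     (\<exists>G p. well_supported F G \<and> slice_geom F G p \<and> localic (slice F G) S (g \<circ>\<^sub>G p))"

text \<open>\<open>l : L \<rightarrow> F\<close> is level \'e of \<open>f : F \<rightarrow> S\<close>. HOL cannot quantify over types inside a formula, so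
  the types of objects and arrows of the competing levels \<open>M\<close> are parameters; a theorem that
  leaves them as type variables covers competing levels of every type.\<close>

definition is_level_e ::
  "'mo itself \<Rightarrow> 'ma itself \<Rightarrow> ('fo, 'fa) cat \<Rightarrow> ('so, 'sa) cat \<Rightarrow> ('fo, 'fa, 'so, 'sa) geom
     \<Rightarrow> ('lo, 'la) cat \<Rightarrow> ('lo, 'la, 'fo, 'fa) geom \<Rightarrow> bool" where
  "is_level_e _ _ F S f L l \<longleftrightarrow> level L F l \<and> etendue L S (f \<circ>\<^sub>G l) \<and>
     (\<forall>(M :: ('mo, 'ma) cat) m.
        level M F m \<and> etendue M S (f \<circ>\<^sub>G m) \<longrightarrow> factors_through M L F m l)"


section \<open>Sets and presheaves\<close>

text \<open>The category of sets is taken relative to a Grothendieck universe, given as a type \<open>'u\<close>: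
  the small sets are the subsets of \<open>'u\<close> of cardinality less than that of \<open>'u\<close>. If \<open>U\<close> is
  a Grothendieck universe in set theory, the elements of \<open>U\<close> are exactly the subsets of \<open>U\<close> of
  cardinality less than that of \<open>U\<close>, and the closure conditions below hold. Conversely they say
  that the cardinality of \<open>'u\<close> is a regular strong limit; uncountability is not
  demanded, so \<open>nat\<close>, whose small sets are the finite ones, is the least instance.\<close>

definition grothendieck_universe :: "'u itself \<Rightarrow> bool" where
  "grothendieck_universe _ \<longleftrightarrow> infinite (UNIV :: 'u set) \<and>
     (\<forall>A :: 'u set. A \<prec> (UNIV :: 'u set) \<longrightarrow> Pow A \<prec> (UNIV :: 'u set)) \<and>
     (\<forall>(I :: 'u set) (A :: 'u \<Rightarrow> 'u set).
        I \<prec> (UNIV :: 'u set) \<and> (\<forall>i \<in> I. A i \<prec> (UNIV :: 'u set))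
        \<longrightarrow> (\<Union>i \<in> I. A i) \<prec> (UNIV :: 'u set))"

definition small_category :: "'u itself \<Rightarrow> ('o, 'a) cat \<Rightarrow> bool" where
  "small_category _ C \<longleftrightarrow> category C \<and> Obj C \<prec> (UNIV :: 'u set) \<and> Arr C \<prec> (UNIV :: 'u set)"

definition Sets :: "('u set, 'u set \<times> ('u \<Rightarrow> 'u) \<times> 'u set) cat" where
  "Sets = \<lparr>
     Obj = {A. A \<prec> (UNIV :: 'u set)},
     Arr = {(A, f, B). A \<prec> (UNIV :: 'u set) \<and> B \<prec> (UNIV :: 'u set) \<and> f \<in> A \<rightarrow>\<^sub>E B},
     Dom = (\<lambda>(A, f, B). A),
     Cod = (\<lambda>(A, f, B). B),
     Idn = (\<lambda>A. (A, \<lambda>x\<in>A. x, A)),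
     Comp = (\<lambda>(B', g, D) (A, f, B). (A, compose A g f, D))\<rparr>"

text \<open>\<open>act X f y\<close> is \<open>y \<cdot> f\<close>.\<close>

record ('o, 'a, 'u) psh =
  fib :: "'o \<Rightarrow> 'u set"
  act :: "'a \<Rightarrow> 'u \<Rightarrow> 'u"

definition is_presheaf :: "('o, 'a) cat \<Rightarrow> ('o, 'a, 'u) psh \<Rightarrow> bool" where
  "is_presheaf C X \<longleftrightarrow>
     fib X \<in> Obj C \<rightarrow>\<^sub>E {A. A \<prec> (UNIV :: 'u set)} \<and>
     act X \<in> (\<Pi>\<^sub>E f \<in> Arr C. fib X (Cod C f) \<rightarrow>\<^sub>E fib X (Dom C f)) \<and>
     (\<forall>c \<in> Obj C. \<forall>x \<in> fib X c. act X (Idn C c) x = x) \<and>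
     (\<forall>f \<in> Arr C. \<forall>g \<in> Arr C. Cod C f = Dom C g \<longrightarrow>
        (\<forall>x \<in> fib X (Cod C g). act X (g \<odot>\<^bsub>C\<^esub> f) x = act X f (act X g x)))"

definition is_psh_map ::
  "('o, 'a) cat \<Rightarrow> ('o, 'a, 'u) psh \<Rightarrow> ('o \<Rightarrow> 'u \<Rightarrow> 'u) \<Rightarrow> ('o, 'a, 'u) psh \<Rightarrow> bool" where
  "is_psh_map C X t Y \<longleftrightarrow> is_presheaf C X \<and> is_presheaf C Y \<and>
     t \<in> (\<Pi>\<^sub>E c \<in> Obj C. fib X c \<rightarrow>\<^sub>E fib Y c) \<and>
     (\<forall>f \<in> Arr C. \<forall>x \<in> fib X (Cod C f).
        t (Dom C f) (act X f x) = act Y f (t (Cod C f) x))"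

type_synonym ('o, 'a, 'u) psh_arr =
  "('o, 'a, 'u) psh \<times> ('o \<Rightarrow> 'u \<Rightarrow> 'u) \<times> ('o, 'a, 'u) psh"

definition Psh :: "('o, 'a) cat \<Rightarrow> (('o, 'a, 'u) psh, ('o, 'a, 'u) psh_arr) cat" where
  "Psh C = \<lparr>
     Obj = {X. is_presheaf C X},
     Arr = {(X, t, Y). is_psh_map C X t Y},
     Dom = (\<lambda>(X, t, Y). X),
     Cod = (\<lambda>(X, t, Y). Y),
     Idn = (\<lambda>X. (X, \<lambda>c\<in>Obj C. \<lambda>x\<in>fib X c. x, X)),
     Comp = (\<lambda>(Y', s, Z) (X, t, Y). (X, \<lambda>c\<in>Obj C. compose (fib X c) (s c) (t c), Z))\<rparr>"

definition elements ::
  "('o, 'a) cat \<Rightarrow> ('o, 'a, 'u) psh \<Rightarrow> ('u \<times> 'o, ('u \<times> 'o) \<times> 'a \<times> ('u \<times> 'o)) cat" where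
  "elements C X = \<lparr>
     Obj = {(x, c). c \<in> Obj C \<and> x \<in> fib X c},
     Arr = {((x, c), f, (y, d)). c \<in> Obj C \<and> x \<in> fib X c \<and> d \<in> Obj C \<and> y \<in> fib X d \<and>
              f \<in> hom C c d \<and> act X f y = x},
     Dom = (\<lambda>(a, f, b). a),
     Cod = (\<lambda>(a, f, b). b),
     Idn = (\<lambda>(x, c). ((x, c), Idn C c, (x, c))),
     Comp = (\<lambda>(b', g, d) (a, f, b). (a, g \<odot>\<^bsub>C\<^esub> f, d))\<rparr>"

definition restriction_ftor ::
  "('o, 'a) cat
     \<Rightarrow> (('o, 'a, 'u) psh, ('o, 'a, 'u) psh_arr, ('o, 'a, 'u) psh, ('o, 'a, 'u) psh_arr) ftor" where
  "restriction_ftor B =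
     (let r = (\<lambda>Y. \<lparr>fib = restrict (fib Y) (Obj B), act = restrict (act Y) (Arr B)\<rparr>)
      in \<lparr>on_obj = r, on_arr = (\<lambda>(Y, t, Z). (r Y, restrict t (Obj B), r Z))\<rparr>)"

text \<open>The equivalence \<open>Psh C / X \<rightarrow> Psh (C/X)\<close> sends \<open>\<phi> : Y \<rightarrow> X\<close> to the presheaf of its fibres
  \<open>(x, c) \<mapsto> {y \<in> Y c. \<phi>\<^sub>c y = x}\<close>.\<close>

definition fibres_psh ::
  "('o, 'a) cat \<Rightarrow> ('o, 'a, 'u) psh \<Rightarrow> ('o, 'a, 'u) psh_arr
     \<Rightarrow> ('u \<times> 'o, ('u \<times> 'o) \<times> 'a \<times> ('u \<times> 'o), 'u) psh" where
  "fibres_psh C X = (\<lambda>(Y, \<phi>, _).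
     (let F = (\<lambda>(x, c). {y \<in> fib Y c. \<phi> c y = x})
      in \<lparr>fib = restrict F (Obj (elements C X)),
          act = (\<lambda>(a, f, b) \<in> Arr (elements C X). \<lambda>y \<in> F b. act Y f y)\<rparr>))"

definition fibres_ftor ::
  "('o, 'a) cat \<Rightarrow> ('o, 'a, 'u) psh
     \<Rightarrow> (('o, 'a, 'u) psh_arr,
         ('o, 'a, 'u) psh_arr \<times> ('o, 'a, 'u) psh_arr \<times> ('o, 'a, 'u) psh_arr,
         ('u \<times> 'o, ('u \<times> 'o) \<times> 'a \<times> ('u \<times> 'o), 'u) psh,
         ('u \<times> 'o, ('u \<times> 'o) \<times> 'a \<times> ('u \<times> 'o), 'u) psh_arr) ftor" where
  "fibres_ftor C X = \<lparr>
     on_obj = fibres_psh C X,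
     on_arr = (\<lambda>(u, (_, t, _), v).
       (fibres_psh C X u,
        (\<lambda>(x, c) \<in> Obj (elements C X). \<lambda>y \<in> fib (fibres_psh C X u) (x, c). t c y),
        fibres_psh C X v))\<rparr>"


section \<open>The hypotheses on the site and the level \<open>D X\<close>\<close>

definition split_epi_mono_factorizations :: "('o, 'a) cat \<Rightarrow> bool" where
  "split_epi_mono_factorizations C \<longleftrightarrow>
     (\<forall>f \<in> Arr C. \<exists>e m. split_epi_arr C e \<and> mono_arr C m \<and> Cod C e = Dom C m \<and>
        f = m \<odot>\<^bsub>C\<^esub> e)"

definition ascending_chain_condition :: "('o, 'a) cat \<Rightarrow> bool" where
  "ascending_chain_condition C \<longleftrightarrow>
     (\<forall>c \<in> Obj C. \<forall>(cs :: nat \<Rightarrow> 'o) m i.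
        (\<forall>n. cs n \<in> Obj C \<and>
             m n \<in> hom C (cs n) (cs (Suc n)) \<and> mono_arr C (m n) \<and>
             i n \<in> hom C (cs n) c \<and> mono_arr C (i n) \<and>
             i (Suc n) \<odot>\<^bsub>C\<^esub> m n = i n)
        \<longrightarrow> (\<exists>t. iso_arr C (m t)))"

definition minimal_obj :: "('o, 'a) cat \<Rightarrow> 'o \<Rightarrow> bool" where
  "minimal_obj A a \<longleftrightarrow> a \<in> Obj A \<and> (\<forall>f \<in> Arr A. Dom A f = a \<longrightarrow> mono_arr A f)"

definition minimal_subcat :: "('o, 'a) cat \<Rightarrow> ('o, 'a) cat" where
  "minimal_subcat A = full_subcat A {a. minimal_obj A a}"

text \<open>\<open>is_D C X d\<close>: \<open>d\<close> is the geometric morphism \<open>Psh (minimal_subcat (C/X)) \<rightarrow> Psh (C/X) \<cong> Psh C / X\<close>.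
  Its inverse image is given explicitly, and its direct image is then determined up to isomorphism.\<close>

definition is_D ::
  "('o, 'a) cat \<Rightarrow> ('o, 'a, 'u) psh
     \<Rightarrow> (('u \<times> 'o, ('u \<times> 'o) \<times> 'a \<times> ('u \<times> 'o), 'u) psh,
         ('u \<times> 'o, ('u \<times> 'o) \<times> 'a \<times> ('u \<times> 'o), 'u) psh_arr,
         ('o, 'a, 'u) psh_arr,
         ('o, 'a, 'u) psh_arr \<times> ('o, 'a, 'u) psh_arr \<times> ('o, 'a, 'u) psh_arr) geom \<Rightarrow> bool" where
  "is_D C X d \<longleftrightarrow>
     geometric_morphism (Psh (minimal_subcat (elements C X))) (slice (Psh C) X) d \<and>
     inverse_image d = restriction_ftor (minimal_subcat (elements C X)) \<circ>\<^sub>F fibres_ftor C X"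

end

theory Submission
  imports Defs
begin

text \<open>Write \<open>A\<close> for the category of elements of \<open>X\<close>. A level of the presheaf topos on \<open>A\<close> determines the
  idempotent ideal \<open>I\<close> of those maps of \<open>A\<close> that lie in the image of the counit of \<open>l\<^sub>! \<stileturn> l\<^sup>*\<close> at a
  representable. Because of the split epi - mono factorizations \<open>I\<close> is generated by monomorphisms, and a
  mono in \<open>I\<close> can be written again and again as a composite of two monos in \<open>I\<close>; the resulting
  ascending chain of subobjects has to stop, so every map in \<open>I\<close> factors through an object \<open>b\<close> whose
  identity is in \<open>I\<close>.

  For such \<open>b\<close> the object \<open>l\<^sup>* b\<close> of the level is projective, and all maps from it to constant objects
  are constant. If the level is an etendue through \<open>G\<close>, then an object \<open>g : l\<^sup>* b \<rightarrow> G\<close> of the slice over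
  \<open>G\<close> is a subquotient, hence a subobject, of some constant object times \<open>G\<close>, so that \<open>g\<close> is monic.
  Maps to \<open>G\<close> exist at every such object, therefore all split epis out of \<open>b\<close> are isomorphisms and \<open>b\<close>
  is minimal. Thus the objects \<open>l\<^sub>! z\<close> are generated by their elements at minimal objects, which makes
  \<open>l\<^sup>*\<close> invert all maps that are bijective there, and this says that the level lies below \<open>D X\<close>.
  Conversely all maps between minimal objects are monic, and the coproduct of the representables
  exhibits \<open>D X\<close> as an etendue.\<close>

section \<open>Categories and adjunctions\<close>

text \<open>A competing level is an arbitrary category at arbitrary types; little is known of it
  beyond its adjoint triple, and no images or generators are given in it. Arguments about it are
  therefore moved into presheaves, where epimorphisms are surjective and representables test
  everything, and the results are carried back through the unit of l_! and l^*, which is invertible.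
  The ideal is the link: l_! after l^* is itself a left adjoint, hence governed by its values at
  representables, and the image of the counit there is a set of arrows of \<open>A\<close>.

  A second obstacle is the factorization through \<open>D X\<close>. Its inverse image must be lex
  and a left adjoint. The right Kan extension from the minimal objects followed by l^* is lex, the
  left Kan extension followed by l^* is a left adjoint, and neither is evidently both. The canonical
  map from the left to the right extension is bijective at minimal objects, so l^* inverts it and
  the two functors coincide up to isomorphism.\<close>

context category
begin

lemma comp_arr [simp]:
  assumes "f \<in> Arr C" "g \<in> Arr C" "Cod C f = Dom C g"
  shows "g \<odot> f \<in> Arr C" "Dom C (g \<odot> f) = Dom C f" "Cod C (g \<odot> f) = Cod C g"
  using comp_hom[of f "Dom C f" "Cod C f" g "Cod C g"] assms by (auto simp: hom_def)

lemma idn_arr [simp]: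
  assumes "a \<in> Obj C"
  shows "Idn C a \<in> Arr C" "Dom C (Idn C a) = a" "Cod C (Idn C a) = a"
  using idn_hom[OF assms] by (auto simp: hom_def)

lemma idn_comp [simp]:
  "f \<in> Arr C \<Longrightarrow> Cod C f = b \<Longrightarrow> Idn C b \<odot> f = f"
  "f \<in> Arr C \<Longrightarrow> Dom C f = a \<Longrightarrow> f \<odot> Idn C a = f"
  using idn_left[of f "Dom C f" b] idn_right[of f a "Cod C f"] by (auto simp: hom_def)

lemma assoc [simp]:
  assumes "f \<in> Arr C" "g \<in> Arr C" "h \<in> Arr C" "Cod C f = Dom C g" "Cod C g = Dom C h"
  shows "(h \<odot> g) \<odot> f = h \<odot> (g \<odot> f)"
  using comp_assoc[of f "Dom C f" "Cod C f" g "Cod C g" h "Cod C h"] assms by (auto simp: hom_def)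

declare dom_obj [simp] cod_obj [simp]

end

text \<open>A chosen inverse as a function of the arrow, so that cancellation can be done by
  rewriting; its value means nothing unless \<open>f\<close> is an isomorphism.\<close>

definition inv_arr :: "('o, 'a) cat \<Rightarrow> 'a \<Rightarrow> 'a" where
  "inv_arr C f = (SOME g. g \<in> hom C (Cod C f) (Dom C f) \<and>
     f \<odot>\<^bsub>C\<^esub> g = Idn C (Cod C f) \<and> g \<odot>\<^bsub>C\<^esub> f = Idn C (Dom C f))"

lemma inv_arr [simp]:
  assumes "iso_arr C f"
  shows "inv_arr C f \<in> Arr C" "Dom C (inv_arr C f) = Cod C f" "Cod C (inv_arr C f) = Dom C f"
    "f \<odot>\<^bsub>C\<^esub> inv_arr C f = Idn C (Cod C f)" "inv_arr C f \<odot>\<^bsub>C\<^esub> f = Idn C (Dom C f)"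
proof -
  have "\<exists>g. g \<in> hom C (Cod C f) (Dom C f) \<and>
     f \<odot>\<^bsub>C\<^esub> g = Idn C (Cod C f) \<and> g \<odot>\<^bsub>C\<^esub> f = Idn C (Dom C f)"
    using assms by (auto simp: iso_arr_def)
  from someI_ex[OF this]
  show "inv_arr C f \<in> Arr C" "Dom C (inv_arr C f) = Cod C f" "Cod C (inv_arr C f) = Dom C f"
    "f \<odot>\<^bsub>C\<^esub> inv_arr C f = Idn C (Cod C f)" "inv_arr C f \<odot>\<^bsub>C\<^esub> f = Idn C (Dom C f)"
    by (auto simp: inv_arr_def hom_def)
qed

lemma iso_arrD: "iso_arr C f \<Longrightarrow> f \<in> Arr C"
  by (simp add: iso_arr_def)

lemma iso_arrI:
  assumes "f \<in> hom C a b" "g \<in> hom C b a" "f \<odot>\<^bsub>C\<^esub> g = Idn C b" "g \<odot>\<^bsub>C\<^esub> f = Idn C a"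
  shows "iso_arr C f"
  using assms by (auto simp: iso_arr_def hom_def)

lemma iso_inv_arr: "iso_arr C f \<Longrightarrow> iso_arr C (inv_arr C f)"
  by (rule iso_arrI[of _ _ "Cod C f" "Dom C f" f]) (auto simp: hom_def iso_arrD)

context category
begin

lemma inv_comp [simp]:
  assumes f: "iso_arr C f" and x: "x \<in> Arr C"
  shows "Cod C x = Cod C f \<Longrightarrow> f \<odot> (inv_arr C f \<odot> x) = x"
    and "Cod C x = Dom C f \<Longrightarrow> inv_arr C f \<odot> (f \<odot> x) = x"
proof -
  note i = inv_arr[OF f] iso_arrD[OF f]
  show "f \<odot> (inv_arr C f \<odot> x) = x" if "Cod C x = Cod C f"
    using assoc[of x "inv_arr C f" f] x that i by (metis idn_comp(1))
  show "inv_arr C f \<odot> (f \<odot> x) = x" if "Cod C x = Dom C f"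
    using assoc[of x f "inv_arr C f"] x that i by (metis idn_comp(1))
qed

lemma iso_comp:
  assumes "iso_arr C f" "iso_arr C g" "Cod C f = Dom C g"
  shows "iso_arr C (g \<odot> f)"
  by (rule iso_arrI[of _ _ "Dom C f" "Cod C g" "inv_arr C f \<odot> inv_arr C g"])
     (use assms in \<open>auto simp: hom_def iso_arrD\<close>)

lemma iso_cancel_left:
  assumes "iso_arr C f" "f \<odot> x = f \<odot> y" "x \<in> Arr C" "y \<in> Arr C"
    "Cod C x = Dom C f" "Cod C y = Dom C f"
  shows "x = y"
  using inv_comp(2)[OF assms(1,3)] inv_comp(2)[OF assms(1,4)] assms by metis

end

section \<open>Functors\<close>

locale ftr = A: category A + B: category B for A :: "('o, 'a) cat" and B :: "('p, 'b) cat" +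
  fixes F :: "('o, 'a, 'p, 'b) ftor"
  assumes func: "is_functor A B F"
begin

lemma F_obj [simp]: "a \<in> Obj A \<Longrightarrow> on_obj F a \<in> Obj B"
  using func by (simp add: is_functor_def)

lemma F_arr [simp]:
  assumes "f \<in> Arr A"
  shows "on_arr F f \<in> Arr B" "Dom B (on_arr F f) = on_obj F (Dom A f)"
    "Cod B (on_arr F f) = on_obj F (Cod A f)"
  using func assms by (auto simp: is_functor_def hom_def)

lemma F_idn [simp]: "a \<in> Obj A \<Longrightarrow> on_arr F (Idn A a) = Idn B (on_obj F a)"
  using func by (simp add: is_functor_def)

lemma F_comp [simp]:
  "f \<in> Arr A \<Longrightarrow> g \<in> Arr A \<Longrightarrow> Cod A f = Dom A g \<Longrightarrow>
    on_arr F (g \<odot>\<^bsub>A\<^esub> f) = on_arr F g \<odot>\<^bsub>B\<^esub> on_arr F f"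
  using func by (simp add: is_functor_def)

lemma F_hom: "f \<in> hom A a b \<Longrightarrow> on_arr F f \<in> hom B (on_obj F a) (on_obj F b)"
  by (auto simp: hom_def)

lemma F_iso:
  assumes "iso_arr A f" shows "iso_arr B (on_arr F f)"
proof (rule iso_arrI[of _ _ "on_obj F (Dom A f)" "on_obj F (Cod A f)" "on_arr F (inv_arr A f)"])
  note [simp] = iso_arrD[OF assms]
  show "on_arr F f \<odot>\<^bsub>B\<^esub> on_arr F (inv_arr A f) = Idn B (on_obj F (Cod A f))"
    using F_comp[of "inv_arr A f" f] assms by simp
  show "on_arr F (inv_arr A f) \<odot>\<^bsub>B\<^esub> on_arr F f = Idn B (on_obj F (Dom A f))"
    using F_comp[of f "inv_arr A f"] assms by simp
qed (use assms iso_arrD[OF assms] in \<open>auto simp: hom_def\<close>)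

end

lemma ftrI: "is_functor A B F \<Longrightarrow> ftr A B F"
  by (simp add: ftr_def ftr_axioms_def is_functor_def)

lemma functor_comp:
  assumes "is_functor A B F" "is_functor B D G"
  shows "is_functor A D (G \<circ>\<^sub>F F)"
proof -
  interpret F: ftr A B F by (rule ftrI) fact
  interpret G: ftr B D G by (rule ftrI) fact
  show ?thesis
    using F.A.category_axioms G.B.category_axioms
    by (auto simp: is_functor_def comp_ftor_def hom_def)
qed

lemma functor_id: "category A \<Longrightarrow> is_functor A A id_ftor"
  by (auto simp: is_functor_def id_ftor_def hom_def)

lemma comp_ftor_simps [simp]:
  "on_obj (G \<circ>\<^sub>F F) a = on_obj G (on_obj F a)" "on_arr (G \<circ>\<^sub>F F) f = on_arr G (on_arr F f)"
  "on_obj id_ftor b = b" "on_arr id_ftor g = g"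
  by (auto simp: comp_ftor_def id_ftor_def)

lemma comp_ftor_assoc: "H \<circ>\<^sub>F (G \<circ>\<^sub>F F) = H \<circ>\<^sub>F G \<circ>\<^sub>F F"
  by (auto simp: comp_ftor_def)

section \<open>Adjunctions with named unit and counit, and universal arrows\<close>

locale adjunction = L: ftr A B L + R: ftr B A R
  for A :: "('o, 'a) cat" and B :: "('p, 'b) cat" and L R +
  fixes \<eta> :: "'o \<Rightarrow> 'a" and \<epsilon> :: "'p \<Rightarrow> 'b"
  assumes unit_hom: "a \<in> Obj A \<Longrightarrow> \<eta> a \<in> hom A a (on_obj R (on_obj L a))"
    and unit_nat: "f \<in> Arr A \<Longrightarrow> \<eta> (Cod A f) \<odot>\<^bsub>A\<^esub> f = on_arr R (on_arr L f) \<odot>\<^bsub>A\<^esub> \<eta> (Dom A f)"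
    and counit_hom: "b \<in> Obj B \<Longrightarrow> \<epsilon> b \<in> hom B (on_obj L (on_obj R b)) b"
    and counit_nat: "g \<in> Arr B \<Longrightarrow> \<epsilon> (Cod B g) \<odot>\<^bsub>B\<^esub> on_arr L (on_arr R g) = g \<odot>\<^bsub>B\<^esub> \<epsilon> (Dom B g)"
    and tri1: "a \<in> Obj A \<Longrightarrow> \<epsilon> (on_obj L a) \<odot>\<^bsub>B\<^esub> on_arr L (\<eta> a) = Idn B (on_obj L a)"
    and tri2: "b \<in> Obj B \<Longrightarrow> on_arr R (\<epsilon> b) \<odot>\<^bsub>A\<^esub> \<eta> (on_obj R b) = Idn A (on_obj R b)"
begin

lemma unit [simp]:
  assumes "a \<in> Obj A"
  shows "\<eta> a \<in> Arr A" "Dom A (\<eta> a) = a" "Cod A (\<eta> a) = on_obj R (on_obj L a)"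
  using unit_hom[OF assms] by (auto simp: hom_def)

lemma counit [simp]:
  assumes "b \<in> Obj B"
  shows "\<epsilon> b \<in> Arr B" "Dom B (\<epsilon> b) = on_obj L (on_obj R b)" "Cod B (\<epsilon> b) = b"
  using counit_hom[OF assms] by (auto simp: hom_def)

lemma adjoint: "adjoint A B L R"
  using L.func R.func functor_comp[OF L.func R.func] functor_comp[OF R.func L.func]
    functor_id[OF L.A.category_axioms] functor_id[OF L.B.category_axioms]
  unfolding adjoint_def
  by (intro conjI exI[of _ \<eta>] exI[of _ \<epsilon>])
     (auto simp: nat_trans_def unit_nat counit_nat tri1 tri2 hom_def)

end

lemma adjointE:
  assumes "adjoint A B L R"
  obtains \<eta> \<epsilon> where "adjunction A B L R \<eta> \<epsilon>"
proof -
  from assms obtain \<eta> \<epsilon> where *: "nat_trans A A id_ftor (R \<circ>\<^sub>F L) \<eta>" "nat_trans B B (L \<circ>\<^sub>F R) id_ftor \<epsilon>"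
    "\<forall>a \<in> Obj A. \<epsilon> (on_obj L a) \<odot>\<^bsub>B\<^esub> on_arr L (\<eta> a) = Idn B (on_obj L a)"
    "\<forall>b \<in> Obj B. on_arr R (\<epsilon> b) \<odot>\<^bsub>A\<^esub> \<eta> (on_obj R b) = Idn A (on_obj R b)"
    "is_functor A B L" "is_functor B A R"
    by (auto simp: adjoint_def)
  have "adjunction A B L R \<eta> \<epsilon>"
    unfolding adjunction_def adjunction_axioms_def
    using * by (auto simp: nat_trans_def intro: ftrI)
  then show ?thesis by (rule that)
qed

text \<open>A terminal object of the comma category of \<open>F\<close> over \<open>b\<close>.
  Adjoints are built from such arrows one object at a time, instead of from a functor, a unit and
  two triangle identities all at once.\<close>

definition couniversal ::
  "('o, 'a) cat \<Rightarrow> ('p, 'b) cat \<Rightarrow> ('o, 'a, 'p, 'b) ftor \<Rightarrow> 'p \<Rightarrow> 'o \<Rightarrow> 'b \<Rightarrow> bool" where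
  "couniversal A B F b r e \<longleftrightarrow> r \<in> Obj A \<and> e \<in> hom B (on_obj F r) b \<and>
     (\<forall>a \<in> Obj A. \<forall>h \<in> hom B (on_obj F a) b. \<exists>!k. k \<in> hom A a r \<and> e \<odot>\<^bsub>B\<^esub> on_arr F k = h)"

definition universal ::
  "('p, 'b) cat \<Rightarrow> ('o, 'a) cat \<Rightarrow> ('p, 'b, 'o, 'a) ftor \<Rightarrow> 'o \<Rightarrow> 'p \<Rightarrow> 'a \<Rightarrow> bool" where
  "universal B A R a l n \<longleftrightarrow> l \<in> Obj B \<and> n \<in> hom A a (on_obj R l) \<and>
     (\<forall>b \<in> Obj B. \<forall>h \<in> hom A a (on_obj R b). \<exists>!k. k \<in> hom B l b \<and> on_arr R k \<odot>\<^bsub>A\<^esub> n = h)"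

lemma couniversalI:
  assumes "r \<in> Obj A" "e \<in> hom B (on_obj F r) b"
    "\<And>a h. a \<in> Obj A \<Longrightarrow> h \<in> hom B (on_obj F a) b \<Longrightarrow> \<exists>k. k \<in> hom A a r \<and> e \<odot>\<^bsub>B\<^esub> on_arr F k = h"
    "\<And>a k k'. a \<in> Obj A \<Longrightarrow> k \<in> hom A a r \<Longrightarrow> k' \<in> hom A a r \<Longrightarrow>
       e \<odot>\<^bsub>B\<^esub> on_arr F k = e \<odot>\<^bsub>B\<^esub> on_arr F k' \<Longrightarrow> k = k'"
  shows "couniversal A B F b r e"
  unfolding couniversal_def using assms by (metis (no_types, opaque_lifting))

lemma universalI:
  assumes "l \<in> Obj B" "n \<in> hom A a (on_obj R l)"
    "\<And>b h. b \<in> Obj B \<Longrightarrow> h \<in> hom A a (on_obj R b) \<Longrightarrow> \<exists>k. k \<in> hom B l b \<and> on_arr R k \<odot>\<^bsub>A\<^esub> n = h"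
    "\<And>b k k'. b \<in> Obj B \<Longrightarrow> k \<in> hom B l b \<Longrightarrow> k' \<in> hom B l b \<Longrightarrow>
       on_arr R k \<odot>\<^bsub>A\<^esub> n = on_arr R k' \<odot>\<^bsub>A\<^esub> n \<Longrightarrow> k = k'"
  shows "universal B A R a l n"
  unfolding universal_def using assms by (metis (no_types, opaque_lifting))

lemma couniversalD:
  assumes "couniversal A B F b r e"
  shows "r \<in> Obj A" "e \<in> Arr B" "Dom B e = on_obj F r" "Cod B e = b"
    "a \<in> Obj A \<Longrightarrow> h \<in> hom B (on_obj F a) b \<Longrightarrow> \<exists>k. k \<in> hom A a r \<and> e \<odot>\<^bsub>B\<^esub> on_arr F k = h"
  using assms unfolding couniversal_def hom_def by blast+

lemma couniversal_eq:
  assumes "couniversal A B F b r e" "ftr A B F" "k \<in> hom A a r" "k' \<in> hom A a r"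
    "e \<odot>\<^bsub>B\<^esub> on_arr F k = e \<odot>\<^bsub>B\<^esub> on_arr F k'"
  shows "k = k'"
proof -
  interpret F: ftr A B F by fact
  have a: "a \<in> Obj A" using assms(3) by (auto simp: hom_def)
  have "e \<odot>\<^bsub>B\<^esub> on_arr F k \<in> hom B (on_obj F a) b"
    using couniversalD[OF assms(1)] assms(3) by (auto simp: hom_def)
  then have "\<exists>!j. j \<in> hom A a r \<and> e \<odot>\<^bsub>B\<^esub> on_arr F j = e \<odot>\<^bsub>B\<^esub> on_arr F k"
    using assms(1) a unfolding couniversal_def by blast
  then show ?thesis using assms(3-5) by metis
qed

lemma universalD:
  assumes "universal B A R a l n"
  shows "l \<in> Obj B" "n \<in> Arr A" "Cod A n = on_obj R l" "Dom A n = a"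
    "b \<in> Obj B \<Longrightarrow> h \<in> hom A a (on_obj R b) \<Longrightarrow> \<exists>k. k \<in> hom B l b \<and> on_arr R k \<odot>\<^bsub>A\<^esub> n = h"
  using assms unfolding universal_def hom_def by blast+

lemma universal_eq:
  assumes "universal B A R a l n" "ftr B A R" "k \<in> hom B l b" "k' \<in> hom B l b"
    "on_arr R k \<odot>\<^bsub>A\<^esub> n = on_arr R k' \<odot>\<^bsub>A\<^esub> n"
  shows "k = k'"
proof -
  interpret R: ftr B A R by fact
  have b: "b \<in> Obj B" using assms(3) by (auto simp: hom_def)
  have "on_arr R k \<odot>\<^bsub>A\<^esub> n \<in> hom A a (on_obj R b)"
    using universalD[OF assms(1)] assms(3) by (auto simp: hom_def)
  then have "\<exists>!j. j \<in> hom B l b \<and> on_arr R j \<odot>\<^bsub>A\<^esub> n = on_arr R k \<odot>\<^bsub>A\<^esub> n"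
    using assms(1) b unfolding universal_def by blast
  then show ?thesis using assms(3-5) by metis
qed

context adjunction
begin

text \<open>Naturality of the counit at \<open>h\<close> followed by the first triangle identity;
  together with \<open>transpose_right\<close> this is the bijection of hom-sets.\<close>

lemma transpose_left:
  assumes "a \<in> Obj A" "h \<in> hom B (on_obj L a) b"
  shows "\<epsilon> b \<odot>\<^bsub>B\<^esub> on_arr L (on_arr R h \<odot>\<^bsub>A\<^esub> \<eta> a) = h"
proof -
  have h: "h \<in> Arr B" "Dom B h = on_obj L a" "Cod B h = b" "b \<in> Obj B"
    using assms by (auto simp: hom_def)
  have "\<epsilon> b \<odot>\<^bsub>B\<^esub> on_arr L (on_arr R h \<odot>\<^bsub>A\<^esub> \<eta> a)
      = (\<epsilon> b \<odot>\<^bsub>B\<^esub> on_arr L (on_arr R h)) \<odot>\<^bsub>B\<^esub> on_arr L (\<eta> a)"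
    using h assms by simp
  also have "\<dots> = (h \<odot>\<^bsub>B\<^esub> \<epsilon> (on_obj L a)) \<odot>\<^bsub>B\<^esub> on_arr L (\<eta> a)"
    using counit_nat[of h] h by simp
  also have "\<dots> = h" using h assms tri1[of a] by simp
  finally show ?thesis .
qed

lemma transpose_right:
  assumes "b \<in> Obj B" "k \<in> hom A a (on_obj R b)"
  shows "on_arr R (\<epsilon> b \<odot>\<^bsub>B\<^esub> on_arr L k) \<odot>\<^bsub>A\<^esub> \<eta> a = k"
proof -
  have k: "k \<in> Arr A" "Dom A k = a" "Cod A k = on_obj R b" "a \<in> Obj A"
    using assms by (auto simp: hom_def)
  have "on_arr R (\<epsilon> b \<odot>\<^bsub>B\<^esub> on_arr L k) \<odot>\<^bsub>A\<^esub> \<eta> a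
      = on_arr R (\<epsilon> b) \<odot>\<^bsub>A\<^esub> (\<eta> (on_obj R b) \<odot>\<^bsub>A\<^esub> k)"
    using k assms unit_nat[of k] by simp
  also have "\<dots> = (on_arr R (\<epsilon> b) \<odot>\<^bsub>A\<^esub> \<eta> (on_obj R b)) \<odot>\<^bsub>A\<^esub> k"
    using k assms by (intro L.A.assoc[symmetric]) auto
  also have "\<dots> = k" using k assms tri2[of b] by simp
  finally show ?thesis .
qed

lemma couniversal: "b \<in> Obj B \<Longrightarrow> couniversal A B L b (on_obj R b) (\<epsilon> b)"
  apply (rule couniversalI)
     apply (auto simp: counit_hom)[2]
  subgoal for a h
    by (rule exI[of _ "on_arr R h \<odot>\<^bsub>A\<^esub> \<eta> a"]) (rule conjI, force simp: hom_def, rule transpose_left)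
  by (metis transpose_right)

lemma universal: "a \<in> Obj A \<Longrightarrow> universal B A R a (on_obj L a) (\<eta> a)"
  apply (rule universalI)
     apply (auto simp: unit_hom)[2]
  subgoal for b h
    by (rule exI[of _ "\<epsilon> b \<odot>\<^bsub>B\<^esub> on_arr L h"]) (rule conjI, force simp: hom_def, rule transpose_right)
  by (metis transpose_left)

end

text \<open>The unit is the transpose of the identity. Its naturality and the second triangle
  identity are equations between maps into some \<open>on_obj R b\<close>, and such maps are
  determined by the composite of their image under \<open>L\<close> with
  \<open>\<epsilon> b\<close>.\<close>

lemma adjointI_couniversal:
  assumes "is_functor A B L" "is_functor B A R"
    and univ: "\<And>b. b \<in> Obj B \<Longrightarrow> couniversal A B L b (on_obj R b) (\<epsilon> b)"
    and nat: "\<And>g. g \<in> Arr B \<Longrightarrow> \<epsilon> (Cod B g) \<odot>\<^bsub>B\<^esub> on_arr L (on_arr R g) = g \<odot>\<^bsub>B\<^esub> \<epsilon> (Dom B g)"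
  obtains \<eta> where "adjunction A B L R \<eta> \<epsilon>"
proof -
  interpret L: ftr A B L by (rule ftrI) fact
  interpret R: ftr B A R by (rule ftrI) fact
  have e [simp]: "\<epsilon> b \<in> Arr B" "Dom B (\<epsilon> b) = on_obj L (on_obj R b)" "Cod B (\<epsilon> b) = b"
    if "b \<in> Obj B" for b using couniversalD[OF univ[OF that]] by auto
  have "\<exists>\<eta>. \<forall>a \<in> Obj A. \<eta> a \<in> hom A a (on_obj R (on_obj L a)) \<and>
      \<epsilon> (on_obj L a) \<odot>\<^bsub>B\<^esub> on_arr L (\<eta> a) = Idn B (on_obj L a)"
  proof (intro bchoice ballI)
    fix a assume "a \<in> Obj A"
    then show "\<exists>k. k \<in> hom A a (on_obj R (on_obj L a)) \<and>
      \<epsilon> (on_obj L a) \<odot>\<^bsub>B\<^esub> on_arr L k = Idn B (on_obj L a)"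
      by (intro couniversalD(5)[OF univ]) (auto simp: hom_def)
  qed
  then obtain \<eta> where \<eta>: "\<And>a. a \<in> Obj A \<Longrightarrow> \<eta> a \<in> hom A a (on_obj R (on_obj L a))"
    and t1: "\<And>a. a \<in> Obj A \<Longrightarrow> \<epsilon> (on_obj L a) \<odot>\<^bsub>B\<^esub> on_arr L (\<eta> a) = Idn B (on_obj L a)"
    by blast
  have h [simp]: "\<eta> a \<in> Arr A" "Dom A (\<eta> a) = a" "Cod A (\<eta> a) = on_obj R (on_obj L a)"
    if "a \<in> Obj A" for a using \<eta>[OF that] by (auto simp: hom_def)
  have "adjunction A B L R \<eta> \<epsilon>"
  proof
    fix f assume f [simp]: "f \<in> Arr A"
    have [simp]: "\<epsilon> (on_obj L (Cod A f)) \<odot>\<^bsub>B\<^esub> (on_arr L (on_arr R (on_arr L f)) \<odot>\<^bsub>B\<^esub> on_arr L (\<eta> (Dom A f)))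
       = on_arr L f"
    proof -
      have "\<epsilon> (on_obj L (Cod A f)) \<odot>\<^bsub>B\<^esub> (on_arr L (on_arr R (on_arr L f)) \<odot>\<^bsub>B\<^esub> on_arr L (\<eta> (Dom A f)))
        = (\<epsilon> (on_obj L (Cod A f)) \<odot>\<^bsub>B\<^esub> on_arr L (on_arr R (on_arr L f))) \<odot>\<^bsub>B\<^esub> on_arr L (\<eta> (Dom A f))"
        by simp
      also have "\<dots> = (on_arr L f \<odot>\<^bsub>B\<^esub> \<epsilon> (on_obj L (Dom A f))) \<odot>\<^bsub>B\<^esub> on_arr L (\<eta> (Dom A f))"
        using nat[of "on_arr L f"] by simp
      also have "\<dots> = on_arr L f" using t1[of "Dom A f"] by simp
      finally show ?thesis .
    qed
    have [simp]: "\<epsilon> (on_obj L (Cod A f)) \<odot>\<^bsub>B\<^esub> (on_arr L (\<eta> (Cod A f)) \<odot>\<^bsub>B\<^esub> on_arr L f) = on_arr L f"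
      using L.B.assoc[of "on_arr L f" "on_arr L (\<eta> (Cod A f))" "\<epsilon> (on_obj L (Cod A f))"]
        t1[of "Cod A f"] by simp
    show "\<eta> (Cod A f) \<odot>\<^bsub>A\<^esub> f = on_arr R (on_arr L f) \<odot>\<^bsub>A\<^esub> \<eta> (Dom A f)"
      by (rule couniversal_eq[OF univ[of "on_obj L (Cod A f)"] L.ftr_axioms, of _ "Dom A f"])
         (auto simp: hom_def)
  next
    fix b assume b [simp]: "b \<in> Obj B"
    have "\<epsilon> b \<odot>\<^bsub>B\<^esub> on_arr L (on_arr R (\<epsilon> b) \<odot>\<^bsub>A\<^esub> \<eta> (on_obj R b))
       = (\<epsilon> b \<odot>\<^bsub>B\<^esub> on_arr L (on_arr R (\<epsilon> b))) \<odot>\<^bsub>B\<^esub> on_arr L (\<eta> (on_obj R b))"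
      by simp
    also have "\<dots> = (\<epsilon> b \<odot>\<^bsub>B\<^esub> \<epsilon> (on_obj L (on_obj R b))) \<odot>\<^bsub>B\<^esub> on_arr L (\<eta> (on_obj R b))"
      using nat[of "\<epsilon> b"] by simp
    also have "\<dots> = \<epsilon> b" using t1[of "on_obj R b"] by simp
    finally show "on_arr R (\<epsilon> b) \<odot>\<^bsub>A\<^esub> \<eta> (on_obj R b) = Idn A (on_obj R b)"
      by (intro couniversal_eq[OF univ[of b] L.ftr_axioms, of _ "on_obj R b"])
         (auto simp: hom_def)
  qed (auto simp: \<eta> t1 nat hom_def)
  then show ?thesis by (rule that)
qed

text \<open>A couniversal arrow is chosen for each object; uniqueness of the induced maps forces
  functoriality, so the choices can be made independently of each other.\<close>

lemma right_adjoint_exists: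
  assumes F: "is_functor A B F"
    and univ: "\<And>b. b \<in> Obj B \<Longrightarrow> \<exists>r e. couniversal A B F b r e"
  shows "\<exists>R. adjoint A B F R"
proof -
  interpret F: ftr A B F by (rule ftrI) fact
  have "\<exists>re. \<forall>b\<in>Obj B. couniversal A B F b (fst (re b)) (snd (re b))"
    using univ by (intro bchoice) auto
  then obtain re where re0: "\<forall>b\<in>Obj B. couniversal A B F b (fst (re b)) (snd (re b))" ..
  define r e where "r = fst \<circ> re" and "e = snd \<circ> re"
  have re: "\<And>b. b \<in> Obj B \<Longrightarrow> couniversal A B F b (r b) (e b)"
    using re0 by (simp add: r_def e_def)
  note [simp] = couniversalD(1-4)[OF re]
  have "\<exists>k. \<forall>g\<in>Arr B. k g \<in> hom A (r (Dom B g)) (r (Cod B g)) \<and>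
      e (Cod B g) \<odot>\<^bsub>B\<^esub> on_arr F (k g) = g \<odot>\<^bsub>B\<^esub> e (Dom B g)"
    by (intro bchoice ballI couniversalD(5)[OF re]) (auto simp: hom_def)
  then obtain k where k: "\<And>g. g\<in>Arr B \<Longrightarrow> k g \<in> hom A (r (Dom B g)) (r (Cod B g))"
    and ek: "\<And>g. g\<in>Arr B \<Longrightarrow> e (Cod B g) \<odot>\<^bsub>B\<^esub> on_arr F (k g) = g \<odot>\<^bsub>B\<^esub> e (Dom B g)"
    by blast
  have [simp]: "k g \<in> Arr A" "Dom A (k g) = r (Dom B g)" "Cod A (k g) = r (Cod B g)"
    if "g \<in> Arr B" for g using k[OF that] by (auto simp: hom_def)
  define R where "R = \<lparr>on_obj = r, on_arr = k\<rparr>"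
  have "is_functor B A R"
    unfolding is_functor_def
  proof (intro conjI ballI impI)
    fix b assume [simp]: "b \<in> Obj B"
    have "k (Idn B b) = Idn A (r b)"
      using ek[of "Idn B b"]
      by (intro couniversal_eq[OF re[of b] F.ftr_axioms, of _ "r b"]) (auto simp: hom_def)
    then show "on_arr R (Idn B b) = Idn A (on_obj R b)" by (simp add: R_def)
  next
    fix f g assume [simp]: "f \<in> Arr B" "g \<in> Arr B" "Cod B f = Dom B g"
    have "e (Cod B g) \<odot>\<^bsub>B\<^esub> on_arr F (k g \<odot>\<^bsub>A\<^esub> k f)
       = (e (Cod B g) \<odot>\<^bsub>B\<^esub> on_arr F (k g)) \<odot>\<^bsub>B\<^esub> on_arr F (k f)" by simp
    also have "\<dots> = e (Cod B g) \<odot>\<^bsub>B\<^esub> on_arr F (k (g \<odot>\<^bsub>B\<^esub> f))"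
      using ek[of "g \<odot>\<^bsub>B\<^esub> f"] ek[of f] ek[of g] by simp
    finally have "k (g \<odot>\<^bsub>B\<^esub> f) = k g \<odot>\<^bsub>A\<^esub> k f"
      by (intro couniversal_eq[OF re[of "Cod B g"] F.ftr_axioms, of _ "r (Dom B f)"])
         (auto simp: hom_def)
    then show "on_arr R (g \<odot>\<^bsub>B\<^esub> f) = on_arr R g \<odot>\<^bsub>A\<^esub> on_arr R f" by (simp add: R_def)
  qed (auto simp: R_def F.A.category_axioms F.B.category_axioms hom_def)
  then obtain \<eta> where "adjunction A B F R \<eta> e"
    by (rule adjointI_couniversal[OF F]) (auto simp: R_def re ek)
  then show ?thesis by (auto dest: adjunction.adjoint)
qed

text \<open>The dual of \<open>right_adjoint_exists\<close>; the counit at \<open>b\<close> is the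
  transpose of the identity of \<open>on_obj R b\<close>.\<close>

lemma left_adjoint_exists:
  assumes G: "is_functor B A R"
    and univ: "\<And>a. a \<in> Obj A \<Longrightarrow> \<exists>l n. universal B A R a l n"
  shows "\<exists>L. adjoint A B L R"
proof -
  interpret R: ftr B A R by (rule ftrI) fact
  have "\<exists>re. \<forall>a\<in>Obj A. universal B A R a (fst (re a)) (snd (re a))"
    using univ by (intro bchoice) auto
  then obtain re where re0: "\<forall>a\<in>Obj A. universal B A R a (fst (re a)) (snd (re a))" ..
  define l n where "l = fst \<circ> re" and "n = snd \<circ> re"
  have ln: "\<And>a. a \<in> Obj A \<Longrightarrow> universal B A R a (l a) (n a)"
    using re0 by (simp add: l_def n_def)
  note [simp] = universalD(1-4)[OF ln]
  have "\<exists>k. \<forall>f\<in>Arr A. k f \<in> hom B (l (Dom A f)) (l (Cod A f)) \<and>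
      on_arr R (k f) \<odot>\<^bsub>A\<^esub> n (Dom A f) = n (Cod A f) \<odot>\<^bsub>A\<^esub> f"
    by (intro bchoice ballI universalD(5)[OF ln]) (auto simp: hom_def)
  then obtain k where k: "\<And>f. f\<in>Arr A \<Longrightarrow> k f \<in> hom B (l (Dom A f)) (l (Cod A f))"
    and kn: "\<And>f. f\<in>Arr A \<Longrightarrow> on_arr R (k f) \<odot>\<^bsub>A\<^esub> n (Dom A f) = n (Cod A f) \<odot>\<^bsub>A\<^esub> f"
    by blast
  have [simp]: "k g \<in> Arr B" "Dom B (k g) = l (Dom A g)" "Cod B (k g) = l (Cod A g)"
    if "g \<in> Arr A" for g using k[OF that] by (auto simp: hom_def)
  define L where "L = \<lparr>on_obj = l, on_arr = k\<rparr>"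
  have L: "is_functor A B L"
    unfolding is_functor_def
  proof (intro conjI ballI impI)
    fix b assume [simp]: "b \<in> Obj A"
    have "k (Idn A b) = Idn B (l b)"
      using kn[of "Idn A b"]
      by (intro universal_eq[OF ln[of b] R.ftr_axioms, of _ "l b"]) (auto simp: hom_def)
    then show "on_arr L (Idn A b) = Idn B (on_obj L b)" by (simp add: L_def)
  next
    fix f g assume [simp]: "f \<in> Arr A" "g \<in> Arr A" "Cod A f = Dom A g"
    have "on_arr R (k g \<odot>\<^bsub>B\<^esub> k f) \<odot>\<^bsub>A\<^esub> n (Dom A f) = on_arr R (k g) \<odot>\<^bsub>A\<^esub> (n (Dom A g) \<odot>\<^bsub>A\<^esub> f)"
      using kn[of f] by simp
    also have "\<dots> = (on_arr R (k g) \<odot>\<^bsub>A\<^esub> n (Dom A g)) \<odot>\<^bsub>A\<^esub> f" 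
      by (intro R.B.assoc[symmetric]) auto
    also have "\<dots> = on_arr R (k (g \<odot>\<^bsub>A\<^esub> f)) \<odot>\<^bsub>A\<^esub> n (Dom A f)"
      using kn[of "g \<odot>\<^bsub>A\<^esub> f"] kn[of g] by simp
    finally have "k (g \<odot>\<^bsub>A\<^esub> f) = k g \<odot>\<^bsub>B\<^esub> k f"
      by (intro universal_eq[OF ln[of "Dom A f"] R.ftr_axioms, of _ "l (Cod A g)"])
         (auto simp: hom_def)
    then show "on_arr L (g \<odot>\<^bsub>A\<^esub> f) = on_arr L g \<odot>\<^bsub>B\<^esub> on_arr L f" by (simp add: L_def)
  qed (auto simp: L_def R.A.category_axioms R.B.category_axioms hom_def)
  then interpret L: ftr A B L by (rule ftrI)
  have "\<exists>\<epsilon>. \<forall>b \<in> Obj B. \<epsilon> b \<in> hom B (l (on_obj R b)) b \<and>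
      on_arr R (\<epsilon> b) \<odot>\<^bsub>A\<^esub> n (on_obj R b) = Idn A (on_obj R b)"
    by (intro bchoice ballI universalD(5)[OF ln]) (auto simp: hom_def)
  then obtain \<epsilon> where \<epsilon>: "\<And>b. b \<in> Obj B \<Longrightarrow> \<epsilon> b \<in> hom B (l (on_obj R b)) b"
    and t2: "\<And>b. b \<in> Obj B \<Longrightarrow> on_arr R (\<epsilon> b) \<odot>\<^bsub>A\<^esub> n (on_obj R b) = Idn A (on_obj R b)"
    by blast
  have [simp]: "\<epsilon> b \<in> Arr B" "Dom B (\<epsilon> b) = l (on_obj R b)" "Cod B (\<epsilon> b) = b"
    if "b \<in> Obj B" for b using \<epsilon>[OF that] by (auto simp: hom_def)
  have [simp]: "on_obj L = l" "on_arr L = k" by (auto simp: L_def)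
  have R2: "on_arr R (\<epsilon> b) \<odot>\<^bsub>A\<^esub> (n (on_obj R b) \<odot>\<^bsub>A\<^esub> x) = x"
    if "b \<in> Obj B" "x \<in> Arr A" "Cod A x = on_obj R b" for b x
    using that R.B.assoc[of x "n (on_obj R b)" "on_arr R (\<epsilon> b)"] t2[of b] by simp
  have "adjunction A B L R n \<epsilon>"
  proof
    fix g assume g [simp]: "g \<in> Arr B"
    have "on_arr R (\<epsilon> (Cod B g) \<odot>\<^bsub>B\<^esub> k (on_arr R g)) \<odot>\<^bsub>A\<^esub> n (on_obj R (Dom B g)) = on_arr R g"
      using kn[of "on_arr R g"] by (simp add: R2)
    moreover have "on_arr R (g \<odot>\<^bsub>B\<^esub> \<epsilon> (Dom B g)) \<odot>\<^bsub>A\<^esub> n (on_obj R (Dom B g)) = on_arr R g"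
      using t2[of "Dom B g"] by simp
    ultimately have "\<epsilon> (Cod B g) \<odot>\<^bsub>B\<^esub> k (on_arr R g) = g \<odot>\<^bsub>B\<^esub> \<epsilon> (Dom B g)"
      by (intro universal_eq[OF ln[of "on_obj R (Dom B g)"] R.ftr_axioms, of _ "Cod B g"])
         (auto simp: hom_def)
    then show "\<epsilon> (Cod B g) \<odot>\<^bsub>B\<^esub> on_arr L (on_arr R g) = g \<odot>\<^bsub>B\<^esub> \<epsilon> (Dom B g)" by simp
  next
    fix a assume a [simp]: "a \<in> Obj A"
    have "on_arr R (\<epsilon> (l a) \<odot>\<^bsub>B\<^esub> k (n a)) \<odot>\<^bsub>A\<^esub> n a = n a"
      using kn[of "n a"] by (simp add: R2)
    then have "\<epsilon> (l a) \<odot>\<^bsub>B\<^esub> k (n a) = Idn B (l a)"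
      by (intro universal_eq[OF ln[of a] R.ftr_axioms, of _ "l a"]) (auto simp: hom_def)
    then show "\<epsilon> (on_obj L a) \<odot>\<^bsub>B\<^esub> on_arr L (n a) = Idn B (on_obj L a)" by simp
  qed (auto simp: kn t2 hom_def)
  then show ?thesis by (auto dest: adjunction.adjoint)
qed

lemma adjoint_comp:
  assumes "adjoint A B L R" "adjoint B D L' R'"
  shows "adjoint A D (L' \<circ>\<^sub>F L) (R \<circ>\<^sub>F R')"
proof -
  obtain \<eta> \<epsilon> where "adjunction A B L R \<eta> \<epsilon>" using assms(1) by (rule adjointE)
  then interpret P: adjunction A B L R \<eta> \<epsilon> .
  obtain \<eta>' \<epsilon>' where "adjunction B D L' R' \<eta>' \<epsilon>'" using assms(2) by (rule adjointE)
  then interpret Q: adjunction B D L' R' \<eta>' \<epsilon>' .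
  \<comment> \<open>The counit of the composite adjunction, pasted from the two given ones;
    \<open>adjointI_couniversal\<close> supplies the matching unit.\<close>
  define e where "e = (\<lambda>d. \<epsilon>' d \<odot>\<^bsub>D\<^esub> on_arr L' (\<epsilon> (on_obj R' d)))"
  obtain \<eta>'' where "adjunction A D (L' \<circ>\<^sub>F L) (R \<circ>\<^sub>F R') \<eta>'' e"
  proof (rule adjointI_couniversal)
    show "is_functor A D (L' \<circ>\<^sub>F L)" by (rule functor_comp[OF P.L.func Q.L.func])
    show "is_functor D A (R \<circ>\<^sub>F R')" by (rule functor_comp[OF Q.R.func P.R.func])
    fix d assume [simp]: "d \<in> Obj D"
    have eL: "e d \<odot>\<^bsub>D\<^esub> on_arr L' (on_arr L k) = \<epsilon>' d \<odot>\<^bsub>D\<^esub> on_arr L' (\<epsilon> (on_obj R' d) \<odot>\<^bsub>B\<^esub> on_arr L k)"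
      if "k \<in> hom A a (on_obj R (on_obj R' d))" for k a
      using that by (simp add: e_def hom_def)
    show "couniversal A D (L' \<circ>\<^sub>F L) d (on_obj (R \<circ>\<^sub>F R') d) (e d)"
    proof (rule couniversalI)
      fix a h assume a [simp]: "a \<in> Obj A" and h: "h \<in> hom D (on_obj (L' \<circ>\<^sub>F L) a) d"
      obtain k' where k': "k' \<in> hom B (on_obj L a) (on_obj R' d)" "\<epsilon>' d \<odot>\<^bsub>D\<^esub> on_arr L' k' = h"
        using couniversalD(5)[OF Q.couniversal[of d], of "on_obj L a" h] h by auto
      obtain k where k: "k \<in> hom A a (on_obj R (on_obj R' d))"
          "\<epsilon> (on_obj R' d) \<odot>\<^bsub>B\<^esub> on_arr L k = k'"
        using couniversalD(5)[OF P.couniversal[of "on_obj R' d"] a k'(1)] by auto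
      show "\<exists>k. k \<in> hom A a (on_obj (R \<circ>\<^sub>F R') d) \<and> e d \<odot>\<^bsub>D\<^esub> on_arr (L' \<circ>\<^sub>F L) k = h"
        using k eL[OF k(1)] k'(2) by auto
    next
      fix a k k' assume a: "a \<in> Obj A" and k: "k \<in> hom A a (on_obj (R \<circ>\<^sub>F R') d)"
        "k' \<in> hom A a (on_obj (R \<circ>\<^sub>F R') d)"
        and eq: "e d \<odot>\<^bsub>D\<^esub> on_arr (L' \<circ>\<^sub>F L) k = e d \<odot>\<^bsub>D\<^esub> on_arr (L' \<circ>\<^sub>F L) k'"
      have "\<epsilon> (on_obj R' d) \<odot>\<^bsub>B\<^esub> on_arr L k = \<epsilon> (on_obj R' d) \<odot>\<^bsub>B\<^esub> on_arr L k'"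
        using k eq eL[of k a] eL[of k' a]
        by (intro couniversal_eq[OF Q.couniversal[of d] Q.L.ftr_axioms, of _ "on_obj L a"])
           (auto simp: hom_def)
      then show "k = k'"
        using k by (intro couniversal_eq[OF P.couniversal[of "on_obj R' d"] P.L.ftr_axioms, of k a]) auto
    qed (auto simp: hom_def e_def)
  next
    fix g assume [simp]: "g \<in> Arr D"
    have "e (Cod D g) \<odot>\<^bsub>D\<^esub> on_arr L' (on_arr L (on_arr R (on_arr R' g)))
      = \<epsilon>' (Cod D g) \<odot>\<^bsub>D\<^esub> on_arr L' (\<epsilon> (on_obj R' (Cod D g)) \<odot>\<^bsub>B\<^esub> on_arr L (on_arr R (on_arr R' g)))"
      by (simp add: e_def)
    also have "\<dots> = (\<epsilon>' (Cod D g) \<odot>\<^bsub>D\<^esub> on_arr L' (on_arr R' g)) \<odot>\<^bsub>D\<^esub> on_arr L' (\<epsilon> (on_obj R' (Dom D g)))"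
      using P.counit_nat[of "on_arr R' g"] by simp
    also have "\<dots> = g \<odot>\<^bsub>D\<^esub> e (Dom D g)"
      using Q.counit_nat[of g] by (simp add: e_def)
    finally show "e (Cod D g) \<odot>\<^bsub>D\<^esub> on_arr (L' \<circ>\<^sub>F L) (on_arr (R \<circ>\<^sub>F R') g) = g \<odot>\<^bsub>D\<^esub> e (Dom D g)"
      by simp
  qed
  then show ?thesis by (rule adjunction.adjoint)
qed

section \<open>Preservation of limits, geometric morphisms\<close>

lemma limit_cone_eq:
  assumes "limit_cone J A D c p" "category A" "is_functor J A D" "h \<in> hom A d c" "h' \<in> hom A d c"
    "\<And>j. j \<in> Obj J \<Longrightarrow> p j \<odot>\<^bsub>A\<^esub> h = p j \<odot>\<^bsub>A\<^esub> h'"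
  shows "h = h'"
proof -
  interpret D: ftr J A D by (rule ftrI) fact
  have pj: "p j \<in> Arr A" "Dom A (p j) = c" "Cod A (p j) = on_obj D j" if "j \<in> Obj J" for j
    using assms(1) that by (auto simp: limit_cone_def cone_def hom_def)
  have pu: "on_arr D u \<odot>\<^bsub>A\<^esub> p (Dom J u) = p (Cod J u)" if "u \<in> Arr J" for u
    using assms(1) that by (auto simp: limit_cone_def cone_def)
  have h: "h \<in> Arr A" "Dom A h = d" "Cod A h = c" using assms(4) by (auto simp: hom_def)
  have "cone J A D d (\<lambda>j. p j \<odot>\<^bsub>A\<^esub> h)"
    unfolding cone_def
  proof (intro conjI ballI)
    fix u assume [simp]: "u \<in> Arr J"
    have "on_arr D u \<odot>\<^bsub>A\<^esub> (p (Dom J u) \<odot>\<^bsub>A\<^esub> h) = (on_arr D u \<odot>\<^bsub>A\<^esub> p (Dom J u)) \<odot>\<^bsub>A\<^esub> h"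
      using h pj by (intro D.B.assoc[symmetric]) auto
    then show "on_arr D u \<odot>\<^bsub>A\<^esub> (p (Dom J u) \<odot>\<^bsub>A\<^esub> h) = p (Cod J u) \<odot>\<^bsub>A\<^esub> h"
      by (simp add: pu)
  qed (use h pj in \<open>auto simp: hom_def\<close>)
  then have "\<exists>!k. k \<in> hom A d c \<and> (\<forall>j\<in>Obj J. p j \<odot>\<^bsub>A\<^esub> k = p j \<odot>\<^bsub>A\<^esub> h)"
    using assms(1) unfolding limit_cone_def by blast
  then show ?thesis using assms(4-6) by metis
qed

text \<open>Cones over \<open>R \<circ>\<^sub>F D\<close> with vertex \<open>d\<close> transpose to
  cones over \<open>D\<close> with vertex \<open>on_obj L d\<close>, and mediating maps transpose
  along with them.\<close>

lemma right_adjoint_lex: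
  assumes "adjoint A B L R"
  shows "lex_functor B A R"
proof -
  obtain \<eta> \<epsilon> where "adjunction A B L R \<eta> \<epsilon>" using assms(1) by (rule adjointE)
  then interpret P: adjunction A B L R \<eta> \<epsilon> .
  have "limit_cone J A (R \<circ>\<^sub>F D) (on_obj R c) (on_arr R \<circ> p)"
    if D: "is_functor J B D" and lim: "limit_cone J B D c p" for J :: "(nat, nat) cat" and D c p
  proof -
    interpret D: ftr J B D by (rule ftrI) fact
    have pj [simp]: "p j \<in> Arr B" "Dom B (p j) = c" "Cod B (p j) = on_obj D j" if "j \<in> Obj J" for j
      using lim that by (auto simp: limit_cone_def cone_def hom_def)
    have pu: "on_arr D u \<odot>\<^bsub>B\<^esub> p (Dom J u) = p (Cod J u)" if "u \<in> Arr J" for u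
      using lim that by (auto simp: limit_cone_def cone_def)
    have c [simp]: "c \<in> Obj B" using lim by (auto simp: limit_cone_def cone_def)
    show ?thesis
      unfolding limit_cone_def
    proof (intro conjI allI impI)
      show "cone J A (R \<circ>\<^sub>F D) (on_obj R c) (on_arr R \<circ> p)"
        using pu by (auto simp: cone_def hom_def P.R.F_comp[symmetric] simp del: P.R.F_comp)
      fix d q assume q: "cone J A (R \<circ>\<^sub>F D) d q"
      have d [simp]: "d \<in> Obj A" and qj [simp]: "\<And>j. j \<in> Obj J \<Longrightarrow>
          q j \<in> Arr A \<and> Dom A (q j) = d \<and> Cod A (q j) = on_obj R (on_obj D j)"
        and qu: "\<And>u. u \<in> Arr J \<Longrightarrow> on_arr R (on_arr D u) \<odot>\<^bsub>A\<^esub> q (Dom J u) = q (Cod J u)"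
        using q by (auto simp: cone_def hom_def)
      \<comment> \<open>Composition with a leg of the cone commutes with transposition; this serves
        both the existence and the uniqueness of the mediating map.\<close>
      have pe: "p j \<odot>\<^bsub>B\<^esub> (\<epsilon> c \<odot>\<^bsub>B\<^esub> on_arr L k) = \<epsilon> (on_obj D j) \<odot>\<^bsub>B\<^esub> on_arr L (on_arr R (p j) \<odot>\<^bsub>A\<^esub> k)"
        if "j \<in> Obj J" "k \<in> hom A d (on_obj R c)" for j k
      proof -
        have k: "k \<in> Arr A" "Dom A k = d" "Cod A k = on_obj R c" using that by (auto simp: hom_def)
        have "p j \<odot>\<^bsub>B\<^esub> (\<epsilon> c \<odot>\<^bsub>B\<^esub> on_arr L k) = (p j \<odot>\<^bsub>B\<^esub> \<epsilon> c) \<odot>\<^bsub>B\<^esub> on_arr L k"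
          using that k by simp
        also have "\<dots> = (\<epsilon> (on_obj D j) \<odot>\<^bsub>B\<^esub> on_arr L (on_arr R (p j))) \<odot>\<^bsub>B\<^esub> on_arr L k"
          using that k P.counit_nat[of "p j"] by simp
        also have "\<dots> = \<epsilon> (on_obj D j) \<odot>\<^bsub>B\<^esub> on_arr L (on_arr R (p j) \<odot>\<^bsub>A\<^esub> k)"
          using that k by simp
        finally show ?thesis .
      qed
      define r where "r = (\<lambda>j. \<epsilon> (on_obj D j) \<odot>\<^bsub>B\<^esub> on_arr L (q j))"
      have "cone J B D (on_obj L d) r"
        unfolding cone_def
      proof (intro conjI ballI)
        fix u assume [simp]: "u \<in> Arr J"
        have "on_arr D u \<odot>\<^bsub>B\<^esub> r (Dom J u) = (on_arr D u \<odot>\<^bsub>B\<^esub> \<epsilon> (on_obj D (Dom J u))) \<odot>\<^bsub>B\<^esub> on_arr L (q (Dom J u))"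
          by (simp add: r_def)
        also have "\<dots> = (\<epsilon> (on_obj D (Cod J u)) \<odot>\<^bsub>B\<^esub> on_arr L (on_arr R (on_arr D u))) \<odot>\<^bsub>B\<^esub> on_arr L (q (Dom J u))"
          using P.counit_nat[of "on_arr D u"] by simp
        also have "\<dots> = \<epsilon> (on_obj D (Cod J u)) \<odot>\<^bsub>B\<^esub> on_arr L (on_arr R (on_arr D u) \<odot>\<^bsub>A\<^esub> q (Dom J u))"
          by simp
        also have "\<dots> = r (Cod J u)" by (simp only: qu \<open>u \<in> Arr J\<close> r_def)
        finally show "on_arr D u \<odot>\<^bsub>B\<^esub> r (Dom J u) = r (Cod J u)" .
      qed (auto simp: r_def hom_def)
      then obtain h where h: "h \<in> hom B (on_obj L d) c" "\<forall>j\<in>Obj J. p j \<odot>\<^bsub>B\<^esub> h = r j"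
        using lim unfolding limit_cone_def by blast
      obtain k where k: "k \<in> hom A d (on_obj R c)" "\<epsilon> c \<odot>\<^bsub>B\<^esub> on_arr L k = h"
        using couniversalD(5)[OF P.couniversal[of c] d h(1)] by auto
      have k1: "on_arr R (p j) \<odot>\<^bsub>A\<^esub> k = q j" if "j \<in> Obj J" for j
        using pe[OF that k(1)] k h that
        by (intro couniversal_eq[OF P.couniversal[of "on_obj D j"] P.L.ftr_axioms, of _ d])
           (auto simp: hom_def r_def)
      show "\<exists>!h. h \<in> hom A d (on_obj R c) \<and> (\<forall>j\<in>Obj J. (on_arr R \<circ> p) j \<odot>\<^bsub>A\<^esub> h = q j)"
      proof (rule ex1I[of _ k])
        show "k \<in> hom A d (on_obj R c) \<and> (\<forall>j\<in>Obj J. (on_arr R \<circ> p) j \<odot>\<^bsub>A\<^esub> k = q j)"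
          using k1 k by auto
        fix k' assume k': "k' \<in> hom A d (on_obj R c) \<and> (\<forall>j\<in>Obj J. (on_arr R \<circ> p) j \<odot>\<^bsub>A\<^esub> k' = q j)"
        have "\<epsilon> c \<odot>\<^bsub>B\<^esub> on_arr L k' = \<epsilon> c \<odot>\<^bsub>B\<^esub> on_arr L k"
        proof (rule limit_cone_eq[OF lim P.L.B.category_axioms D, of _ "on_obj L d"])
          fix j assume j: "j \<in> Obj J"
          have "on_arr R (p j) \<odot>\<^bsub>A\<^esub> k' = q j" using k' j by simp
          then show "p j \<odot>\<^bsub>B\<^esub> (\<epsilon> c \<odot>\<^bsub>B\<^esub> on_arr L k') = p j \<odot>\<^bsub>B\<^esub> (\<epsilon> c \<odot>\<^bsub>B\<^esub> on_arr L k)"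
            using pe[OF j k(1)] pe[OF j conjunct1[OF k']] k1[OF j] by (simp only:)
        qed (use k k' in \<open>auto simp: hom_def\<close>)
        then show "k' = k"
          using k k' by (intro couniversal_eq[OF P.couniversal[of c] P.L.ftr_axioms, of k' d]) auto
      qed
    qed
  qed
  then show ?thesis by (auto simp: lex_functor_def P.R.func)
qed

lemma lex_comp:
  assumes "lex_functor A B F" "lex_functor B D G"
  shows "lex_functor A D (G \<circ>\<^sub>F F)"
  unfolding lex_functor_def
proof (intro conjI allI impI)
  show "is_functor A D (G \<circ>\<^sub>F F)" using assms functor_comp by (auto simp: lex_functor_def)
  fix J :: "(nat, nat) cat" and E c p
  assume J: "category J \<and> finite (Obj J) \<and> finite (Arr J) \<and> is_functor J A E \<and> limit_cone J A E c p"
  then have "limit_cone J B (F \<circ>\<^sub>F E) (on_obj F c) (on_arr F \<circ> p)"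
    using assms(1) by (auto simp: lex_functor_def)
  moreover have "is_functor J B (F \<circ>\<^sub>F E)"
    using J assms(1) functor_comp by (auto simp: lex_functor_def)
  ultimately have "limit_cone J D (G \<circ>\<^sub>F (F \<circ>\<^sub>F E)) (on_obj G (on_obj F c)) (on_arr G \<circ> (on_arr F \<circ> p))"
    using assms(2) J by (auto simp: lex_functor_def)
  then show "limit_cone J D (G \<circ>\<^sub>F F \<circ>\<^sub>F E) (on_obj (G \<circ>\<^sub>F F) c) (on_arr (G \<circ>\<^sub>F F) \<circ> p)"
    by (simp add: comp_ftor_def comp_assoc)
qed

lemma geometric_comp:
  assumes "geometric_morphism F S f" "geometric_morphism L F l"
  shows "geometric_morphism L S (f \<circ>\<^sub>G l)"
  using assms by (auto simp: geometric_morphism_def comp_geom_def intro: adjoint_comp lex_comp)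

text \<open>The empty diagram shape, for which \<open>lex_functor\<close> says that terminal objects
  are preserved. The functions are arbitrary, there being nothing to apply them to.\<close>

definition empty_cat :: "(nat, nat) cat" where
  "empty_cat = \<lparr>Obj = {}, Arr = {}, Dom = id, Cod = id, Idn = id, Comp = (\<lambda>x y. x)\<rparr>"

lemma limit_cone_empty_cat: "limit_cone empty_cat A D t p \<longleftrightarrow> terminal_obj A t"
  by (auto simp: limit_cone_def cone_def terminal_obj_def empty_cat_def)

lemma lex_terminal:
  assumes F: "lex_functor A B F" and t: "terminal_obj A t"
  shows "terminal_obj B (on_obj F t)"
proof -
  have J: "category empty_cat" "finite (Obj empty_cat)" "finite (Arr empty_cat)"
    by (simp_all add: category_def empty_cat_def hom_def)
  have D: "is_functor empty_cat A D" for D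
    using F J(1) by (simp add: lex_functor_def is_functor_def) (simp add: empty_cat_def)
  have "limit_cone empty_cat A D t p" for D p using t by (simp add: limit_cone_empty_cat)
  then have "limit_cone empty_cat B (F \<circ>\<^sub>F D) (on_obj F t) (on_arr F \<circ> p)" for D p
    using F J D unfolding lex_functor_def by blast
  then show ?thesis by (simp add: limit_cone_empty_cat)
qed

section \<open>Fully faithful right adjoints\<close>

context adjunction
begin

lemma full_faithful_right:
  assumes "\<And>b. b \<in> Obj B \<Longrightarrow> iso_arr B (\<epsilon> b)"
  shows "full_faithful B A R"
  unfolding full_faithful_def
proof (intro conjI ballI)
  show "is_functor B A R" by (rule R.func)
  fix b b' assume b [simp]: "b \<in> Obj B" "b' \<in> Obj B"
  note i [simp] = assms[OF b(1)]
  \<comment> \<open>A map is recovered from its image under \<open>R\<close> by conjugating with the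
    counit, which gives faithfulness; the same formula produces the preimage \<open>x\<close>
    below.\<close>
  have k: "k = \<epsilon> b' \<odot>\<^bsub>B\<^esub> (on_arr L (on_arr R k) \<odot>\<^bsub>B\<^esub> inv_arr B (\<epsilon> b))" if "k \<in> hom B b b'" for k
  proof -
    have k: "k \<in> Arr B" "Dom B k = b" "Cod B k = b'" using that by (auto simp: hom_def)
    then have "\<epsilon> b' \<odot>\<^bsub>B\<^esub> (on_arr L (on_arr R k) \<odot>\<^bsub>B\<^esub> inv_arr B (\<epsilon> b))
      = (\<epsilon> b' \<odot>\<^bsub>B\<^esub> on_arr L (on_arr R k)) \<odot>\<^bsub>B\<^esub> inv_arr B (\<epsilon> b)" by simp
    also have "\<dots> = k" using k counit_nat[of k] by simp
    finally show ?thesis by simp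
  qed
  show "bij_betw (on_arr R) (hom B b b') (hom A (on_obj R b) (on_obj R b'))"
  proof (rule bij_betwI')
    show "(on_arr R x = on_arr R y) = (x = y)" if "x \<in> hom B b b'" "y \<in> hom B b b'" for x y
      using k[OF that(1)] k[OF that(2)] by auto
    show "on_arr R x \<in> hom A (on_obj R b) (on_obj R b')" if "x \<in> hom B b b'" for x
      using that by (rule R.F_hom)
    fix g assume g: "g \<in> hom A (on_obj R b) (on_obj R b')"
    define x where "x = \<epsilon> b' \<odot>\<^bsub>B\<^esub> (on_arr L g \<odot>\<^bsub>B\<^esub> inv_arr B (\<epsilon> b))"
    have x: "x \<in> hom B b b'" using g by (auto simp: x_def hom_def)
    have xs: "x \<in> Arr B" "Dom B x = b" "Cod B x = b'" using x by (auto simp: hom_def)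
    have "\<epsilon> b' \<odot>\<^bsub>B\<^esub> on_arr L (on_arr R x) = x \<odot>\<^bsub>B\<^esub> \<epsilon> b"
      using counit_nat[of x] xs by simp
    also have "\<dots> = \<epsilon> b' \<odot>\<^bsub>B\<^esub> on_arr L g"
      using g by (simp add: hom_def x_def)
    finally have "\<epsilon> b' \<odot>\<^bsub>B\<^esub> on_arr L (on_arr R x) = \<epsilon> b' \<odot>\<^bsub>B\<^esub> on_arr L g" .
    then have "on_arr R x = g"
      using x g by (intro couniversal_eq[OF couniversal[of b'] L.ftr_axioms, of _ "on_obj R b"])
        (auto simp: hom_def)
    then show "\<exists>x\<in>hom B b b'. g = on_arr R x" using x by auto
  qed
qed

text \<open>Fullness provides a \<open>k\<close> that \<open>R\<close> sends to the unit at
  \<open>on_obj R b\<close>; faithfulness and the first triangle identity make it inverse to the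
  counit.\<close>

lemma counit_iso:
  assumes "full_faithful B A R" "b \<in> Obj B"
  shows "iso_arr B (\<epsilon> b)"
proof -
  note [simp] = assms(2)
  have bij: "bij_betw (on_arr R) (hom B x y) (hom A (on_obj R x) (on_obj R y))"
    if "x \<in> Obj B" "y \<in> Obj B" for x y using assms(1) that by (auto simp: full_faithful_def)
  have "\<eta> (on_obj R b) \<in> hom A (on_obj R b) (on_obj R (on_obj L (on_obj R b)))"
    by (auto simp: hom_def)
  then obtain k where k: "k \<in> hom B b (on_obj L (on_obj R b))" "on_arr R k = \<eta> (on_obj R b)"
    using bij_betw_imp_surj_on[OF bij[of b "on_obj L (on_obj R b)"]] by (force simp: image_iff)
  have k' [simp]: "k \<in> Arr B" "Dom B k = b" "Cod B k = on_obj L (on_obj R b)"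
    using k(1) by (auto simp: hom_def)
  have "on_arr R (\<epsilon> b \<odot>\<^bsub>B\<^esub> k) = on_arr R (Idn B b)"
    using k tri2[of b] by simp
  then have 1: "\<epsilon> b \<odot>\<^bsub>B\<^esub> k = Idn B b"
    using bij_betw_imp_inj_on[OF bij[of b b]] by (auto simp: inj_on_def hom_def)
  have 2: "k \<odot>\<^bsub>B\<^esub> \<epsilon> b = Idn B (on_obj L (on_obj R b))"
    using counit_nat[of k] tri1[of "on_obj R b"] k by simp
  show ?thesis by (rule iso_arrI[OF counit_hom k(1) 1 2]) simp
qed

text \<open>Couniversal arrows for the same object differ by an isomorphism, so one invertible
  couniversal arrow per object makes every choice of counit invertible. This serves for right
  adjoints that are given only up to isomorphism, such as the direct image in
  \<open>is_D\<close>.\<close>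

lemma full_faithful_rightI:
  assumes "\<And>b. b \<in> Obj B \<Longrightarrow> \<exists>r e. couniversal A B L b r e \<and> iso_arr B e"
  shows "full_faithful B A R" and "\<And>b. b \<in> Obj B \<Longrightarrow> iso_arr B (\<epsilon> b)"
proof -
  show *: "iso_arr B (\<epsilon> b)" if [simp]: "b \<in> Obj B" for b
  proof -
    obtain r e where r: "couniversal A B L b r e" and e: "iso_arr B e" using assms[of b] by auto
    note [simp] = couniversalD(1-4)[OF r]
    obtain k where k: "k \<in> hom A (on_obj R b) r" "e \<odot>\<^bsub>B\<^esub> on_arr L k = \<epsilon> b"
      using couniversalD(5)[OF r, of "on_obj R b" "\<epsilon> b"] by (auto simp: hom_def)
    obtain k' where k': "k' \<in> hom A r (on_obj R b)" "\<epsilon> b \<odot>\<^bsub>B\<^esub> on_arr L k' = e"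
      using couniversalD(5)[OF couniversal[of b], of r e] by (auto simp: hom_def)
    have ks: "k \<in> Arr A" "Dom A k = on_obj R b" "Cod A k = r"
      "k' \<in> Arr A" "Dom A k' = r" "Cod A k' = on_obj R b"
      using k(1) k'(1) by (auto simp: hom_def)
    have "e \<odot>\<^bsub>B\<^esub> on_arr L (k \<odot>\<^bsub>A\<^esub> k') = (e \<odot>\<^bsub>B\<^esub> on_arr L k) \<odot>\<^bsub>B\<^esub> on_arr L k'"
      using ks by simp
    then have 1: "k \<odot>\<^bsub>A\<^esub> k' = Idn A r"
      using ks k(2) k'(2)
      by (intro couniversal_eq[OF r L.ftr_axioms, of _ r]) (auto simp: hom_def)
    have "\<epsilon> b \<odot>\<^bsub>B\<^esub> on_arr L (k' \<odot>\<^bsub>A\<^esub> k) = (\<epsilon> b \<odot>\<^bsub>B\<^esub> on_arr L k') \<odot>\<^bsub>B\<^esub> on_arr L k"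
      using ks by simp
    then have 2: "k' \<odot>\<^bsub>A\<^esub> k = Idn A (on_obj R b)"
      using ks k(2) k'(2)
      by (intro couniversal_eq[OF couniversal[of b] L.ftr_axioms, of _ "on_obj R b"]) (auto simp: hom_def)
    have "iso_arr A k" by (rule iso_arrI[OF k(1) k'(1) 1 2])
    then have "iso_arr B (e \<odot>\<^bsub>B\<^esub> on_arr L k)" using e ks by (intro L.B.iso_comp L.F_iso) auto
    then show ?thesis by (simp add: k)
  qed
  show "full_faithful B A R" by (rule full_faithful_right) (rule *)
qed

end

text \<open>In an adjoint triple \<open>L\<close>, \<open>R\<close>, \<open>S\<close> full
  faithfulness passes from \<open>S\<close> to \<open>L\<close>. Maps from
  \<open>on_obj R (on_obj L z)\<close> to \<open>x\<close> correspond to maps from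
  \<open>on_obj L z\<close> to \<open>on_obj S x\<close>, hence to maps from \<open>z\<close> to
  \<open>on_obj R (on_obj S x)\<close>, which is \<open>x\<close> up to isomorphism; so
  \<open>\<eta> z\<close> has the universal property of an identity.\<close>

lemma unit_iso_of_ff_right:
  assumes "adjunction M E L R \<eta> \<sigma>" "adjunction E M R S \<eta>' \<epsilon>"
    and iso: "\<And>z. z \<in> Obj M \<Longrightarrow> iso_arr M (\<epsilon> z)" and z: "z \<in> Obj M"
  shows "iso_arr M (\<eta> z)"
proof -
  interpret P: adjunction M E L R \<eta> \<sigma> by fact
  interpret Q: adjunction E M R S \<eta>' \<epsilon> by fact
  note [simp] = z
  have "inv_arr M (\<epsilon> z) \<in> hom M z (on_obj R (on_obj S z))"
    using iso[OF z] by (auto simp: hom_def)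
  then obtain w where w: "w \<in> hom E (on_obj L z) (on_obj S z)"
    "on_arr R w \<odot>\<^bsub>M\<^esub> \<eta> z = inv_arr M (\<epsilon> z)"
    using universalD(5)[OF P.universal[OF z], of "on_obj S z"] by auto
  have ws [simp]: "w \<in> Arr E" "Dom E w = on_obj L z" "Cod E w = on_obj S z"
    using w(1) by (auto simp: hom_def)
  \<comment> \<open>The map whose composite with \<open>\<eta> z\<close> is the identity;
    \<open>eq\<close> below shows that it is also a section.\<close>
  define u where "u = \<epsilon> z \<odot>\<^bsub>M\<^esub> on_arr R w"
  have us: "u \<in> Arr M" "Dom M u = on_obj R (on_obj L z)" "Cod M u = z" by (auto simp: u_def)
  have u: "u \<odot>\<^bsub>M\<^esub> \<eta> z = Idn M z" using w(2) iso[OF z] by (simp add: u_def)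
  have eq: "f = g" if f: "f \<in> hom M (on_obj R (on_obj L z)) x" and g: "g \<in> hom M (on_obj R (on_obj L z)) x"
    and fg: "f \<odot>\<^bsub>M\<^esub> \<eta> z = g \<odot>\<^bsub>M\<^esub> \<eta> z" for f g x
  proof -
    have x [simp]: "x \<in> Obj M" using f by (auto simp: hom_def)
    obtain f' where f': "f' \<in> hom E (on_obj L z) (on_obj S x)" "\<epsilon> x \<odot>\<^bsub>M\<^esub> on_arr R f' = f"
      using couniversalD(5)[OF Q.couniversal[OF x], of "on_obj L z" f] f by auto
    obtain g' where g': "g' \<in> hom E (on_obj L z) (on_obj S x)" "\<epsilon> x \<odot>\<^bsub>M\<^esub> on_arr R g' = g"
      using couniversalD(5)[OF Q.couniversal[OF x], of "on_obj L z" g] g by auto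
    have s: "f' \<in> Arr E" "Dom E f' = on_obj L z" "Cod E f' = on_obj S x"
      "g' \<in> Arr E" "Dom E g' = on_obj L z" "Cod E g' = on_obj S x"
      using f' g' by (auto simp: hom_def)
    have "\<epsilon> x \<odot>\<^bsub>M\<^esub> (on_arr R f' \<odot>\<^bsub>M\<^esub> \<eta> z) = \<epsilon> x \<odot>\<^bsub>M\<^esub> (on_arr R g' \<odot>\<^bsub>M\<^esub> \<eta> z)"
      using fg s unfolding f'(2)[symmetric] g'(2)[symmetric] by simp
    then have "on_arr R f' \<odot>\<^bsub>M\<^esub> \<eta> z = on_arr R g' \<odot>\<^bsub>M\<^esub> \<eta> z"
      using s by - (rule P.L.A.iso_cancel_left[OF iso[OF x]], auto)
    then have "f' = g'"
      by (rule universal_eq[OF P.universal[OF z] P.R.ftr_axioms f'(1) g'(1)])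
    then show ?thesis using f' g' by auto
  qed
  have "\<eta> z \<odot>\<^bsub>M\<^esub> u = Idn M (on_obj R (on_obj L z))"
    using u us by - (rule eq[of _ "on_obj R (on_obj L z)"], auto simp: hom_def)
  then show ?thesis
    using u us by (intro iso_arrI[of _ _ z "on_obj R (on_obj L z)" u]) (auto simp: hom_def)
qed

section \<open>Natural isomorphisms and equivalences\<close>

lemma nat_transE:
  assumes "nat_trans A B F G t"
  shows "is_functor A B F" "is_functor A B G"
    "a \<in> Obj A \<Longrightarrow> t a \<in> Arr B" "a \<in> Obj A \<Longrightarrow> Dom B (t a) = on_obj F a"
    "a \<in> Obj A \<Longrightarrow> Cod B (t a) = on_obj G a"
    "f \<in> Arr A \<Longrightarrow> t (Cod A f) \<odot>\<^bsub>B\<^esub> on_arr F f = on_arr G f \<odot>\<^bsub>B\<^esub> t (Dom A f)"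
  using assms by (auto simp: nat_trans_def hom_def)

lemma nat_trans_inv:
  assumes t: "nat_trans A B F G t" and iso: "\<And>a. a \<in> Obj A \<Longrightarrow> iso_arr B (t a)"
  shows "nat_trans A B G F (\<lambda>a. inv_arr B (t a))"
proof -
  interpret F: ftr A B F by (rule ftrI) (rule nat_transE(1)[OF t])
  interpret G: ftr A B G by (rule ftrI) (rule nat_transE(2)[OF t])
  note [simp] = nat_transE(3-5)[OF t] iso
  have "inv_arr B (t (Cod A f)) \<odot>\<^bsub>B\<^esub> on_arr G f = on_arr F f \<odot>\<^bsub>B\<^esub> inv_arr B (t (Dom A f))"
    if [simp]: "f \<in> Arr A" for f
  proof (rule F.B.iso_cancel_left[OF iso[of "Cod A f"]])
    have "t (Cod A f) \<odot>\<^bsub>B\<^esub> (on_arr F f \<odot>\<^bsub>B\<^esub> inv_arr B (t (Dom A f)))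
      = (t (Cod A f) \<odot>\<^bsub>B\<^esub> on_arr F f) \<odot>\<^bsub>B\<^esub> inv_arr B (t (Dom A f))" by simp
    also have "\<dots> = on_arr G f" by (simp only: nat_transE(6)[OF t that]) simp
    finally show "t (Cod A f) \<odot>\<^bsub>B\<^esub> (inv_arr B (t (Cod A f)) \<odot>\<^bsub>B\<^esub> on_arr G f) =
      t (Cod A f) \<odot>\<^bsub>B\<^esub> (on_arr F f \<odot>\<^bsub>B\<^esub> inv_arr B (t (Dom A f)))" by simp
  qed simp_all
  then show ?thesis by (auto simp: nat_trans_def F.func G.func hom_def)
qed

lemma nat_isomorphic_sym:
  assumes "nat_isomorphic A B F G"
  shows "nat_isomorphic A B G F"
proof -
  obtain t where "nat_trans A B F G t" "\<And>a. a \<in> Obj A \<Longrightarrow> iso_arr B (t a)"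
    using assms by (auto simp: nat_isomorphic_def)
  then show ?thesis
    unfolding nat_isomorphic_def
    by (intro exI[of _ "\<lambda>a. inv_arr B (t a)"]) (auto intro: nat_trans_inv iso_inv_arr)
qed

text \<open>The new counit is the old one preceded by the inverse of the isomorphism. In this way
  one functor can inherit its right adjoint from another.\<close>

lemma adjoint_nat_iso:
  assumes "adjoint A B F R" "nat_isomorphic A B F G"
  shows "adjoint A B G R"
proof -
  obtain \<eta> \<epsilon> where "adjunction A B F R \<eta> \<epsilon>" using assms(1) by (rule adjointE)
  then interpret P: adjunction A B F R \<eta> \<epsilon> .
  obtain t where t: "nat_trans A B F G t" and iso: "\<And>a. a \<in> Obj A \<Longrightarrow> iso_arr B (t a)"
    using assms(2) by (auto simp: nat_isomorphic_def)
  interpret G: ftr A B G by (rule ftrI) (rule nat_transE(2)[OF t])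
  note [simp] = nat_transE(3-5)[OF t] iso
  define e where "e = (\<lambda>b. \<epsilon> b \<odot>\<^bsub>B\<^esub> inv_arr B (t (on_obj R b)))"
  have inv: "inv_arr B (t (Cod A k)) \<odot>\<^bsub>B\<^esub> on_arr G k = on_arr F k \<odot>\<^bsub>B\<^esub> inv_arr B (t (Dom A k))"
    if "k \<in> Arr A" for k using nat_transE(6)[OF nat_trans_inv[OF t iso] that] .
  have eG: "e b \<odot>\<^bsub>B\<^esub> on_arr G k = (\<epsilon> b \<odot>\<^bsub>B\<^esub> on_arr F k) \<odot>\<^bsub>B\<^esub> inv_arr B (t a)"
    if "k \<in> hom A a (on_obj R b)" "b \<in> Obj B" for k a b
    using that inv[of k] by (auto simp: e_def hom_def)
  have eGt: "(e b \<odot>\<^bsub>B\<^esub> on_arr G k) \<odot>\<^bsub>B\<^esub> t a = \<epsilon> b \<odot>\<^bsub>B\<^esub> on_arr F k"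
    if "k \<in> hom A a (on_obj R b)" "b \<in> Obj B" "a \<in> Obj A" for k a b
    using that unfolding eG[OF that(1,2)] by (auto simp: hom_def)
  obtain \<eta>' where "adjunction A B G R \<eta>' e"
  proof (rule adjointI_couniversal)
    fix b assume b [simp]: "b \<in> Obj B"
    show "couniversal A B G b (on_obj R b) (e b)"
    proof (rule couniversalI)
      fix a h assume a [simp]: "a \<in> Obj A" and h: "h \<in> hom B (on_obj G a) b"
      obtain k where k: "k \<in> hom A a (on_obj R b)" "\<epsilon> b \<odot>\<^bsub>B\<^esub> on_arr F k = h \<odot>\<^bsub>B\<^esub> t a"
        using couniversalD(5)[OF P.couniversal[OF b] a, of "h \<odot>\<^bsub>B\<^esub> t a"] h by (auto simp: hom_def)
      show "\<exists>k. k \<in> hom A a (on_obj R b) \<and> e b \<odot>\<^bsub>B\<^esub> on_arr G k = h"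
        using h k by (intro exI[of _ k]) (auto simp: eG[OF k(1) b] hom_def)
    next
      fix a k k' assume "a \<in> Obj A" and k: "k \<in> hom A a (on_obj R b)" "k' \<in> hom A a (on_obj R b)"
        "e b \<odot>\<^bsub>B\<^esub> on_arr G k = e b \<odot>\<^bsub>B\<^esub> on_arr G k'"
      then show "k = k'"
        using eGt[of k a b] eGt[of k' a b] couniversal_eq[OF P.couniversal[OF b] P.L.ftr_axioms k(1,2)] by auto
    qed (auto simp: e_def hom_def)
  next
    fix g assume [simp]: "g \<in> Arr B"
    have "e (Cod B g) \<odot>\<^bsub>B\<^esub> on_arr G (on_arr R g)
      = (\<epsilon> (Cod B g) \<odot>\<^bsub>B\<^esub> on_arr F (on_arr R g)) \<odot>\<^bsub>B\<^esub> inv_arr B (t (on_obj R (Dom B g)))"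
      by (rule eG) (auto simp: hom_def)
    also have "\<dots> = g \<odot>\<^bsub>B\<^esub> e (Dom B g)"
      using P.counit_nat[of g] by (simp add: e_def)
    finally show "e (Cod B g) \<odot>\<^bsub>B\<^esub> on_arr G (on_arr R g) = g \<odot>\<^bsub>B\<^esub> e (Dom B g)" .
  qed (rule G.func P.R.func)+
  then show ?thesis by (rule adjunction.adjoint)
qed

lemma full_faithfulD:
  assumes "full_faithful A B F" "a \<in> Obj A" "a' \<in> Obj A"
  shows "g \<in> hom B (on_obj F a) (on_obj F a') \<Longrightarrow> \<exists>f. f \<in> hom A a a' \<and> on_arr F f = g"
    and "f \<in> hom A a a' \<Longrightarrow> f' \<in> hom A a a' \<Longrightarrow> on_arr F f = on_arr F f' \<Longrightarrow> f = f'"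
proof -
  have "bij_betw (on_arr F) (hom A a a') (hom B (on_obj F a) (on_obj F a'))"
    using assms by (auto simp: full_faithful_def)
  then have inj: "inj_on (on_arr F) (hom A a a')"
    and im: "on_arr F ` hom A a a' = hom B (on_obj F a) (on_obj F a')"
    by (auto simp: bij_betw_def)
  show "g \<in> hom B (on_obj F a) (on_obj F a') \<Longrightarrow> \<exists>f. f \<in> hom A a a' \<and> on_arr F f = g"
    unfolding im[symmetric] by blast
  show "f \<in> hom A a a' \<Longrightarrow> f' \<in> hom A a a' \<Longrightarrow> on_arr F f = on_arr F f' \<Longrightarrow> f = f'"
    using inj by (auto simp: inj_on_def)
qed

lemma full_faithful_reflects_iso:
  assumes ff: "full_faithful A B F" and f: "f \<in> Arr A" and iso: "iso_arr B (on_arr F f)"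
  shows "iso_arr A f"
proof -
  interpret F: ftr A B F using ff by (intro ftrI) (simp add: full_faithful_def)
  note [simp] = f
  have "inv_arr B (on_arr F f) \<in> hom B (on_obj F (Cod A f)) (on_obj F (Dom A f))"
    using iso by (auto simp: hom_def)
  then obtain g where g: "g \<in> hom A (Cod A f) (Dom A f)" "on_arr F g = inv_arr B (on_arr F f)"
    using full_faithfulD(1)[OF ff, of "Cod A f" "Dom A f"] by auto
  have gs [simp]: "g \<in> Arr A" "Dom A g = Cod A f" "Cod A g = Dom A f" using g by (auto simp: hom_def)
  have "f \<odot>\<^bsub>A\<^esub> g = Idn A (Cod A f)"
    using g iso by (intro full_faithfulD(2)[OF ff, of "Cod A f" "Cod A f"]) (auto simp: hom_def)
  moreover have "g \<odot>\<^bsub>A\<^esub> f = Idn A (Dom A f)"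
    using g iso by (intro full_faithfulD(2)[OF ff, of "Dom A f" "Dom A f"]) (auto simp: hom_def)
  ultimately show ?thesis using f g(1) by (auto simp: iso_arr_def)
qed

lemma full_faithful_comp:
  assumes "full_faithful A B F" "full_faithful B D G"
  shows "full_faithful A D (G \<circ>\<^sub>F F)"
proof -
  interpret F: ftr A B F using assms by (intro ftrI) (simp add: full_faithful_def)
  have "bij_betw (on_arr G \<circ> on_arr F) (hom A a b) (hom D (on_obj G (on_obj F a)) (on_obj G (on_obj F b)))"
    if "a \<in> Obj A" "b \<in> Obj A" for a b
    using assms that by (intro bij_betw_trans) (auto simp: full_faithful_def)
  then show ?thesis
    using assms functor_comp by (auto simp: full_faithful_def comp_ftor_def)
qed

text \<open>For fully faithful \<open>H\<close> an isomorphism from an object in its image to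
  \<open>z\<close> is already a couniversal arrow, so a right adjoint \<open>K\<close> exists. Its
  unit and counit are invertible, and their inverses make \<open>K\<close> a left adjoint as well;
  adjoint triples are transported with both.\<close>

lemma equivalence_inverse:
  assumes ff: "full_faithful E P H"
    and es: "\<And>z. z \<in> Obj P \<Longrightarrow> \<exists>e i. e \<in> Obj E \<and> i \<in> hom P (on_obj H e) z \<and> iso_arr P i"
  obtains K \<eta> where "adjoint E P H K" "adjoint P E K H" "full_faithful P E K" "nat_trans E E id_ftor (K \<circ>\<^sub>F H) \<eta>"
    "\<And>e. e \<in> Obj E \<Longrightarrow> iso_arr E (\<eta> e)"
proof -
  interpret H: ftr E P H using ff by (intro ftrI) (simp add: full_faithful_def)
  have cu: "\<exists>r e. couniversal E P H z r e \<and> iso_arr P e" if z: "z \<in> Obj P" for z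
  proof -
    obtain e i where e [simp]: "e \<in> Obj E" and i: "i \<in> hom P (on_obj H e) z" "iso_arr P i"
      using es[OF z] by auto
    have ii: "i \<in> Arr P" "Dom P i = on_obj H e" "Cod P i = z" using i by (auto simp: hom_def)
    have "couniversal E P H z e i"
    proof (rule couniversalI)
      fix a h assume a: "a \<in> Obj E" and h: "h \<in> hom P (on_obj H a) z"
      have "inv_arr P i \<odot>\<^bsub>P\<^esub> h \<in> hom P (on_obj H a) (on_obj H e)"
        using h i(2) ii by (auto simp: hom_def)
      then obtain k where "k \<in> hom E a e" "on_arr H k = inv_arr P i \<odot>\<^bsub>P\<^esub> h"
        using full_faithfulD(1)[OF ff a e] by auto
      then show "\<exists>k. k \<in> hom E a e \<and> i \<odot>\<^bsub>P\<^esub> on_arr H k = h"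
        using h i(2) ii by (auto simp: hom_def)
    next
      fix a k k' assume "a \<in> Obj E" "k \<in> hom E a e" "k' \<in> hom E a e" "i \<odot>\<^bsub>P\<^esub> on_arr H k = i \<odot>\<^bsub>P\<^esub> on_arr H k'"
      then show "k = k'"
        using ii by - (rule full_faithfulD(2)[OF ff _ e, of a], assumption+, rule H.B.iso_cancel_left[OF i(2)], auto simp: hom_def)
    qed (use i in auto)
    then show ?thesis using i by auto
  qed
  obtain K where K: "adjoint E P H K"
    using right_adjoint_exists[OF H.func] cu by blast
  then obtain \<eta> \<epsilon> where "adjunction E P H K \<eta> \<epsilon>" by (rule adjointE)
  then interpret P: adjunction E P H K \<eta> \<epsilon> .
  have ei: "iso_arr P (\<epsilon> z)" if "z \<in> Obj P" for z
    by (rule P.full_faithful_rightI(2)) (use cu that in auto)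
  \<comment> \<open>By a triangle identity \<open>H\<close> sends the unit to the inverse of the
    counit, and \<open>H\<close> reflects isomorphisms.\<close>
  have hi: "iso_arr E (\<eta> e)" if e [simp]: "e \<in> Obj E" for e
  proof -
    have eH: "iso_arr P (\<epsilon> (on_obj H e))" by (rule ei) auto
    have "inv_arr P (\<epsilon> (on_obj H e)) = on_arr H (\<eta> e)"
      using P.tri1[OF e] eH by - (rule H.B.iso_cancel_left[OF eH], auto)
    then have "iso_arr P (on_arr H (\<eta> e))" using iso_inv_arr[OF eH] by simp
    then show ?thesis by (intro full_faithful_reflects_iso[OF ff]) auto
  qed
  have n1: "nat_trans E E id_ftor (K \<circ>\<^sub>F H) \<eta>"
    using P.unit_nat functor_id[OF H.A.category_axioms] functor_comp[OF H.func P.R.func]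
    by (auto simp: nat_trans_def hom_def)
  have n2: "nat_trans P P (H \<circ>\<^sub>F K) id_ftor \<epsilon>"
    using P.counit_nat functor_id[OF H.B.category_axioms] functor_comp[OF P.R.func H.func]
    by (auto simp: nat_trans_def hom_def)
  note i1 = nat_transE(6)[OF nat_trans_inv[OF n1 hi], simplified]
    and i2 = nat_transE(6)[OF nat_trans_inv[OF n2 ei], simplified]
  have "adjunction P E K H (\<lambda>z. inv_arr P (\<epsilon> z)) (\<lambda>e. inv_arr E (\<eta> e))"
  proof
    fix a assume a [simp]: "a \<in> Obj P"
    have "on_arr K (inv_arr P (\<epsilon> a)) = \<eta> (on_obj K a)"
      using P.tri2[OF a] P.R.F_comp[of "inv_arr P (\<epsilon> a)" "\<epsilon> a"] ei[OF a]
      by - (rule H.A.iso_cancel_left[OF P.R.F_iso[OF ei[OF a]]], auto)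
    then show "inv_arr E (\<eta> (on_obj K a)) \<odot>\<^bsub>E\<^esub> on_arr K (inv_arr P (\<epsilon> a)) = Idn E (on_obj K a)"
      using hi[of "on_obj K a"] by simp
  next
    fix b assume b [simp]: "b \<in> Obj E"
    have "inv_arr P (\<epsilon> (on_obj H b)) = on_arr H (\<eta> b)"
      using P.tri1[OF b] ei[of "on_obj H b"]
      by - (rule H.B.iso_cancel_left[OF ei[of "on_obj H b"]], auto)
    then show "on_arr H (inv_arr E (\<eta> b)) \<odot>\<^bsub>P\<^esub> inv_arr P (\<epsilon> (on_obj H b)) = Idn P (on_obj H b)"
      using hi[OF b] H.F_comp[of "\<eta> b" "inv_arr E (\<eta> b)"] by simp
  qed (use i1 i2 ei hi in \<open>auto simp: hom_def\<close>)
  then have "adjoint P E K H" by (rule adjunction.adjoint)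
  then show ?thesis using K n1 hi P.full_faithful_right[OF ei] that by blast
qed

section \<open>Presheaf toposes\<close>

text \<open>The axioms of the universe speak of unions of subsets of \<open>'u\<close> indexed by a
  subset of \<open>'u\<close>, whereas here index and fibres live at other types. Both are injected
  into \<open>'u\<close>, and a pairing function, available since \<open>'u\<close> is infinite,
  keeps the fibres apart.\<close>

lemma small_Sigma:
  fixes I :: "'i set" and A :: "'i \<Rightarrow> 'x set"
  assumes gu: "grothendieck_universe TYPE('u)"
    and I: "I \<prec> (UNIV :: 'u set)" and A: "\<And>i. i \<in> I \<Longrightarrow> A i \<prec> (UNIV :: 'u set)"
  shows "Sigma I A \<prec> (UNIV :: 'u set)"
proof -
  have inf: "infinite (UNIV :: 'u set)" using gu by (simp add: grothendieck_universe_def)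
  have "(UNIV :: 'u set) \<times> (UNIV :: 'u set) \<lesssim> (UNIV :: 'u set)"
    using card_of_Times_same_infinite[OF inf] eqpoll_iff_card_of_ordIso eqpoll_imp_lepoll by blast
  then obtain p :: "'u \<times> 'u \<Rightarrow> 'u" where p: "inj p" by (auto simp: lepoll_def)
  obtain f :: "'i \<Rightarrow> 'u" where f: "inj_on f I"
    using lesspoll_imp_lepoll[OF I] by (auto simp: lepoll_def)
  have "\<exists>g :: 'i \<Rightarrow> 'x \<Rightarrow> 'u. \<forall>i \<in> I. inj_on (g i) (A i)"
    using lesspoll_imp_lepoll[OF A] by (intro bchoice) (auto simp: lepoll_def)
  then obtain g :: "'i \<Rightarrow> 'x \<Rightarrow> 'u" where g: "\<And>i. i \<in> I \<Longrightarrow> inj_on (g i) (A i)" by blast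
  \<comment> \<open>The fibres moved into \<open>'u\<close> and tagged with their index by the
    pairing; \<open>inv_into\<close> recovers the original index.\<close>
  define A' where "A' = (\<lambda>j. (\<lambda>x. p (j, g (inv_into I f j) x)) ` A (inv_into I f j))"
  have "f ` I \<prec> (UNIV :: 'u set)" using I f by simp
  moreover have "\<forall>j \<in> f ` I. A' j \<prec> (UNIV :: 'u set)"
    using A f unfolding A'_def by (auto intro: lesspoll_trans1[OF image_lepoll])
  ultimately have "(\<Union>j \<in> f ` I. A' j) \<prec> (UNIV :: 'u set)"
    using gu unfolding grothendieck_universe_def by blast
  moreover have "Sigma I A \<lesssim> (\<Union>j \<in> f ` I. A' j)"
    unfolding lepoll_def
  proof (intro exI[of _ "\<lambda>(i, x). p (f i, g i x)"] conjI)
    show "inj_on (\<lambda>(i, x). p (f i, g i x)) (Sigma I A)"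
    proof (rule inj_onI, clarify)
      fix i x j y assume *: "i \<in> I" "x \<in> A i" "j \<in> I" "y \<in> A j" "p (f i, g i x) = p (f j, g j y)"
      then have eq: "f i = f j" "g i x = g j y" using injD[OF p *(5)] by auto
      then have "i = j" using * f by (auto dest: inj_onD)
      then show "i = j \<and> x = y" using eq * inj_onD[OF g[of i]] by auto
    qed
    show "(\<lambda>(i, x). p (f i, g i x)) ` Sigma I A \<subseteq> (\<Union>j \<in> f ` I. A' j)"
      using f by (force simp: A'_def)
  qed
  ultimately show ?thesis by (rule lesspoll_trans1[rotated])
qed

lemma small_image: "A \<prec> (UNIV :: 'u set) \<Longrightarrow> f ` A \<prec> (UNIV :: 'u set)"
  by (rule lesspoll_trans1[OF image_lepoll])

lemma small_subset: "B \<prec> (UNIV :: 'u set) \<Longrightarrow> A \<subseteq> B \<Longrightarrow> A \<prec> (UNIV :: 'u set)"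
  by (rule lesspoll_trans1[OF subset_imp_lepoll])

lemma small_finite:
  "grothendieck_universe TYPE('u) \<Longrightarrow> finite A \<Longrightarrow> A \<prec> (UNIV :: 'u set)"
  by (simp add: grothendieck_universe_def finite_lesspoll_infinite)

lemma small_Times:
  assumes "grothendieck_universe TYPE('u)" "A \<prec> (UNIV :: 'u set)" "B \<prec> (UNIV :: 'u set)"
  shows "A \<times> B \<prec> (UNIV :: 'u set)"
  using assms by (intro small_Sigma) auto

lemma small_Pow:
  fixes A :: "'x set"
  assumes gu: "grothendieck_universe TYPE('u)" and A: "A \<prec> (UNIV :: 'u set)"
  shows "Pow A \<prec> (UNIV :: 'u set)"
proof -
  obtain f :: "'x \<Rightarrow> 'u" where f: "inj_on f A"
    using lesspoll_imp_lepoll[OF A] by (auto simp: lepoll_def)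
  then have "f ` A \<prec> (UNIV :: 'u set)" using A by simp
  then have "Pow (f ` A) \<prec> (UNIV :: 'u set)" using gu by (simp add: grothendieck_universe_def)
  moreover have "Pow A \<lesssim> Pow (f ` A)"
    unfolding lepoll_def using f
    by (intro exI[of _ "image f"]) (auto intro: inj_on_image_Pow)
  ultimately show ?thesis by (rule lesspoll_trans1[rotated])
qed

text \<open>A function on \<open>I\<close> is encoded by its graph, a subset of
  \<open>Sigma I A\<close>.\<close>

lemma small_PiE:
  assumes gu: "grothendieck_universe TYPE('u)"
    and "I \<prec> (UNIV :: 'u set)" and "\<And>i. i \<in> I \<Longrightarrow> A i \<prec> (UNIV :: 'u set)"
  shows "(\<Pi>\<^sub>E i\<in>I. A i) \<prec> (UNIV :: 'u set)"
proof -
  have "Pow (Sigma I A) \<prec> (UNIV :: 'u set)" by (intro small_Pow small_Sigma assms)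
  moreover have "(\<Pi>\<^sub>E i\<in>I. A i) \<lesssim> Pow (Sigma I A)"
    unfolding lepoll_def
  proof (intro exI[of _ "\<lambda>h. (\<lambda>i. (i, h i)) ` I"] conjI)
    show "inj_on (\<lambda>h. (\<lambda>i. (i, h i)) ` I) (\<Pi>\<^sub>E i\<in>I. A i)"
    proof (rule inj_onI)
      fix h k assume hk: "h \<in> (\<Pi>\<^sub>E i\<in>I. A i)" "k \<in> (\<Pi>\<^sub>E i\<in>I. A i)"
        and eq: "(\<lambda>i. (i, h i)) ` I = (\<lambda>i. (i, k i)) ` I"
      show "h = k"
      proof (rule PiE_ext[OF hk])
        fix i assume "i \<in> I"
        then have "(i, h i) \<in> (\<lambda>i. (i, k i)) ` I" by (subst eq[symmetric]) blast
        then show "h i = k i" by blast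
      qed
    qed
  qed (auto simp: PiE_iff)
  ultimately show ?thesis by (rule lesspoll_trans1[rotated])
qed

text \<open>The argument \<open>U\<close> fixes the universe type, which does not occur in the type
  of \<open>C\<close>.\<close>

locale site = category C for C :: "('o, 'a) cat" (structure) +
  fixes U :: "'u itself"
  assumes gu: "grothendieck_universe TYPE('u)"
    and small_Obj: "Obj C \<prec> (UNIV :: 'u set)"
    and small_Arr: "Arr C \<prec> (UNIV :: 'u set)"

lemma siteI:
  assumes "grothendieck_universe TYPE('u)" "small_category TYPE('u) C"
  shows "site TYPE('u) C"
  using assms by (simp add: site_def site_axioms_def small_category_def)

section \<open>Presheaves and their maps\<close>

context category
begin

lemma act_in [simp]:
  "X \<in> Obj (Psh C) \<Longrightarrow> f \<in> Arr C \<Longrightarrow> x \<in> fib X (Cod C f) \<Longrightarrow> act X f x \<in> fib X (Dom C f)"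
  by (auto simp: Psh_def is_presheaf_def PiE_iff)

lemma act_idn [simp]:
  "X \<in> Obj (Psh C) \<Longrightarrow> c \<in> Obj C \<Longrightarrow> x \<in> fib X c \<Longrightarrow> act X (Idn C c) x = x"
  by (auto simp: Psh_def is_presheaf_def)

lemma act_comp:
  "X \<in> Obj (Psh C) \<Longrightarrow> f \<in> Arr C \<Longrightarrow> g \<in> Arr C \<Longrightarrow> Cod C f = Dom C g \<Longrightarrow> x \<in> fib X (Cod C g) \<Longrightarrow>
    act X (g \<odot> f) x = act X f (act X g x)"
  by (auto simp: Psh_def is_presheaf_def)

lemma fib_small:
  fixes X :: "('o, 'a, 'u) psh"
  assumes "X \<in> Obj (Psh C)" "c \<in> Obj C" 
  shows "fib X c \<prec> (UNIV :: 'u set)"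
proof -
  have "is_presheaf C X" using assms(1) by (simp add: Psh_def)
  then have "fib X \<in> Obj C \<rightarrow>\<^sub>E {A. A \<prec> (UNIV :: 'u set)}" unfolding is_presheaf_def by (elim conjE)
  then show ?thesis using assms(2) by (blast dest: PiE_mem)
qed

text \<open>Equality of presheaves is equality of records, which is why \<open>is_presheaf\<close>
  asks for extensional functions; arbitrary data are cut down to their domains here.\<close>

definition mk_psh :: "('o \<Rightarrow> 'u set) \<Rightarrow> ('a \<Rightarrow> 'u \<Rightarrow> 'u) \<Rightarrow> ('o, 'a, 'u) psh" where
  "mk_psh F \<alpha> = \<lparr>fib = restrict F (Obj C), act = (\<lambda>f \<in> Arr C. \<lambda>x \<in> F (Cod C f). \<alpha> f x)\<rparr>"

lemma mk_psh_obj: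
  fixes F :: "'o \<Rightarrow> 'u set"
  assumes "\<And>c. c \<in> Obj C \<Longrightarrow> F c \<prec> (UNIV :: 'u set)"
    and "\<And>f x. f \<in> Arr C \<Longrightarrow> x \<in> F (Cod C f) \<Longrightarrow> \<alpha> f x \<in> F (Dom C f)"
    and "\<And>c x. c \<in> Obj C \<Longrightarrow> x \<in> F c \<Longrightarrow> \<alpha> (Idn C c) x = x"
    and "\<And>f g x. f \<in> Arr C \<Longrightarrow> g \<in> Arr C \<Longrightarrow> Cod C f = Dom C g \<Longrightarrow> x \<in> F (Cod C g) \<Longrightarrow>
      \<alpha> (g \<odot> f) x = \<alpha> f (\<alpha> g x)"
  shows "mk_psh F \<alpha> \<in> Obj (Psh C)"
proof -
  have "is_presheaf C (mk_psh F \<alpha>)"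
    unfolding is_presheaf_def
  proof (intro conjI)
    show "fib (mk_psh F \<alpha>) \<in> Obj C \<rightarrow>\<^sub>E {A. A \<prec> (UNIV :: 'u set)}"
      unfolding mk_psh_def psh.simps
      by (rule restrict_PiE_iff[THEN iffD2]) (blast intro: assms(1))
    show "act (mk_psh F \<alpha>) \<in> (\<Pi>\<^sub>E f\<in>Arr C. fib (mk_psh F \<alpha>) (Cod C f) \<rightarrow>\<^sub>E fib (mk_psh F \<alpha>) (Dom C f))"
      using assms(2) by (simp add: mk_psh_def)
  qed (use assms(2-4) in \<open>auto simp: mk_psh_def\<close>)
  then show ?thesis by (simp add: Psh_def)
qed

lemma mk_psh_simps [simp]:
  "c \<in> Obj C \<Longrightarrow> fib (mk_psh F \<alpha>) c = F c"
  "f \<in> Arr C \<Longrightarrow> x \<in> F (Cod C f) \<Longrightarrow> act (mk_psh F \<alpha>) f x = \<alpha> f x"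
  by (simp_all add: mk_psh_def)

end

definition ap :: "('o, 'a, 'u) psh_arr \<Rightarrow> 'o \<Rightarrow> 'u \<Rightarrow> 'u" where
  "ap t = fst (snd t)"

context category
begin

lemma psh_arrD:
  assumes "t \<in> hom (Psh C) X Y"
  shows "X \<in> Obj (Psh C)" "Y \<in> Obj (Psh C)" "t = (X, ap t, Y)"
    "ap t \<in> (\<Pi>\<^sub>E c \<in> Obj C. fib X c \<rightarrow>\<^sub>E fib Y c)"
proof -
  obtain a where t: "t = (X, a, Y)" "is_psh_map C X a Y" using assms by (auto simp: hom_def Psh_def)
  show "X \<in> Obj (Psh C)" "Y \<in> Obj (Psh C)" "t = (X, ap t, Y)"
    using t by (simp_all add: Psh_def is_psh_map_def ap_def)
  show "ap t \<in> (\<Pi>\<^sub>E c \<in> Obj C. fib X c \<rightarrow>\<^sub>E fib Y c)"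
    using t unfolding is_psh_map_def by (simp add: ap_def)
qed

lemma ap_in [simp]:
  assumes "t \<in> hom (Psh C) X Y" "c \<in> Obj C" "x \<in> fib X c"
  shows "ap t c x \<in> fib Y c"
  by (rule PiE_mem[OF PiE_mem[OF psh_arrD(4)[OF assms(1)] assms(2)] assms(3)])

lemma ap_nat:
  assumes "t \<in> hom (Psh C) X Y" "f \<in> hom C a b" "x \<in> fib X b"
  shows "ap t a (act X f x) = act Y f (ap t b x)"
  using assms by (auto simp: hom_def Psh_def ap_def is_psh_map_def)

lemma psh_arr_eqI:
  assumes "s \<in> hom (Psh C) X Y" "t \<in> hom (Psh C) X Y"
    and "\<And>c x. c \<in> Obj C \<Longrightarrow> x \<in> fib X c \<Longrightarrow> ap s c x = ap t c x"
  shows "s = t"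
proof -
  have "ap s = ap t"
  proof (rule PiE_ext[OF psh_arrD(4)[OF assms(1)] psh_arrD(4)[OF assms(2)]])
    fix c assume c: "c \<in> Obj C"
    show "ap s c = ap t c"
      by (rule PiE_ext[OF PiE_mem[OF psh_arrD(4)[OF assms(1)] c] PiE_mem[OF psh_arrD(4)[OF assms(2)] c]])
         (rule assms(3)[OF c])
  qed
  then show ?thesis using psh_arrD(3)[OF assms(1)] psh_arrD(3)[OF assms(2)] by metis
qed

definition mk_map ::
  "('o, 'a, 'u) psh \<Rightarrow> ('o, 'a, 'u) psh \<Rightarrow> ('o \<Rightarrow> 'u \<Rightarrow> 'u) \<Rightarrow> ('o, 'a, 'u) psh_arr" where
  "mk_map X Y h = (X, \<lambda>c\<in>Obj C. \<lambda>x\<in>fib X c. h c x, Y)"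

lemma mk_map:
  assumes "X \<in> Obj (Psh C)" "Y \<in> Obj (Psh C)"
    and "\<And>c x. c \<in> Obj C \<Longrightarrow> x \<in> fib X c \<Longrightarrow> h c x \<in> fib Y c"
    and "\<And>f x. f \<in> Arr C \<Longrightarrow> x \<in> fib X (Cod C f) \<Longrightarrow>
      h (Dom C f) (act X f x) = act Y f (h (Cod C f) x)"
  shows "mk_map X Y h \<in> hom (Psh C) X Y"
  using assms act_in[OF assms(1)]
  by (simp add: hom_def Psh_def mk_map_def is_psh_map_def PiE_iff)

lemma ap_mk_map [simp]: "c \<in> Obj C \<Longrightarrow> x \<in> fib X c \<Longrightarrow> ap (mk_map X Y h) c x = h c x"
  by (simp add: ap_def mk_map_def)

lemma ap_idn [simp]: "c \<in> Obj C \<Longrightarrow> x \<in> fib X c \<Longrightarrow> ap (Idn (Psh C) X) c x = x"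
  by (simp add: ap_def Psh_def)

lemma ap_comp:
  "t \<in> hom (Psh C) X Y \<Longrightarrow> c \<in> Obj C \<Longrightarrow> x \<in> fib X c \<Longrightarrow>
    ap (s \<odot>\<^bsub>Psh C\<^esub> t) c x = ap s c (ap t c x)"
  by (auto simp: ap_def Psh_def hom_def compose_def split: prod.splits)

lemma psh_idn_eq: "Idn (Psh C) X = mk_map X X (\<lambda>c x. x)"
  by (simp add: Psh_def mk_map_def)

lemma psh_comp_eq:
  assumes "t \<in> hom (Psh C) X Y" "s \<in> hom (Psh C) Y Z"
  shows "s \<odot>\<^bsub>Psh C\<^esub> t = mk_map X Z (\<lambda>c x. ap s c (ap t c x))"
  using assms by (auto simp: ap_def Psh_def hom_def compose_def mk_map_def split: prod.splits)

lemma psh_comp_hom: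
  assumes "t \<in> hom (Psh C) X Y" "s \<in> hom (Psh C) Y Z"
  shows "s \<odot>\<^bsub>Psh C\<^esub> t \<in> hom (Psh C) X Z"
  unfolding psh_comp_eq[OF assms]
proof (rule mk_map)
  fix f x assume f: "f \<in> Arr C" and x: "x \<in> fib X (Cod C f)"
  have fh: "f \<in> hom C (Dom C f) (Cod C f)" using f by (simp add: hom_def)
  have "ap t (Cod C f) x \<in> fib Y (Cod C f)" using assms(1) f x by simp
  then show "ap s (Dom C f) (ap t (Dom C f) (act X f x)) = act Z f (ap s (Cod C f) (ap t (Cod C f) x))"
    using ap_nat[OF assms(1) fh x] ap_nat[OF assms(2) fh] by simp
qed (use psh_arrD[OF assms(1)] psh_arrD[OF assms(2)] ap_in[OF assms(1)] ap_in[OF assms(2)] in auto)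

lemma category_Psh: "category (Psh C :: (('o, 'a, 'u) psh, ('o, 'a, 'u) psh_arr) cat)"
proof
  fix f :: "('o, 'a, 'u) psh_arr" assume f: "f \<in> Arr (Psh C)"
  then have "f \<in> hom (Psh C) (Dom (Psh C) f) (Cod (Psh C) f)" by (simp add: hom_def)
  from psh_arrD(1,2)[OF this] show "Dom (Psh C) f \<in> Obj (Psh C)" "Cod (Psh C) f \<in> Obj (Psh C)"
    by auto
next
  fix a :: "('o, 'a, 'u) psh" assume "a \<in> Obj (Psh C)"
  then show "Idn (Psh C) a \<in> hom (Psh C) a a"
    unfolding psh_idn_eq by (intro mk_map) auto
next
  fix f g h :: "('o, 'a, 'u) psh_arr" and a b c d
  assume f: "f \<in> hom (Psh C) a b" and g: "g \<in> hom (Psh C) b c"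
  then show "g \<odot>\<^bsub>Psh C\<^esub> f \<in> hom (Psh C) a c" by (rule psh_comp_hom)
  assume h: "h \<in> hom (Psh C) c d"
  show "h \<odot>\<^bsub>Psh C\<^esub> (g \<odot>\<^bsub>Psh C\<^esub> f) = h \<odot>\<^bsub>Psh C\<^esub> g \<odot>\<^bsub>Psh C\<^esub> f"
    by (rule psh_arr_eqI[of _ a d])
       (use f g h in \<open>auto simp: ap_comp[OF f] ap_comp[OF g] ap_comp[OF psh_comp_hom[OF f g]]
          intro!: psh_comp_hom\<close>)
next
  fix f :: "('o, 'a, 'u) psh_arr" and a b
  assume f: "f \<in> hom (Psh C) a b"
  have i: "Idn (Psh C) a \<in> hom (Psh C) a a" "Idn (Psh C) b \<in> hom (Psh C) b b"
    unfolding psh_idn_eq using psh_arrD[OF f] by (auto intro!: mk_map)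
  show "Idn (Psh C) b \<odot>\<^bsub>Psh C\<^esub> f = f"
    using f i by (intro psh_arr_eqI[of _ a b] psh_comp_hom[of _ a b]) (auto simp: ap_comp[OF f])
  show "f \<odot>\<^bsub>Psh C\<^esub> Idn (Psh C) a = f"
    using f i by (intro psh_arr_eqI[of _ a b] psh_comp_hom[of _ a a]) (auto simp: ap_comp[OF i(1)])
qed

text \<open>The pointwise inverse is natural because \<open>t\<close> is.\<close>

lemma psh_isoI:
  assumes t: "t \<in> hom (Psh C) X Y"
    and bij: "\<And>c. c \<in> Obj C \<Longrightarrow> bij_betw (ap t c) (fib X c) (fib Y c)"
  shows "iso_arr (Psh C) t"
proof -
  define h where "h = (\<lambda>c. inv_into (fib X c) (ap t c))"
  have h1: "h c y \<in> fib X c" "ap t c (h c y) = y" if "c \<in> Obj C" "y \<in> fib Y c" for c y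
    using bij_betw_imp_surj_on[OF bij[OF that(1)]] that(2)
    by (auto simp: h_def intro: inv_into_into f_inv_into_f)
  have h2: "h c (ap t c x) = x" if "c \<in> Obj C" "x \<in> fib X c" for c x
    using bij_betw_imp_inj_on[OF bij[OF that(1)]] that(2) by (simp add: h_def)
  have s: "mk_map Y X h \<in> hom (Psh C) Y X"
  proof (rule mk_map)
    fix f y assume f: "f \<in> Arr C" and y: "y \<in> fib Y (Cod C f)"
    have fh: "f \<in> hom C (Dom C f) (Cod C f)" using f by (simp add: hom_def)
    have "act Y f y = ap t (Dom C f) (act X f (h (Cod C f) y))"
      using ap_nat[OF t fh h1(1)] f y h1(2) by simp
    then show "h (Dom C f) (act Y f y) = act X f (h (Cod C f) y)"
      using f y h1 h2 psh_arrD(1)[OF t] by simp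
  qed (use psh_arrD[OF t] h1 in auto)
  show ?thesis
    by (rule iso_arrI[OF t s]; rule psh_arr_eqI)
       (use t s h1 h2 psh_arrD[OF t] in \<open>auto simp: ap_comp[OF t] ap_comp[OF s] intro: psh_comp_hom category.idn_hom[OF category_Psh]\<close>)
qed

lemma psh_iso_bij:
  assumes iso: "iso_arr (Psh C) t" and t: "t \<in> hom (Psh C) X Y" and c: "c \<in> Obj C"
  shows "bij_betw (ap t c) (fib X c) (fib Y c)"
proof -
  obtain s where s: "s \<in> hom (Psh C) Y X" "t \<odot>\<^bsub>Psh C\<^esub> s = Idn (Psh C) Y" "s \<odot>\<^bsub>Psh C\<^esub> t = Idn (Psh C) X"
    using iso t by (auto simp: iso_arr_def hom_def)
  show ?thesis
  proof (rule bij_betw_byWitness[of _ "ap s c"])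
    show "\<forall>x\<in>fib X c. ap s c (ap t c x) = x" using ap_comp[OF t c, of _ s] s c by auto
    show "\<forall>x\<in>fib Y c. ap t c (ap s c x) = x" using ap_comp[OF s(1) c, of _ t] s c by auto
  qed (use t s c in auto)
qed

text \<open>Subpresheaves as families of sets. Images, unions and equalizers are formed in this
  shape, and \<open>subpsh\<close> turns them into objects where necessary.\<close>

definition closed_under_act :: "('o, 'a, 'u) psh \<Rightarrow> ('o \<Rightarrow> 'u set) \<Rightarrow> bool" where
  "closed_under_act X S \<longleftrightarrow> (\<forall>c \<in> Obj C. S c \<subseteq> fib X c) \<and>
     (\<forall>f \<in> Arr C. \<forall>x \<in> S (Cod C f). act X f x \<in> S (Dom C f))"

lemma subpsh:
  assumes "X \<in> Obj (Psh C)" "closed_under_act X S"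
  shows "mk_psh S (act X) \<in> Obj (Psh C)"
    and "mk_map (mk_psh S (act X)) X (\<lambda>c x. x) \<in> hom (Psh C) (mk_psh S (act X)) X"
proof -
  have S: "x \<in> fib X c" if "c \<in> Obj C" "x \<in> S c" for c x
    using assms(2) that by (auto simp: closed_under_act_def)
  show *: "mk_psh S (act X) \<in> Obj (Psh C)"
    using assms by (intro mk_psh_obj)
      (auto simp: closed_under_act_def S act_comp intro: small_subset[OF fib_small])
  show "mk_map (mk_psh S (act X)) X (\<lambda>c x. x) \<in> hom (Psh C) (mk_psh S (act X)) X"
    using assms * by (intro mk_map) (auto simp: closed_under_act_def)
qed

end

section \<open>Epimorphisms and representables\<close>

context site
begin

text \<open>Presheaves of tuples, of families and the like are formed at their natural type first, and then
  encoded by subsets of the universe.\<close>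

lemma encode_psh:
  fixes F :: "'o \<Rightarrow> 'z set"
  assumes sm: "\<And>c. c \<in> Obj C \<Longrightarrow> F c \<prec> (UNIV :: 'u set)"
    and ac: "\<And>f x. f \<in> Arr C \<Longrightarrow> x \<in> F (Cod C f) \<Longrightarrow> \<alpha> f x \<in> F (Dom C f)"
    and ai: "\<And>c x. c \<in> Obj C \<Longrightarrow> x \<in> F c \<Longrightarrow> \<alpha> (Idn C c) x = x"
    and am: "\<And>f g x. f \<in> Arr C \<Longrightarrow> g \<in> Arr C \<Longrightarrow> Cod C f = Dom C g \<Longrightarrow> x \<in> F (Cod C g) \<Longrightarrow>
      \<alpha> (g \<odot> f) x = \<alpha> f (\<alpha> g x)"
  obtains Y :: "('o, 'a, 'u) psh" and e :: "'o \<Rightarrow> 'z \<Rightarrow> 'u" and d :: "'o \<Rightarrow> 'u \<Rightarrow> 'z"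
  where "Y \<in> Obj (Psh C)"
    "\<And>c x. c \<in> Obj C \<Longrightarrow> x \<in> F c \<Longrightarrow> e c x \<in> fib Y c"
    "\<And>c x. c \<in> Obj C \<Longrightarrow> x \<in> F c \<Longrightarrow> d c (e c x) = x"
    "\<And>c y. c \<in> Obj C \<Longrightarrow> y \<in> fib Y c \<Longrightarrow> d c y \<in> F c"
    "\<And>c y. c \<in> Obj C \<Longrightarrow> y \<in> fib Y c \<Longrightarrow> e c (d c y) = y"
    "\<And>f x. f \<in> Arr C \<Longrightarrow> x \<in> F (Cod C f) \<Longrightarrow> act Y f (e (Cod C f) x) = e (Dom C f) (\<alpha> f x)"
proof -
  \<comment> \<open>Smallness provides merely some injection of each fibre into \<open>'u\<close>;
    one is chosen for every object, and \<open>d\<close> undoes it.\<close>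
  have "\<exists>e :: 'o \<Rightarrow> 'z \<Rightarrow> 'u. \<forall>c \<in> Obj C. inj_on (e c) (F c)"
    using lesspoll_imp_lepoll[OF sm] by (intro bchoice) (auto simp: lepoll_def)
  then obtain e :: "'o \<Rightarrow> 'z \<Rightarrow> 'u" where e: "\<And>c. c \<in> Obj C \<Longrightarrow> inj_on (e c) (F c)" by blast
  define d where "d = (\<lambda>c. inv_into (F c) (e c))"
  have de [simp]: "d c (e c x) = x" if "c \<in> Obj C" "x \<in> F c" for c x
    using e that by (simp add: d_def)
  define Y where "Y = mk_psh (\<lambda>c. e c ` F c) (\<lambda>f y. e (Dom C f) (\<alpha> f (d (Cod C f) y)))"
  have "Y \<in> Obj (Psh C)"
    unfolding Y_def
    by (rule mk_psh_obj) (auto simp: sm ac ai am small_image)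
  then show ?thesis
    by (rule that[of Y e d]) (auto simp: Y_def)
qed

text \<open>The cokernel pair of \<open>S \<subseteq> Z\<close> glues two copies of \<open>Z\<close> along \<open>S\<close>.\<close>

lemma jointly_epi_surj:
  fixes Z :: "('o, 'a, 'u) psh"
  assumes Z [simp]: "Z \<in> Obj (Psh C)" and S: "closed_under_act Z S"
    and epi: "\<And>W u v. u \<in> hom (Psh C) Z W \<Longrightarrow> v \<in> hom (Psh C) Z W \<Longrightarrow>
      (\<And>c x. c \<in> Obj C \<Longrightarrow> x \<in> S c \<Longrightarrow> ap u c x = ap v c x) \<Longrightarrow> u = v"
    and c: "c \<in> Obj C"
  shows "S c = fib Z c"
proof
  show "S c \<subseteq> fib Z c" using S c by (auto simp: closed_under_act_def)
  \<comment> \<open>The tag names the copy: \<open>(x, True)\<close> lies in the first one,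
    \<open>(x, False)\<close> in the second, and points of \<open>S\<close> carry only the tag
    \<open>True\<close>. Accordingly \<alpha> resets the tag as soon as an element enters
    \<open>S\<close>.\<close>
  define F where "F = (\<lambda>c. {(x, b). x \<in> fib Z c \<and> (x \<in> S c \<longrightarrow> b)})"
  define \<alpha> where "\<alpha> = (\<lambda>f (x, b). (act Z f x, b \<or> act Z f x \<in> S (Dom C f)))"
  have SA: "\<And>f x. f \<in> Arr C \<Longrightarrow> x \<in> S (Cod C f) \<Longrightarrow> act Z f x \<in> S (Dom C f)"
    using S by (auto simp: closed_under_act_def)
  obtain W :: "('o, 'a, 'u) psh" and e d where W: "W \<in> Obj (Psh C)"
    "\<And>c x. c \<in> Obj C \<Longrightarrow> x \<in> F c \<Longrightarrow> e c x \<in> fib W c"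
    "\<And>c x. c \<in> Obj C \<Longrightarrow> x \<in> F c \<Longrightarrow> d c (e c x) = x"
    "\<And>f x. f \<in> Arr C \<Longrightarrow> x \<in> F (Cod C f) \<Longrightarrow> act W f (e (Cod C f) x) = e (Dom C f) (\<alpha> f x)"
  proof (rule encode_psh[of F \<alpha>])
    fix c assume c: "c \<in> Obj C"
    have "fib Z c \<times> (UNIV :: bool set) \<prec> (UNIV :: 'u set)"
      using c by (intro small_Times gu fib_small small_finite) auto
    then show "F c \<prec> (UNIV :: 'u set)" by (rule small_subset) (auto simp: F_def)
  qed (auto simp: F_def \<alpha>_def act_comp SA intro: that)
  \<comment> \<open>The two inclusions of \<open>Z\<close>; they agree on \<open>S\<close> and
    nowhere else, so their equality forces every element into \<open>S\<close>.\<close>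
  define u where "u = mk_map Z W (\<lambda>c x. e c (x, True))"
  define v where "v = mk_map Z W (\<lambda>c x. e c (x, x \<in> S c))"
  have u: "u \<in> hom (Psh C) Z W"
    unfolding u_def by (rule mk_map) (auto simp: W F_def \<alpha>_def)
  have v: "v \<in> hom (Psh C) Z W"
    unfolding v_def
  proof (rule mk_map)
    fix f x assume f: "f \<in> Arr C" and x: "x \<in> fib Z (Cod C f)"
    have "(x \<in> S (Cod C f) \<or> act Z f x \<in> S (Dom C f)) = (act Z f x \<in> S (Dom C f))"
      using SA[OF f] by blast
    then show "e (Dom C f) (act Z f x, act Z f x \<in> S (Dom C f)) = act W f (e (Cod C f) (x, x \<in> S (Cod C f)))"
      using f x by (simp add: W F_def \<alpha>_def)
  qed (auto simp: W F_def)
  have "u = v"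
  proof (rule epi[OF u v])
    fix c x assume "c \<in> Obj C" "x \<in> S c"
    then show "ap u c x = ap v c x"
      using S by (subgoal_tac "x \<in> fib Z c") (auto simp: u_def v_def closed_under_act_def)
  qed
  show "fib Z c \<subseteq> S c"
  proof
    fix x assume x: "x \<in> fib Z c"
    have "e c (x, True) = e c (x, x \<in> S c)"
      using \<open>u = v\<close> x c ap_mk_map[OF c x, of W "\<lambda>c x. e c (x, True)"]
        ap_mk_map[OF c x, of W "\<lambda>c x. e c (x, x \<in> S c)"] by (simp add: u_def v_def)
    then have "d c (e c (x, True)) = d c (e c (x, x \<in> S c))" by simp
    then show "x \<in> S c" using x c W(3)[of c "(x, True)"] W(3)[of c "(x, x \<in> S c)"] by (auto simp: F_def)
  qed
qed

text \<open>The image is a subpresheaf on which maps out of \<open>Z\<close> are determined, so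
  \<open>jointly_epi_surj\<close> applies to it.\<close>

lemma psh_epi_surj:
  fixes t :: "('o, 'a, 'u) psh_arr"
  assumes epi: "epi_arr (Psh C) t" and t: "t \<in> hom (Psh C) Y Z" and c: "c \<in> Obj C"
  shows "ap t c ` fib Y c = fib Z c"
proof (rule jointly_epi_surj[of Z "\<lambda>c. ap t c ` fib Y c"])
  note O = psh_arrD(1,2)[OF t]
  show "Z \<in> Obj (Psh C)" by fact
  show "closed_under_act Z (\<lambda>c. ap t c ` fib Y c)"
    unfolding closed_under_act_def
  proof (intro conjI ballI)
    fix f x assume f: "f \<in> Arr C" and "x \<in> ap t (Cod C f) ` fib Y (Cod C f)"
    then obtain y where y: "y \<in> fib Y (Cod C f)" "x = ap t (Cod C f) y" by auto
    have "act Z f x = ap t (Dom C f) (act Y f y)"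
      unfolding y(2) using f y by (intro ap_nat[symmetric, OF t]) (auto simp: hom_def)
    then show "act Z f x \<in> ap t (Dom C f) ` fib Y (Dom C f)" using O f y by auto
  qed (use t in auto)
  fix W u v
  assume u: "u \<in> hom (Psh C) Z W" and v: "v \<in> hom (Psh C) Z W"
    and eq: "\<And>c x. c \<in> Obj C \<Longrightarrow> x \<in> ap t c ` fib Y c \<Longrightarrow> ap u c x = ap v c x"
  have "u \<odot>\<^bsub>Psh C\<^esub> t = v \<odot>\<^bsub>Psh C\<^esub> t"
    by (rule psh_arr_eqI[OF psh_comp_hom[OF t u] psh_comp_hom[OF t v]]) (simp add: ap_comp[OF t] eq)
  moreover have "Cod (Psh C) t = Z" using t by (simp add: hom_def)
  ultimately show "u = v" using epi u v unfolding epi_arr_def by blast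
qed (rule c)

text \<open>Left adjoints preserve jointly epimorphic families, and such a family of presheaf maps
  is jointly surjective, since the union \<open>S\<close> of the images is a subpresheaf. It is
  applied to the points of a set and to the maps from representables into a presheaf, and thus
  replaces arguments by colimits.\<close>

lemma left_adjoint_jointly_surj:
  fixes L :: "('e, 'f, ('o, 'a, 'u) psh, ('o, 'a, 'u) psh_arr) ftor"
  assumes adj: "adjoint E (Psh C) L R" and e: "e \<in> Obj E"
    and G: "\<And>g. g \<in> G \<Longrightarrow> g \<in> Arr E \<and> Cod E g = e"
    and epi: "\<And>x u v. u \<in> hom E e x \<Longrightarrow> v \<in> hom E e x \<Longrightarrow>
      (\<And>g. g \<in> G \<Longrightarrow> u \<odot>\<^bsub>E\<^esub> g = v \<odot>\<^bsub>E\<^esub> g) \<Longrightarrow> u = v"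
    and c: "c \<in> Obj C" and w: "w \<in> fib (on_obj L e) c"
  obtains g w' where "g \<in> G" "w' \<in> fib (on_obj L (Dom E g)) c" "ap (on_arr L g) c w' = w"
proof -
  obtain \<eta> \<epsilon> where "adjunction E (Psh C) L R \<eta> \<epsilon>" using adj by (rule adjointE)
  then interpret P: adjunction E "Psh C" L R \<eta> \<epsilon> .
  define S where "S = (\<lambda>c. \<Union>g \<in> G. ap (on_arr L g) c ` fib (on_obj L (Dom E g)) c)"
  have Lg: "on_arr L g \<in> hom (Psh C) (on_obj L (Dom E g)) (on_obj L e)" if "g \<in> G" for g
    using G[OF that] by (auto simp: hom_def)
  have "S c = fib (on_obj L e) c"
  proof (rule jointly_epi_surj)
    show "on_obj L e \<in> Obj (Psh C)" using e by simp
    show "closed_under_act (on_obj L e) S"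
      unfolding closed_under_act_def
    proof (intro conjI ballI)
      show "S c \<subseteq> fib (on_obj L e) c" if "c \<in> Obj C" for c
        using ap_in[OF Lg that] by (auto simp: S_def)
      fix f x assume f: "f \<in> Arr C" and "x \<in> S (Cod C f)"
      then obtain g y where g: "g \<in> G" and y: "y \<in> fib (on_obj L (Dom E g)) (Cod C f)"
        "x = ap (on_arr L g) (Cod C f) y" by (auto simp: S_def)
      have "act (on_obj L e) f x = ap (on_arr L g) (Dom C f) (act (on_obj L (Dom E g)) f y)"
        unfolding y(2) using f y by (intro ap_nat[symmetric, OF Lg[OF g]]) (auto simp: hom_def)
      moreover have "act (on_obj L (Dom E g)) f y \<in> fib (on_obj L (Dom E g)) (Dom C f)"
        using f y psh_arrD(1)[OF Lg[OF g]] by simp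
      ultimately show "act (on_obj L e) f x \<in> S (Dom C f)"
        using g by (auto simp: S_def)
    qed
    fix W u v
    assume u: "u \<in> hom (Psh C) (on_obj L e) W" and v: "v \<in> hom (Psh C) (on_obj L e) W"
      and eq: "\<And>c x. c \<in> Obj C \<Longrightarrow> x \<in> S c \<Longrightarrow> ap u c x = ap v c x"
    have us: "u \<in> Arr (Psh C)" "Dom (Psh C) u = on_obj L e" "Cod (Psh C) u = W"
      "v \<in> Arr (Psh C)" "Dom (Psh C) v = on_obj L e" "Cod (Psh C) v = W" "W \<in> Obj (Psh C)"
      using u v psh_arrD(2)[OF u] by (auto simp: hom_def)
    \<comment> \<open>Equality is tested on the transposes, which are maps out of \<open>e\<close>;
      there the family \<open>G\<close> is jointly epic by assumption.\<close>
    have "on_arr R u \<odot>\<^bsub>E\<^esub> \<eta> e = on_arr R v \<odot>\<^bsub>E\<^esub> \<eta> e"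
    proof (rule epi)
      fix g assume g: "g \<in> G"
      have gs: "g \<in> Arr E" "Cod E g = e" using G[OF g] by auto
      have "u \<odot>\<^bsub>Psh C\<^esub> on_arr L g = v \<odot>\<^bsub>Psh C\<^esub> on_arr L g"
        by (rule psh_arr_eqI[OF psh_comp_hom[OF Lg[OF g] u] psh_comp_hom[OF Lg[OF g] v]])
           (simp add: ap_comp[OF Lg[OF g]], rule eq, use g in \<open>auto simp: S_def\<close>)
      then have "on_arr R (u \<odot>\<^bsub>Psh C\<^esub> on_arr L g) \<odot>\<^bsub>E\<^esub> \<eta> (Dom E g) = on_arr R (v \<odot>\<^bsub>Psh C\<^esub> on_arr L g) \<odot>\<^bsub>E\<^esub> \<eta> (Dom E g)"
        by simp
      then show "(on_arr R u \<odot>\<^bsub>E\<^esub> \<eta> e) \<odot>\<^bsub>E\<^esub> g = (on_arr R v \<odot>\<^bsub>E\<^esub> \<eta> e) \<odot>\<^bsub>E\<^esub> g"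
        using gs us e P.unit_nat[of g] by simp
    qed (use us e in \<open>auto simp: hom_def\<close>)
    then show "u = v" by (rule universal_eq[OF P.universal[OF e] P.R.ftr_axioms u v])
  qed (rule c)
  then have "w \<in> (\<Union>g \<in> G. ap (on_arr L g) c ` fib (on_obj L (Dom E g)) c)"
    using w by (simp add: S_def)
  then show ?thesis using that by blast
qed

text \<open>A presheaf with a universal element instead of a fixed Yoneda embedding: fibres are
  encoded in \<open>'u\<close> by arbitrary injections, so a representable is determined only up to
  isomorphism.\<close>

definition represents :: "('o, 'a, 'u) psh \<Rightarrow> 'o \<Rightarrow> 'u \<Rightarrow> bool" where
  "represents Y a i \<longleftrightarrow> Y \<in> Obj (Psh C) \<and> a \<in> Obj C \<and> i \<in> fib Y a \<and>
     (\<forall>c \<in> Obj C. bij_betw (\<lambda>f. act Y f i) (hom C c a) (fib Y c))"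

lemma representable_exists:
  assumes a: "a \<in> Obj C"
  obtains Y i where "represents Y a i"
proof -
  obtain Y :: "('o, 'a, 'u) psh" and e d where Y: "Y \<in> Obj (Psh C)"
    "\<And>c x. c \<in> Obj C \<Longrightarrow> x \<in> hom C c a \<Longrightarrow> e c x \<in> fib Y c"
    "\<And>c x. c \<in> Obj C \<Longrightarrow> x \<in> hom C c a \<Longrightarrow> d c (e c x) = x"
    "\<And>c y. c \<in> Obj C \<Longrightarrow> y \<in> fib Y c \<Longrightarrow> d c y \<in> hom C c a"
    "\<And>c y. c \<in> Obj C \<Longrightarrow> y \<in> fib Y c \<Longrightarrow> e c (d c y) = y"
    "\<And>f x. f \<in> Arr C \<Longrightarrow> x \<in> hom C (Cod C f) a \<Longrightarrow> act Y f (e (Cod C f) x) = e (Dom C f) (x \<odot> f)"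
    by (rule encode_psh[of "\<lambda>c. hom C c a" "\<lambda>f x. x \<odot> f"])
       (auto simp: hom_def intro: small_subset[OF small_Arr])
  have i: "Idn C a \<in> hom C a a" using a by (rule idn_hom)
  have *: "act Y f (e a (Idn C a)) = e c f" if "f \<in> hom C c a" for c f
    using Y(6)[of f "Idn C a"] that a by (auto simp: hom_def)
  have "represents Y a (e a (Idn C a))"
    unfolding represents_def
  proof (intro conjI ballI)
    fix c assume c: "c \<in> Obj C"
    show "bij_betw (\<lambda>f. act Y f (e a (Idn C a))) (hom C c a) (fib Y c)"
    proof (rule bij_betw_byWitness[of _ "d c"])
      show "\<forall>f\<in>hom C c a. d c (act Y f (e a (Idn C a))) = f" using c Y(3) * by simp
      show "\<forall>y\<in>fib Y c. act Y (d c y) (e a (Idn C a)) = y"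
        using *[OF Y(4)[OF c]] Y(5)[OF c] by simp
      show "(\<lambda>f. act Y f (e a (Idn C a))) ` hom C c a \<subseteq> fib Y c" using c Y(2) * by auto
      show "d c ` fib Y c \<subseteq> hom C c a" using c Y(4) by auto
    qed
  qed (use Y i a in auto)
  then show ?thesis by (rule that)
qed

lemma representsD:
  assumes "represents Y a i"
  shows "Y \<in> Obj (Psh C)" "a \<in> Obj C" "i \<in> fib Y a"
    and "c \<in> Obj C \<Longrightarrow> y \<in> fib Y c \<Longrightarrow> \<exists>f \<in> hom C c a. y = act Y f i"
    and "f \<in> hom C c a \<Longrightarrow> g \<in> hom C c a \<Longrightarrow> act Y f i = act Y g i \<Longrightarrow> f = g"
proof -
  show O: "Y \<in> Obj (Psh C)" "a \<in> Obj C" "i \<in> fib Y a" using assms by (auto simp: represents_def)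
  have bij: "bij_betw (\<lambda>f. act Y f i) (hom C c a) (fib Y c)" if "c \<in> Obj C" for c
    using assms that by (auto simp: represents_def)
  show "\<exists>f \<in> hom C c a. y = act Y f i" if "c \<in> Obj C" "y \<in> fib Y c"
    using bij_betw_imp_surj_on[OF bij[OF that(1)]] that(2) by auto
  show "f = g" if "f \<in> hom C c a" "g \<in> hom C c a" "act Y f i = act Y g i"
    using bij_betw_imp_inj_on[OF bij, of c] that by (auto simp: inj_on_def hom_def)
qed

text \<open>Every element of \<open>Y\<close> is \<open>act Y f i\<close> for some \<open>f\<close>,
  so naturality determines a map by its value at \<open>i\<close>; this is the uniqueness half of
  the Yoneda lemma.\<close>

lemma yoneda_eq:
  assumes Y: "represents Y a i" and s: "s \<in> hom (Psh C) Y Z" and t: "t \<in> hom (Psh C) Y Z"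
    and eq: "ap s a i = ap t a i"
  shows "s = t"
proof (rule psh_arr_eqI[OF s t])
  fix c y assume c: "c \<in> Obj C" and "y \<in> fib Y c"
  then obtain f where f: "f \<in> hom C c a" "y = act Y f i" using representsD(4)[OF Y] by blast
  show "ap s c y = ap t c y"
    unfolding f(2) ap_nat[OF s f(1) representsD(3)[OF Y]] ap_nat[OF t f(1) representsD(3)[OF Y]]
    by (simp add: eq)
qed

lemma yoneda_exists:
  assumes Y: "represents Y a i" and Z: "Z \<in> Obj (Psh C)" and z: "z \<in> fib Z a"
  obtains t where "t \<in> hom (Psh C) Y Z" "ap t a i = z"
proof -
  note [simp] = representsD(1-3)[OF Y]
  \<comment> \<open>By representability an element is \<open>act Y f i\<close> for exactly one
    \<open>f\<close>, so the description is meaningful.\<close>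
  define h where "h = (\<lambda>c y. act Z (THE f. f \<in> hom C c a \<and> y = act Y f i) z)"
  have h: "h c (act Y f i) = act Z f z" if "f \<in> hom C c a" for c f
  proof -
    have "(THE g. g \<in> hom C c a \<and> act Y f i = act Y g i) = f"
      using that representsD(5)[OF Y] by (intro the_equality) auto
    then show ?thesis by (simp add: h_def)
  qed
  have t: "mk_map Y Z h \<in> hom (Psh C) Y Z"
  proof (rule mk_map)
    fix c y assume c: "c \<in> Obj C" and "y \<in> fib Y c"
    then obtain f where f: "f \<in> hom C c a" "y = act Y f i" using representsD(4)[OF Y] by blast
    have "act Z f z \<in> fib Z c" using act_in[OF Z, of f z] f z by (auto simp: hom_def)
    then show "h c y \<in> fib Z c" by (simp add: f(2) h[OF f(1)])
  next
    fix g y assume g: "g \<in> Arr C" and "y \<in> fib Y (Cod C g)"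
    then obtain f where f: "f \<in> hom C (Cod C g) a" "y = act Y f i" using representsD(4)[OF Y] by force
    have fs: "f \<in> Arr C" "Dom C f = Cod C g" "Cod C f = a" using f(1) by (auto simp: hom_def)
    have "act Y g y = act Y (f \<odot> g) i" using fs g f(2) by (simp add: act_comp)
    then have "h (Dom C g) (act Y g y) = act Z (f \<odot> g) z"
      using fs g by (simp add: h hom_def)
    also have "\<dots> = act Z g (h (Cod C g) y)"
      using fs g z Z h[OF f(1)] f(2) by (simp add: act_comp)
    finally show "h (Dom C g) (act Y g y) = act Z g (h (Cod C g) y)" .
  qed (use Z in auto)
  have "ap (mk_map Y Z h) a i = z"
    using h[of "Idn C a" a] idn_hom[of a] Z z by simp
  with t show ?thesis by (rule that)
qed

end

section \<open>Kan extensions\<close>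

text \<open>Restriction along \<open>K\<close>. Two cases matter: the inclusion of the minimal
  objects, where it is \<open>restriction_ftor\<close>, and the projection from the category of
  elements.\<close>

definition pull :: "('p, 'b) cat \<Rightarrow> ('p, 'b, 'o, 'a) ftor \<Rightarrow>
    (('o, 'a, 'u) psh, ('o, 'a, 'u) psh_arr, ('p, 'b, 'u) psh, ('p, 'b, 'u) psh_arr) ftor" where
  "pull B K =
     (let r = (\<lambda>Y. \<lparr>fib = \<lambda>b\<in>Obj B. fib Y (on_obj K b), act = \<lambda>f\<in>Arr B. act Y (on_arr K f)\<rparr>)
      in \<lparr>on_obj = r, on_arr = (\<lambda>(Y, t, Z). (r Y, \<lambda>b\<in>Obj B. t (on_obj K b), r Z))\<rparr>)"

lemma restriction_ftor_pull: "restriction_ftor B = pull B id_ftor"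
  by (simp add: restriction_ftor_def pull_def Let_def restrict_def)

lemma pull_simps [simp]:
  "b \<in> Obj B \<Longrightarrow> fib (on_obj (pull B K) Y) b = fib Y (on_obj K b)"
  "f \<in> Arr B \<Longrightarrow> act (on_obj (pull B K) Y) f = act Y (on_arr K f)"
  "b \<in> Obj B \<Longrightarrow> ap (on_arr (pull B K) t) b = ap t (on_obj K b)"
  by (simp_all add: pull_def Let_def ap_def case_prod_beta)

locale site_functor = A: site A U + B: site B U + K: ftr B A K
  for U :: "'u itself" and A :: "('o, 'a) cat" and B :: "('p, 'b) cat" and K
begin

lemma pull_obj [simp]:
  fixes Y :: "('o, 'a, 'u) psh"
  assumes Y: "Y \<in> Obj (Psh A)"
  shows "on_obj (pull B K) Y \<in> Obj (Psh B)"
proof -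
  have "is_presheaf B (on_obj (pull B K) Y)"
    unfolding is_presheaf_def
  proof (intro conjI)
    show "fib (on_obj (pull B K) Y) \<in> Obj B \<rightarrow>\<^sub>E {A. A \<prec> (UNIV :: 'u set)}"
      unfolding pull_def Let_def ftor.simps psh.simps restrict_PiE_iff
      using A.fib_small[OF Y K.F_obj] by blast
    have aY: "act Y \<in> (\<Pi>\<^sub>E f \<in> Arr A. fib Y (Cod A f) \<rightarrow>\<^sub>E fib Y (Dom A f))"
      using Y unfolding Psh_def is_presheaf_def by simp
    show "act (on_obj (pull B K) Y) \<in> (\<Pi>\<^sub>E f\<in>Arr B. fib (on_obj (pull B K) Y) (Cod B f) \<rightarrow>\<^sub>E
        fib (on_obj (pull B K) Y) (Dom B f))"
    proof (rule PiE_I)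
      fix f assume f: "f \<in> Arr B"
      show "act (on_obj (pull B K) Y) f \<in> fib (on_obj (pull B K) Y) (Cod B f) \<rightarrow>\<^sub>E fib (on_obj (pull B K) Y) (Dom B f)"
        using PiE_mem[OF aY K.F_arr(1)[OF f]] f by simp
    qed (simp add: pull_def)
  qed (use Y in \<open>simp_all add: A.act_comp\<close>)
  then show ?thesis by (simp add: Psh_def)
qed

lemma pull_hom:
  fixes t :: "('o, 'a, 'u) psh_arr"
  assumes t: "t \<in> hom (Psh A) X Y"
  shows "on_arr (pull B K) t \<in> hom (Psh B) (on_obj (pull B K) X) (on_obj (pull B K) Y)"
proof -
  have O: "X \<in> Obj (Psh A)" "Y \<in> Obj (Psh A)" using A.psh_arrD[OF t] by auto
  have "B.mk_map (on_obj (pull B K) X) (on_obj (pull B K) Y) (\<lambda>b. ap t (on_obj K b)) \<in>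
      hom (Psh B) (on_obj (pull B K) X) (on_obj (pull B K) Y)"
  proof (rule B.mk_map)
    fix f x assume f: "f \<in> Arr B" and x: "x \<in> fib (on_obj (pull B K) X) (Cod B f)"
    have "on_arr K f \<in> hom A (on_obj K (Dom B f)) (on_obj K (Cod B f))" using f by (simp add: hom_def)
    from A.ap_nat[OF t this]
    show "ap t (on_obj K (Dom B f)) (act (on_obj (pull B K) X) f x) =
        act (on_obj (pull B K) Y) f (ap t (on_obj K (Cod B f)) x)"
      using f x by simp
  qed (use O A.ap_in[OF t] in auto)
  moreover have "on_arr (pull B K) t = B.mk_map (on_obj (pull B K) X) (on_obj (pull B K) Y) (\<lambda>b. ap t (on_obj K b))"
  proof -
    have "restrict (ap t (on_obj K b)) (fib X (on_obj K b)) = ap t (on_obj K b)" if "b \<in> Obj B" for b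
      using PiE_mem[OF A.psh_arrD(4)[OF t] K.F_obj[OF that]] by (rule PiE_restrict)
    then show ?thesis
      by (subst A.psh_arrD(3)[OF t])
         (simp add: pull_def Let_def B.mk_map_def restrict_def fun_eq_iff)
  qed
  ultimately show ?thesis by simp
qed

lemma pull_functor: "is_functor (Psh A :: (('o, 'a, 'u) psh, ('o, 'a, 'u) psh_arr) cat) (Psh B) (pull B K)"
proof -
  interpret PA: category "Psh A :: (('o, 'a, 'u) psh, ('o, 'a, 'u) psh_arr) cat" by (rule A.category_Psh)
  interpret PB: category "Psh B :: (('p, 'b, 'u) psh, ('p, 'b, 'u) psh_arr) cat" by (rule B.category_Psh)
  show ?thesis
    unfolding is_functor_def
  proof (intro conjI ballI impI)
    fix Y :: "('o, 'a, 'u) psh" assume Y: "Y \<in> Obj (Psh A)"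
    show "on_obj (pull B K) Y \<in> Obj (Psh B)" using Y by simp
    show "on_arr (pull B K) (Idn (Psh A) Y) = Idn (Psh B) (on_obj (pull B K) Y)"
      by (rule B.psh_arr_eqI[OF pull_hom[OF PA.idn_hom[OF Y]] PB.idn_hom[OF pull_obj[OF Y]]])
         simp
  next
    fix s t :: "('o, 'a, 'u) psh_arr"
    assume t: "t \<in> Arr (Psh A)" 
    then have th: "t \<in> hom (Psh A) (Dom (Psh A) t) (Cod (Psh A) t)" by (simp add: hom_def)
    from pull_hom[OF th]
    show "on_arr (pull B K) t \<in> hom (Psh B) (on_obj (pull B K) (Dom (Psh A) t)) (on_obj (pull B K) (Cod (Psh A) t))" .
    assume s: "s \<in> Arr (Psh A)" and "Cod (Psh A) t = Dom (Psh A) s"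
    then have sh: "s \<in> hom (Psh A) (Cod (Psh A) t) (Cod (Psh A) s)" by (simp add: hom_def)
    show "on_arr (pull B K) (s \<odot>\<^bsub>Psh A\<^esub> t) = on_arr (pull B K) s \<odot>\<^bsub>Psh B\<^esub> on_arr (pull B K) t"
      by (rule B.psh_arr_eqI[OF pull_hom[OF A.psh_comp_hom[OF th sh]] B.psh_comp_hom[OF pull_hom[OF th] pull_hom[OF sh]]])
         (simp add: B.ap_comp[OF pull_hom[OF th]] A.ap_comp[OF th])
  qed (rule PA.category_axioms PB.category_axioms)+
qed

text \<open>The right Kan extension: matching families on the comma category.\<close>

lemma pull_couniversal:
  fixes Z :: "('p, 'b, 'u) psh"
  assumes Z: "Z \<in> Obj (Psh B)"
  obtains R E where "couniversal (Psh A) (Psh B) (pull B K) Z R E"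
    and "full_faithful B A K \<Longrightarrow> iso_arr (Psh B) E"
proof -
  \<comment> \<open>\<open>I a\<close> lists the objects of the comma category of \<open>K\<close>
    over \<open>a\<close>; \<open>F a\<close> consists of the natural transformations into
    \<open>Z\<close> from the presheaf of maps \<open>on_obj K b\<close> to \<open>a\<close>, and
    \<alpha> acts on them by composition.\<close>
  define I where "I = (\<lambda>a. {(b, f). b \<in> Obj B \<and> f \<in> hom A (on_obj K b) a})"
  define F where "F = (\<lambda>a. {\<phi> \<in> (\<Pi>\<^sub>E bf \<in> I a. fib Z (fst bf)).
    \<forall>b f b' u. (b, f) \<in> I a \<and> u \<in> hom B b' b \<longrightarrow> \<phi> (b', f \<odot>\<^bsub>A\<^esub> on_arr K u) = act Z u (\<phi> (b, f))})"
  define \<alpha> where "\<alpha> = (\<lambda>g (\<phi> :: 'p \<times> 'a \<Rightarrow> 'u). \<lambda>bf \<in> I (Dom A g). \<phi> (fst bf, g \<odot>\<^bsub>A\<^esub> snd bf))"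
  have Iu: "(b', f \<odot>\<^bsub>A\<^esub> on_arr K u) \<in> I a" if "(b, f) \<in> I a" "u \<in> hom B b' b" for a b f b' u
    using that by (auto simp: I_def hom_def)
  have Ig: "(b, g \<odot>\<^bsub>A\<^esub> f) \<in> I (Cod A g)" if "(b, f) \<in> I (Dom A g)" "g \<in> Arr A" for b f g
    using that by (auto simp: I_def hom_def)
  have Iid: "(b, Idn A (on_obj K b)) \<in> I (on_obj K b)" if "b \<in> Obj B" for b
    using that by (auto simp: I_def hom_def)
  have Fm: "\<phi> (b, f) \<in> fib Z b" if "\<phi> \<in> F a" "(b, f) \<in> I a" for \<phi> a b f
    using that PiE_mem[of \<phi> "I a" "\<lambda>bf. fib Z (fst bf)" "(b, f)"] by (simp add: F_def)
  have Fn: "\<phi> (b', f \<odot>\<^bsub>A\<^esub> on_arr K u) = act Z u (\<phi> (b, f))"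
    if "\<phi> \<in> F a" "(b, f) \<in> I a" "u \<in> hom B b' b" for \<phi> a b f b' u
    using that by (simp add: F_def)
  have FI: "\<phi> \<in> F a" if "\<phi> \<in> extensional (I a)" "\<And>b f. (b, f) \<in> I a \<Longrightarrow> \<phi> (b, f) \<in> fib Z b"
    "\<And>b f b' u. (b, f) \<in> I a \<Longrightarrow> u \<in> hom B b' b \<Longrightarrow> \<phi> (b', f \<odot>\<^bsub>A\<^esub> on_arr K u) = act Z u (\<phi> (b, f))"
    for \<phi> a
    using that by (auto simp: F_def PiE_iff)
  have Feq: "\<phi> = \<psi>" if "\<phi> \<in> F a" "\<psi> \<in> F a" "\<And>b f. (b, f) \<in> I a \<Longrightarrow> \<phi> (b, f) = \<psi> (b, f)" for \<phi> \<psi> a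
    using that PiE_ext[of \<phi> "I a" "\<lambda>bf. fib Z (fst bf)" \<psi>] by (auto simp: F_def)
  have smallF: "F a \<prec> (UNIV :: 'u set)" if "a \<in> Obj A" for a
  proof (rule small_subset)
    show "(\<Pi>\<^sub>E bf \<in> I a. fib Z (fst bf)) \<prec> (UNIV :: 'u set)"
    proof (rule small_PiE[OF A.gu])
      show "I a \<prec> (UNIV :: 'u set)"
        by (rule small_subset[OF small_Times[OF A.gu B.small_Obj A.small_Arr]]) (auto simp: I_def hom_def)
      show "fib Z (fst i) \<prec> (UNIV :: 'u set)" if "i \<in> I a" for i
        using that by (intro B.fib_small[OF Z]) (auto simp: I_def)
    qed
  qed (simp add: F_def)
  have \<alpha>F: "\<alpha> g \<phi> \<in> F (Dom A g)" if g: "g \<in> Arr A" and \<phi>: "\<phi> \<in> F (Cod A g)" for g \<phi>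
  proof (rule FI)
    fix b f b' u assume f: "(b, f) \<in> I (Dom A g)" and u: "u \<in> hom B b' b"
    have "g \<odot>\<^bsub>A\<^esub> (f \<odot>\<^bsub>A\<^esub> on_arr K u) = (g \<odot>\<^bsub>A\<^esub> f) \<odot>\<^bsub>A\<^esub> on_arr K u"
      using f u g by (auto simp: I_def hom_def)
    then show "\<alpha> g \<phi> (b', f \<odot>\<^bsub>A\<^esub> on_arr K u) = act Z u (\<alpha> g \<phi> (b, f))"
      using f Iu[OF f u] Fn[OF \<phi> Ig[OF f g] u] by (simp add: \<alpha>_def)
  qed (use Fm[OF \<phi> Ig] g in \<open>auto simp: \<alpha>_def\<close>)
  obtain R :: "('o, 'a, 'u) psh" and e d where R: "R \<in> Obj (Psh A)"
    and eF: "\<And>c x. c \<in> Obj A \<Longrightarrow> x \<in> F c \<Longrightarrow> e c x \<in> fib R c"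
    and de: "\<And>c x. c \<in> Obj A \<Longrightarrow> x \<in> F c \<Longrightarrow> d c (e c x) = x"
    and dF: "\<And>c y. c \<in> Obj A \<Longrightarrow> y \<in> fib R c \<Longrightarrow> d c y \<in> F c"
    and ed: "\<And>c y. c \<in> Obj A \<Longrightarrow> y \<in> fib R c \<Longrightarrow> e c (d c y) = y"
    and ac: "\<And>f x. f \<in> Arr A \<Longrightarrow> x \<in> F (Cod A f) \<Longrightarrow> act R f (e (Cod A f) x) = e (Dom A f) (\<alpha> f x)"
  proof (rule A.encode_psh[of F \<alpha>])
    fix a \<phi> assume a: "a \<in> Obj A" and \<phi>: "\<phi> \<in> F a"
    then show "\<alpha> (Idn A a) \<phi> = \<phi>"
      using \<alpha>F[of "Idn A a" \<phi>]
      by (intro Feq[of _ a]) (auto simp: \<alpha>_def I_def hom_def)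
  next
    fix f g \<phi> assume f: "f \<in> Arr A" "g \<in> Arr A" "Cod A f = Dom A g" and \<phi>: "\<phi> \<in> F (Cod A g)"
    show "\<alpha> (g \<odot>\<^bsub>A\<^esub> f) \<phi> = \<alpha> f (\<alpha> g \<phi>)"
    proof (rule Feq[of _ "Dom A f"])
      show "\<alpha> (g \<odot>\<^bsub>A\<^esub> f) \<phi> \<in> F (Dom A f)" using \<alpha>F[of "g \<odot>\<^bsub>A\<^esub> f" \<phi>] f \<phi> by simp
      show "\<alpha> f (\<alpha> g \<phi>) \<in> F (Dom A f)" using \<alpha>F[of f "\<alpha> g \<phi>"] \<alpha>F[of g \<phi>] f \<phi> by simp
      fix b h assume h: "(b, h) \<in> I (Dom A f)"
      have "(g \<odot>\<^bsub>A\<^esub> f) \<odot>\<^bsub>A\<^esub> h = g \<odot>\<^bsub>A\<^esub> (f \<odot>\<^bsub>A\<^esub> h)" using h f by (auto simp: I_def hom_def)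
      then show "\<alpha> (g \<odot>\<^bsub>A\<^esub> f) \<phi> (b, h) = \<alpha> f (\<alpha> g \<phi>) (b, h)"
        using h f Ig[OF h f(1)] by (simp add: \<alpha>_def)
    qed
  qed (auto simp: smallF \<alpha>F intro: that)
  have d_act: "d (Dom A g) (act R g y) = \<alpha> g (d (Cod A g) y)" if "g \<in> Arr A" "y \<in> fib R (Cod A g)" for g y
    using ac[OF that(1) dF] de[of "Dom A g" "\<alpha> g (d (Cod A g) y)"] \<alpha>F[OF that(1) dF] ed that by simp
  \<comment> \<open>The value of a family at \<open>(b, f)\<close> is the value at an identity of
    its restriction along \<open>f\<close>; hence the counit \<open>E\<close>, which evaluates at
    identities only, determines maps into \<open>R\<close>.\<close>
  have d_id: "d (on_obj K b) (act R f y) (b, Idn A (on_obj K b)) = d a y (b, f)"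
    if "a \<in> Obj A" "y \<in> fib R a" "(b, f) \<in> I a" for a b f y
  proof -
    have f: "f \<in> Arr A" "Dom A f = on_obj K b" "Cod A f = a" "b \<in> Obj B"
      using that by (auto simp: I_def hom_def)
    then show ?thesis using d_act[of f y] that Iid[of b] by (simp add: \<alpha>_def)
  qed
  define E where "E = B.mk_map (on_obj (pull B K) R) Z (\<lambda>b y. d (on_obj K b) y (b, Idn A (on_obj K b)))"
  have E: "E \<in> hom (Psh B) (on_obj (pull B K) R) Z"
    unfolding E_def
  proof (rule B.mk_map)
    fix u y assume u: "u \<in> Arr B" and "y \<in> fib (on_obj (pull B K) R) (Cod B u)"
    then have y: "y \<in> fib R (on_obj K (Cod B u))" by simp
    have uh: "u \<in> hom B (Dom B u) (Cod B u)" using u by (simp add: hom_def)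
    have Ku: "(Dom B u, on_arr K u) \<in> I (on_obj K (Cod B u))" using u by (auto simp: I_def hom_def)
    have "d (on_obj K (Dom B u)) (act R (on_arr K u) y) (Dom B u, Idn A (on_obj K (Dom B u)))
      = d (on_obj K (Cod B u)) y (Dom B u, on_arr K u)"
      using u y Ku by (intro d_id) auto
    also have "\<dots> = act Z u (d (on_obj K (Cod B u)) y (Cod B u, Idn A (on_obj K (Cod B u))))"
      using Fn[OF dF[OF _ y] Iid uh] u by simp
    finally show "d (on_obj K (Dom B u)) (act (on_obj (pull B K) R) u y) (Dom B u, Idn A (on_obj K (Dom B u)))
      = act Z u (d (on_obj K (Cod B u)) y (Cod B u, Idn A (on_obj K (Cod B u))))"
      using u by simp
  qed (use R Z in \<open>auto intro!: Fm[OF dF] Iid\<close>)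
  have apE: "ap E b y = d (on_obj K b) y (b, Idn A (on_obj K b))" if "b \<in> Obj B" "y \<in> fib R (on_obj K b)" for b y
    using that by (simp add: E_def)
  have "couniversal (Psh A) (Psh B) (pull B K) Z R E"
  proof (rule couniversalI)
    fix V h assume V: "V \<in> Obj (Psh A)" and h: "h \<in> hom (Psh B) (on_obj (pull B K) V) Z"
    \<comment> \<open>The transpose of \<open>h\<close>: an element \<open>v\<close> gives the
      family of values of \<open>h\<close> at all restrictions of \<open>v\<close>.\<close>
    define k where "k = (\<lambda>a v. \<lambda>bf \<in> I a. ap h (fst bf) (act V (snd bf) v))"
    have vf: "act V f v \<in> fib V (on_obj K b)" if "v \<in> fib V a" "(b, f) \<in> I a" for a b f v
      using that A.act_in[OF V, of f v] by (auto simp: I_def hom_def)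
    have kF: "k a v \<in> F a" if a: "a \<in> Obj A" "v \<in> fib V a" for a v
    proof (rule FI)
      fix b f b' u assume f: "(b, f) \<in> I a" and u: "u \<in> hom B b' b"
      have "act V (f \<odot>\<^bsub>A\<^esub> on_arr K u) v = act V (on_arr K u) (act V f v)"
        using f u a by (intro A.act_comp[OF V]) (auto simp: I_def hom_def)
      moreover have "ap h b' (act (on_obj (pull B K) V) u (act V f v)) = act Z u (ap h b (act V f v))"
        using vf[OF a(2) f] f by (intro B.ap_nat[OF h u]) (auto simp: I_def)
      ultimately show "k a v (b', f \<odot>\<^bsub>A\<^esub> on_arr K u) = act Z u (k a v (b, f))"
        using Iu[OF f u] f u by (simp add: k_def hom_def)
    qed (use B.ap_in[OF h] vf[OF a(2)] in \<open>auto simp: k_def I_def\<close>)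
    have km: "A.mk_map V R (\<lambda>a v. e a (k a v)) \<in> hom (Psh A) V R"
    proof (rule A.mk_map)
      fix g v assume g: "g \<in> Arr A" and v: "v \<in> fib V (Cod A g)"
      have "k (Dom A g) (act V g v) = \<alpha> g (k (Cod A g) v)"
      proof (rule Feq[of _ "Dom A g"])
        fix b f assume f: "(b, f) \<in> I (Dom A g)"
        have "act V (g \<odot>\<^bsub>A\<^esub> f) v = act V f (act V g v)"
          using f g v by (intro A.act_comp[OF V]) (auto simp: I_def hom_def)
        then show "k (Dom A g) (act V g v) (b, f) = \<alpha> g (k (Cod A g) v) (b, f)"
          using f Ig[OF f g] by (simp add: k_def \<alpha>_def)
      qed (use g v V kF \<alpha>F in auto)
      then show "e (Dom A g) (k (Dom A g) (act V g v)) = act R g (e (Cod A g) (k (Cod A g) v))"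
        using ac[OF g kF] g v by simp
    qed (use V R eF kF in auto)
    have "E \<odot>\<^bsub>Psh B\<^esub> on_arr (pull B K) (A.mk_map V R (\<lambda>a v. e a (k a v))) = h"
    proof (rule B.psh_arr_eqI[OF B.psh_comp_hom[OF pull_hom[OF km] E] h])
      fix b v assume b: "b \<in> Obj B" and "v \<in> fib (on_obj (pull B K) V) b"
      then have v: "v \<in> fib V (on_obj K b)" by simp
      then show "ap (E \<odot>\<^bsub>Psh B\<^esub> on_arr (pull B K) (A.mk_map V R (\<lambda>a v. e a (k a v)))) b v = ap h b v"
        using b V Iid[OF b] by (simp add: B.ap_comp[OF pull_hom[OF km]] apE eF kF de) (simp add: k_def)
    qed
    with km show "\<exists>k. k \<in> hom (Psh A) V R \<and> E \<odot>\<^bsub>Psh B\<^esub> on_arr (pull B K) k = h" by blast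
  next
    fix V k k' assume V: "V \<in> Obj (Psh A)" and k: "k \<in> hom (Psh A) V R" and k': "k' \<in> hom (Psh A) V R"
      and eq: "E \<odot>\<^bsub>Psh B\<^esub> on_arr (pull B K) k = E \<odot>\<^bsub>Psh B\<^esub> on_arr (pull B K) k'"
    have Eb: "d (on_obj K b) (ap k (on_obj K b) v) (b, Idn A (on_obj K b)) =
      d (on_obj K b) (ap k' (on_obj K b) v) (b, Idn A (on_obj K b))"
      if b: "b \<in> Obj B" and v: "v \<in> fib V (on_obj K b)" for b v
      using arg_cong[OF eq, of "\<lambda>t. ap t b v"] b v A.ap_in[OF k K.F_obj[OF b] v] A.ap_in[OF k' K.F_obj[OF b] v]
      by (simp add: B.ap_comp[OF pull_hom[OF k]] B.ap_comp[OF pull_hom[OF k']] apE)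
    show "k = k'"
    proof (rule A.psh_arr_eqI[OF k k'])
      fix a v assume a: "a \<in> Obj A" and v: "v \<in> fib V a"
      note m = A.ap_in[OF k a v] A.ap_in[OF k' a v]
      have "d a (ap k a v) = d a (ap k' a v)"
      proof (rule Feq[OF dF[OF a m(1)] dF[OF a m(2)]])
        fix b f assume f: "(b, f) \<in> I a"
        then have fh: "f \<in> hom A (on_obj K b) a" and b: "b \<in> Obj B" by (auto simp: I_def)
        have fv: "act V f v \<in> fib V (on_obj K b)" using A.act_in[OF V, of f v] fh v by (auto simp: hom_def)
        show "d a (ap k a v) (b, f) = d a (ap k' a v) (b, f)"
          unfolding d_id[OF a m(1) f, symmetric] d_id[OF a m(2) f, symmetric]
            A.ap_nat[OF k fh v, symmetric] A.ap_nat[OF k' fh v, symmetric]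
          by (rule Eb[OF b fv])
      qed
      then have "e a (d a (ap k a v)) = e a (d a (ap k' a v))" by simp
      then show "ap k a v = ap k' a v" using ed[OF a] m by simp
    qed
  qed (rule R E)+
  \<comment> \<open>For fully faithful \<open>K\<close> each index over \<open>on_obj K b\<close> is
    the image of a unique arrow of \<open>B\<close>, so that a family amounts to its value at the
    identity.\<close>
  moreover have "iso_arr (Psh B) E" if ff: "full_faithful B A K"
  proof (rule B.psh_isoI[OF E])
    fix b assume b: "b \<in> Obj B"
    show "bij_betw (ap E b) (fib (on_obj (pull B K) R) b) (fib Z b)"
    proof (rule bij_betwI')
      fix y y' assume "y \<in> fib (on_obj (pull B K) R) b" "y' \<in> fib (on_obj (pull B K) R) b"
      then have y: "y \<in> fib R (on_obj K b)" "y' \<in> fib R (on_obj K b)" using b by auto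
      note m = dF[OF K.F_obj[OF b] y(1)] dF[OF K.F_obj[OF b] y(2)]
      show "(ap E b y = ap E b y') = (y = y')"
      proof
        assume "ap E b y = ap E b y'"
        then have *: "d (on_obj K b) y (b, Idn A (on_obj K b)) = d (on_obj K b) y' (b, Idn A (on_obj K b))"
          using b y by (simp add: apE)
        have "d (on_obj K b) y = d (on_obj K b) y'"
        proof (rule Feq[OF m])
          fix b' f assume f: "(b', f) \<in> I (on_obj K b)"
          then have b': "b' \<in> Obj B" and fh: "f \<in> hom A (on_obj K b') (on_obj K b)" by (auto simp: I_def)
          then obtain u where u: "u \<in> hom B b' b" "on_arr K u = f"
            using full_faithfulD(1)[OF ff b' b fh] by auto
          have "Idn A (on_obj K b) \<odot>\<^bsub>A\<^esub> on_arr K u = f" using fh b u(2) by (auto simp: hom_def)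
          then show "d (on_obj K b) y (b', f) = d (on_obj K b) y' (b', f)"
            using Fn[OF m(1) Iid[OF b] u(1)] Fn[OF m(2) Iid[OF b] u(1)] * by simp
        qed
        then have "e (on_obj K b) (d (on_obj K b) y) = e (on_obj K b) (d (on_obj K b) y')" by simp
        then show "y = y'" using ed[OF K.F_obj[OF b]] y by simp
      qed simp
    next
      fix y assume "y \<in> fib (on_obj (pull B K) R) b"
      then show "ap E b y \<in> fib Z b" by (rule B.ap_in[OF E b])
    next
      fix z assume z: "z \<in> fib Z b"
      define q where "q = (\<lambda>b' f. SOME u. u \<in> hom B b' b \<and> on_arr K u = f)"
      have q: "q b' f \<in> hom B b' b" "on_arr K (q b' f) = f" if f: "(b', f) \<in> I (on_obj K b)" for b' f
      proof -
        have b': "b' \<in> Obj B" and fh: "f \<in> hom A (on_obj K b') (on_obj K b)" using f by (auto simp: I_def)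
        from someI_ex[OF full_faithfulD(1)[OF ff b' b fh]]
        show "q b' f \<in> hom B b' b" "on_arr K (q b' f) = f" by (auto simp: q_def)
      qed
      have qu: "q b' (on_arr K u) = u" if u: "u \<in> hom B b' b" for b' u
      proof -
        have *: "(b', on_arr K u) \<in> I (on_obj K b)" using u by (auto simp: I_def hom_def)
        have "b' \<in> Obj B" using u by (auto simp: hom_def)
        then show ?thesis using q[OF *] u by (intro full_faithfulD(2)[OF ff _ b]) auto
      qed
      \<comment> \<open>The family generated by \<open>z\<close>: fullness turns each index into an
        arrow \<open>q b' f\<close> of \<open>B\<close>, along which \<open>z\<close> is
        restricted.\<close>
      define \<phi> where "\<phi> = (\<lambda>bf \<in> I (on_obj K b). act Z (q (fst bf) (snd bf)) z)"
      have \<phi>: "\<phi> \<in> F (on_obj K b)"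
      proof (rule FI)
        fix b' f b'' u assume f: "(b', f) \<in> I (on_obj K b)" and u: "u \<in> hom B b'' b'"
        have w: "q b' f \<odot>\<^bsub>B\<^esub> u \<in> hom B b'' b" using q(1)[OF f] u by (auto simp: hom_def)
        have "on_arr K (q b' f \<odot>\<^bsub>B\<^esub> u) = f \<odot>\<^bsub>A\<^esub> on_arr K u" using q[OF f] u by (auto simp: hom_def)
        then have "q b'' (f \<odot>\<^bsub>A\<^esub> on_arr K u) = q b' f \<odot>\<^bsub>B\<^esub> u" using qu[OF w] by simp
        moreover have "act Z (q b' f \<odot>\<^bsub>B\<^esub> u) z = act Z u (act Z (q b' f) z)"
          using q(1)[OF f] u z by (intro B.act_comp[OF Z]) (auto simp: hom_def)
        ultimately show "\<phi> (b'', f \<odot>\<^bsub>A\<^esub> on_arr K u) = act Z u (\<phi> (b', f))"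
          using f Iu[OF f u] by (simp add: \<phi>_def)
      next
        fix b' f assume f: "(b', f) \<in> I (on_obj K b)"
        show "\<phi> (b', f) \<in> fib Z b'"
          using B.act_in[OF Z, of "q b' f" z] q(1)[OF f] f z by (simp add: \<phi>_def hom_def)
      qed (simp add: \<phi>_def)
      have "q b (Idn A (on_obj K b)) = Idn B b" using qu[OF B.idn_hom[OF b]] b by simp
      then have "ap E b (e (on_obj K b) \<phi>) = z"
        using b \<phi> Iid[OF b] z Z by (simp add: apE eF de) (simp add: \<phi>_def)
      then show "\<exists>y\<in>fib (on_obj (pull B K) R) b. z = ap E b y"
        using eF[OF K.F_obj[OF b] \<phi>] b by (intro bexI[of _ "e (on_obj K b) \<phi>"]) auto
    qed
  qed
  ultimately show ?thesis by (rule that)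
qed

text \<open>The left Kan extension. The class of a triple \<open>(b, f, z)\<close> is encoded as evaluation at that triple
  on the functions that are constant on classes, so that no quotient has to be formed.\<close>

lemma pull_universal:
  fixes Z :: "('p, 'b, 'u) psh"
  assumes Z: "Z \<in> Obj (Psh B)"
  obtains L n where "universal (Psh A) (Psh B) (pull B K) Z L n"
proof -
  define P where "P = (\<lambda>a. {(b, f, z). b \<in> Obj B \<and> f \<in> hom A a (on_obj K b) \<and> z \<in> fib Z b})"
  \<comment> \<open>Compatible functions do not distinguish the two triples that an arrow
    \<open>u\<close> links. Values in \<open>'u\<close> suffice, since the fibres of every target
    presheaf live there; on the other functions \<open>ev\<close> is \<open>undefined\<close>, so
    only compatible ones can tell classes apart.\<close>
  define compat :: "'o \<Rightarrow> ('p \<times> 'a \<times> 'u \<Rightarrow> 'u) \<Rightarrow> bool" where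
    "compat = (\<lambda>a h. \<forall>b b' u f z. u \<in> hom B b b' \<and> f \<in> hom A a (on_obj K b) \<and> z \<in> fib Z b' \<longrightarrow>
       h (b', on_arr K u \<odot>\<^bsub>A\<^esub> f, z) = h (b, f, act Z u z))"
  define ev where "ev = (\<lambda>a p h. if compat a h then h p else undefined)"
  define F where "F = (\<lambda>a. ev a ` P a)"
  \<comment> \<open>Restriction along \<open>g\<close> is composition on triples; on evaluations it
    is precomposition with \<open>sh g\<close>, which preserves compatibility.\<close>
  define sh where "sh = (\<lambda>g (h :: 'p \<times> 'a \<times> 'u \<Rightarrow> 'u) (b, f, z). h (b, f \<odot>\<^bsub>A\<^esub> g, z))"
  define \<alpha> where "\<alpha> = (\<lambda>g (\<xi> :: ('p \<times> 'a \<times> 'u \<Rightarrow> 'u) \<Rightarrow> 'u) h. if compat (Dom A g) h then \<xi> (sh g h) else undefined)"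
  have sh: "compat (Cod A g) (sh g h)" if "compat (Dom A g) h" "g \<in> Arr A" for g h
    unfolding compat_def
  proof (intro allI impI)
    fix b b' u f z assume *: "u \<in> hom B b b' \<and> f \<in> hom A (Cod A g) (on_obj K b) \<and> z \<in> fib Z b'"
    have "(on_arr K u \<odot>\<^bsub>A\<^esub> f) \<odot>\<^bsub>A\<^esub> g = on_arr K u \<odot>\<^bsub>A\<^esub> (f \<odot>\<^bsub>A\<^esub> g)"
      using * that(2) by (auto simp: hom_def)
    moreover have "f \<odot>\<^bsub>A\<^esub> g \<in> hom A (Dom A g) (on_obj K b)" using * that(2) by (auto simp: hom_def)
    ultimately show "sh g h (b', on_arr K u \<odot>\<^bsub>A\<^esub> f, z) = sh g h (b, f, act Z u z)"
      using that(1) * by (simp add: sh_def compat_def)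
  qed
  have ev_act: "\<alpha> g (ev (Cod A g) (b, f, z)) = ev (Dom A g) (b, f \<odot>\<^bsub>A\<^esub> g, z)" if "g \<in> Arr A" for g b f z
    using sh[OF _ that] by (auto simp: \<alpha>_def ev_def sh_def fun_eq_iff)
  have ev_rel: "ev a (b', on_arr K u \<odot>\<^bsub>A\<^esub> f, z) = ev a (b, f, act Z u z)"
    if "u \<in> hom B b b'" "f \<in> hom A a (on_obj K b)" "z \<in> fib Z b'" for a b b' u f z
    using that unfolding ev_def compat_def by (intro ext) auto
  have Pg: "(b, f \<odot>\<^bsub>A\<^esub> g, z) \<in> P (Dom A g)" if "g \<in> Arr A" "(b, f, z) \<in> P (Cod A g)" for b f g z
    using that by (auto simp: P_def hom_def)
  obtain L :: "('o, 'a, 'u) psh" and e d where L: "L \<in> Obj (Psh A)"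
    and eF: "\<And>c x. c \<in> Obj A \<Longrightarrow> x \<in> F c \<Longrightarrow> e c x \<in> fib L c"
    and de: "\<And>c x. c \<in> Obj A \<Longrightarrow> x \<in> F c \<Longrightarrow> d c (e c x) = x"
    and dF: "\<And>c y. c \<in> Obj A \<Longrightarrow> y \<in> fib L c \<Longrightarrow> d c y \<in> F c"
    and ed: "\<And>c y. c \<in> Obj A \<Longrightarrow> y \<in> fib L c \<Longrightarrow> e c (d c y) = y"
    and ac: "\<And>f x. f \<in> Arr A \<Longrightarrow> x \<in> F (Cod A f) \<Longrightarrow> act L f (e (Cod A f) x) = e (Dom A f) (\<alpha> f x)"
  proof (rule A.encode_psh[of F \<alpha>])
    fix a assume a: "a \<in> Obj A"
    have "Sigma (Obj B) (\<lambda>b. Arr A \<times> fib Z b) \<prec> (UNIV :: 'u set)"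
      by (intro small_Sigma small_Times A.gu B.small_Obj A.small_Arr B.fib_small[OF Z])
    then have "P a \<prec> (UNIV :: 'u set)"
      by (rule small_subset) (auto simp: P_def hom_def)
    then show "F a \<prec> (UNIV :: 'u set)" unfolding F_def by (rule small_image)
  next
    fix g \<xi> assume g: "g \<in> Arr A" and "\<xi> \<in> F (Cod A g)"
    then obtain b f z where *: "\<xi> = ev (Cod A g) (b, f, z)" "(b, f, z) \<in> P (Cod A g)" by (auto simp: F_def)
    show "\<alpha> g \<xi> \<in> F (Dom A g)"
      unfolding *(1) ev_act[OF g] F_def by (rule imageI[OF Pg[OF g *(2)]])
  next
    fix a \<xi> assume a: "a \<in> Obj A" and "\<xi> \<in> F a"
    then obtain b f z where *: "\<xi> = ev a (b, f, z)" "(b, f, z) \<in> P a" by (auto simp: F_def)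
    then show "\<alpha> (Idn A a) \<xi> = \<xi>"
      using ev_act[of "Idn A a" b f z] a by (auto simp: P_def hom_def)
  next
    fix f g \<xi> assume f: "f \<in> Arr A" "g \<in> Arr A" "Cod A f = Dom A g" and "\<xi> \<in> F (Cod A g)"
    then obtain b h z where *: "\<xi> = ev (Cod A g) (b, h, z)" "(b, h, z) \<in> P (Cod A g)" by (auto simp: F_def)
    have "(h \<odot>\<^bsub>A\<^esub> g) \<odot>\<^bsub>A\<^esub> f = h \<odot>\<^bsub>A\<^esub> (g \<odot>\<^bsub>A\<^esub> f)" using * f by (auto simp: P_def hom_def)
    moreover have "\<alpha> (g \<odot>\<^bsub>A\<^esub> f) \<xi> = ev (Dom A f) (b, h \<odot>\<^bsub>A\<^esub> (g \<odot>\<^bsub>A\<^esub> f), z)"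
      unfolding *(1) using ev_act[OF A.comp_arr(1)[OF f], of b h z]
      by (simp only: A.comp_arr(2,3)[OF f])
    moreover have "\<alpha> f (\<alpha> g \<xi>) = ev (Dom A f) (b, (h \<odot>\<^bsub>A\<^esub> g) \<odot>\<^bsub>A\<^esub> f, z)"
      unfolding *(1) ev_act[OF f(2)] f(3)[symmetric] by (rule ev_act[OF f(1)])
    ultimately show "\<alpha> (g \<odot>\<^bsub>A\<^esub> f) \<xi> = \<alpha> f (\<alpha> g \<xi>)" by (simp only:)
  qed (auto intro: that)
  have evF: "ev a (b, f, z) \<in> F a" if "b \<in> Obj B" "f \<in> hom A a (on_obj K b)" "z \<in> fib Z b" for a b f z
    unfolding F_def by (rule imageI) (use that in \<open>simp add: P_def\<close>)
  have Kid: "Idn A (on_obj K b) \<in> hom A (on_obj K b) (on_obj K b)" if "b \<in> Obj B" for b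
    using that by (auto simp: hom_def)
  \<comment> \<open>Every class is a restriction of a value of the unit \<nu>; naturality of the
    unit and uniqueness of transposes rest on this.\<close>
  have gen: "act L f (e (on_obj K b) (ev (on_obj K b) (b, Idn A (on_obj K b), z))) = e a (ev a (b, f, z))"
    if b: "b \<in> Obj B" and f: "f \<in> hom A a (on_obj K b)" and z: "z \<in> fib Z b" for a b f z
  proof -
    have fs: "f \<in> Arr A" "Dom A f = a" "Cod A f = on_obj K b" using f by (auto simp: hom_def)
    show ?thesis
      using ac[of f "ev (on_obj K b) (b, Idn A (on_obj K b), z)"] evF[OF b Kid[OF b] z]
        ev_act[of f b "Idn A (on_obj K b)" z] fs by simp
  qed
  define \<nu> where "\<nu> = (\<lambda>b z. e (on_obj K b) (ev (on_obj K b) (b, Idn A (on_obj K b), z)))"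
  have \<nu>L: "\<nu> b z \<in> fib L (on_obj K b)" if "b \<in> Obj B" "z \<in> fib Z b" for b z
    unfolding \<nu>_def using that by (intro eF evF Kid) auto
  define n where "n = B.mk_map Z (on_obj (pull B K) L) \<nu>"
  have n: "n \<in> hom (Psh B) Z (on_obj (pull B K) L)"
    unfolding n_def
  proof (rule B.mk_map)
    fix u z assume u: "u \<in> Arr B" and z: "z \<in> fib Z (Cod B u)"
    have uh: "u \<in> hom B (Dom B u) (Cod B u)" using u by (simp add: hom_def)
    have "on_arr K u \<odot>\<^bsub>A\<^esub> Idn A (on_obj K (Dom B u)) = on_arr K u" using u by simp
    then have "ev (on_obj K (Dom B u)) (Cod B u, on_arr K u, z) =
      ev (on_obj K (Dom B u)) (Dom B u, Idn A (on_obj K (Dom B u)), act Z u z)"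
      using ev_rel[OF uh Kid z] u by simp
    then show "\<nu> (Dom B u) (act Z u z) = act (on_obj (pull B K) L) u (\<nu> (Cod B u) z)"
      using gen[of "Cod B u" "on_arr K u" "on_obj K (Dom B u)" z] u z K.F_hom[OF uh] by (simp add: \<nu>_def)
  qed (use Z L \<nu>L in auto)
  have L_gen: "\<exists>b f z. b \<in> Obj B \<and> f \<in> hom A a (on_obj K b) \<and> z \<in> fib Z b \<and> y = e a (ev a (b, f, z))"
    if ay: "a \<in> Obj A" "y \<in> fib L a" for a y
  proof -
    obtain b f z where "(b, f, z) \<in> P a" "d a y = ev a (b, f, z)" using dF[OF ay] by (auto simp: F_def)
    then show ?thesis using ed[OF ay] by (intro exI[of _ b] exI[of _ f] exI[of _ z]) (auto simp: P_def)
  qed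
  have "universal (Psh A) (Psh B) (pull B K) Z L n"
  proof (rule universalI)
    fix V h assume V: "V \<in> Obj (Psh A)" and h: "h \<in> hom (Psh B) Z (on_obj (pull B K) V)"
    \<comment> \<open>Applying a class to this compatible function gives the transpose of
      \<open>h\<close>. Since a class is itself an evaluation, the map is defined without choosing
      representatives.\<close>
    define hh where "hh = (\<lambda>(b, f, z). act V f (ap h b z))"
    have hV: "ap h b z \<in> fib V (on_obj K b)" if "b \<in> Obj B" "z \<in> fib Z b" for b z
      using B.ap_in[OF h that] that by simp
    have hc: "compat a hh" for a
      unfolding compat_def
    proof (intro allI impI)
      fix b b' u f z assume *: "u \<in> hom B b b' \<and> f \<in> hom A a (on_obj K b) \<and> z \<in> fib Z b'"
      then have us: "u \<in> Arr B" "Dom B u = b" "Cod B u = b'" "b' \<in> Obj B" by (auto simp: hom_def)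
      have "act V (on_arr K u \<odot>\<^bsub>A\<^esub> f) (ap h b' z) = act V f (act V (on_arr K u) (ap h b' z))"
        using * us hV[of b' z] by (intro A.act_comp[OF V]) (auto simp: hom_def)
      moreover have "ap h b (act Z u z) = act V (on_arr K u) (ap h b' z)"
        using B.ap_nat[OF h, of u b b' z] * us by simp
      ultimately show "hh (b', on_arr K u \<odot>\<^bsub>A\<^esub> f, z) = hh (b, f, act Z u z)" by (simp add: hh_def)
    qed
    have dh: "d a (e a (ev a (b, f, z))) hh = act V f (ap h b z)"
      if "b \<in> Obj B" "f \<in> hom A a (on_obj K b)" "z \<in> fib Z b" "a \<in> Obj A" for a b f z
      using de[OF that(4) evF[OF that(1-3)]] hc[of a] by (simp add: ev_def hh_def)
    have km: "A.mk_map L V (\<lambda>a y. d a y hh) \<in> hom (Psh A) L V"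
    proof (rule A.mk_map)
      fix a y assume a: "a \<in> Obj A" and y: "y \<in> fib L a"
      obtain b f z where b: "b \<in> Obj B" "f \<in> hom A a (on_obj K b)" "z \<in> fib Z b" "y = e a (ev a (b, f, z))"
        using L_gen[OF a y] by blast
      have "act V f (ap h b z) \<in> fib V a"
        using A.act_in[OF V, of f "ap h b z"] hV[of b z] b by (auto simp: hom_def)
      then show "d a y hh \<in> fib V a" using dh[OF b(1-3) a] b(4) by simp
    next
      fix g y assume g: "g \<in> Arr A" and y: "y \<in> fib L (Cod A g)"
      obtain b f z where b: "b \<in> Obj B" "f \<in> hom A (Cod A g) (on_obj K b)" "z \<in> fib Z b"
        "y = e (Cod A g) (ev (Cod A g) (b, f, z))"
        using L_gen[OF _ y] g by auto
      have fg: "f \<odot>\<^bsub>A\<^esub> g \<in> hom A (Dom A g) (on_obj K b)" using b g by (auto simp: hom_def)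
      have "act L g y = e (Dom A g) (ev (Dom A g) (b, f \<odot>\<^bsub>A\<^esub> g, z))"
        using ac[OF g evF[OF b(1-3)]] ev_act[OF g, of b f z] b(4) by simp
      moreover have "act V (f \<odot>\<^bsub>A\<^esub> g) (ap h b z) = act V g (act V f (ap h b z))"
        using b g hV[of b z] by (intro A.act_comp[OF V]) (auto simp: hom_def)
      ultimately show "d (Dom A g) (act L g y) hh = act V g (d (Cod A g) y hh)"
        using dh[OF b(1-3)] dh[OF b(1) fg b(3)] b(4) g by simp
    qed (rule L V)+
    have "on_arr (pull B K) (A.mk_map L V (\<lambda>a y. d a y hh)) \<odot>\<^bsub>Psh B\<^esub> n = h"
    proof (rule B.psh_arr_eqI[OF B.psh_comp_hom[OF n pull_hom[OF km]] h])
      fix b z assume b: "b \<in> Obj B" and z: "z \<in> fib Z b"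
      show "ap (on_arr (pull B K) (A.mk_map L V (\<lambda>a y. d a y hh)) \<odot>\<^bsub>Psh B\<^esub> n) b z = ap h b z"
        using b z \<nu>L[OF b z] dh[OF b Kid[OF b] z] hV[OF b z] V by (simp add: B.ap_comp[OF n]) (simp add: n_def \<nu>_def)
    qed
    with km show "\<exists>k. k \<in> hom (Psh A) L V \<and> on_arr (pull B K) k \<odot>\<^bsub>Psh B\<^esub> n = h" by blast
  next
    fix V k k' assume V: "V \<in> Obj (Psh A)" and k: "k \<in> hom (Psh A) L V" and k': "k' \<in> hom (Psh A) L V"
      and eq: "on_arr (pull B K) k \<odot>\<^bsub>Psh B\<^esub> n = on_arr (pull B K) k' \<odot>\<^bsub>Psh B\<^esub> n"
    show "k = k'"
    proof (rule A.psh_arr_eqI[OF k k'])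
      fix a y assume a: "a \<in> Obj A" and y: "y \<in> fib L a"
      obtain b f z where b: "b \<in> Obj B" "f \<in> hom A a (on_obj K b)" "z \<in> fib Z b" "y = e a (ev a (b, f, z))"
        using L_gen[OF a y] by blast
      have y': "y = act L f (\<nu> b z)" using gen[OF b(1-3)] b(4) by (simp add: \<nu>_def)
      have "ap k (on_obj K b) (\<nu> b z) = ap k' (on_obj K b) (\<nu> b z)"
        using arg_cong[OF eq, of "\<lambda>t. ap t b z"] b by (simp add: B.ap_comp[OF n]) (simp add: n_def)
      then show "ap k a y = ap k' a y"
        unfolding y' A.ap_nat[OF k b(2) \<nu>L[OF b(1,3)]] A.ap_nat[OF k' b(2) \<nu>L[OF b(1,3)]] by simp
    qed
  qed (rule L n)+
  then show ?thesis by (rule that)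
qed

end

section \<open>Slices and categories of elements\<close>

lemma slice_simps [simp]:
  "u \<in> Obj (slice E G) \<longleftrightarrow> u \<in> Arr E \<and> Cod E u = G"
  "(u, h, v) \<in> Arr (slice E G) \<longleftrightarrow> u \<in> Arr E \<and> Cod E u = G \<and> v \<in> Arr E \<and> Cod E v = G \<and>
     h \<in> hom E (Dom E u) (Dom E v) \<and> v \<odot>\<^bsub>E\<^esub> h = u"
  "Dom (slice E G) (u, h, v) = u" "Cod (slice E G) (u, h, v) = v"
  "Idn (slice E G) u = (u, Idn E (Dom E u), u)"
  "(v', k, w) \<odot>\<^bsub>slice E G\<^esub> (u, h, v) = (u, k \<odot>\<^bsub>E\<^esub> h, w)"
  by (simp_all add: slice_def)

lemma slice_hom_iff:
  "a \<in> hom (slice E G) u v \<longleftrightarrow> (\<exists>h. a = (u, h, v) \<and> u \<in> Arr E \<and> Cod E u = G \<and>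
     v \<in> Arr E \<and> Cod E v = G \<and> h \<in> hom E (Dom E u) (Dom E v) \<and> v \<odot>\<^bsub>E\<^esub> h = u)"
  by (cases a) (auto simp: hom_def)

lemma slice_homE:
  assumes "f \<in> hom (slice E G) u v"
  obtains h where "f = (u, h, v)" "u \<in> Arr E" "Cod E u = G" "v \<in> Arr E" "Cod E v = G"
    "h \<in> Arr E" "Dom E h = Dom E u" "Cod E h = Dom E v" "v \<odot>\<^bsub>E\<^esub> h = u"
proof -
  obtain h where "f = (u, h, v)" "u \<in> Arr E" "Cod E u = G" "v \<in> Arr E" "Cod E v = G"
    "h \<in> hom E (Dom E u) (Dom E v)" "v \<odot>\<^bsub>E\<^esub> h = u"
    using assms unfolding slice_hom_iff by blast
  then show ?thesis by (intro that) (simp_all add: hom_def)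
qed

lemma category_slice:
  assumes "category E"
  shows "category (slice E G)"
proof -
  interpret E: category E by fact
  show ?thesis
  proof
    fix f assume f: "f \<in> Arr (slice E G)"
    then show "Dom (slice E G) f \<in> Obj (slice E G)" "Cod (slice E G) f \<in> Obj (slice E G)"
      by (cases f, simp)+
  next
    fix a assume "a \<in> Obj (slice E G)"
    then show "Idn (slice E G) a \<in> hom (slice E G) a a" by (simp add: hom_def)
  next
    fix f g h a b c d
    assume f: "f \<in> hom (slice E G) a b" and g: "g \<in> hom (slice E G) b c"
    obtain f' where f': "f = (a, f', b)" "a \<in> Arr E" "Cod E a = G" "b \<in> Arr E" "Cod E b = G"
      "f' \<in> Arr E" "Dom E f' = Dom E a" "Cod E f' = Dom E b" "b \<odot>\<^bsub>E\<^esub> f' = a"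
      using f by (rule slice_homE)
    obtain g' where g': "g = (b, g', c)" "b \<in> Arr E" "Cod E b = G" "c \<in> Arr E" "Cod E c = G"
      "g' \<in> Arr E" "Dom E g' = Dom E b" "Cod E g' = Dom E c" "c \<odot>\<^bsub>E\<^esub> g' = b"
      using g by (rule slice_homE)
    have "c \<odot>\<^bsub>E\<^esub> (g' \<odot>\<^bsub>E\<^esub> f') = a"
      using E.assoc[of f' g' c] f' g' by simp
    then show "g \<odot>\<^bsub>slice E G\<^esub> f \<in> hom (slice E G) a c"
      using f' g' by (simp add: hom_def)
    assume h: "h \<in> hom (slice E G) c d"
    obtain h' where h': "h = (c, h', d)" "c \<in> Arr E" "Cod E c = G" "d \<in> Arr E" "Cod E d = G"
      "h' \<in> Arr E" "Dom E h' = Dom E c" "Cod E h' = Dom E d" "d \<odot>\<^bsub>E\<^esub> h' = c"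
      using h by (rule slice_homE)
    show "h \<odot>\<^bsub>slice E G\<^esub> (g \<odot>\<^bsub>slice E G\<^esub> f) = h \<odot>\<^bsub>slice E G\<^esub> g \<odot>\<^bsub>slice E G\<^esub> f"
      unfolding f'(1) g'(1) h'(1) slice_simps
      using E.assoc[of f' g' h'] f'(6-8) g'(6-8) h'(6-8) by simp
  next
    fix f a b assume f: "f \<in> hom (slice E G) a b"
    obtain f' where f': "f = (a, f', b)" "a \<in> Arr E" "Cod E a = G" "b \<in> Arr E" "Cod E b = G"
      "f' \<in> Arr E" "Dom E f' = Dom E a" "Cod E f' = Dom E b" "b \<odot>\<^bsub>E\<^esub> f' = a"
      using f by (rule slice_homE)
    show "Idn (slice E G) b \<odot>\<^bsub>slice E G\<^esub> f = f" "f \<odot>\<^bsub>slice E G\<^esub> Idn (slice E G) a = f"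
      unfolding f'(1) slice_simps using f'(6-8) by simp_all
  qed
qed

lemma full_subcat_simps [simp]:
  "a \<in> Obj (full_subcat A P) \<longleftrightarrow> a \<in> Obj A \<and> a \<in> P"
  "f \<in> Arr (full_subcat A P) \<longleftrightarrow> f \<in> Arr A \<and> Dom A f \<in> P \<and> Cod A f \<in> P"
  "Dom (full_subcat A P) = Dom A" "Cod (full_subcat A P) = Cod A" "Idn (full_subcat A P) = Idn A"
  "f \<odot>\<^bsub>full_subcat A P\<^esub> g = f \<odot>\<^bsub>A\<^esub> g"
  by (simp_all add: full_subcat_def)

lemma hom_full_subcat:
  "f \<in> hom (full_subcat A P) a b \<longleftrightarrow> f \<in> hom A a b \<and> a \<in> P \<and> b \<in> P"
  by (auto simp: hom_def)

lemma (in category) category_full_subcat: "category (full_subcat C P)"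
proof
  show "f \<in> hom (full_subcat C P) a b \<Longrightarrow> g \<in> hom (full_subcat C P) b c \<Longrightarrow>
    h \<in> hom (full_subcat C P) c d \<Longrightarrow> h \<odot>\<^bsub>full_subcat C P\<^esub> (g \<odot>\<^bsub>full_subcat C P\<^esub> f) =
      h \<odot>\<^bsub>full_subcat C P\<^esub> g \<odot>\<^bsub>full_subcat C P\<^esub> f" for f g h a b c d
    by (simp add: hom_full_subcat) (auto simp: hom_def)
qed (auto simp: hom_def)

lemma (in site) site_full_subcat: "site (TYPE('u)) (full_subcat C P)"
  using category_full_subcat gu small_subset[OF small_Obj, of "Obj (full_subcat C P)"]
    small_subset[OF small_Arr, of "Arr (full_subcat C P)"]
  unfolding site_def site_axioms_def by (simp add: subset_iff)

lemma (in category) full_subcat_inclusion: "full_faithful (full_subcat C P) C id_ftor"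
proof -
  have "is_functor (full_subcat C P) C id_ftor"
    using category_full_subcat category_axioms by (simp add: is_functor_def hom_def)
  moreover have "hom (full_subcat C P) a b = hom C a b"
    if "a \<in> P" "b \<in> P" for a b
    using that by (auto simp: hom_full_subcat)
  ultimately show ?thesis by (simp add: full_faithful_def bij_betw_def inj_on_def)
qed

section \<open>Categories of elements and the equivalence with slices\<close>

lemma elements_simps [simp]:
  "(x, c) \<in> Obj (elements C X) \<longleftrightarrow> c \<in> Obj C \<and> x \<in> fib X c"
  "((x, c), f, (y, d)) \<in> Arr (elements C X) \<longleftrightarrow> c \<in> Obj C \<and> x \<in> fib X c \<and> d \<in> Obj C \<and>
     y \<in> fib X d \<and> f \<in> hom C c d \<and> act X f y = x"
  "Dom (elements C X) (a, f, b) = a" "Cod (elements C X) (a, f, b) = b"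
  "Idn (elements C X) (x, c) = ((x, c), Idn C c, (x, c))"
  "(b', g, d') \<odot>\<^bsub>elements C X\<^esub> (a, f, b) = (a, g \<odot>\<^bsub>C\<^esub> f, d')"
  by (simp_all add: elements_def)

lemma elements_hom_iff:
  "g \<in> hom (elements C X) (x, c) (y, d) \<longleftrightarrow> (\<exists>f. g = ((x, c), f, (y, d)) \<and> c \<in> Obj C \<and> x \<in> fib X c \<and>
     d \<in> Obj C \<and> y \<in> fib X d \<and> f \<in> hom C c d \<and> act X f y = x)"
  by (cases g) (auto simp: hom_def)

lemma elements_ArrE:
  assumes "g \<in> Arr (elements C X)"
  obtains x c f y d where "g = ((x, c), f, (y, d))" "c \<in> Obj C" "x \<in> fib X c" "d \<in> Obj C"
    "y \<in> fib X d" "f \<in> hom C c d" "act X f y = x"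
  using assms by (cases g) auto

locale slice_site = site C U for C :: "('o, 'a) cat" (structure) and U :: "'u itself" +
  fixes X :: "('o, 'a, 'u) psh"
  assumes X [simp]: "X \<in> Obj (Psh C)"
begin

lemma category_elements: "category (elements C X)"
proof
  fix f assume f: "f \<in> Arr (elements C X)"
  then show "Dom (elements C X) f \<in> Obj (elements C X)" "Cod (elements C X) f \<in> Obj (elements C X)"
    by (rule elements_ArrE, simp)+
next
  fix a assume "a \<in> Obj (elements C X)"
  then show "Idn (elements C X) a \<in> hom (elements C X) a a"
    by (cases a) (auto simp: hom_def)
next
  fix f g h and a b c d :: "'u \<times> 'o"
  assume f: "f \<in> hom (elements C X) a b" and g: "g \<in> hom (elements C X) b c"
  obtain x a' y b' z c' w d' where [simp]: "a = (x, a')" "b = (y, b')" "c = (z, c')" "d = (w, d')"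
    by (cases a; cases b; cases c; cases d) auto
  obtain f' where f': "f = (a, f', b)" "f' \<in> hom C a' b'" "act X f' y = x" "a \<in> Obj (elements C X)"
    using f by (auto simp: elements_hom_iff)
  obtain g' where g': "g = (b, g', c)" "g' \<in> hom C b' c'" "act X g' z = y" "c \<in> Obj (elements C X)"
    using g by (auto simp: elements_hom_iff)
  have "act X (g' \<odot> f') z = act X f' (act X g' z)"
    using f' g' by (intro act_comp) (auto simp: hom_def)
  then show "g \<odot>\<^bsub>elements C X\<^esub> f \<in> hom (elements C X) a c"
    using f' g' comp_hom[OF f'(2) g'(2)] by (auto simp: elements_hom_iff)
  assume h: "h \<in> hom (elements C X) c d"
  obtain h' where h': "h = (c, h', d)" "h' \<in> hom C c' d'"
    using h by (auto simp: elements_hom_iff)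
  show "h \<odot>\<^bsub>elements C X\<^esub> (g \<odot>\<^bsub>elements C X\<^esub> f) = h \<odot>\<^bsub>elements C X\<^esub> g \<odot>\<^bsub>elements C X\<^esub> f"
    using f' g' h' comp_assoc[OF f'(2) g'(2) h'(2)] by simp
next
  fix f a b assume f: "f \<in> hom (elements C X) a b"
  obtain x a' y b' where [simp]: "a = (x, a')" "b = (y, b')" by (cases a; cases b) auto
  obtain f' where f': "f = (a, f', b)" "f' \<in> hom C a' b'" 
    using f by (auto simp: elements_hom_iff)
  show "Idn (elements C X) b \<odot>\<^bsub>elements C X\<^esub> f = f" using f' idn_left[OF f'(2)] by simp
  show "f \<odot>\<^bsub>elements C X\<^esub> Idn (elements C X) a = f" using f' idn_right[OF f'(2)] by simp
qed

sublocale El: site "elements C X" U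
proof (unfold site_def site_axioms_def, intro conjI)
  have O: "Obj (elements C X) \<prec> (UNIV :: 'u set)"
  proof (rule small_subset)
    show "(\<lambda>p. (snd p, fst p)) ` Sigma (Obj C) (fib X) \<prec> (UNIV :: 'u set)"
      by (intro small_image small_Sigma gu small_Obj fib_small X)
  qed (auto simp: elements_def image_iff)
  then show "Obj (elements C X) \<prec> (UNIV :: 'u set)" .
  show "Arr (elements C X) \<prec> (UNIV :: 'u set)"
    by (rule small_subset[OF small_Times[OF gu O small_Times[OF gu small_Arr O]]])
       (auto simp: elements_def hom_def)
qed (rule category_elements gu)+

lemma site_functor_projection: 
  "site_functor TYPE('u) C (elements C X) \<lparr>on_obj = snd, on_arr = (\<lambda>(a, f, b). f)\<rparr>"
  unfolding site_functor_def ftr_def ftr_axioms_def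
  using site_axioms El.site_axioms category_axioms El.category_axioms
  by (auto simp: is_functor_def elim!: elements_ArrE)

lemma slice_objD:
  assumes "u \<in> Obj (slice (Psh C) X)"
  shows "u \<in> hom (Psh C) (Dom (Psh C) u) X" "Dom (Psh C) u \<in> Obj (Psh C)"
proof -
  show *: "u \<in> hom (Psh C) (Dom (Psh C) u) X" using assms by (simp add: hom_def)
  show "Dom (Psh C) u \<in> Obj (Psh C)" by (rule psh_arrD(1)[OF *])
qed

lemma fibres_simps [simp]:
  assumes "c \<in> Obj C" "x \<in> fib X c"
  shows "fib (fibres_psh C X u) (x, c) = {y \<in> fib (Dom (Psh C) u) c. ap u c y = x}"
  using assms by (simp add: fibres_psh_def Let_def Psh_def ap_def split: prod.splits)

lemma fibres_act [simp]:
  assumes "((x, c), f, (y, d)) \<in> Arr (elements C X)" "z \<in> fib (Dom (Psh C) u) d" "ap u d z = y"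
  shows "act (fibres_psh C X u) ((x, c), f, (y, d)) z = act (Dom (Psh C) u) f z"
proof -
  obtain Y \<phi> Z where "u = (Y, \<phi>, Z)" by (cases u)
  then show ?thesis using assms by (simp add: fibres_psh_def Let_def Psh_def ap_def)
qed

lemma fibres_obj [simp]:
  assumes u: "u \<in> Obj (slice (Psh C) X)"
  shows "fibres_psh C X u \<in> Obj (Psh (elements C X))"
proof -
  note uh = slice_objD[OF u]
  let ?Y = "Dom (Psh C) u"
  define F where "F = (\<lambda>(x, c). {y \<in> fib ?Y c. ap u c y = x})"
  have "fibres_psh C X u = El.mk_psh F (\<lambda>(a, f, b). act ?Y f)"
    by (auto simp: fibres_psh_def El.mk_psh_def F_def Psh_def ap_def Let_def restrict_def fun_eq_iff
        split: prod.splits)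
  moreover have "El.mk_psh F (\<lambda>(a, f, b). act ?Y f) \<in> Obj (Psh (elements C X))"
  proof (rule El.mk_psh_obj)
    fix b assume "b \<in> Obj (elements C X)"
    then show "F b \<prec> (UNIV :: 'u set)"
      by (cases b) (auto simp: F_def intro: small_subset[OF fib_small[OF uh(2)]])
  next
    fix g y assume "g \<in> Arr (elements C X)" "y \<in> F (Cod (elements C X) g)"
    then show "(case g of (a, f, b) \<Rightarrow> act ?Y f) y \<in> F (Dom (elements C X) g)"
      using uh(2) by (auto elim!: elements_ArrE simp: F_def ap_nat[OF uh(1)]) (auto simp: hom_def)
  next
    fix b y assume "b \<in> Obj (elements C X)" "y \<in> F b"
    then show "(case Idn (elements C X) b of (a, f, b) \<Rightarrow> act ?Y f) y = y"
      using uh(2) by (cases b) (auto simp: F_def)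
  next
    fix f g y assume f: "f \<in> Arr (elements C X)" and g: "g \<in> Arr (elements C X)"
      and fg: "Cod (elements C X) f = Dom (elements C X) g" and y: "y \<in> F (Cod (elements C X) g)"
    obtain a f' b where f': "f = (a, f', b)" by (cases f) auto
    obtain b' g' d where g': "g = (b', g', d)" by (cases g) auto
    obtain x a' y' b'' z d' where [simp]: "a = (x, a')" "b = (y', b'')" "d = (z, d')" "b' = (y', b'')"
      using fg f' g' by (cases a; cases b; cases d) auto
    have "f' \<in> hom C a' b''" "g' \<in> hom C b'' d'" using f g f' g' by auto
    then show "(case g \<odot>\<^bsub>elements C X\<^esub> f of (a, f, b) \<Rightarrow> act ?Y f) y =
      (case f of (a, f, b) \<Rightarrow> act ?Y f) ((case g of (a, f, b) \<Rightarrow> act ?Y f) y)"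
      using y f' g' by (simp add: F_def) (intro act_comp uh(2), auto simp: hom_def)
  qed
  ultimately show ?thesis by simp
qed

lemma fibres_on_obj [simp]: "on_obj (fibres_ftor C X) u = fibres_psh C X u"
  by (simp add: fibres_ftor_def)

lemma fibres_hom:
  assumes s: "(u, h, v) \<in> hom (slice (Psh C) X) u v"
  shows "on_arr (fibres_ftor C X) (u, h, v) =
      El.mk_map (fibres_psh C X u) (fibres_psh C X v) (\<lambda>(x, c). ap h c)" (is "?l = ?r")
    and "on_arr (fibres_ftor C X) (u, h, v) \<in> hom (Psh (elements C X)) (fibres_psh C X u) (fibres_psh C X v)"
proof -
  show eq: "?l = ?r"
    by (auto simp: fibres_ftor_def El.mk_map_def ap_def restrict_def fun_eq_iff split: prod.splits)
  have uv: "u \<in> Obj (slice (Psh C) X)" "v \<in> Obj (slice (Psh C) X)"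
    and h: "h \<in> hom (Psh C) (Dom (Psh C) u) (Dom (Psh C) v)" and vh: "v \<odot>\<^bsub>Psh C\<^esub> h = u"
    using s by (auto simp: slice_hom_iff)
  note uh = slice_objD[OF uv(1)] slice_objD[OF uv(2)]
  have vha: "ap v c (ap h c y) = ap u c y" if "c \<in> Obj C" "y \<in> fib (Dom (Psh C) u) c" for c y
    using ap_comp[OF h that, of v] vh by simp
  show "?l \<in> hom (Psh (elements C X)) (fibres_psh C X u) (fibres_psh C X v)"
    unfolding eq
  proof (rule El.mk_map)
    fix b y assume b: "b \<in> Obj (elements C X)" "y \<in> fib (fibres_psh C X u) b"
    obtain x c where [simp]: "b = (x, c)" by (cases b) auto
    show "(case b of (x, c) \<Rightarrow> ap h c) y \<in> fib (fibres_psh C X v) b"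
      using b vha[of c y] ap_in[OF h, of c y] by auto
  next
    fix g y assume g: "g \<in> Arr (elements C X)" and y: "y \<in> fib (fibres_psh C X u) (Cod (elements C X) g)"
    from g obtain x c f z d where g': "g = ((x, c), f, (z, d))" "c \<in> Obj C" "x \<in> fib X c" "d \<in> Obj C"
      "z \<in> fib X d" "f \<in> hom C c d" "act X f z = x" by (rule elements_ArrE)
    have y': "y \<in> fib (Dom (Psh C) u) d" "ap u d y = z" using y g' by auto
    have "act (fibres_psh C X u) g y = act (Dom (Psh C) u) f y"
      using y' g g'(1) by (simp only: fibres_act)
    moreover have "act (fibres_psh C X v) g (ap h d y) = act (Dom (Psh C) v) f (ap h d y)"
      using y' g g'(1) vha[of d y] ap_in[OF h, of d y] g'(4) by (simp only: fibres_act)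
    ultimately show "(case Dom (elements C X) g of (x, c) \<Rightarrow> ap h c) (act (fibres_psh C X u) g y) =
      act (fibres_psh C X v) g ((case Cod (elements C X) g of (x, c) \<Rightarrow> ap h c) y)"
      using ap_nat[OF h g'(6) y'(1)] by (simp add: g'(1))
  qed (use uv in auto)
qed

lemma ap_fibres [simp]:
  assumes "(u, h, v) \<in> hom (slice (Psh C) X) u v" "c \<in> Obj C" "y \<in> fib (Dom (Psh C) u) c"
    "ap u c y = x" "x \<in> fib X c"
  shows "ap (on_arr (fibres_ftor C X) (u, h, v)) (x, c) y = ap h c y"
  using assms unfolding fibres_hom(1)[OF assms(1)] by (subst El.ap_mk_map) auto

lemma category_slice_psh: "category (slice (Psh C :: (('o, 'a, 'u) psh, ('o, 'a, 'u) psh_arr) cat) X)"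
  by (rule category_slice[OF category_Psh])

lemma fibres_functor: "is_functor (slice (Psh C) X) (Psh (elements C X)) (fibres_ftor C X)"
proof -
  interpret S: category "slice (Psh C) X" by (rule category_slice_psh)
  interpret P: category "Psh (elements C X) :: ((_, _, 'u) psh, _) cat" by (rule El.category_Psh)
  show ?thesis
    unfolding is_functor_def
  proof (intro conjI ballI impI)
    fix u assume u: "u \<in> Obj (slice (Psh C) X)"
    then show "on_obj (fibres_ftor C X) u \<in> Obj (Psh (elements C X))" by simp
    have i: "(u, Idn (Psh C) (Dom (Psh C) u), u) \<in> hom (slice (Psh C) X) u u"
      using S.idn_hom[OF u] by simp
    have "on_arr (fibres_ftor C X) (u, Idn (Psh C) (Dom (Psh C) u), u) = Idn (Psh (elements C X)) (fibres_psh C X u)"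
    proof (rule El.psh_arr_eqI[OF fibres_hom(2)[OF i] P.idn_hom])
      fix b y assume "b \<in> Obj (elements C X)" "y \<in> fib (fibres_psh C X u) b"
      then show "ap (on_arr (fibres_ftor C X) (u, Idn (Psh C) (Dom (Psh C) u), u)) b y
        = ap (Idn (Psh (elements C X)) (fibres_psh C X u)) b y"
        using i by (cases b) auto
    qed (use u in simp)
    then show "on_arr (fibres_ftor C X) (Idn (slice (Psh C) X) u) = Idn (Psh (elements C X)) (on_obj (fibres_ftor C X) u)"
      by simp
  next
    fix f assume f: "f \<in> Arr (slice (Psh C) X)"
    obtain u h v where [simp]: "f = (u, h, v)" by (cases f) auto
    have fh: "(u, h, v) \<in> hom (slice (Psh C) X) u v" using f unfolding hom_def by simp
    show "on_arr (fibres_ftor C X) f \<in> hom (Psh (elements C X)) (on_obj (fibres_ftor C X) (Dom (slice (Psh C) X) f))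
        (on_obj (fibres_ftor C X) (Cod (slice (Psh C) X) f))"
      using fibres_hom(2)[OF fh] by simp
    fix g assume g: "g \<in> Arr (slice (Psh C) X)" "Cod (slice (Psh C) X) f = Dom (slice (Psh C) X) g"
    obtain k w where [simp]: "g = (v, k, w)" using g(2) by (cases g) auto
    have gh: "(v, k, w) \<in> hom (slice (Psh C) X) v w" using g unfolding hom_def by simp
    have hh: "h \<in> hom (Psh C) (Dom (Psh C) u) (Dom (Psh C) v)" and vh: "v \<odot>\<^bsub>Psh C\<^esub> h = u"
      using f by auto
    have gf: "(u, k \<odot>\<^bsub>Psh C\<^esub> h, w) \<in> hom (slice (Psh C) X) u w"
      using S.comp_hom[OF fh gh] by simp
    have "on_arr (fibres_ftor C X) (u, k \<odot>\<^bsub>Psh C\<^esub> h, w) =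
      on_arr (fibres_ftor C X) (v, k, w) \<odot>\<^bsub>Psh (elements C X)\<^esub> on_arr (fibres_ftor C X) (u, h, v)"
    proof (rule El.psh_arr_eqI[OF fibres_hom(2)[OF gf] El.psh_comp_hom[OF fibres_hom(2)[OF fh] fibres_hom(2)[OF gh]]])
      fix b y assume b: "b \<in> Obj (elements C X)" "y \<in> fib (fibres_psh C X u) b"
      obtain x c where [simp]: "b = (x, c)" by (cases b) auto
      have c: "c \<in> Obj C" "y \<in> fib (Dom (Psh C) u) c" "ap u c y = x" "x \<in> fib X c" using b by auto
      have "ap v c (ap h c y) = x" using ap_comp[OF hh c(1,2), of v] vh c(3) by simp
      then show "ap (on_arr (fibres_ftor C X) (u, k \<odot>\<^bsub>Psh C\<^esub> h, w)) b y =
        ap (on_arr (fibres_ftor C X) (v, k, w) \<odot>\<^bsub>Psh (elements C X)\<^esub> on_arr (fibres_ftor C X) (u, h, v)) b y"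
        using b c ap_in[OF hh c(1,2)] gf gh fh
        by (simp add: El.ap_comp[OF fibres_hom(2)[OF fh]] ap_comp[OF hh])
    qed
    then show "on_arr (fibres_ftor C X) (g \<odot>\<^bsub>slice (Psh C) X\<^esub> f) =
      on_arr (fibres_ftor C X) g \<odot>\<^bsub>Psh (elements C X)\<^esub> on_arr (fibres_ftor C X) f" by simp
  qed (rule S.category_axioms P.category_axioms)+
qed

text \<open>Each element of the total presheaf lies in exactly one fibre, so a natural family of
  maps between the fibres is the same as a map of the total presheaves over
  \<open>X\<close>.\<close>

lemma fibres_full_faithful: "full_faithful (slice (Psh C) X) (Psh (elements C X)) (fibres_ftor C X)"
  unfolding full_faithful_def
proof (intro conjI ballI)
  show "is_functor (slice (Psh C) X) (Psh (elements C X)) (fibres_ftor C X)" by (rule fibres_functor)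
  fix u v assume u: "u \<in> Obj (slice (Psh C) X)" and v: "v \<in> Obj (slice (Psh C) X)"
  note uh = slice_objD[OF u] and vh = slice_objD[OF v]
  have ux: "ap u c y \<in> fib X c" if "c \<in> Obj C" "y \<in> fib (Dom (Psh C) u) c" for c y
    using ap_in[OF uh(1) that] .
  show "bij_betw (on_arr (fibres_ftor C X)) (hom (slice (Psh C) X) u v)
    (hom (Psh (elements C X)) (on_obj (fibres_ftor C X) u) (on_obj (fibres_ftor C X) v))"
  proof (rule bij_betwI')
    fix f g assume f: "f \<in> hom (slice (Psh C) X) u v" and g: "g \<in> hom (slice (Psh C) X) u v"
    obtain h where h: "f = (u, h, v)" "h \<in> hom (Psh C) (Dom (Psh C) u) (Dom (Psh C) v)"
      using f by (auto simp: slice_hom_iff)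
    obtain k where k: "g = (u, k, v)" "k \<in> hom (Psh C) (Dom (Psh C) u) (Dom (Psh C) v)"
      using g by (auto simp: slice_hom_iff)
    show "(on_arr (fibres_ftor C X) f = on_arr (fibres_ftor C X) g) = (f = g)"
    proof
      assume eq: "on_arr (fibres_ftor C X) f = on_arr (fibres_ftor C X) g"
      have "h = k"
      proof (rule psh_arr_eqI[OF h(2) k(2)])
        fix c y assume c: "c \<in> Obj C" "y \<in> fib (Dom (Psh C) u) c"
        then show "ap h c y = ap k c y"
          using arg_cong[OF eq, of "\<lambda>t. ap t (ap u c y, c) y"] f g ux[OF c]
          by (simp add: h(1) k(1))
      qed
      then show "f = g" by (simp add: h(1) k(1))
    qed simp
  next
    fix f assume f: "f \<in> hom (slice (Psh C) X) u v"
    then obtain h where "f = (u, h, v)" by (auto simp: slice_hom_iff)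
    then show "on_arr (fibres_ftor C X) f \<in> hom (Psh (elements C X)) (on_obj (fibres_ftor C X) u) (on_obj (fibres_ftor C X) v)"
      using fibres_hom(2) f by simp
  next
    fix s assume "s \<in> hom (Psh (elements C X)) (on_obj (fibres_ftor C X) u) (on_obj (fibres_ftor C X) v)"
    then have s: "s \<in> hom (Psh (elements C X)) (fibres_psh C X u) (fibres_psh C X v)" by simp
    \<comment> \<open>The element \<open>y\<close> itself tells over which point of \<open>X\<close>
      the map \<open>s\<close> has to be applied.\<close>
    define h where "h = mk_map (Dom (Psh C) u) (Dom (Psh C) v) (\<lambda>c y. ap s (ap u c y, c) y)"
    have sv: "ap s (ap u c y, c) y \<in> fib (Dom (Psh C) v) c" "ap v c (ap s (ap u c y, c) y) = ap u c y"
      if "c \<in> Obj C" "y \<in> fib (Dom (Psh C) u) c" for c y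
      using El.ap_in[OF s, of "(ap u c y, c)" y] that ux[OF that] by auto
    have h: "h \<in> hom (Psh C) (Dom (Psh C) u) (Dom (Psh C) v)"
      unfolding h_def
    proof (rule mk_map)
      fix f y assume f: "f \<in> Arr C" and y: "y \<in> fib (Dom (Psh C) u) (Cod C f)"
      have fh: "f \<in> hom C (Dom C f) (Cod C f)" using f by (simp add: hom_def)
      have yD: "act (Dom (Psh C) u) f y \<in> fib (Dom (Psh C) u) (Dom C f)"
        using f y uh by simp
      let ?a = "(ap u (Dom C f) (act (Dom (Psh C) u) f y), Dom C f)" and ?b = "(ap u (Cod C f) y, Cod C f)"
      have g: "(?a, f, ?b) \<in> hom (elements C X) ?a ?b"
        using f y fh ux[OF _ y] ux[OF _ yD] ap_nat[OF uh(1) fh y] by (auto simp: elements_hom_iff)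
      have gA: "(?a, f, ?b) \<in> Arr (elements C X)" using g unfolding hom_def by blast
      have "y \<in> fib (fibres_psh C X u) ?b" using y f ux[OF _ y] by simp
      from El.ap_nat[OF s g this]
      have "ap s ?a (act (fibres_psh C X u) (?a, f, ?b) y) = act (fibres_psh C X v) (?a, f, ?b) (ap s ?b y)" .
      moreover have "act (fibres_psh C X u) (?a, f, ?b) y = act (Dom (Psh C) u) f y"
        by (rule fibres_act[OF gA y refl])
      moreover have "act (fibres_psh C X v) (?a, f, ?b) (ap s ?b y) = act (Dom (Psh C) v) f (ap s ?b y)"
        using sv[of "Cod C f" y] f y by (intro fibres_act[OF gA]) auto
      ultimately show "ap s (ap u (Dom C f) (act (Dom (Psh C) u) f y), Dom C f) (act (Dom (Psh C) u) f y)
        = act (Dom (Psh C) v) f (ap s (ap u (Cod C f) y, Cod C f) y)" by simp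
    qed (use uh vh sv in auto)
    have "v \<odot>\<^bsub>Psh C\<^esub> h = u"
      by (rule psh_arr_eqI[OF psh_comp_hom[OF h vh(1)] uh(1)]) (simp add: ap_comp[OF h] sv, simp add: h_def sv)
    then have f: "(u, h, v) \<in> hom (slice (Psh C) X) u v"
      using u v h by (simp add: slice_hom_iff)
    have "on_arr (fibres_ftor C X) (u, h, v) = s"
    proof (rule El.psh_arr_eqI[OF fibres_hom(2)[OF f] s])
      fix b y assume b: "b \<in> Obj (elements C X)" "y \<in> fib (fibres_psh C X u) b"
      then show "ap (on_arr (fibres_ftor C X) (u, h, v)) b y = ap s b y"
        using f by (cases b) (auto simp: h_def)
    qed
    then show "\<exists>f\<in>hom (slice (Psh C) X) u v. s = on_arr (fibres_ftor C X) f" using f by blast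
  qed
qed

text \<open>The total presheaf is the disjoint sum of the fibres \<open>fib Z (x, c)\<close> over
  all \<open>x\<close>, with the first projection as its map to \<open>X\<close>.\<close>

lemma fibres_ess_surj:
  assumes Z: "Z \<in> Obj (Psh (elements C X))"
  shows "\<exists>u i. u \<in> Obj (slice (Psh C) X) \<and>
    i \<in> hom (Psh (elements C X)) (on_obj (fibres_ftor C X) u) Z \<and> iso_arr (Psh (elements C X)) i"
proof -
  define F where "F = (\<lambda>c. {(x, z). x \<in> fib X c \<and> z \<in> fib Z (x, c)})"
  \<comment> \<open>The projection to \<open>C\<close> is a discrete fibration:
    \<open>lift f x\<close> is the only arrow over \<open>f\<close> that ends in
    \<open>(x, Cod C f)\<close>.\<close>
  define lift where "lift = (\<lambda>f x. ((act X f x, Dom C f), f, (x, Cod C f)))"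
  define \<alpha> where "\<alpha> = (\<lambda>f (x, z). (act X f x, act Z (lift f x) z))"
  have lift: "lift f x \<in> Arr (elements C X)" if "f \<in> Arr C" "x \<in> fib X (Cod C f)" for f x
    using that by (auto simp: lift_def hom_def)
  have lift_s: "Dom (elements C X) (lift f x) = (act X f x, Dom C f)"
    "Cod (elements C X) (lift f x) = (x, Cod C f)" for f x
    by (auto simp: lift_def)
  obtain Y :: "('o, 'a, 'u) psh" and e d where Y: "Y \<in> Obj (Psh C)"
    and eF: "\<And>c x. c \<in> Obj C \<Longrightarrow> x \<in> F c \<Longrightarrow> e c x \<in> fib Y c"
    and de: "\<And>c x. c \<in> Obj C \<Longrightarrow> x \<in> F c \<Longrightarrow> d c (e c x) = x"
    and dF: "\<And>c y. c \<in> Obj C \<Longrightarrow> y \<in> fib Y c \<Longrightarrow> d c y \<in> F c"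
    and ed: "\<And>c y. c \<in> Obj C \<Longrightarrow> y \<in> fib Y c \<Longrightarrow> e c (d c y) = y"
    and ac: "\<And>f x. f \<in> Arr C \<Longrightarrow> x \<in> F (Cod C f) \<Longrightarrow> act Y f (e (Cod C f) x) = e (Dom C f) (\<alpha> f x)"
  proof (rule encode_psh[of F \<alpha>])
    fix c assume c: "c \<in> Obj C"
    have "F c = Sigma (fib X c) (\<lambda>x. fib Z (x, c))" by (auto simp: F_def)
    then show "F c \<prec> (UNIV :: 'u set)"
      using c El.fib_small[OF Z] by (simp add: small_Sigma[OF gu fib_small[OF X]])
  next
    fix f p assume "f \<in> Arr C" "p \<in> F (Cod C f)"
    then show "\<alpha> f p \<in> F (Dom C f)"
      using El.act_in[OF Z lift] lift_s by (auto simp: F_def \<alpha>_def)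
  next
    fix c p assume c: "c \<in> Obj C" and p: "p \<in> F c"
    obtain x z where [simp]: "p = (x, z)" by (cases p) auto
    have "lift (Idn C c) x = Idn (elements C X) (x, c)" using c p by (simp add: lift_def F_def)
    then show "\<alpha> (Idn C c) p = p"
      using c p El.act_idn[OF Z, of "(x, c)" z] by (simp add: \<alpha>_def F_def)
  next
    fix f g p assume f: "f \<in> Arr C" "g \<in> Arr C" "Cod C f = Dom C g" and p: "p \<in> F (Cod C g)"
    obtain x z where [simp]: "p = (x, z)" by (cases p) auto
    have x: "x \<in> fib X (Cod C g)" "z \<in> fib Z (x, Cod C g)" using p by (auto simp: F_def)
    have "lift (g \<odot> f) x = lift g x \<odot>\<^bsub>elements C X\<^esub> lift f (act X g x)"
      using f x by (simp add: lift_def act_comp)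
    moreover have "act Z (lift g x \<odot>\<^bsub>elements C X\<^esub> lift f (act X g x)) z = act Z (lift f (act X g x)) (act Z (lift g x) z)"
      using f x by (intro El.act_comp[OF Z] lift) (auto simp: lift_s)
    ultimately show "\<alpha> (g \<odot> f) p = \<alpha> f (\<alpha> g p)"
      using f x by (simp add: \<alpha>_def act_comp)
  qed (auto intro: that)
  define u where "u = mk_map Y X (\<lambda>c y. fst (d c y))"
  have d_act: "d (Dom C f) (act Y f y) = \<alpha> f (d (Cod C f) y)" if fy: "f \<in> Arr C" "y \<in> fib Y (Cod C f)" for f y
  proof -
    have m: "d (Cod C f) y \<in> F (Cod C f)" using dF fy by simp
    have "\<alpha> f (d (Cod C f) y) \<in> F (Dom C f)"
      using m fy El.act_in[OF Z lift] lift_s by (auto simp: F_def \<alpha>_def)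
    then show ?thesis using ac[OF fy(1) m] ed[OF _ fy(2)] de fy by simp
  qed
  have uh: "u \<in> hom (Psh C) Y X"
    unfolding u_def
  proof (rule mk_map)
    fix f y assume f: "f \<in> Arr C" "y \<in> fib Y (Cod C f)"
    show "fst (d (Dom C f) (act Y f y)) = act X f (fst (d (Cod C f) y))"
      using d_act[OF f] by (simp add: \<alpha>_def case_prod_beta)
  qed (use Y dF in \<open>auto simp: F_def case_prod_beta\<close>)
  have us: "Dom (Psh C) u = Y" and u: "u \<in> Obj (slice (Psh C) X)" using uh by (auto simp: hom_def)
  have apu: "ap u c y = fst (d c y)" if "c \<in> Obj C" "y \<in> fib Y c" for c y
    using that by (simp add: u_def)
  define i where "i = El.mk_map (fibres_psh C X u) Z (\<lambda>(x, c) y. snd (d c y))"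
  have i: "i \<in> hom (Psh (elements C X)) (fibres_psh C X u) Z"
    unfolding i_def
  proof (rule El.mk_map)
    fix b y assume b: "b \<in> Obj (elements C X)" "y \<in> fib (fibres_psh C X u) b"
    obtain x c where [simp]: "b = (x, c)" by (cases b) auto
    have "c \<in> Obj C" "y \<in> fib Y c" "fst (d c y) = x" using b us apu by auto
    then show "(case b of (x, c) \<Rightarrow> \<lambda>y. snd (d c y)) y \<in> fib Z b"
      using dF[of c y] by (auto simp: F_def)
  next
    fix g y assume g: "g \<in> Arr (elements C X)" and y: "y \<in> fib (fibres_psh C X u) (Cod (elements C X) g)"
    from g obtain x c f z b where g': "g = ((x, c), f, (z, b))" "c \<in> Obj C" "x \<in> fib X c" "b \<in> Obj C"
      "z \<in> fib X b" "f \<in> hom C c b" "act X f z = x" by (rule elements_ArrE)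
    have fs: "f \<in> Arr C" "Dom C f = c" "Cod C f = b" using g'(6) by (auto simp: hom_def)
    have y': "y \<in> fib Y b" "fst (d b y) = z" "ap u b y = z" using y g' apu us by auto
    have gl: "g = lift f z" using g' fs by (simp add: lift_def)
    have "act (fibres_psh C X u) g y = act Y f y"
      using y' g g'(1) us by (simp only: fibres_act)
    moreover have "snd (d c (act Y f y)) = act Z g (snd (d b y))"
      using d_act[of f y] fs y' gl by (simp add: \<alpha>_def case_prod_beta)
    ultimately show "(case Dom (elements C X) g of (x, c) \<Rightarrow> \<lambda>y. snd (d c y)) (act (fibres_psh C X u) g y) =
      act Z g ((case Cod (elements C X) g of (x, c) \<Rightarrow> \<lambda>y. snd (d c y)) y)"
      by (simp add: g'(1))
  qed (use u Z in auto)
  have "iso_arr (Psh (elements C X)) i"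
  proof (rule El.psh_isoI[OF i])
    fix b assume b: "b \<in> Obj (elements C X)"
    obtain x c where [simp]: "b = (x, c)" by (cases b) auto
    have c: "c \<in> Obj C" "x \<in> fib X c" using b by auto
    have fu: "y \<in> fib (fibres_psh C X u) (x, c) \<longleftrightarrow> y \<in> fib Y c \<and> fst (d c y) = x" for y
      using c us apu by auto
    have ai: "ap i (x, c) y = snd (d c y)" if "y \<in> fib (fibres_psh C X u) (x, c)" for y
      using that b by (simp add: i_def del: fibres_simps)
    have "bij_betw (ap i (x, c)) (fib (fibres_psh C X u) (x, c)) (fib Z (x, c))"
    proof (rule bij_betw_byWitness[of _ "\<lambda>z. e c (x, z)"])
      show "\<forall>y\<in>fib (fibres_psh C X u) (x, c). e c (x, ap i (x, c) y) = y"
      proof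
        fix y assume y: "y \<in> fib (fibres_psh C X u) (x, c)"
        then have "d c y = (x, snd (d c y))" using fu by (metis prod.collapse)
        then show "e c (x, ap i (x, c) y) = y" using ed[of c y] c y fu ai by metis
      qed
      have F: "(x, z) \<in> F c" if "z \<in> fib Z (x, c)" for z using that c by (simp add: F_def)
      have m: "e c (x, z) \<in> fib (fibres_psh C X u) (x, c)" if "z \<in> fib Z (x, c)" for z
        using fu eF[OF c(1) F[OF that]] de[OF c(1) F[OF that]] by simp
      show "\<forall>z\<in>fib Z (x, c). ap i (x, c) (e c (x, z)) = z"
        using ai[OF m] de[OF c(1) F] by simp
      show "(\<lambda>z. e c (x, z)) ` fib Z (x, c) \<subseteq> fib (fibres_psh C X u) (x, c)" using m by blast
      show "ap i (x, c) ` fib (fibres_psh C X u) (x, c) \<subseteq> fib Z (x, c)"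
        using El.ap_in[OF i] b by auto
    qed
    then show "bij_betw (ap i b) (fib (fibres_psh C X u) b) (fib Z b)" by simp
  qed
  then show ?thesis using u i by (intro exI[of _ u] exI[of _ i]) (simp del: slice_simps)
qed

end

text \<open>Full faithfulness pulls the arrow and its universal property back along
  \<open>H\<close>. This gives \<open>G\<close> a right adjoint when its composite with
  \<open>H\<close> is better understood than \<open>G\<close>, as happens for the pullback to a
  slice.\<close>

lemma couniversal_via_full_faithful:
  assumes G: "is_functor A S G" and T: "is_functor A P T" and ff: "full_faithful S P H"
    and t: "nat_trans A P (H \<circ>\<^sub>F G) T \<theta>" and iso: "\<And>a. a \<in> Obj A \<Longrightarrow> iso_arr P (\<theta> a)"
    and v: "v \<in> Obj S" and e: "couniversal A P T (on_obj H v) r e"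
  shows "\<exists>e. couniversal A S G v r e"
proof -
  interpret G: ftr A S G by (rule ftrI) fact
  interpret T: ftr A P T by (rule ftrI) fact
  interpret H: ftr S P H using ff by (intro ftrI) (simp add: full_faithful_def)
  note [simp] = nat_transE(3-5)[OF t, simplified] iso couniversalD(1-4)[OF e] v
  have nat: "\<theta> (Cod A f) \<odot>\<^bsub>P\<^esub> on_arr H (on_arr G f) = on_arr T f \<odot>\<^bsub>P\<^esub> \<theta> (Dom A f)" if "f \<in> Arr A" for f
    using nat_transE(6)[OF t that] by simp
  have "e \<odot>\<^bsub>P\<^esub> \<theta> r \<in> hom P (on_obj H (on_obj G r)) (on_obj H v)"
    by (simp add: hom_def)
  then obtain e' where e': "e' \<in> hom S (on_obj G r) v" "on_arr H e' = e \<odot>\<^bsub>P\<^esub> \<theta> r"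
    using full_faithfulD(1)[OF ff, of "on_obj G r" v] by auto
  have es [simp]: "e' \<in> Arr S" "Dom S e' = on_obj G r" "Cod S e' = v" using e' by (auto simp: hom_def)
  have He: "on_arr H (e' \<odot>\<^bsub>S\<^esub> on_arr G k) = (e \<odot>\<^bsub>P\<^esub> on_arr T k) \<odot>\<^bsub>P\<^esub> \<theta> a" if "k \<in> hom A a r" for k a
  proof -
    have k: "k \<in> Arr A" "Dom A k = a" "Cod A k = r" using that by (auto simp: hom_def)
    have "on_arr H (e' \<odot>\<^bsub>S\<^esub> on_arr G k) = e \<odot>\<^bsub>P\<^esub> (\<theta> r \<odot>\<^bsub>P\<^esub> on_arr H (on_arr G k))"
      using k e'(2) by simp
    also have "\<theta> r \<odot>\<^bsub>P\<^esub> on_arr H (on_arr G k) = on_arr T k \<odot>\<^bsub>P\<^esub> \<theta> a" using nat[of k] k by simp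
    finally show ?thesis using k G.A.dom_obj[of k] by simp
  qed
  have "couniversal A S G v r e'"
  proof (rule couniversalI)
    fix a h assume a: "a \<in> Obj A" and h: "h \<in> hom S (on_obj G a) v"
    have hs: "h \<in> Arr S" "Dom S h = on_obj G a" "Cod S h = v" using h by (auto simp: hom_def)
    have "on_arr H h \<odot>\<^bsub>P\<^esub> inv_arr P (\<theta> a) \<in> hom P (on_obj T a) (on_obj H v)"
      using hs a by (simp add: hom_def)
    then obtain k where k: "k \<in> hom A a r" "e \<odot>\<^bsub>P\<^esub> on_arr T k = on_arr H h \<odot>\<^bsub>P\<^esub> inv_arr P (\<theta> a)"
      using couniversalD(5)[OF e a] by blast
    have "on_arr H (e' \<odot>\<^bsub>S\<^esub> on_arr G k) = on_arr H h"
      unfolding He[OF k(1)] k(2) using hs a by simp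
    then have "e' \<odot>\<^bsub>S\<^esub> on_arr G k = h"
      using h k(1) a by (intro full_faithfulD(2)[OF ff, of "on_obj G a" v]) (auto simp: hom_def)
    with k(1) show "\<exists>k. k \<in> hom A a r \<and> e' \<odot>\<^bsub>S\<^esub> on_arr G k = h" by blast
  next
    fix a k k' assume a: "a \<in> Obj A" and k: "k \<in> hom A a r" "k' \<in> hom A a r"
      and eq: "e' \<odot>\<^bsub>S\<^esub> on_arr G k = e' \<odot>\<^bsub>S\<^esub> on_arr G k'"
    have ks: "k \<in> Arr A" "Dom A k = a" "Cod A k = r" "k' \<in> Arr A" "Dom A k' = a" "Cod A k' = r"
      using k by (auto simp: hom_def)
    have "((e \<odot>\<^bsub>P\<^esub> on_arr T k) \<odot>\<^bsub>P\<^esub> \<theta> a) \<odot>\<^bsub>P\<^esub> inv_arr P (\<theta> a) = ((e \<odot>\<^bsub>P\<^esub> on_arr T k') \<odot>\<^bsub>P\<^esub> \<theta> a) \<odot>\<^bsub>P\<^esub> inv_arr P (\<theta> a)"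
      using arg_cong[OF eq, of "on_arr H"] He[OF k(1)] He[OF k(2)] by (simp only:)
    then have "e \<odot>\<^bsub>P\<^esub> on_arr T k = e \<odot>\<^bsub>P\<^esub> on_arr T k'" using ks a by simp
    then show "k = k'" by (rule couniversal_eq[OF e T.ftr_axioms k])
  qed (use e' in auto)
  then show ?thesis by blast
qed

section \<open>The geometric morphism from a slice\<close>

definition forget_ftor :: "('o, 'a) cat \<Rightarrow> ('a, 'a \<times> 'a \<times> 'a, 'o, 'a) ftor" where
  "forget_ftor E = \<lparr>on_obj = Dom E, on_arr = (\<lambda>(u, h, v). h)\<rparr>"

lemma forget_simps [simp]:
  "on_obj (forget_ftor E) u = Dom E u" "on_arr (forget_ftor E) (u, h, v) = h"
  by (simp_all add: forget_ftor_def)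

lemma forget_functor:
  assumes "category E" shows "is_functor (slice E G) E (forget_ftor E)"
proof -
  interpret E: category E by fact
  show ?thesis
    unfolding is_functor_def
  proof (intro conjI ballI impI)
    show "category (slice E G)" "category E" using assms category_slice by auto
    fix f assume f: "f \<in> Arr (slice E G)"
    obtain u h v where [simp]: "f = (u, h, v)" by (cases f) auto
    show "on_arr (forget_ftor E) f \<in> hom E (on_obj (forget_ftor E) (Dom (slice E G) f)) (on_obj (forget_ftor E) (Cod (slice E G) f))"
      using f by simp
    fix g assume g: "g \<in> Arr (slice E G)"
    then show "on_arr (forget_ftor E) (g \<odot>\<^bsub>slice E G\<^esub> f) = on_arr (forget_ftor E) g \<odot>\<^bsub>E\<^esub> on_arr (forget_ftor E) f"
      by (cases g) simp
  qed auto
qed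

lemma forget_slice_homD:
  assumes "g \<in> hom (slice E G) u v"
  shows "g = (u, on_arr (forget_ftor E) g, v)"
    "on_arr (forget_ftor E) g \<in> hom E (Dom E u) (Dom E v)" "v \<odot>\<^bsub>E\<^esub> on_arr (forget_ftor E) g = u"
  using assms unfolding slice_hom_iff by auto

text \<open>A couniversal arrow for the forgetful functor at \<open>Y\<close> makes its vertex a
  product of \<open>Y\<close> and \<open>G\<close>, with the counit as projection to
  \<open>Y\<close>. So the product condition in \<open>slice_geom\<close> comes from an adjunction,
  and \<open>right_adjoint_lex\<close> provides lexness.\<close>

lemma slice_geomI:
  assumes E: "category E" and G: "G \<in> Obj E" and adj: "adjoint (slice E G) E (forget_ftor E) pb"
    and r: "adjoint E (slice E G) pb R"
  shows "slice_geom E G \<lparr>inverse_image = pb, direct_image = R\<rparr>"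
proof -
  obtain \<eta> \<epsilon> where "adjunction (slice E G) E (forget_ftor E) pb \<eta> \<epsilon>" using adj by (rule adjointE)
  then interpret P: adjunction "slice E G" E "forget_ftor E" pb \<eta> \<epsilon> .
  have "is_product E Y G (Dom E q) (\<epsilon> Y) q" if Y [simp]: "Y \<in> Obj E" and q: "q = on_obj pb Y" for Y q
    unfolding is_product_def
  proof (intro conjI ballI)
    have qo: "q \<in> Obj (slice E G)" using q by (simp del: slice_simps)
    then have qs: "q \<in> Arr E" "Cod E q = G" by auto
    show "Dom E q \<in> Obj E" using qs by simp
    show "\<epsilon> Y \<in> hom E (Dom E q) Y" using P.counit_hom[of Y] q by simp
    show "q \<in> hom E (Dom E q) G" using qs by (simp add: hom_def)
    fix c u v assume c: "c \<in> Obj E" and u: "u \<in> hom E c Y" and v: "v \<in> hom E c G"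
    have vo: "v \<in> Obj (slice E G)" "Dom E v = c" "v \<in> Arr E" "Cod E v = G" using v by (auto simp: hom_def)
    obtain k where k: "k \<in> hom (slice E G) v q" "\<epsilon> Y \<odot>\<^bsub>E\<^esub> on_arr (forget_ftor E) k = u"
      using couniversalD(5)[OF P.couniversal[OF Y] vo(1), of u] u vo q by auto
    show "\<exists>!h. h \<in> hom E c (Dom E q) \<and> \<epsilon> Y \<odot>\<^bsub>E\<^esub> h = u \<and> q \<odot>\<^bsub>E\<^esub> h = v"
    proof (rule ex1I[of _ "on_arr (forget_ftor E) k"])
      show "on_arr (forget_ftor E) k \<in> hom E c (Dom E q) \<and> \<epsilon> Y \<odot>\<^bsub>E\<^esub> on_arr (forget_ftor E) k = u \<and>
        q \<odot>\<^bsub>E\<^esub> on_arr (forget_ftor E) k = v"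
        using forget_slice_homD[OF k(1)] k(2) vo by simp
      fix h assume h: "h \<in> hom E c (Dom E q) \<and> \<epsilon> Y \<odot>\<^bsub>E\<^esub> h = u \<and> q \<odot>\<^bsub>E\<^esub> h = v"
      then have h': "(v, h, q) \<in> hom (slice E G) v q"
        using vo qs by (simp add: slice_hom_iff)
      have "(v, h, q) = k"
        using h k by (intro couniversal_eq[OF P.couniversal[OF Y] P.L.ftr_axioms, of "(v, h, q)" v]) (auto simp: q[symmetric] h')
      then show "h = on_arr (forget_ftor E) k" by auto
    qed
  qed
  moreover have "\<epsilon> (Cod E k) \<odot>\<^bsub>E\<^esub> fst (snd (on_arr pb k)) = k \<odot>\<^bsub>E\<^esub> \<epsilon> (Dom E k)" if "k \<in> Arr E" for k
    using P.counit_nat[OF that] by (simp add: forget_ftor_def case_prod_beta)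
  moreover have "geometric_morphism (slice E G) E \<lparr>inverse_image = pb, direct_image = R\<rparr>"
    using r right_adjoint_lex[OF adj] by (simp add: geometric_morphism_def)
  ultimately show ?thesis
    using G unfolding slice_geom_def by (auto simp: Let_def)
qed

context slice_site
begin

text \<open>The pointwise product of \<open>Y\<close> with \<open>X\<close>, encoded in the
  universe; its second projection is the object of the slice.\<close>

lemma forget_couniversal:
  assumes Y: "Y \<in> Obj (Psh C)"
  shows "\<exists>r e. couniversal (slice (Psh C) X) (Psh C) (forget_ftor (Psh C)) Y r e"
proof -
  obtain P :: "('o, 'a, 'u) psh" and e d where P: "P \<in> Obj (Psh C)"
    and eF: "\<And>c x. c \<in> Obj C \<Longrightarrow> x \<in> fib Y c \<times> fib X c \<Longrightarrow> e c x \<in> fib P c"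
    and de: "\<And>c x. c \<in> Obj C \<Longrightarrow> x \<in> fib Y c \<times> fib X c \<Longrightarrow> d c (e c x) = x"
    and dF: "\<And>c y. c \<in> Obj C \<Longrightarrow> y \<in> fib P c \<Longrightarrow> d c y \<in> fib Y c \<times> fib X c"
    and ed: "\<And>c y. c \<in> Obj C \<Longrightarrow> y \<in> fib P c \<Longrightarrow> e c (d c y) = y"
    and ac: "\<And>f x. f \<in> Arr C \<Longrightarrow> x \<in> fib Y (Cod C f) \<times> fib X (Cod C f) \<Longrightarrow>
      act P f (e (Cod C f) x) = e (Dom C f) (map_prod (act Y f) (act X f) x)"
  proof (rule encode_psh[of "\<lambda>c. fib Y c \<times> fib X c" "\<lambda>f. map_prod (act Y f) (act X f)"])
    show "fib Y c \<times> fib X c \<prec> (UNIV :: 'u set)" if "c \<in> Obj C" for c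
      using that by (intro small_Times gu fib_small Y X)
  qed (use Y in \<open>auto simp: act_comp intro: that\<close>)
  have d_act: "d (Dom C f) (act P f y) = map_prod (act Y f) (act X f) (d (Cod C f) y)"
    if fy: "f \<in> Arr C" "y \<in> fib P (Cod C f)" for f y
  proof -
    have m: "d (Cod C f) y \<in> fib Y (Cod C f) \<times> fib X (Cod C f)" using dF fy by simp
    have "map_prod (act Y f) (act X f) (d (Cod C f) y) \<in> fib Y (Dom C f) \<times> fib X (Dom C f)"
      using m fy Y by auto
    then show ?thesis using ac[OF fy(1) m] ed[OF _ fy(2)] de fy by simp
  qed
  define q where "q = mk_map P X (\<lambda>c y. snd (d c y))"
  define \<pi> where "\<pi> = mk_map P Y (\<lambda>c y. fst (d c y))"
  have q: "q \<in> hom (Psh C) P X"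
    unfolding q_def by (rule mk_map) (use P dF d_act in \<open>auto simp: mem_Times_iff\<close>)
  have \<pi>: "\<pi> \<in> hom (Psh C) P Y"
    unfolding \<pi>_def by (rule mk_map) (use P Y dF d_act in \<open>auto simp: mem_Times_iff\<close>)
  have qs: "q \<in> Arr (Psh C)" "Dom (Psh C) q = P" "Cod (Psh C) q = X" using q by (auto simp: hom_def)
  have "couniversal (slice (Psh C) X) (Psh C) (forget_ftor (Psh C)) Y q \<pi>"
  proof (rule couniversalI)
    fix v h assume v: "v \<in> Obj (slice (Psh C) X)" and "h \<in> hom (Psh C) (on_obj (forget_ftor (Psh C)) v) Y"
    then have h: "h \<in> hom (Psh C) (Dom (Psh C) v) Y" by simp
    note vh = slice_objD[OF v]
    define k where "k = mk_map (Dom (Psh C) v) P (\<lambda>c x. e c (ap h c x, ap v c x))"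
    have m: "(ap h c x, ap v c x) \<in> fib Y c \<times> fib X c" if "c \<in> Obj C" "x \<in> fib (Dom (Psh C) v) c" for c x
      using that h vh by simp
    have k: "k \<in> hom (Psh C) (Dom (Psh C) v) P"
      unfolding k_def
    proof (rule mk_map)
      fix f x assume f: "f \<in> Arr C" and x: "x \<in> fib (Dom (Psh C) v) (Cod C f)"
      have fh: "f \<in> hom C (Dom C f) (Cod C f)" using f by (simp add: hom_def)
      show "e (Dom C f) (ap h (Dom C f) (act (Dom (Psh C) v) f x), ap v (Dom C f) (act (Dom (Psh C) v) f x)) =
        act P f (e (Cod C f) (ap h (Cod C f) x, ap v (Cod C f) x))"
        using ac[OF f m] f x ap_nat[OF h fh x] ap_nat[OF vh(1) fh x] by simp
    qed (use vh P eF m in auto)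
    have ak: "ap k c x = e c (ap h c x, ap v c x)" if "c \<in> Obj C" "x \<in> fib (Dom (Psh C) v) c" for c x
      using that by (simp add: k_def)
    have "q \<odot>\<^bsub>Psh C\<^esub> k = v"
      by (rule psh_arr_eqI[OF psh_comp_hom[OF k q] vh(1)])
         (simp add: ap_comp[OF k] ak, use eF m de in \<open>simp add: q_def\<close>)
    moreover have "\<pi> \<odot>\<^bsub>Psh C\<^esub> k = h"
      by (rule psh_arr_eqI[OF psh_comp_hom[OF k \<pi>] h])
         (simp add: ap_comp[OF k] ak, use eF m de in \<open>simp add: \<pi>_def\<close>)
    ultimately show "\<exists>k. k \<in> hom (slice (Psh C) X) v q \<and> \<pi> \<odot>\<^bsub>Psh C\<^esub> on_arr (forget_ftor (Psh C)) k = h"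
      using v k qs by (intro exI[of _ "(v, k, q)"]) (simp add: slice_hom_iff)
  next
    fix v k k' assume v: "v \<in> Obj (slice (Psh C) X)" and k: "k \<in> hom (slice (Psh C) X) v q"
      and k': "k' \<in> hom (slice (Psh C) X) v q"
      and eq: "\<pi> \<odot>\<^bsub>Psh C\<^esub> on_arr (forget_ftor (Psh C)) k = \<pi> \<odot>\<^bsub>Psh C\<^esub> on_arr (forget_ftor (Psh C)) k'"
    define h h' where "h = on_arr (forget_ftor (Psh C)) k" and "h' = on_arr (forget_ftor (Psh C)) k'"
    have h: "k = (v, h, q)" "h \<in> hom (Psh C) (Dom (Psh C) v) P" "q \<odot>\<^bsub>Psh C\<^esub> h = v"
      using forget_slice_homD[OF k] qs by (simp_all add: h_def)
    have h': "k' = (v, h', q)" "h' \<in> hom (Psh C) (Dom (Psh C) v) P" "q \<odot>\<^bsub>Psh C\<^esub> h' = v"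
      using forget_slice_homD[OF k'] qs by (simp_all add: h'_def)
    have "h = h'"
    proof (rule psh_arr_eqI[OF h(2) h'(2)])
      fix c x assume c: "c \<in> Obj C" and x: "x \<in> fib (Dom (Psh C) v) c"
      note m = ap_in[OF h(2) c x] ap_in[OF h'(2) c x]
      have "ap (q \<odot>\<^bsub>Psh C\<^esub> h) c x = ap (q \<odot>\<^bsub>Psh C\<^esub> h') c x" using h(3) h'(3) by simp
      moreover have "ap (\<pi> \<odot>\<^bsub>Psh C\<^esub> h) c x = ap (\<pi> \<odot>\<^bsub>Psh C\<^esub> h') c x" using eq by (simp add: h_def h'_def)
      ultimately have "d c (ap h c x) = d c (ap h' c x)"
        using c x m by (simp add: ap_comp[OF h(2)] ap_comp[OF h'(2)] q_def \<pi>_def prod_eq_iff)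
      then have "e c (d c (ap h c x)) = e c (d c (ap h' c x))" by simp
      then show "ap h c x = ap h' c x" using ed[OF c] m by simp
    qed
    then show "k = k'" by (simp add: h(1) h'(1))
  qed (use qs \<pi> in auto)
  then show ?thesis by blast
qed

text \<open>The difficulty is a right adjoint of the pullback functor. Seen through the equivalence
  with presheaves on the category of elements, that functor is restriction along the projection to
  \<open>C\<close>, and there right Kan extensions are available.\<close>

lemma slice_geom_exists: "\<exists>q. slice_geom (Psh C) X q"
proof -
  let ?E = "Psh C :: (('o, 'a, 'u) psh, ('o, 'a, 'u) psh_arr) cat" and ?S = "slice (Psh C) X"
  let ?H = "fibres_ftor C X" and ?P = "Psh (elements C X) :: ((_, _, 'u) psh, _) cat"
  have fF: "is_functor ?S ?E (forget_ftor ?E)" by (rule forget_functor[OF category_Psh])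
  obtain pb where pb: "adjoint ?S ?E (forget_ftor ?E) pb"
    using right_adjoint_exists[OF fF forget_couniversal] by blast
  obtain \<eta> \<epsilon> where "adjunction ?S ?E (forget_ftor ?E) pb \<eta> \<epsilon>" using pb by (rule adjointE)
  then interpret F: adjunction ?S ?E "forget_ftor ?E" pb \<eta> \<epsilon> .
  interpret pr: site_functor U C "elements C X" "\<lparr>on_obj = snd, on_arr = (\<lambda>(a, f, b). f)\<rparr>"
    by (rule site_functor_projection)
  let ?T = "pull (elements C X) \<lparr>on_obj = snd, on_arr = (\<lambda>(a, f, b). f)\<rparr> :: (('o, 'a, 'u) psh, _, _, _) ftor"
  have pbo: "on_obj pb Y \<in> Obj ?S" if "Y \<in> Obj ?E" for Y using that by (rule F.R.F_obj)
  have \<epsilon>h: "\<epsilon> Y \<in> hom ?E (Dom ?E (on_obj pb Y)) Y" if "Y \<in> Obj ?E" for Y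
    using F.counit_hom[OF that] by simp
  \<comment> \<open>\<open>pb\<close> is known only by its universal property, so its fibres are
    computed by testing against representables: \<open>ex\<close> and \<open>un\<close> say that
    they are those of the product.\<close>
  have ex: "\<exists>p \<in> fib (Dom ?E (on_obj pb Y)) c. ap (on_obj pb Y) c p = x \<and> ap (\<epsilon> Y) c p = y"
    if Y: "Y \<in> Obj ?E" and c: "c \<in> Obj C" and y: "y \<in> fib Y c" and x: "x \<in> fib X c" for Y c x y
  proof -
    obtain R i where R: "represents R c i" by (rule representable_exists[OF c])
    obtain s where s: "s \<in> hom ?E R Y" "ap s c i = y" by (rule yoneda_exists[OF R Y y])
    obtain t where t: "t \<in> hom ?E R X" "ap t c i = x" by (rule yoneda_exists[OF R X x])
    have to: "t \<in> Obj ?S" and td: "Dom ?E t = R" using t(1) by (auto simp: hom_def)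
    obtain k where k: "k \<in> hom ?S t (on_obj pb Y)" "\<epsilon> Y \<odot>\<^bsub>?E\<^esub> on_arr (forget_ftor ?E) k = s"
      using couniversalD(5)[OF F.couniversal[OF Y] to, of s] s td by auto
    define h where "h = on_arr (forget_ftor ?E) k"
    have h: "h \<in> hom ?E R (Dom ?E (on_obj pb Y))" "on_obj pb Y \<odot>\<^bsub>?E\<^esub> h = t" "\<epsilon> Y \<odot>\<^bsub>?E\<^esub> h = s"
      using forget_slice_homD[OF k(1)] k(2) td by (simp_all add: h_def)
    have i: "i \<in> fib R c" by (rule representsD(3)[OF R])
    have "ap (on_obj pb Y) c (ap h c i) = x" using ap_comp[OF h(1) c i, of "on_obj pb Y"] h(2) t(2) by simp
    moreover have "ap (\<epsilon> Y) c (ap h c i) = y" using ap_comp[OF h(1) c i, of "\<epsilon> Y"] h(3) s(2) by simp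
    ultimately show ?thesis using ap_in[OF h(1) c i] by blast
  qed
  have un: "p = p'" if Y: "Y \<in> Obj ?E" and c: "c \<in> Obj C"
    and p: "p \<in> fib (Dom ?E (on_obj pb Y)) c" "p' \<in> fib (Dom ?E (on_obj pb Y)) c"
    and eq: "ap (on_obj pb Y) c p = ap (on_obj pb Y) c p'" "ap (\<epsilon> Y) c p = ap (\<epsilon> Y) c p'" for Y c p p'
  proof -
    obtain R i where R: "represents R c i" by (rule representable_exists[OF c])
    note q = slice_objD[OF pbo[OF Y]]
    have i: "i \<in> fib R c" by (rule representsD(3)[OF R])
    obtain s where s: "s \<in> hom ?E R (Dom ?E (on_obj pb Y))" "ap s c i = p" by (rule yoneda_exists[OF R q(2) p(1)])
    obtain t where t: "t \<in> hom ?E R (Dom ?E (on_obj pb Y))" "ap t c i = p'" by (rule yoneda_exists[OF R q(2) p(2)])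
    define x where "x = on_obj pb Y \<odot>\<^bsub>?E\<^esub> s"
    have xt: "x = on_obj pb Y \<odot>\<^bsub>?E\<^esub> t"
      unfolding x_def
      by (rule yoneda_eq[OF R psh_comp_hom[OF s(1) q(1)] psh_comp_hom[OF t(1) q(1)]])
         (use s t c i eq in \<open>simp add: ap_comp[OF s(1)] ap_comp[OF t(1)]\<close>)
    have "\<epsilon> Y \<odot>\<^bsub>?E\<^esub> s = \<epsilon> Y \<odot>\<^bsub>?E\<^esub> t"
      by (rule yoneda_eq[OF R psh_comp_hom[OF s(1) \<epsilon>h[OF Y]] psh_comp_hom[OF t(1) \<epsilon>h[OF Y]]])
         (use s t c i eq in \<open>simp add: ap_comp[OF s(1)] ap_comp[OF t(1)]\<close>)
    moreover have xh: "x \<in> hom ?E R X" unfolding x_def by (rule psh_comp_hom[OF s(1) q(1)])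
    have "(x, s, on_obj pb Y) \<in> hom ?S x (on_obj pb Y)" "(x, t, on_obj pb Y) \<in> hom ?S x (on_obj pb Y)"
      unfolding slice_hom_iff using xh s(1) t(1) q(1) xt by (auto simp: x_def[symmetric]) (auto simp: hom_def)
    ultimately have "(x, s, on_obj pb Y) = (x, t, on_obj pb Y)"
      by (intro couniversal_eq[OF F.couniversal[OF Y] F.L.ftr_axioms, of _ x]) auto
    then show ?thesis using s t by simp
  qed
  \<comment> \<open>On the fibre over \<open>x\<close> only the component in \<open>Y\<close> is
    left, so by \<open>ex\<close> and \<open>un\<close> the projection \<open>\<epsilon> Y\<close>
    is bijective there.\<close>
  define \<theta> where "\<theta> = (\<lambda>Y. El.mk_map (fibres_psh C X (on_obj pb Y)) (on_obj ?T Y) (\<lambda>(x, c). ap (\<epsilon> Y) c))"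
  have \<theta>: "\<theta> Y \<in> hom ?P (fibres_psh C X (on_obj pb Y)) (on_obj ?T Y)" if Y: "Y \<in> Obj ?E" for Y
    unfolding \<theta>_def
  proof (rule El.mk_map)
    fix b y assume "b \<in> Obj (elements C X)" "y \<in> fib (fibres_psh C X (on_obj pb Y)) b"
    then show "(case b of (x, c) \<Rightarrow> ap (\<epsilon> Y) c) y \<in> fib (on_obj ?T Y) b"
      using ap_in[OF \<epsilon>h[OF Y]] by (cases b) auto
  next
    fix g y assume g: "g \<in> Arr (elements C X)" and y: "y \<in> fib (fibres_psh C X (on_obj pb Y)) (Cod (elements C X) g)"
    from g obtain x c f z b where g': "g = ((x, c), f, (z, b))" "c \<in> Obj C" "x \<in> fib X c" "b \<in> Obj C"
      "z \<in> fib X b" "f \<in> hom C c b" "act X f z = x" by (rule elements_ArrE)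
    have y': "y \<in> fib (Dom ?E (on_obj pb Y)) b" "ap (on_obj pb Y) b y = z" using y g' by auto
    have "act (fibres_psh C X (on_obj pb Y)) g y = act (Dom ?E (on_obj pb Y)) f y"
      using y' g g'(1) by (simp only: fibres_act)
    moreover have "act (on_obj ?T Y) g = act Y f" using g by (simp add: g'(1))
    ultimately show "(case Dom (elements C X) g of (x, c) \<Rightarrow> ap (\<epsilon> Y) c) (act (fibres_psh C X (on_obj pb Y)) g y) =
      act (on_obj ?T Y) g ((case Cod (elements C X) g of (x, c) \<Rightarrow> ap (\<epsilon> Y) c) y)"
      using ap_nat[OF \<epsilon>h[OF Y] g'(6) y'(1)] by (simp add: g'(1))
  qed (use Y pbo in \<open>simp_all del: slice_simps\<close>)
  have ap\<theta>: "ap (\<theta> Y) (x, c) y = ap (\<epsilon> Y) c y"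
    if "(x, c) \<in> Obj (elements C X)" "y \<in> fib (fibres_psh C X (on_obj pb Y)) (x, c)" for Y x c y
    using that by (simp add: \<theta>_def del: fibres_simps)
  have iso: "iso_arr ?P (\<theta> Y)" if Y: "Y \<in> Obj ?E" for Y
  proof (rule El.psh_isoI[OF \<theta>[OF Y]])
    fix b assume b: "b \<in> Obj (elements C X)"
    obtain x c where [simp]: "b = (x, c)" by (cases b) auto
    have c: "c \<in> Obj C" "x \<in> fib X c" using b by auto
    show "bij_betw (ap (\<theta> Y) b) (fib (fibres_psh C X (on_obj pb Y)) b) (fib (on_obj ?T Y) b)"
    proof (rule bij_betwI')
      fix p p' assume p: "p \<in> fib (fibres_psh C X (on_obj pb Y)) b" "p' \<in> fib (fibres_psh C X (on_obj pb Y)) b"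
      then show "(ap (\<theta> Y) b p = ap (\<theta> Y) b p') = (p = p')"
        using b c un[OF Y c(1), of p p'] ap\<theta>[of x c] by auto
    next
      fix p assume "p \<in> fib (fibres_psh C X (on_obj pb Y)) b"
      then show "ap (\<theta> Y) b p \<in> fib (on_obj ?T Y) b" by (rule El.ap_in[OF \<theta>[OF Y] b])
    next
      fix y assume "y \<in> fib (on_obj ?T Y) b"
      then have y: "y \<in> fib Y c" using b by simp
      obtain p where "p \<in> fib (Dom ?E (on_obj pb Y)) c" "ap (on_obj pb Y) c p = x" "ap (\<epsilon> Y) c p = y"
        using ex[OF Y c(1) y c(2)] by blast
      then show "\<exists>p\<in>fib (fibres_psh C X (on_obj pb Y)) b. y = ap (\<theta> Y) b p"
        using c b ap\<theta>[of x c p] by (intro bexI[of _ p]) auto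
    qed
  qed
  have nat: "nat_trans ?E ?P (?H \<circ>\<^sub>F pb) ?T \<theta>"
    unfolding nat_trans_def
  proof (intro conjI ballI)
    show "is_functor ?E ?P (?H \<circ>\<^sub>F pb)" by (rule functor_comp[OF F.R.func fibres_functor])
    show "is_functor ?E ?P ?T" by (rule pr.pull_functor)
    show "\<theta> Y \<in> hom ?P (on_obj (?H \<circ>\<^sub>F pb) Y) (on_obj ?T Y)" if "Y \<in> Obj ?E" for Y
      using \<theta>[OF that] by simp
    fix f assume f: "f \<in> Arr ?E"
    define Y Y' where "Y = Dom ?E f" and "Y' = Cod ?E f"
    have fh: "f \<in> hom ?E Y Y'" using f by (simp add: hom_def Y_def Y'_def)
    note O = psh_arrD(1,2)[OF fh]
    have pf: "on_arr pb f \<in> hom ?S (on_obj pb Y) (on_obj pb Y')" by (rule F.R.F_hom[OF fh])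
    define h where "h = on_arr (forget_ftor ?E) (on_arr pb f)"
    have h: "on_arr pb f = (on_obj pb Y, h, on_obj pb Y')" "h \<in> hom ?E (Dom ?E (on_obj pb Y)) (Dom ?E (on_obj pb Y'))"
      using forget_slice_homD[OF pf] by (simp_all add: h_def)
    have pf': "(on_obj pb Y, h, on_obj pb Y') \<in> hom ?S (on_obj pb Y) (on_obj pb Y')" using pf by (simp only: h)
    have \<epsilon>n: "\<epsilon> Y' \<odot>\<^bsub>?E\<^esub> h = f \<odot>\<^bsub>?E\<^esub> \<epsilon> Y"
      using F.counit_nat[OF f] by (simp add: h_def Y_def Y'_def)
    have Hf: "on_arr ?H (on_arr pb f) \<in> hom ?P (fibres_psh C X (on_obj pb Y)) (fibres_psh C X (on_obj pb Y'))"
      unfolding h(1) by (rule fibres_hom(2)[OF pf'])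
    have "\<theta> Y' \<odot>\<^bsub>?P\<^esub> on_arr ?H (on_arr pb f) = on_arr ?T f \<odot>\<^bsub>?P\<^esub> \<theta> Y"
    proof (rule El.psh_arr_eqI[OF El.psh_comp_hom[OF Hf \<theta>[OF O(2)]] El.psh_comp_hom[OF \<theta>[OF O(1)] pr.pull_hom[OF fh]]])
      fix b p assume b: "b \<in> Obj (elements C X)" and p: "p \<in> fib (fibres_psh C X (on_obj pb Y)) b"
      obtain x c where bb [simp]: "b = (x, c)" by (cases b) auto
      have c: "c \<in> Obj C" "x \<in> fib X c" using b by auto
      have p': "p \<in> fib (Dom ?E (on_obj pb Y)) c" "ap (on_obj pb Y) c p = x" using p c by auto
      have hp: "ap (on_arr ?H (on_arr pb f)) (x, c) p = ap h c p"
        unfolding h(1) by (rule ap_fibres[OF pf' c(1) p' c(2)])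
      have "ap h c p \<in> fib (fibres_psh C X (on_obj pb Y')) (x, c)"
        using El.ap_in[OF Hf b p] hp by simp
      then have "ap (\<theta> Y' \<odot>\<^bsub>?P\<^esub> on_arr ?H (on_arr pb f)) b p = ap (\<epsilon> Y') c (ap h c p)"
        using El.ap_comp[OF Hf b p, of "\<theta> Y'"] hp ap\<theta>[of x c "ap h c p" Y'] b by simp
      also have "\<dots> = ap f c (ap (\<epsilon> Y) c p)"
        using ap_comp[OF h(2) c(1) p'(1), of "\<epsilon> Y'"] ap_comp[OF \<epsilon>h[OF O(1)] c(1) p'(1), of f] \<epsilon>n by simp
      also have "\<dots> = ap (on_arr ?T f \<odot>\<^bsub>?P\<^esub> \<theta> Y) b p"
        using El.ap_comp[OF \<theta>[OF O(1)] b p, of "on_arr ?T f"] ap\<theta>[of x c p Y] b p by simp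
      finally show "ap (\<theta> Y' \<odot>\<^bsub>?P\<^esub> on_arr ?H (on_arr pb f)) b p = ap (on_arr ?T f \<odot>\<^bsub>?P\<^esub> \<theta> Y) b p" .
    qed
    then show "\<theta> (Cod ?E f) \<odot>\<^bsub>?P\<^esub> on_arr (?H \<circ>\<^sub>F pb) f = on_arr ?T f \<odot>\<^bsub>?P\<^esub> \<theta> (Dom ?E f)"
      by (simp add: Y_def Y'_def)
  qed
  have "\<exists>r e. couniversal ?E ?S pb v r e" if v: "v \<in> Obj ?S" for v
  proof -
    have "on_obj ?H v \<in> Obj ?P" using v by (simp del: slice_simps)
    then obtain r e where "couniversal ?E ?P ?T (on_obj ?H v) r e" by (rule pr.pull_couniversal)
    then show ?thesis
      using couniversal_via_full_faithful[OF F.R.func pr.pull_functor fibres_full_faithful nat iso v] by blast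
  qed
  then obtain R where "adjoint ?E ?S pb R" using right_adjoint_exists[OF F.R.func] by blast
  then show ?thesis using slice_geomI[OF category_Psh X pb] by blast
qed

end

section \<open>Etendues of presheaves\<close>

lemma category_Sets: "category (Sets :: ('u set, 'u set \<times> ('u \<Rightarrow> 'u) \<times> 'u set) cat)"
proof
  fix f :: "'u set \<times> ('u \<Rightarrow> 'u) \<times> 'u set" assume f: "f \<in> Arr Sets"
  then show "Dom Sets f \<in> Obj Sets" "Cod Sets f \<in> Obj Sets"
    by (cases f, simp add: Sets_def)+
next
  fix a :: "'u set" assume "a \<in> Obj Sets"
  then show "Idn Sets a \<in> hom Sets a a" by (simp add: Sets_def hom_def)
next
  fix f g h :: "'u set \<times> ('u \<Rightarrow> 'u) \<times> 'u set" and a b c d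
  assume f: "f \<in> hom Sets a b" and g: "g \<in> hom Sets b c"
  obtain f' where f': "f = (a, f', b)" "f' \<in> a \<rightarrow>\<^sub>E b" "a \<in> Obj Sets" "b \<in> Obj Sets"
    using f by (cases f) (simp add: hom_def Sets_def)
  obtain g' where g': "g = (b, g', c)" "g' \<in> b \<rightarrow>\<^sub>E c" "c \<in> Obj Sets"
    using g by (cases g) (simp add: hom_def Sets_def)
  have "compose a g' f' \<in> a \<rightarrow>\<^sub>E c"
    by (rule PiE_I) (use f' g' in \<open>auto simp: compose_def\<close>)
  then show "g \<odot>\<^bsub>Sets\<^esub> f \<in> hom Sets a c" using f' g' by (simp add: hom_def Sets_def)
  assume h: "h \<in> hom Sets c d"
  obtain h' where h': "h = (c, h', d)" "h' \<in> c \<rightarrow>\<^sub>E d"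
    using h by (cases h) (simp add: hom_def Sets_def)
  have "compose a h' (compose a g' f') = compose a (compose b h' g') f'"
    using f' by (auto simp: compose_def fun_eq_iff)
  then show "h \<odot>\<^bsub>Sets\<^esub> (g \<odot>\<^bsub>Sets\<^esub> f) = h \<odot>\<^bsub>Sets\<^esub> g \<odot>\<^bsub>Sets\<^esub> f"
    unfolding f'(1) g'(1) h'(1) by (simp add: Sets_def)
next
  fix f :: "'u set \<times> ('u \<Rightarrow> 'u) \<times> 'u set" and a b assume f: "f \<in> hom Sets a b"
  obtain f' where f': "f = (a, f', b)" "f' \<in> a \<rightarrow>\<^sub>E b"
    using f by (cases f) (simp add: hom_def Sets_def)
  have "compose a (\<lambda>x\<in>b. x) f' = f'"
    by (rule PiE_ext[of _ a "\<lambda>_. b"]) (use f' in \<open>auto simp: compose_def\<close>)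
  moreover have "compose a f' (\<lambda>x\<in>a. x) = f'"
    by (rule PiE_ext[of _ a "\<lambda>_. b"]) (use f' in \<open>auto simp: compose_def\<close>)
  ultimately show "Idn Sets b \<odot>\<^bsub>Sets\<^esub> f = f" "f \<odot>\<^bsub>Sets\<^esub> Idn Sets a = f"
    unfolding f'(1) by (simp_all add: Sets_def)
qed

text \<open>The set \<open>{undefined}\<close> plays the one-point set, \<open>undefined\<close>
  being an element of \<open>'u\<close> that can be named without further data.\<close>

definition point :: "'u set \<Rightarrow> 'u \<Rightarrow> 'u set \<times> ('u \<Rightarrow> 'u) \<times> 'u set" where
  "point A a = ({undefined}, \<lambda>x\<in>{undefined}. a, A)"

lemma small_point:
  assumes "grothendieck_universe TYPE('u)"
  shows "{undefined} \<in> Obj (Sets :: ('u set, _) cat)"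
  using small_finite[OF assms, of "{undefined :: 'u}"] by (simp add: Sets_def)

lemma point_hom:
  fixes A :: "'u set"
  assumes "grothendieck_universe TYPE('u)" "A \<in> Obj Sets" "a \<in> A"
  shows "point A a \<in> hom Sets {undefined} A"
  using small_point[OF assms(1)] assms(2,3) by (simp add: hom_def Sets_def point_def)

lemma terminal_point:
  assumes gu: "grothendieck_universe TYPE('u)"
  shows "terminal_obj (Sets :: ('u set, _) cat) {undefined}"
  unfolding terminal_obj_def
proof (intro conjI ballI)
  show p: "{undefined} \<in> Obj (Sets :: ('u set, _) cat)" by (rule small_point[OF gu])
  fix A :: "'u set" assume A: "A \<in> Obj Sets"
  show "\<exists>!f. f \<in> hom Sets A {undefined :: 'u}"
  proof (rule ex1I[of _ "(A, \<lambda>x\<in>A. undefined, {undefined})"])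
    show "(A, \<lambda>x\<in>A. undefined, {undefined}) \<in> hom Sets A {undefined :: 'u}"
      using A p by (simp add: hom_def Sets_def)
    fix f assume f: "f \<in> hom Sets A {undefined :: 'u}"
    obtain f' where f': "f = (A, f', {undefined})" "f' \<in> A \<rightarrow>\<^sub>E {undefined}"
      using f by (cases f) (simp add: hom_def Sets_def)
    then show "f = (A, \<lambda>x\<in>A. undefined, {undefined})"
      using PiE_arb[OF f'(2)] PiE_mem[OF f'(2)] by (auto simp: fun_eq_iff restrict_def)
  qed
qed

lemma point_separates:
  fixes A B :: "'u set"
  assumes "u \<in> hom Sets A B" "v \<in> hom Sets A B"
    and eq: "\<And>a. a \<in> A \<Longrightarrow> u \<odot>\<^bsub>Sets\<^esub> point A a = v \<odot>\<^bsub>Sets\<^esub> point A a"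
  shows "u = v"
proof -
  obtain u' where u: "u = (A, u', B)" "u' \<in> A \<rightarrow>\<^sub>E B"
    using assms(1) by (cases u) (simp add: hom_def Sets_def)
  obtain v' where v: "v = (A, v', B)" "v' \<in> A \<rightarrow>\<^sub>E B"
    using assms(2) by (cases v) (simp add: hom_def Sets_def)
  have "u' = v'"
  proof (rule PiE_ext[OF u(2) v(2)])
    fix a assume "a \<in> A"
    from eq[OF this] have "compose {undefined :: 'u} u' (\<lambda>x\<in>{undefined}. a) = compose {undefined} v' (\<lambda>x\<in>{undefined}. a)"
      by (simp add: u v point_def Sets_def)
    from fun_cong[OF this, of undefined] show "u' a = v' a" by (simp add: compose_def)
  qed
  then show ?thesis by (simp add: u v)
qed

section \<open>Constant presheaves and products, computed pointwise\<close>

context site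
begin

text \<open>Elements at \<open>c\<close> are the maps from the representable at
  \<open>c\<close>.\<close>

lemma terminal_psh_singleton:
  fixes T :: "('o, 'a, 'u) psh"
  assumes T: "terminal_obj (Psh C) T" and c: "c \<in> Obj C"
  shows "\<exists>!s. s \<in> fib T c"
proof -
  obtain R :: "('o, 'a, 'u) psh" and i where R: "represents R c i" by (rule representable_exists[OF c])
  have TO: "T \<in> Obj (Psh C)" using T by (simp add: terminal_obj_def)
  have e1: "\<exists>!t. t \<in> hom (Psh C) R T"
    using T representsD(1)[OF R] unfolding terminal_obj_def by blast
  then obtain t where t: "t \<in> hom (Psh C) R T" by blast
  show ?thesis
  proof (rule ex1I[of _ "ap t c i"])
    show "ap t c i \<in> fib T c" by (rule ap_in[OF t c representsD(3)[OF R]])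
    fix s assume "s \<in> fib T c"
    then obtain t' where t': "t' \<in> hom (Psh C) R T" "ap t' c i = s" by (rule yoneda_exists[OF R TO])
    have "t' = t" using t t'(1) e1 by blast
    then show "s = ap t c i" using t'(2) by simp
  qed
qed

text \<open>The points of a set are jointly epimorphic, and a left adjoint to presheaves turns them
  into a jointly surjective family.\<close>

lemma constant_psh_surj:
  fixes L :: "('u set, _, ('o, 'a, 'u) psh, ('o, 'a, 'u) psh_arr) ftor"
  assumes adj: "adjoint Sets (Psh C) L R" and A: "A \<in> Obj Sets"
    and c: "c \<in> Obj C" and w: "w \<in> fib (on_obj L A) c"
  shows "\<exists>a \<in> A. \<exists>s \<in> fib (on_obj L {undefined}) c. ap (on_arr L (point A a)) c s = w"
proof -
  have p: "point A a \<in> Arr Sets" "Dom Sets (point A a) = {undefined}" "Cod Sets (point A a) = A"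
    if "a \<in> A" for a
    using point_hom[OF gu A that] by (auto simp: hom_def)
  obtain g w' where "g \<in> point A ` A" "w' \<in> fib (on_obj L (Dom Sets g)) c" "ap (on_arr L g) c w' = w"
  proof (rule left_adjoint_jointly_surj[OF adj A _ _ c w, of "point A ` A"])
    show "g \<in> Arr Sets \<and> Cod Sets g = A" if "g \<in> point A ` A" for g using p that by auto
    show "u = v" if "u \<in> hom Sets A x" "v \<in> hom Sets A x"
      "\<And>g. g \<in> point A ` A \<Longrightarrow> u \<odot>\<^bsub>Sets\<^esub> g = v \<odot>\<^bsub>Sets\<^esub> g" for x u v
      using that by (intro point_separates[of u A x v]) auto
  qed
  then obtain a where "a \<in> A" "w' \<in> fib (on_obj L {undefined}) c" "ap (on_arr L (point A a)) c w' = w"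
    using p(2) by auto
  then show ?thesis by blast
qed

text \<open>\<open>L\<close> is given only as a left adjoint that sends the point to a terminal
  object, so its values are found by comparison with the literal constant presheaf \<open>Q\<close>.
  The comparison \<open>m\<close> sends everything on the image of the point \<open>a\<close> to
  \<open>a\<close>, and \<open>constant_psh_surj\<close> says that nothing else exists.\<close>

lemma constant_psh:
  fixes L :: "('u set, _, ('o, 'a, 'u) psh, ('o, 'a, 'u) psh_arr) ftor"
  assumes adj: "adjoint Sets (Psh C) L R" and T: "terminal_obj (Psh C) (on_obj L {undefined})"
    and A: "A \<in> Obj Sets"
  obtains v where "\<And>c. c \<in> Obj C \<Longrightarrow> bij_betw (v c) (fib (on_obj L A) c) A"
    "\<And>f w. f \<in> Arr C \<Longrightarrow> w \<in> fib (on_obj L A) (Cod C f) \<Longrightarrow>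
      v (Dom C f) (act (on_obj L A) f w) = v (Cod C f) w"
proof -
  obtain \<eta> \<epsilon> where "adjunction Sets (Psh C) L R \<eta> \<epsilon>" using adj by (rule adjointE)
  then interpret P: adjunction Sets "Psh C" L R \<eta> \<epsilon> .
  let ?I = "{undefined :: 'u}"
  have I [simp]: "?I \<in> Obj Sets" by (rule small_point[OF gu])
  note [simp] = A
  define Q :: "('o, 'a, 'u) psh" where "Q = mk_psh (\<lambda>_. A) (\<lambda>_ x. x)"
  have Q [simp]: "Q \<in> Obj (Psh C)"
    unfolding Q_def by (rule mk_psh_obj) (use A in \<open>auto simp: Sets_def\<close>)
  define \<kappa> where "\<kappa> = (\<lambda>a. mk_map (on_obj L ?I) Q (\<lambda>_ _. a))"
  have \<kappa>: "\<kappa> a \<in> hom (Psh C) (on_obj L ?I) Q" if "a \<in> A" for a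
    unfolding \<kappa>_def by (rule mk_map) (use that in \<open>auto simp: Q_def[symmetric]\<close>, auto simp: Q_def that)
  define h where "h = (\<lambda>a. on_arr R (\<kappa> a) \<odot>\<^bsub>Sets\<^esub> \<eta> ?I)"
  have h: "h a \<in> hom Sets ?I (on_obj R Q)" if "a \<in> A" for a
    using \<kappa>[OF that] by (simp add: h_def hom_def)
  \<comment> \<open>The transposes \<open>h a\<close> of the constant maps \<kappa> are points of
    \<open>on_obj R Q\<close>; collected over all \<open>a\<close> they form one function on
    \<open>A\<close>.\<close>
  define g where "g = (A, \<lambda>a\<in>A. fst (snd (h a)) undefined, on_obj R Q)"
  have RQ: "on_obj R Q \<in> Obj Sets" by simp
  have g: "g \<in> hom Sets A (on_obj R Q)"
  proof -
    have "fst (snd (h a)) undefined \<in> on_obj R Q" if a: "a \<in> A" for a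
    proof -
      obtain k where k: "h a = (?I, k, on_obj R Q)" "k \<in> ?I \<rightarrow>\<^sub>E on_obj R Q"
        using h[OF a] by (cases "h a") (simp add: hom_def Sets_def)
      then show ?thesis by (auto intro: PiE_mem)
    qed
    then show ?thesis using A RQ by (simp add: g_def hom_def Sets_def)
  qed
  have gp: "g \<odot>\<^bsub>Sets\<^esub> point A a = h a" if a: "a \<in> A" for a
  proof -
    obtain k where k: "h a = (?I, k, on_obj R Q)" "k \<in> ?I \<rightarrow>\<^sub>E on_obj R Q"
      using h[OF a] by (cases "h a") (simp add: hom_def Sets_def)
    have "compose ?I (\<lambda>a\<in>A. fst (snd (h a)) undefined) (\<lambda>x\<in>?I. a) = k"
      by (rule PiE_ext[of _ ?I "\<lambda>_. on_obj R Q"]) (use a k PiE_mem[OF k(2)] in \<open>auto simp: compose_def\<close>)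
    then show ?thesis by (simp add: g_def point_def Sets_def k(1))
  qed
  obtain m where m: "m \<in> hom (Psh C) (on_obj L A) Q" "on_arr R m \<odot>\<^bsub>Sets\<^esub> \<eta> A = g"
    using universalD(5)[OF P.universal[OF A] Q g] by blast
  have p: "point A a \<in> Arr Sets" "Dom Sets (point A a) = ?I" "Cod Sets (point A a) = A"
    if "a \<in> A" for a
    using point_hom[OF gu A that] by (auto simp: hom_def)
  have ms: "m \<in> Arr (Psh C)" "Dom (Psh C) m = on_obj L A" "Cod (Psh C) m = Q" using m by (auto simp: hom_def)
  have Lp: "on_arr L (point A a) \<in> hom (Psh C) (on_obj L ?I) (on_obj L A)" if "a \<in> A" for a
    using p[OF that] by (simp add: hom_def)
  \<comment> \<open>Both sides are compared through their transposes, where naturality of the unit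
    reduces the claim to the equation \<open>gp\<close> between functions.\<close>
  have mp: "m \<odot>\<^bsub>Psh C\<^esub> on_arr L (point A a) = \<kappa> a" if a: "a \<in> A" for a
  proof (rule universal_eq[OF P.universal[OF I] P.R.ftr_axioms psh_comp_hom[OF Lp[OF a] m(1)] \<kappa>[OF a]])
    have "on_arr R (m \<odot>\<^bsub>Psh C\<^esub> on_arr L (point A a)) \<odot>\<^bsub>Sets\<^esub> \<eta> ?I
      = on_arr R m \<odot>\<^bsub>Sets\<^esub> (\<eta> A \<odot>\<^bsub>Sets\<^esub> point A a)"
      using P.unit_nat[OF p(1)[OF a]] p[OF a] ms by simp
    also have "\<dots> = (on_arr R m \<odot>\<^bsub>Sets\<^esub> \<eta> A) \<odot>\<^bsub>Sets\<^esub> point A a"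
      using p[OF a] ms by simp
    also have "\<dots> = h a" unfolding m(2) by (rule gp[OF a])
    finally show "on_arr R (m \<odot>\<^bsub>Psh C\<^esub> on_arr L (point A a)) \<odot>\<^bsub>Sets\<^esub> \<eta> ?I = on_arr R (\<kappa> a) \<odot>\<^bsub>Sets\<^esub> \<eta> ?I"
      by (simp add: h_def)
  qed
  have mw: "ap m c (ap (on_arr L (point A a)) c s) = a"
    if "a \<in> A" "c \<in> Obj C" "s \<in> fib (on_obj L ?I) c" for a c s
    using ap_comp[OF Lp[OF that(1)] that(2,3), of m] mp[OF that(1)] that by (simp add: \<kappa>_def)
  show ?thesis
  proof (rule that[of "ap m"])
    fix c assume c: "c \<in> Obj C"
    obtain s where s: "s \<in> fib (on_obj L ?I) c" and s1: "\<And>s'. s' \<in> fib (on_obj L ?I) c \<Longrightarrow> s' = s"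
      using terminal_psh_singleton[OF T c] by blast
    show "bij_betw (ap m c) (fib (on_obj L A) c) A"
    proof (rule bij_betw_byWitness[of _ "\<lambda>a. ap (on_arr L (point A a)) c s"])
      show "\<forall>w\<in>fib (on_obj L A) c. ap (on_arr L (point A (ap m c w))) c s = w"
      proof
        fix w assume "w \<in> fib (on_obj L A) c"
        then obtain a s' where "a \<in> A" "s' \<in> fib (on_obj L ?I) c" "ap (on_arr L (point A a)) c s' = w"
          using constant_psh_surj[OF adj A c] by blast
        then show "ap (on_arr L (point A (ap m c w))) c s = w"
          using mw[of a c s'] s1[of s'] c by auto
      qed
      show "\<forall>a\<in>A. ap m c (ap (on_arr L (point A a)) c s) = a" using mw c s by blast
      show "ap m c ` fib (on_obj L A) c \<subseteq> A" using ap_in[OF m(1) c] c by (auto simp: Q_def)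
      show "(\<lambda>a. ap (on_arr L (point A a)) c s) ` A \<subseteq> fib (on_obj L A) c"
        using ap_in[OF Lp c s] by blast
    qed
  next
    fix f w assume f: "f \<in> Arr C" and w: "w \<in> fib (on_obj L A) (Cod C f)"
    have fh: "f \<in> hom C (Dom C f) (Cod C f)" using f by (simp add: hom_def)
    have "ap m (Cod C f) w \<in> A" using ap_in[OF m(1) _ w] f by (simp add: Q_def)
    then show "ap m (Dom C f) (act (on_obj L A) f w) = ap m (Cod C f) w"
      using ap_nat[OF m(1) fh w] f by (simp add: Q_def)
  qed
qed

text \<open>Both elements correspond to maps from the representable at \<open>c\<close>, and the
  universal property pairs these maps.\<close>

lemma product_pointwise:
  fixes P :: "('o, 'a, 'u) psh"
  assumes prod: "is_product (Psh C) Y Z P p q" and c: "c \<in> Obj C"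
    and y: "y \<in> fib Y c" and z: "z \<in> fib Z c"
  shows "\<exists>w \<in> fib P c. ap p c w = y \<and> ap q c w = z"
proof -
  obtain R :: "('o, 'a, 'u) psh" and i where R: "represents R c i" by (rule representable_exists[OF c])
  have p: "p \<in> hom (Psh C) P Y" and q: "q \<in> hom (Psh C) P Z" using prod by (auto simp: is_product_def)
  obtain s where s: "s \<in> hom (Psh C) R Y" "ap s c i = y" by (rule yoneda_exists[OF R psh_arrD(2)[OF p] y])
  obtain t where t: "t \<in> hom (Psh C) R Z" "ap t c i = z" by (rule yoneda_exists[OF R psh_arrD(2)[OF q] z])
  obtain h where h: "h \<in> hom (Psh C) R P" "p \<odot>\<^bsub>Psh C\<^esub> h = s" "q \<odot>\<^bsub>Psh C\<^esub> h = t"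
    using prod s(1) t(1) representsD(1)[OF R] unfolding is_product_def by blast
  have i: "i \<in> fib R c" by (rule representsD(3)[OF R])
  show ?thesis
    using ap_comp[OF h(1) c i, of p] ap_comp[OF h(1) c i, of q] h s t ap_in[OF h(1) c i]
    by (intro bexI[of _ "ap h c i"]) auto
qed

lemma epi_sliceI:
  fixes h :: "('o, 'a, 'u) psh_arr"
  assumes f: "(u, h, v) \<in> hom (slice (Psh C) G) u v"
    and surj: "\<And>c y. c \<in> Obj C \<Longrightarrow> y \<in> fib (Dom (Psh C) v) c \<Longrightarrow> \<exists>x \<in> fib (Dom (Psh C) u) c. ap h c x = y"
  shows "epi_arr (slice (Psh C) G) (u, h, v)"
  unfolding epi_arr_def
proof (intro conjI allI ballI impI)
  show "(u, h, v) \<in> Arr (slice (Psh C) G)" using f unfolding hom_def by blast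
  have h: "h \<in> hom (Psh C) (Dom (Psh C) u) (Dom (Psh C) v)" using f by (simp add: slice_hom_iff)
  fix x s t assume "s \<in> hom (slice (Psh C) G) (Cod (slice (Psh C) G) (u, h, v)) x"
    and "t \<in> hom (slice (Psh C) G) (Cod (slice (Psh C) G) (u, h, v)) x"
    and eq: "s \<odot>\<^bsub>slice (Psh C) G\<^esub> (u, h, v) = t \<odot>\<^bsub>slice (Psh C) G\<^esub> (u, h, v)"
  then obtain s' t' where s: "s = (v, s', x)" "s' \<in> hom (Psh C) (Dom (Psh C) v) (Dom (Psh C) x)"
    and t: "t = (v, t', x)" "t' \<in> hom (Psh C) (Dom (Psh C) v) (Dom (Psh C) x)"
    by (auto simp: slice_hom_iff)
  have eq': "s' \<odot>\<^bsub>Psh C\<^esub> h = t' \<odot>\<^bsub>Psh C\<^esub> h" using eq by (simp add: s t)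
  have "s' = t'"
  proof (rule psh_arr_eqI[OF s(2) t(2)])
    fix c y assume c: "c \<in> Obj C" and "y \<in> fib (Dom (Psh C) v) c"
    then obtain x where x: "x \<in> fib (Dom (Psh C) u) c" "ap h c x = y" using surj by blast
    show "ap s' c y = ap t' c y"
      using ap_comp[OF h c x(1), of s'] ap_comp[OF h c x(1), of t'] eq' x(2) by simp
  qed
  then show "s = t" by (simp add: s t)
qed

lemma mono_sliceI:
  fixes h :: "('o, 'a, 'u) psh_arr"
  assumes f: "(u, h, v) \<in> hom (slice (Psh C) G) u v"
    and inj: "\<And>c. c \<in> Obj C \<Longrightarrow> inj_on (ap h c) (fib (Dom (Psh C) u) c)"
  shows "mono_arr (slice (Psh C) G) (u, h, v)"
  unfolding mono_arr_def
proof (intro conjI allI ballI impI)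
  show "(u, h, v) \<in> Arr (slice (Psh C) G)" using f unfolding hom_def by blast
  fix x s t assume "s \<in> hom (slice (Psh C) G) x (Dom (slice (Psh C) G) (u, h, v))"
    and "t \<in> hom (slice (Psh C) G) x (Dom (slice (Psh C) G) (u, h, v))"
    and eq: "(u, h, v) \<odot>\<^bsub>slice (Psh C) G\<^esub> s = (u, h, v) \<odot>\<^bsub>slice (Psh C) G\<^esub> t"
  then obtain s' t' where s: "s = (x, s', u)" "s' \<in> hom (Psh C) (Dom (Psh C) x) (Dom (Psh C) u)"
    and t: "t = (x, t', u)" "t' \<in> hom (Psh C) (Dom (Psh C) x) (Dom (Psh C) u)"
    by (auto simp: slice_hom_iff)
  have eq': "h \<odot>\<^bsub>Psh C\<^esub> s' = h \<odot>\<^bsub>Psh C\<^esub> t'" using eq by (simp add: s t)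
  have "s' = t'"
  proof (rule psh_arr_eqI[OF s(2) t(2)])
    fix c y assume c: "c \<in> Obj C" and y: "y \<in> fib (Dom (Psh C) x) c"
    have "ap h c (ap s' c y) = ap h c (ap t' c y)"
      using ap_comp[OF s(2) c y, of h] ap_comp[OF t(2) c y, of h] eq' by simp
    then show "ap s' c y = ap t' c y"
      using inj[OF c] ap_in[OF s(2) c y] ap_in[OF t(2) c y] by (auto dest: inj_onD)
  qed
  then show "s = t" by (simp add: s t)
qed

text \<open>The well-supported object is the coproduct of all representables. Its category of elements is
  a preorder since all maps are monic.\<close>

lemma etendue_of_monos:
  fixes g :: "(('o, 'a, 'u) psh, ('o, 'a, 'u) psh_arr, 'u set, 'u set \<times> ('u \<Rightarrow> 'u) \<times> 'u set) geom"
  assumes mono: "\<And>f. f \<in> Arr C \<Longrightarrow> mono_arr C f"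
    and g: "geometric_morphism (Psh C) Sets g"
  shows "etendue (Psh C) Sets g"
proof -
  let ?E = "Psh C :: (('o, 'a, 'u) psh, ('o, 'a, 'u) psh_arr) cat"
  \<comment> \<open>At \<open>c\<close> the coproduct of the representables is the set of all arrows
    with domain \<open>c\<close>, acted on by composition.\<close>
  let ?F = "\<lambda>c. {f \<in> Arr C. Dom C f = c}"
  obtain G :: "('o, 'a, 'u) psh" and e d where G: "G \<in> Obj (Psh C)"
    and eF: "\<And>c x. c \<in> Obj C \<Longrightarrow> x \<in> ?F c \<Longrightarrow> e c x \<in> fib G c"
    and de: "\<And>c x. c \<in> Obj C \<Longrightarrow> x \<in> ?F c \<Longrightarrow> d c (e c x) = x"
    and dF: "\<And>c y. c \<in> Obj C \<Longrightarrow> y \<in> fib G c \<Longrightarrow> d c y \<in> ?F c"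
    and ed: "\<And>c y. c \<in> Obj C \<Longrightarrow> y \<in> fib G c \<Longrightarrow> e c (d c y) = y"
    and ac: "\<And>f x. f \<in> Arr C \<Longrightarrow> x \<in> ?F (Cod C f) \<Longrightarrow> act G f (e (Cod C f) x) = e (Dom C f) (x \<odot> f)"
    by (rule encode_psh[of ?F "\<lambda>f x. x \<odot> f"]) (auto intro: small_subset[OF small_Arr])
  \<comment> \<open>Cancellation of the mono that \<open>y\<close> encodes. This is where the
    hypothesis on arrows enters, and it makes the relation \<open>Q\<close> below
    single-valued.\<close>
  have free: "u = u'" if u: "u \<in> hom C c b" "u' \<in> hom C c b" and y: "y \<in> fib G b"
    and eq: "act G u y = act G u' y" for u u' c b y
  proof -
    have us: "u \<in> Arr C" "Dom C u = c" "Cod C u = b" "u' \<in> Arr C" "Dom C u' = c" "Cod C u' = b" "b \<in> Obj C" "c \<in> Obj C"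
      using u by (auto simp: hom_def)
    define w where "w = d b y"
    have w: "w \<in> Arr C" "Dom C w = b" "y = e b w" using dF[OF us(7) y] ed[OF us(7) y] by (auto simp: w_def)
    have "e c (w \<odot> u) = e c (w \<odot> u')"
      using ac[of u w] ac[of u' w] eq us w by simp
    then have "d c (e c (w \<odot> u)) = d c (e c (w \<odot> u'))" by simp
    then have "w \<odot> u = w \<odot> u'" using de[OF us(8)] us w by simp
    then show ?thesis using mono[OF w(1)] u w(2) unfolding mono_arr_def by blast
  qed
  have L: "adjoint Sets ?E (inverse_image g) (direct_image g)" and lex: "lex_functor Sets ?E (inverse_image g)"
    using g by (auto simp: geometric_morphism_def)
  let ?L = "inverse_image g"
  define t where "t = on_obj ?L {undefined}"
  have T: "terminal_obj ?E t" unfolding t_def by (rule lex_terminal[OF lex terminal_point[OF gu]])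
  have tO: "t \<in> Obj ?E" using T by (simp add: terminal_obj_def)
  obtain b where b: "b \<in> hom ?E G t" using T G unfolding terminal_obj_def by blast
  have "epi_arr ?E b"
    unfolding epi_arr_def
  proof (intro conjI allI ballI impI)
    show "b \<in> Arr ?E" using b by (simp add: hom_def)
    have bc: "Cod ?E b = t" using b by (simp add: hom_def)
    fix W u v assume u: "u \<in> hom ?E (Cod ?E b) W" and v: "v \<in> hom ?E (Cod ?E b) W"
      and eq: "u \<odot>\<^bsub>?E\<^esub> b = v \<odot>\<^bsub>?E\<^esub> b"
    show "u = v"
    proof (rule psh_arr_eqI[OF u[unfolded bc] v[unfolded bc]])
      fix c s assume c: "c \<in> Obj C" and s: "s \<in> fib t c"
      \<comment> \<open>The identity of \<open>c\<close> shows that the fibre of \<open>G\<close> at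
        \<open>c\<close> is inhabited.\<close>
      have y: "e c (Idn C c) \<in> fib G c" using eF[OF c, of "Idn C c"] c by simp
      have "ap b c (e c (Idn C c)) = s"
        using terminal_psh_singleton[OF T c] s ap_in[OF b c y] by blast
      then show "ap u c s = ap v c s"
        using ap_comp[OF b c y, of u] ap_comp[OF b c y, of v] eq by simp
    qed
  qed
  then have ws: "well_supported ?E G" unfolding well_supported_def using G T b by blast
  interpret S: slice_site C U G by unfold_locales (rule G)
  obtain q where q: "slice_geom ?E G q" using S.slice_geom_exists by blast
  have qg: "geometric_morphism (slice ?E G) ?E q" using q by (simp add: slice_geom_def)
  obtain \<pi> where prod: "\<And>Y. Y \<in> Obj ?E \<Longrightarrow>
      is_product ?E Y G (Dom ?E (on_obj (inverse_image q) Y)) (\<pi> Y) (on_obj (inverse_image q) Y)"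
    using q unfolding slice_geom_def Let_def by blast
  have "subquotient (slice ?E G) \<phi> (on_obj (inverse_image (g \<circ>\<^sub>G q)) A)"
    if \<phi>o: "\<phi> \<in> Obj (slice ?E G)" and A: "A \<in> Obj Sets" and j: "inj_on j (Sigma (Obj C) (fib (Dom ?E \<phi>)))"
      and Aj: "A = j ` Sigma (Obj C) (fib (Dom ?E \<phi>))" for \<phi> A j
  proof -
    define Z where "Z = Dom ?E \<phi>"
    define Y where "Y = on_obj ?L A"
    define w where "w = on_obj (inverse_image q) Y"
    define P where "P = Dom ?E w"
    have \<phi>: "\<phi> \<in> hom ?E Z G" and Z: "Z \<in> Obj ?E" using S.slice_objD[OF \<phi>o] by (auto simp: Z_def)
    have "is_functor Sets ?E ?L" using lex by (simp add: lex_functor_def)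
    then have Y: "Y \<in> Obj ?E" using A by (simp add: Y_def is_functor_def)
    note pr = prod[OF Y, folded w_def P_def]
    have P: "P \<in> Obj ?E" and \<pi>: "\<pi> Y \<in> hom ?E P Y" and w: "w \<in> hom ?E P G"
      using pr by (auto simp: is_product_def)
    obtain v where vb: "\<And>c. c \<in> Obj C \<Longrightarrow> bij_betw (v c) (fib Y c) A"
      and vn: "\<And>f y. f \<in> Arr C \<Longrightarrow> y \<in> fib Y (Cod C f) \<Longrightarrow> v (Dom C f) (act Y f y) = v (Cod C f) y"
      using constant_psh[OF L T[unfolded t_def] A] unfolding Y_def by blast
    \<comment> \<open>\<open>A\<close> is a set of names for all elements of \<open>Z\<close>. An
      element \<open>p\<close> of the product of the constant presheaf with \<open>G\<close> carries
      the name of some \<open>y\<close> at \<open>b\<close> together with an element of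
      \<open>G\<close>; if the latter is the restriction along some \<open>u\<close> of the image of
      \<open>y\<close>, then \<open>p\<close> is sent to the restriction of \<open>y\<close> along
      \<open>u\<close>.\<close>
    define Q where "Q = (\<lambda>c p z. \<exists>b y u. b \<in> Obj C \<and> y \<in> fib Z b \<and> u \<in> hom C c b \<and>
      v c (ap (\<pi> Y) c p) = j (b, y) \<and> ap w c p = act G u (ap \<phi> b y) \<and> z = act Z u y)"
    have Qdet: "z = z'" if "Q c p z" "Q c p z'" for c p z z'
    proof -
      obtain b y u where 1: "b \<in> Obj C" "y \<in> fib Z b" "u \<in> hom C c b" "v c (ap (\<pi> Y) c p) = j (b, y)"
        "ap w c p = act G u (ap \<phi> b y)" "z = act Z u y" using \<open>Q c p z\<close> unfolding Q_def by blast
      obtain b' y' u' where 2: "b' \<in> Obj C" "y' \<in> fib Z b'" "u' \<in> hom C c b'" "v c (ap (\<pi> Y) c p) = j (b', y')"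
        "ap w c p = act G u' (ap \<phi> b' y')" "z' = act Z u' y'" using \<open>Q c p z'\<close> unfolding Q_def by blast
      have "j (b, y) = j (b', y')" using 1(4) 2(4) by simp
      then have "(b, y) = (b', y')" by (rule inj_onD[OF j]) (use 1 2 in \<open>auto simp: Z_def\<close>)
      then have eq: "b' = b" "y' = y" by auto
      have "u = u'"
        using 1(5) 2(5) eq by (intro free[OF 1(3) 2(3)[unfolded eq] ap_in[OF \<phi> 1(1,2)]]) simp
      then show ?thesis using 1(6) 2(6) eq by simp
    qed
    have Qact: "Q (Dom C f) (act P f p) (act Z f z)" if f: "f \<in> Arr C" and p: "p \<in> fib P (Cod C f)" and "Q (Cod C f) p z" for f p z
    proof -
      obtain b y u where 1: "b \<in> Obj C" "y \<in> fib Z b" "u \<in> hom C (Cod C f) b" "v (Cod C f) (ap (\<pi> Y) (Cod C f) p) = j (b, y)"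
        "ap w (Cod C f) p = act G u (ap \<phi> b y)" "z = act Z u y" using \<open>Q (Cod C f) p z\<close> unfolding Q_def by blast
      have fh: "f \<in> hom C (Dom C f) (Cod C f)" using f by (simp add: hom_def)
      have us: "u \<in> Arr C" "Dom C u = Cod C f" "Cod C u = b" using 1(3) by (auto simp: hom_def)
      have "v (Dom C f) (ap (\<pi> Y) (Dom C f) (act P f p)) = j (b, y)"
        using ap_nat[OF \<pi> fh p] vn[OF f ap_in[OF \<pi> _ p]] f 1(4) by simp
      moreover have "ap w (Dom C f) (act P f p) = act G (u \<odot> f) (ap \<phi> b y)"
        using ap_nat[OF w fh p] 1(5) act_comp[OF G f us(1)] us ap_in[OF \<phi> 1(1,2)] by simp
      moreover have "act Z f z = act Z (u \<odot> f) y"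
        using 1(6) act_comp[OF Z f us(1)] us 1(2) by simp
      ultimately show ?thesis using 1 comp_hom[OF fh 1(3)] unfolding Q_def by blast
    qed
    have QZ: "z \<in> fib Z c" if "Q c p z" for c p z
      using that act_in[OF Z] unfolding Q_def hom_def by auto
    \<comment> \<open>The domain of definition of this partial map is a subpresheaf of the product;
      it is the middle object of the subquotient.\<close>
    define S where "S = (\<lambda>c. {p \<in> fib P c. \<exists>z. Q c p z})"
    have cl: "closed_under_act P S"
      unfolding closed_under_act_def S_def using Qact P by (auto intro!: act_in[OF P])
    define S0 where "S0 = mk_psh S (act P)"
    define \<iota> where "\<iota> = mk_map S0 P (\<lambda>c x. x)"
    have S0: "S0 \<in> Obj ?E" and \<iota>: "\<iota> \<in> hom ?E S0 P"
      using subpsh[OF P cl] by (auto simp: S0_def \<iota>_def)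
    define k where "k = (\<lambda>c p. THE z. Q c p z)"
    have kQ: "k c p = z" if "Q c p z" for c p z
      unfolding k_def using that Qdet by blast
    define h where "h = mk_map S0 Z k"
    have kS: "Q c p (k c p)" if "c \<in> Obj C" "p \<in> fib S0 c" for c p
      using that kQ by (auto simp: S0_def S_def)
    have h: "h \<in> hom ?E S0 Z"
      unfolding h_def
    proof (rule mk_map)
      fix f p assume f: "f \<in> Arr C" and p: "p \<in> fib S0 (Cod C f)"
      then have p': "p \<in> S (Cod C f)" "p \<in> fib P (Cod C f)" by (auto simp: S0_def S_def)
      show "k (Dom C f) (act S0 f p) = act Z f (k (Cod C f) p)"
        using kQ[OF Qact[OF f p'(2) kS[OF _ p]]] f p' by (simp add: S0_def)
    qed (use S0 Z QZ[OF kS] in auto)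
    have \<iota>s: "w \<odot>\<^bsub>?E\<^esub> \<iota> \<in> hom ?E S0 G" by (rule psh_comp_hom[OF \<iota> w])
    have "\<phi> \<odot>\<^bsub>?E\<^esub> h = w \<odot>\<^bsub>?E\<^esub> \<iota>"
    proof (rule psh_arr_eqI[OF psh_comp_hom[OF h \<phi>] \<iota>s])
      fix c p assume c: "c \<in> Obj C" and p: "p \<in> fib S0 c"
      obtain b y u where 1: "b \<in> Obj C" "y \<in> fib Z b" "u \<in> hom C c b" 
        "ap w c p = act G u (ap \<phi> b y)" "k c p = act Z u y" using kS[OF c p] unfolding Q_def by blast
      show "ap (\<phi> \<odot>\<^bsub>?E\<^esub> h) c p = ap (w \<odot>\<^bsub>?E\<^esub> \<iota>) c p"
        using ap_nat[OF \<phi> 1(3,2)] 1 c p by (simp add: ap_comp[OF h] ap_comp[OF \<iota>]) (simp add: h_def \<iota>_def)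
    qed
    then have eS: "(w \<odot>\<^bsub>?E\<^esub> \<iota>, h, \<phi>) \<in> hom (slice ?E G) (w \<odot>\<^bsub>?E\<^esub> \<iota>) \<phi>"
      using \<iota>s \<phi> h unfolding slice_hom_iff by (simp add: hom_def)
    have mS: "(w \<odot>\<^bsub>?E\<^esub> \<iota>, \<iota>, w) \<in> hom (slice ?E G) (w \<odot>\<^bsub>?E\<^esub> \<iota>) w"
      using \<iota>s w \<iota> unfolding slice_hom_iff by (simp add: hom_def)
    have DS: "Dom ?E (w \<odot>\<^bsub>?E\<^esub> \<iota>) = S0" using \<iota>s by (simp add: hom_def)
    have "mono_arr (slice ?E G) (w \<odot>\<^bsub>?E\<^esub> \<iota>, \<iota>, w)"
      by (rule mono_sliceI[OF mS], unfold DS) (simp add: \<iota>_def inj_on_def)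
    moreover have "epi_arr (slice ?E G) (w \<odot>\<^bsub>?E\<^esub> \<iota>, h, \<phi>)"
    proof (rule epi_sliceI[OF eS], unfold DS Z_def[symmetric])
      \<comment> \<open>Surjectivity: \<open>z\<close> is reached through its own name, with the
        identity as \<open>u\<close>.\<close>
      fix c z assume c: "c \<in> Obj C" and z: "z \<in> fib Z c"
      have "j (c, z) \<in> v c ` fib Y c"
        using bij_betw_imp_surj_on[OF vb[OF c]] c z by (auto simp: Aj Z_def)
      then obtain y where y: "y \<in> fib Y c" "v c y = j (c, z)" by auto
      obtain p where p: "p \<in> fib P c" "ap (\<pi> Y) c p = y" "ap w c p = ap \<phi> c z"
        using product_pointwise[OF pr c y(1) ap_in[OF \<phi> c z]] by blast
      have "Q c p z"
        unfolding Q_def using c z y(2) p Z G ap_in[OF \<phi> c z] idn_hom[OF c]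
        by (intro exI[of _ c] exI[of _ z] exI[of _ "Idn C c"]) simp
      then have pS: "p \<in> fib S0 c" using c p(1) by (auto simp: S0_def S_def)
      have "ap h c p = z" using c pS kQ[OF \<open>Q c p z\<close>] by (simp add: h_def)
      with pS show "\<exists>x\<in>fib S0 c. ap h c x = z" by blast
    qed
    moreover have "on_obj (inverse_image (g \<circ>\<^sub>G q)) A = w"
      by (simp add: comp_geom_def w_def Y_def)
    ultimately show ?thesis
      unfolding subquotient_def
      by (intro exI[of _ "(w \<odot>\<^bsub>?E\<^esub> \<iota>, \<iota>, w)"] exI[of _ "(w \<odot>\<^bsub>?E\<^esub> \<iota>, h, \<phi>)"]) simp
  qed
  \<comment> \<open>Names exist because a presheaf on a small category has, over all objects
    together, only a small set of elements.\<close>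
  moreover have "\<exists>(A :: 'u set) j. A \<in> Obj Sets \<and> inj_on j (Sigma (Obj C) (fib (Dom ?E \<phi>))) \<and> A = j ` Sigma (Obj C) (fib (Dom ?E \<phi>))"
    if \<phi>o: "\<phi> \<in> Obj (slice ?E G)" for \<phi>
  proof -
    have sm: "Sigma (Obj C) (fib (Dom ?E \<phi>)) \<prec> (UNIV :: 'u set)"
      using S.slice_objD(2)[OF \<phi>o] by (intro small_Sigma gu small_Obj fib_small) auto
    obtain j :: "'o \<times> 'u \<Rightarrow> 'u" where "inj_on j (Sigma (Obj C) (fib (Dom ?E \<phi>)))"
      using lesspoll_imp_lepoll[OF sm] by (auto simp: lepoll_def)
    moreover have "j ` Sigma (Obj C) (fib (Dom ?E \<phi>)) \<in> Obj Sets"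
      using small_image[OF sm, of j] by (simp add: Sets_def)
    ultimately show ?thesis by blast
  qed
  ultimately have "\<exists>A \<in> Obj Sets. subquotient (slice ?E G) \<phi> (on_obj (inverse_image (g \<circ>\<^sub>G q)) A)"
    if "\<phi> \<in> Obj (slice ?E G)" for \<phi> using that by blast
  then have "localic (slice ?E G) Sets (g \<circ>\<^sub>G q)"
    using geometric_comp[OF g qg] by (simp add: localic_def)
  then show ?thesis using g ws q unfolding etendue_def by blast
qed

end

section \<open>Levels that are etendues\<close>

context slice_site
begin

text \<open>Two arrows of \<open>C\<close> equalized by \<open>f\<close> restrict \<open>x\<close>
  to the same element, because \<open>x\<close> is itself a restriction along \<open>f\<close>; so
  they lift to parallel arrows of the category of elements.\<close>

lemma elements_mono_iff:
  assumes f: "((x, c), f, (y, d)) \<in> Arr (elements C X)"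
  shows "mono_arr (elements C X) ((x, c), f, (y, d)) \<longleftrightarrow> mono_arr C f"
proof -
  have fs: "f \<in> Arr C" "Dom C f = c" "Cod C f = d" "x \<in> fib X c" "y \<in> fib X d" "act X f y = x"
    using f by (auto simp: hom_def)
  have lift: "((act X u x, a), u, (x, c)) \<in> hom (elements C X) (act X u x, a) (x, c)"
    if "u \<in> hom C a c" for u a
    using that fs act_in[OF X, of u x] by (auto simp: elements_hom_iff) (auto simp: hom_def)
  show ?thesis
  proof
    assume m: "mono_arr (elements C X) ((x, c), f, (y, d))"
    show "mono_arr C f"
      unfolding mono_arr_def fs(2)
    proof (intro conjI allI ballI impI)
      fix a u v assume u: "u \<in> hom C a c" and v: "v \<in> hom C a c" and eq: "f \<odot> u = f \<odot> v"
      have "act X u x = act X (f \<odot> u) y" "act X v x = act X (f \<odot> v) y"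
        using u v fs by (auto simp: hom_def act_comp)
      then have xx: "act X u x = act X v x" using eq by simp
      have "((act X u x, a), u, (x, c)) = ((act X u x, a), v, (x, c))"
        using m lift[OF u] lift[OF v] eq unfolding mono_arr_def xx by fastforce
      then show "u = v" by simp
    qed (rule fs)
  next
    assume m: "mono_arr C f"
    show "mono_arr (elements C X) ((x, c), f, (y, d))"
      unfolding mono_arr_def
    proof (intro conjI allI ballI impI)
      fix a u v
      assume u: "u \<in> hom (elements C X) a (Dom (elements C X) ((x, c), f, (y, d)))"
        and v: "v \<in> hom (elements C X) a (Dom (elements C X) ((x, c), f, (y, d)))"
        and eq: "((x, c), f, (y, d)) \<odot>\<^bsub>elements C X\<^esub> u = ((x, c), f, (y, d)) \<odot>\<^bsub>elements C X\<^esub> v"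
      obtain z b where [simp]: "a = (z, b)" by (cases a) auto
      obtain u' v' where u': "u = (a, u', (x, c))" "u' \<in> hom C b c" and v': "v = (a, v', (x, c))" "v' \<in> hom C b c"
        using u v by (auto simp: elements_hom_iff)
      have "f \<odot> u' = f \<odot> v'" using eq by (simp add: u' v')
      then have "u' = v'" using m u'(2) v'(2) unfolding mono_arr_def fs(2) by blast
      then show "u = v" by (simp add: u' v')
    qed (rule f)
  qed
qed

text \<open>The middle object carries the restriction of \<open>y\<close> along \<open>m\<close>. A
  section \<open>s\<close> of \<open>e\<close> lifts as well: restricting \<open>x\<close> along
  \<open>s\<close> gives that element back, since \<open>e \<odot> s\<close> is an identity.\<close>

lemma elements_factorizations:
  assumes "split_epi_mono_factorizations C"
  shows "split_epi_mono_factorizations (elements C X)"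
  unfolding split_epi_mono_factorizations_def
proof
  fix g assume "g \<in> Arr (elements C X)"
  then obtain x c f y d where g: "g = ((x, c), f, (y, d))" "c \<in> Obj C" "x \<in> fib X c" "d \<in> Obj C"
    "y \<in> fib X d" "f \<in> hom C c d" "act X f y = x" by (rule elements_ArrE)
  have fs: "f \<in> Arr C" "Dom C f = c" "Cod C f = d" using g(6) by (auto simp: hom_def)
  obtain e m where e: "split_epi_arr C e" and m: "mono_arr C m" and em: "Cod C e = Dom C m" "f = m \<odot> e"
    using assms fs(1) unfolding split_epi_mono_factorizations_def by blast
  have ea: "e \<in> Arr C" and ma: "m \<in> Arr C" using e m by (auto simp: split_epi_arr_def mono_arr_def)
  have D: "Dom C e = c" "Cod C m = d" using fs em ea ma by auto
  obtain s where s: "s \<in> hom C (Dom C m) c" "e \<odot> s = Idn C (Dom C m)"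
    using e em D by (auto simp: split_epi_arr_def)
  have ss: "s \<in> Arr C" "Dom C s = Dom C m" "Cod C s = c" using s by (auto simp: hom_def)
  let ?z = "act X m y" and ?b = "Dom C m"
  have z: "?z \<in> fib X ?b" using act_in[OF X ma] D g by simp
  have xe: "act X e ?z = x" using act_comp[OF X ea ma em(1)] g(5,7) em(2) D by simp
  have "act X s x = act X (e \<odot> s) ?z" using act_comp[OF X ss(1) ea] ss z em D xe by simp
  then have xs: "act X s x = ?z" using s(2) z ma by simp
  have 1: "((x, c), e, (?z, ?b)) \<in> Arr (elements C X)" using g z ea ma em D xe by (simp add: hom_def)
  have 2: "((?z, ?b), m, (y, d)) \<in> Arr (elements C X)" using g z ma D by (simp add: hom_def)
  have 3: "((?z, ?b), s, (x, c)) \<in> hom (elements C X) (?z, ?b) (x, c)"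
    using g z ma s(1) xs by (simp add: elements_hom_iff)
  show "\<exists>e m. split_epi_arr (elements C X) e \<and> mono_arr (elements C X) m \<and>
    Cod (elements C X) e = Dom (elements C X) m \<and> g = m \<odot>\<^bsub>elements C X\<^esub> e"
  proof (intro exI conjI)
    show "split_epi_arr (elements C X) ((x, c), e, (?z, ?b))"
      unfolding split_epi_arr_def
      using 1 3 s(2) by (intro conjI bexI[of _ "((?z, ?b), s, (x, c))"]) simp_all
    show "mono_arr (elements C X) ((?z, ?b), m, (y, d))" using elements_mono_iff[OF 2] m by simp
    show "Cod (elements C X) ((x, c), e, (?z, ?b)) = Dom (elements C X) ((?z, ?b), m, (y, d))" by simp
    show "g = ((?z, ?b), m, (y, d)) \<odot>\<^bsub>elements C X\<^esub> ((x, c), e, (?z, ?b))" by (simp add: g(1) em(2))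
  qed
qed

text \<open>The projection to \<open>C\<close> preserves chains of monos, and an inverse found in
  \<open>C\<close> lifts because it restricts \<open>x t\<close> to
  \<open>x (Suc t)\<close>.\<close>

lemma elements_acc:
  assumes "ascending_chain_condition C"
  shows "ascending_chain_condition (elements C X)"
  unfolding ascending_chain_condition_def
proof (intro ballI allI impI)
  fix a and cs :: "nat \<Rightarrow> 'u \<times> 'o" and m i
  assume a: "a \<in> Obj (elements C X)" and "\<forall>n. cs n \<in> Obj (elements C X) \<and>
    m n \<in> hom (elements C X) (cs n) (cs (Suc n)) \<and> mono_arr (elements C X) (m n) \<and>
    i n \<in> hom (elements C X) (cs n) a \<and> mono_arr (elements C X) (i n) \<and>
    i (Suc n) \<odot>\<^bsub>elements C X\<^esub> m n = i n"
  then have h: "cs n \<in> Obj (elements C X)" "m n \<in> hom (elements C X) (cs n) (cs (Suc n))"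
    "mono_arr (elements C X) (m n)" "i n \<in> hom (elements C X) (cs n) a" "mono_arr (elements C X) (i n)"
    "i (Suc n) \<odot>\<^bsub>elements C X\<^esub> m n = i n" for n by blast+
  define x c where "x = (\<lambda>n. fst (cs n))" and "c = (\<lambda>n. snd (cs n))"
  define m' i' where "m' = (\<lambda>n. fst (snd (m n)))" and "i' = (\<lambda>n. fst (snd (i n)))"
  obtain y d where ad: "a = (y, d)" by (cases a) auto
  have cs: "cs n = (x n, c n)" for n by (simp add: x_def c_def)
  have m: "m n = ((x n, c n), m' n, (x (Suc n), c (Suc n)))" "m' n \<in> hom C (c n) (c (Suc n))"
    "x (Suc n) \<in> fib X (c (Suc n))" "act X (m' n) (x (Suc n)) = x n" "x n \<in> fib X (c n)" for n
    using h(2)[of n] unfolding cs elements_hom_iff by (auto simp: m'_def)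
  have i: "i n = ((x n, c n), i' n, (y, d))" "i' n \<in> hom C (c n) d" for n
    using h(4)[of n] unfolding cs ad elements_hom_iff by (auto simp: i'_def)
  have dO: "d \<in> Obj C" using a ad by simp
  have mA: "((x n, c n), m' n, (x (Suc n), c (Suc n))) \<in> Arr (elements C X)" for n
    using h(2)[of n] unfolding m(1) hom_def by blast
  have iA: "((x n, c n), i' n, (y, d)) \<in> Arr (elements C X)" for n
    using h(4)[of n] unfolding i(1) hom_def by blast
  have "\<forall>n. c n \<in> Obj C \<and> m' n \<in> hom C (c n) (c (Suc n)) \<and> mono_arr C (m' n) \<and>
    i' n \<in> hom C (c n) d \<and> mono_arr C (i' n) \<and> i' (Suc n) \<odot> m' n = i' n"
  proof
    fix n
    show "c n \<in> Obj C \<and> m' n \<in> hom C (c n) (c (Suc n)) \<and> mono_arr C (m' n) \<and>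
      i' n \<in> hom C (c n) d \<and> mono_arr C (i' n) \<and> i' (Suc n) \<odot> m' n = i' n"
      using h(1)[of n] m(2)[of n] i(2)[of n] h(3)[of n] h(5)[of n] h(6)[of n]
        elements_mono_iff[OF mA[of n]] elements_mono_iff[OF iA[of n]]
      unfolding m(1) i(1) cs by simp
  qed
  then obtain t where "iso_arr C (m' t)"
    using assms dO unfolding ascending_chain_condition_def by blast
  then obtain g where g: "g \<in> hom C (c (Suc t)) (c t)" "m' t \<odot> g = Idn C (c (Suc t))" "g \<odot> m' t = Idn C (c t)"
    using m(2)[of t] by (auto simp: iso_arr_def hom_def)
  have gs: "g \<in> Arr C" "Dom C g = c (Suc t)" "Cod C g = c t" using g(1) by (auto simp: hom_def)
  have ms: "m' t \<in> Arr C" "Dom C (m' t) = c t" "Cod C (m' t) = c (Suc t)" using m(2)[of t] by (auto simp: hom_def)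
  have "act X g (x t) = act X (m' t \<odot> g) (x (Suc t))"
    using act_comp[OF X gs(1) ms(1)] gs ms m(3,4)[of t] by simp
  then have "act X g (x t) = x (Suc t)" using g(2) m(3)[of t] dom_obj[OF gs(1)] gs(2) by simp
  then have gE: "((x (Suc t), c (Suc t)), g, (x t, c t)) \<in> hom (elements C X) (x (Suc t), c (Suc t)) (x t, c t)"
    using g(1) m(3)[of t] m(5)[of t] dom_obj[OF gs(1)] cod_obj[OF gs(1)] gs by (simp add: elements_hom_iff)
  have "iso_arr (elements C X) (m t)"
    unfolding m(1)
    by (rule iso_arrI[OF h(2)[of t, unfolded m(1) cs] gE]) (simp_all add: g)
  then show "\<exists>t. iso_arr (elements C X) (m t)" by blast
qed

end

section \<open>Epimorphisms and monomorphisms under adjoints\<close>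

context adjunction
begin

text \<open>Testing \<open>on_arr L e\<close> against two maps amounts to testing \<open>e\<close>
  against their transposes; \<open>right_adjoint_mono\<close> is the dual.\<close>

lemma left_adjoint_epi:
  assumes "epi_arr A e" shows "epi_arr B (on_arr L e)"
proof -
  have e [simp]: "e \<in> Arr A" using assms by (simp add: epi_arr_def)
  show ?thesis
    unfolding epi_arr_def
  proof (intro conjI allI ballI impI)
    fix b u v assume u: "u \<in> hom B (Cod B (on_arr L e)) b" and v: "v \<in> hom B (Cod B (on_arr L e)) b"
      and eq: "u \<odot>\<^bsub>B\<^esub> on_arr L e = v \<odot>\<^bsub>B\<^esub> on_arr L e"
    have u': "u \<in> hom B (on_obj L (Cod A e)) b" and v': "v \<in> hom B (on_obj L (Cod A e)) b"
      using u v by simp_all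
    have R: "(on_arr R w \<odot>\<^bsub>A\<^esub> \<eta> (Cod A e)) \<odot>\<^bsub>A\<^esub> e = on_arr R (w \<odot>\<^bsub>B\<^esub> on_arr L e) \<odot>\<^bsub>A\<^esub> \<eta> (Dom A e)"
      if "w \<in> hom B (on_obj L (Cod A e)) b" for w
    proof -
      have w: "w \<in> Arr B" "Dom B w = on_obj L (Cod A e)" using that by (auto simp: hom_def)
      then show ?thesis using unit_nat[of e] by simp
    qed
    have RR: "on_arr R w \<odot>\<^bsub>A\<^esub> \<eta> (Cod A e) \<in> hom A (Cod A e) (on_obj R b)"
      if "w \<in> hom B (on_obj L (Cod A e)) b" for w
    proof -
      have w: "w \<in> Arr B" "Dom B w = on_obj L (Cod A e)" "Cod B w = b" using that by (auto simp: hom_def)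
      then show ?thesis by (simp add: hom_def)
    qed
    have "(on_arr R u \<odot>\<^bsub>A\<^esub> \<eta> (Cod A e)) \<odot>\<^bsub>A\<^esub> e = (on_arr R v \<odot>\<^bsub>A\<^esub> \<eta> (Cod A e)) \<odot>\<^bsub>A\<^esub> e"
      unfolding R[OF u'] R[OF v'] eq ..
    then have "on_arr R u \<odot>\<^bsub>A\<^esub> \<eta> (Cod A e) = on_arr R v \<odot>\<^bsub>A\<^esub> \<eta> (Cod A e)"
      using assms RR[OF u'] RR[OF v'] unfolding epi_arr_def by blast
    then show "u = v"
      by (rule universal_eq[OF universal[of "Cod A e"] R.ftr_axioms u' v', rotated]) simp
  qed simp
qed

lemma right_adjoint_mono:
  assumes "mono_arr B m" shows "mono_arr A (on_arr R m)"
proof -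
  have m [simp]: "m \<in> Arr B" using assms by (simp add: mono_arr_def)
  show ?thesis
    unfolding mono_arr_def
  proof (intro conjI allI ballI impI)
    fix a u v assume u: "u \<in> hom A a (Dom A (on_arr R m))" and v: "v \<in> hom A a (Dom A (on_arr R m))"
      and eq: "on_arr R m \<odot>\<^bsub>A\<^esub> u = on_arr R m \<odot>\<^bsub>A\<^esub> v"
    have u': "u \<in> hom A a (on_obj R (Dom B m))" and v': "v \<in> hom A a (on_obj R (Dom B m))"
      using u v by simp_all
    have R: "m \<odot>\<^bsub>B\<^esub> (\<epsilon> (Dom B m) \<odot>\<^bsub>B\<^esub> on_arr L w) = \<epsilon> (Cod B m) \<odot>\<^bsub>B\<^esub> on_arr L (on_arr R m \<odot>\<^bsub>A\<^esub> w)"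
      if "w \<in> hom A a (on_obj R (Dom B m))" for w
    proof -
      have w: "w \<in> Arr A" "Cod A w = on_obj R (Dom B m)" using that by (auto simp: hom_def)
      have "m \<odot>\<^bsub>B\<^esub> (\<epsilon> (Dom B m) \<odot>\<^bsub>B\<^esub> on_arr L w) = (m \<odot>\<^bsub>B\<^esub> \<epsilon> (Dom B m)) \<odot>\<^bsub>B\<^esub> on_arr L w"
        using w by simp
      then show ?thesis using w unfolding counit_nat[OF m, symmetric] by simp
    qed
    have RR: "\<epsilon> (Dom B m) \<odot>\<^bsub>B\<^esub> on_arr L w \<in> hom B (on_obj L a) (Dom B m)"
      if "w \<in> hom A a (on_obj R (Dom B m))" for w
    proof -
      have w: "w \<in> Arr A" "Dom A w = a" "Cod A w = on_obj R (Dom B m)" using that by (auto simp: hom_def)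
      then show ?thesis by (simp add: hom_def)
    qed
    have "m \<odot>\<^bsub>B\<^esub> (\<epsilon> (Dom B m) \<odot>\<^bsub>B\<^esub> on_arr L u) = m \<odot>\<^bsub>B\<^esub> (\<epsilon> (Dom B m) \<odot>\<^bsub>B\<^esub> on_arr L v)"
      unfolding R[OF u'] R[OF v'] eq ..
    then have "\<epsilon> (Dom B m) \<odot>\<^bsub>B\<^esub> on_arr L u = \<epsilon> (Dom B m) \<odot>\<^bsub>B\<^esub> on_arr L v"
      using assms RR[OF u'] RR[OF v'] unfolding mono_arr_def by blast
    then show "u = v"
      by (rule couniversal_eq[OF couniversal[of "Dom B m"] L.ftr_axioms u' v', rotated]) simp
  qed simp
qed

text \<open>Extending the unit along \<open>p\<close> and transposing gives a retraction of
  \<open>on_arr L p\<close>. The latter is also epic, as \<open>L\<close> preserves epis, and a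
  split mono that is epic is invertible.\<close>

lemma left_adjoint_inverts:
  assumes p: "p \<in> hom A y w" and epi: "epi_arr A p"
    and ext: "\<And>z h. z \<in> Obj B \<Longrightarrow> h \<in> hom A y (on_obj R z) \<Longrightarrow> \<exists>k \<in> hom A w (on_obj R z). k \<odot>\<^bsub>A\<^esub> p = h"
  shows "iso_arr B (on_arr L p)"
proof -
  have ps [simp]: "p \<in> Arr A" "Dom A p = y" "Cod A p = w" using p by (auto simp: hom_def)
  have y [simp]: "y \<in> Obj A" and w [simp]: "w \<in> Obj A" using L.A.dom_obj[of p] L.A.cod_obj[of p] by simp_all
  obtain k where k: "k \<in> hom A w (on_obj R (on_obj L y))" "k \<odot>\<^bsub>A\<^esub> p = \<eta> y"
    using ext[of "on_obj L y" "\<eta> y"] unit_hom[OF y] by auto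
  have ks [simp]: "k \<in> Arr A" "Dom A k = w" "Cod A k = on_obj R (on_obj L y)" using k by (auto simp: hom_def)
  define r where "r = \<epsilon> (on_obj L y) \<odot>\<^bsub>B\<^esub> on_arr L k"
  have rs [simp]: "r \<in> Arr B" "Dom B r = on_obj L w" "Cod B r = on_obj L y" by (simp_all add: r_def)
  have "r \<odot>\<^bsub>B\<^esub> on_arr L p = \<epsilon> (on_obj L y) \<odot>\<^bsub>B\<^esub> on_arr L (k \<odot>\<^bsub>A\<^esub> p)"
    by (simp add: r_def)
  then have 1: "r \<odot>\<^bsub>B\<^esub> on_arr L p = Idn B (on_obj L y)" by (simp only: k(2) tri1[OF y])
  have e: "epi_arr B (on_arr L p)" by (rule left_adjoint_epi[OF epi])
  have "(on_arr L p \<odot>\<^bsub>B\<^esub> r) \<odot>\<^bsub>B\<^esub> on_arr L p = Idn B (on_obj L w) \<odot>\<^bsub>B\<^esub> on_arr L p"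
    using 1 by simp
  moreover have "on_arr L p \<odot>\<^bsub>B\<^esub> r \<in> hom B (Cod B (on_arr L p)) (on_obj L w)"
    "Idn B (on_obj L w) \<in> hom B (Cod B (on_arr L p)) (on_obj L w)" by (simp_all add: hom_def)
  ultimately have 2: "on_arr L p \<odot>\<^bsub>B\<^esub> r = Idn B (on_obj L w)"
    using e unfolding epi_arr_def by blast
  show ?thesis by (rule iso_arrI[OF L.F_hom[OF p] _ 2 1]) (simp add: hom_def)
qed

end

text \<open>The forgetful functor of a slice has a right adjoint and therefore preserves epis. That
  adjoint is present only through the products in \<open>slice_geom\<close>: the test maps
  \<open>u\<close> and \<open>v\<close> are paired with \<open>g\<close>, which turns them into maps
  over \<open>G\<close>.\<close>

lemma epi_slice_imp_epi:
  assumes M: "category M" and q: "slice_geom M G q" and e: "epi_arr (slice M G) (s, e, g)"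
  shows "epi_arr M e"
proof -
  interpret M: category M by fact
  have "(s, e, g) \<in> Arr (slice M G)" using e by (simp add: epi_arr_def)
  then have a: "s \<in> Arr M" "Cod M s = G" "g \<in> Arr M" "Cod M g = G" "g \<odot>\<^bsub>M\<^esub> e = s"
    and es: "e \<in> Arr M" "Dom M e = Dom M s" "Cod M e = Dom M g" by (auto simp: hom_def)
  show ?thesis
    unfolding epi_arr_def
  proof (intro conjI allI ballI impI)
    fix z u v assume "u \<in> hom M (Cod M e) z" "v \<in> hom M (Cod M e) z" and eq: "u \<odot>\<^bsub>M\<^esub> e = v \<odot>\<^bsub>M\<^esub> e"
    then have u: "u \<in> hom M (Dom M g) z" and v: "v \<in> hom M (Dom M g) z" using es by auto
    then have z: "z \<in> Obj M" by (auto simp: hom_def)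
    obtain P \<pi> r where pr: "is_product M z G P \<pi> r"
      using q z unfolding slice_geom_def Let_def by blast
    then have ps: "P \<in> Obj M" "\<pi> \<in> Arr M" "Dom M \<pi> = P" "Cod M \<pi> = z" "r \<in> Arr M" "Dom M r = P" "Cod M r = G"
      by (auto simp: is_product_def hom_def)
    have univ: "\<exists>!h. h \<in> hom M c P \<and> \<pi> \<odot>\<^bsub>M\<^esub> h = x \<and> r \<odot>\<^bsub>M\<^esub> h = y"
      if "c \<in> Obj M" "x \<in> hom M c z" "y \<in> hom M c G" for c x y
      using pr that unfolding is_product_def by blast
    have g: "g \<in> hom M (Dom M g) G" "Dom M g \<in> Obj M" using a by (auto simp: hom_def)
    obtain h where h: "h \<in> hom M (Dom M g) P" "\<pi> \<odot>\<^bsub>M\<^esub> h = u" "r \<odot>\<^bsub>M\<^esub> h = g"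
      using univ[OF g(2) u g(1)] by blast
    obtain k where k: "k \<in> hom M (Dom M g) P" "\<pi> \<odot>\<^bsub>M\<^esub> k = v" "r \<odot>\<^bsub>M\<^esub> k = g"
      using univ[OF g(2) v g(1)] by blast
    have hs: "h \<in> Arr M" "Dom M h = Dom M g" "Cod M h = P" "k \<in> Arr M" "Dom M k = Dom M g" "Cod M k = P"
      using h(1) k(1) by (auto simp: hom_def)
    have "\<pi> \<odot>\<^bsub>M\<^esub> (h \<odot>\<^bsub>M\<^esub> e) = u \<odot>\<^bsub>M\<^esub> e" "\<pi> \<odot>\<^bsub>M\<^esub> (k \<odot>\<^bsub>M\<^esub> e) = u \<odot>\<^bsub>M\<^esub> e"
      "r \<odot>\<^bsub>M\<^esub> (h \<odot>\<^bsub>M\<^esub> e) = s" "r \<odot>\<^bsub>M\<^esub> (k \<odot>\<^bsub>M\<^esub> e) = s"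
      using M.assoc[of e h \<pi>] M.assoc[of e k \<pi>] M.assoc[of e h r] M.assoc[of e k r] h k hs ps es eq a by simp_all
    moreover have "h \<odot>\<^bsub>M\<^esub> e \<in> hom M (Dom M s) P" "k \<odot>\<^bsub>M\<^esub> e \<in> hom M (Dom M s) P"
      "u \<odot>\<^bsub>M\<^esub> e \<in> hom M (Dom M s) z" "s \<in> hom M (Dom M s) G" "Dom M s \<in> Obj M"
      using hs es u a by (auto simp: hom_def)
    ultimately have he: "h \<odot>\<^bsub>M\<^esub> e = k \<odot>\<^bsub>M\<^esub> e" using univ[of "Dom M s" "u \<odot>\<^bsub>M\<^esub> e" s] by blast
    have "(g, h, r) \<in> hom (slice M G) g r" "(g, k, r) \<in> hom (slice M G) g r"
      using h k a ps by (auto simp: slice_hom_iff)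
    moreover have "(g, h, r) \<odot>\<^bsub>slice M G\<^esub> (s, e, g) = (g, k, r) \<odot>\<^bsub>slice M G\<^esub> (s, e, g)"
      using he by simp
    ultimately have "(g, h, r) = (g, k, r)" using e unfolding epi_arr_def by fastforce
    then show "u = v" using h k by auto
  qed (rule es)
qed

text \<open>The maps \<open>e\<close> and \<open>s\<close> are mutually inverse, so cancelling
  \<open>m\<close> leaves an isomorphism to cancel.\<close>

lemma (in category) split_epi_mono_iso:
  assumes e: "e \<in> hom C a b" and s: "s \<in> hom C b a" and "e \<odot> s = Idn C b" "s \<odot> e = Idn C a"
    and m: "mono_arr C m" "Dom C m = b"
  shows "mono_arr C (m \<odot> e)"
proof -
  have es: "e \<in> Arr C" "Dom C e = a" "Cod C e = b" "s \<in> Arr C" "Dom C s = b" "Cod C s = a"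
    using e s by (auto simp: hom_def)
  have ma: "m \<in> Arr C" using m by (simp add: mono_arr_def)
  show ?thesis
    unfolding mono_arr_def
  proof (intro conjI allI ballI impI)
    show "m \<odot> e \<in> Arr C" using es ma m(2) by simp
    fix x u v assume "u \<in> hom C x (Dom C (m \<odot> e))" "v \<in> hom C x (Dom C (m \<odot> e))"
      and eq: "(m \<odot> e) \<odot> u = (m \<odot> e) \<odot> v"
    then have u: "u \<in> Arr C" "Dom C u = x" "Cod C u = a" and v: "v \<in> Arr C" "Dom C v = x" "Cod C v = a"
      using es ma m(2) by (auto simp: hom_def)
    have "m \<odot> (e \<odot> u) = m \<odot> (e \<odot> v)" using eq u v es ma m(2) by simp
    moreover have "e \<odot> u \<in> hom C x (Dom C m)" "e \<odot> v \<in> hom C x (Dom C m)"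
      using u v es m(2) by (auto simp: hom_def)
    ultimately have "e \<odot> u = e \<odot> v" using m(1) unfolding mono_arr_def by blast
    then have "(s \<odot> e) \<odot> u = (s \<odot> e) \<odot> v" using u v es by simp
    then show "u = v" using assms(4) u v by simp
  qed
qed

text \<open>The functors \<open>S\<close>, \<open>N\<close>, \<open>R\<close> are \<open>l\<^sub>!\<close>, \<open>l\<^sup>*\<close>, \<open>l\<^sub>*\<close>.\<close>

locale etendue_level = A: site A U + P: adjunction M "Psh A :: (('o, 'a, 'u) psh, ('o, 'a, 'u) psh_arr) cat" S N \<eta> \<sigma> +
  Q: adjunction "Psh A :: (('o, 'a, 'u) psh, ('o, 'a, 'u) psh_arr) cat" M N R \<eta>' \<epsilon>
  for A :: "('o, 'a) cat" and U :: "'u itself" and M :: "('mo, 'ma) cat" and S N R \<eta> \<sigma> \<eta>' \<epsilon> +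
  fixes G :: 'mo and q :: "('ma, 'ma \<times> 'ma \<times> 'ma, 'mo, 'ma) geom"
  assumes counit_iso: "z \<in> Obj M \<Longrightarrow> iso_arr M (\<epsilon> z)"
    and factorizations: "split_epi_mono_factorizations A"
    and acc: "ascending_chain_condition A"
    and well_supported: "well_supported M G"
    and slice_geom: "slice_geom M G q"
    and localic: "g \<in> Obj (slice M G) \<Longrightarrow> \<exists>W j \<Delta>. W \<in> Obj M \<and> subquotient (slice M G) g (on_obj (inverse_image q) W) \<and>
       \<Delta> \<in> Obj (Psh A) \<and> j \<in> hom M W (on_obj N \<Delta>) \<and> iso_arr M j \<and>
       (\<forall>b \<in> Obj A. \<forall>w \<in> fib \<Delta> b. \<exists>T s pt. terminal_obj (Psh A) T \<and> s \<in> fib T b \<and>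
          pt \<in> hom (Psh A) T \<Delta> \<and> ap pt b s = w)"
begin

abbreviation "E \<equiv> Psh A :: (('o, 'a, 'u) psh, ('o, 'a, 'u) psh_arr) cat"

abbreviation "SN Y \<equiv> on_obj S (on_obj N Y)"

section \<open>The counit and the ideal that it determines\<close>

lemma \<sigma>_hom: "Y \<in> Obj E \<Longrightarrow> \<sigma> Y \<in> hom E (SN Y) Y"
  using P.counit_hom by simp

lemma eta_iso: "z \<in> Obj M \<Longrightarrow> iso_arr M (\<eta> z)"
  by (rule unit_iso_of_ff_right[OF P.adjunction_axioms Q.adjunction_axioms counit_iso])

lemma SN_hom: "t \<in> hom E Y Z \<Longrightarrow> on_arr S (on_arr N t) \<in> hom E (SN Y) (SN Z)"
  by (intro P.L.F_hom P.R.F_hom)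

lemma \<sigma>_nat:
  assumes t: "t \<in> hom E Y Z" and c: "c \<in> Obj A" and w: "w \<in> fib (SN Y) c"
  shows "ap (\<sigma> Z) c (ap (on_arr S (on_arr N t)) c w) = ap t c (ap (\<sigma> Y) c w)"
proof -
  have ts: "t \<in> Arr E" "Dom E t = Y" "Cod E t = Z" using t by (auto simp: hom_def)
  have "\<sigma> Z \<odot>\<^bsub>E\<^esub> on_arr S (on_arr N t) = t \<odot>\<^bsub>E\<^esub> \<sigma> Y" using P.counit_nat[OF ts(1)] ts by simp
  then show ?thesis
    using A.ap_comp[OF SN_hom[OF t] c w, of "\<sigma> Z"] A.ap_comp[OF \<sigma>_hom c w, of t] A.psh_arrD(1)[OF t] by simp
qed

text \<open>One representation of the codomain suffices: by \<open>ideal_image\<close> the property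
  passes to every presheaf and every element over the codomain.\<close>

definition ideal :: "'a \<Rightarrow> bool" where
  "ideal f \<longleftrightarrow> f \<in> Arr A \<and> (\<exists>Y i. A.represents Y (Cod A f) i \<and>
     (\<exists>w \<in> fib (SN Y) (Dom A f). ap (\<sigma> Y) (Dom A f) w = act Y f i))"

lemma idealD: "ideal f \<Longrightarrow> f \<in> Arr A"
  by (simp add: ideal_def)

text \<open>Naturality of the counit along the map that the Yoneda lemma assigns to
  \<open>z\<close>.\<close>

lemma ideal_image:
  assumes f: "ideal f" and Z: "Z \<in> Obj E" and z: "z \<in> fib Z (Cod A f)"
  shows "\<exists>w \<in> fib (SN Z) (Dom A f). ap (\<sigma> Z) (Dom A f) w = act Z f z"
proof -
  obtain Y i w where Y: "A.represents Y (Cod A f) i" and w: "w \<in> fib (SN Y) (Dom A f)"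
    "ap (\<sigma> Y) (Dom A f) w = act Y f i" using f unfolding ideal_def by blast
  have fa: "f \<in> Arr A" and fh: "f \<in> hom A (Dom A f) (Cod A f)" using idealD[OF f] by (auto simp: hom_def)
  obtain t where t: "t \<in> hom E Y Z" "ap t (Cod A f) i = z" by (rule A.yoneda_exists[OF Y Z z])
  have D: "Dom A f \<in> Obj A" using fa by simp
  have "ap (\<sigma> Z) (Dom A f) (ap (on_arr S (on_arr N t)) (Dom A f) w) = act Z f z"
    using \<sigma>_nat[OF t(1) D w(1)] w(2) A.ap_nat[OF t(1) fh A.representsD(3)[OF Y]] t(2) by simp
  then show ?thesis using A.ap_in[OF SN_hom[OF t(1)] D w(1)] by blast
qed

text \<open>\<open>S \<circ>\<^sub>F N\<close> is itself a left adjoint, with right adjoint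
  \<open>R \<circ>\<^sub>F N\<close>, so it preserves the jointly epimorphic family of all maps from
  representables to \<open>Z\<close>. Hence \<open>w\<close> comes from a representable
  \<open>Y\<close>, where its image under the counit is an arrow of \<open>A\<close>.\<close>

lemma image_ideal:
  assumes Z: "Z \<in> Obj E" and c: "c \<in> Obj A" and w: "w \<in> fib (SN Z) c"
  shows "\<exists>f z. ideal f \<and> Dom A f = c \<and> z \<in> fib Z (Cod A f) \<and> ap (\<sigma> Z) c w = act Z f z"
proof -
  have adj: "adjoint E E (S \<circ>\<^sub>F N) (R \<circ>\<^sub>F N)"
    by (rule adjoint_comp[OF Q.adjoint P.adjoint])
  have w': "w \<in> fib (on_obj (S \<circ>\<^sub>F N) Z) c" using w by simp
  let ?G = "{t. \<exists>Y b i. A.represents Y b i \<and> t \<in> hom E Y Z}"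
  obtain t w1 where t: "t \<in> ?G" and w1: "w1 \<in> fib (on_obj (S \<circ>\<^sub>F N) (Dom E t)) c"
    "ap (on_arr (S \<circ>\<^sub>F N) t) c w1 = w"
  proof (rule A.left_adjoint_jointly_surj[OF adj Z _ _ c w', of ?G])
    show "t \<in> Arr E \<and> Cod E t = Z" if "t \<in> ?G" for t using that by (auto simp: hom_def)
    fix W u v assume u: "u \<in> hom E Z W" and v: "v \<in> hom E Z W"
      and eq: "\<And>t. t \<in> ?G \<Longrightarrow> u \<odot>\<^bsub>E\<^esub> t = v \<odot>\<^bsub>E\<^esub> t"
    show "u = v"
    proof (rule A.psh_arr_eqI[OF u v])
      fix a z assume a: "a \<in> Obj A" and z: "z \<in> fib Z a"
      obtain Y :: "('o, 'a, 'u) psh" and i where Y: "A.represents Y a i" by (rule A.representable_exists[OF a])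
      obtain t where t: "t \<in> hom E Y Z" "ap t a i = z" by (rule A.yoneda_exists[OF Y Z z])
      have "u \<odot>\<^bsub>E\<^esub> t = v \<odot>\<^bsub>E\<^esub> t" using t Y by (intro eq) blast
      then show "ap u a z = ap v a z"
        using A.ap_comp[OF t(1) a A.representsD(3)[OF Y], of u] A.ap_comp[OF t(1) a A.representsD(3)[OF Y], of v] t(2)
        by simp
    qed
  qed
  from t obtain Y b i where Y: "A.represents Y b i" and th: "t \<in> hom E Y Z" by blast
  have "Dom E t = Y" using th by (simp add: hom_def)
  then have w1': "w1 \<in> fib (SN Y) c" "ap (on_arr S (on_arr N t)) c w1 = w" using w1 by simp_all
  have YO: "Y \<in> Obj E" by (rule A.representsD(1)[OF Y])
  obtain f where f: "f \<in> hom A c b" "ap (\<sigma> Y) c w1 = act Y f i"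
    using A.representsD(4)[OF Y c A.ap_in[OF \<sigma>_hom[OF YO] c w1'(1)]] by blast
  have fs: "f \<in> Arr A" "Dom A f = c" "Cod A f = b" using f(1) by (auto simp: hom_def)
  have i: "i \<in> fib Y b" by (rule A.representsD(3)[OF Y])
  have "ideal f" unfolding ideal_def fs using fs(1) Y w1'(1) f(2) by blast
  moreover have "ap (\<sigma> Z) c w = act Z f (ap t b i)"
    using \<sigma>_nat[OF th c w1'(1)] w1'(2) f(2) A.ap_nat[OF th f(1) i] by simp
  moreover have "ap t b i \<in> fib Z b" by (rule A.ap_in[OF th A.representsD(2)[OF Y] i])
  ultimately show ?thesis using fs by blast
qed

lemma ideal_right:
  assumes f: "ideal f" and h: "h \<in> Arr A" "Cod A h = Dom A f"
  shows "ideal (f \<odot>\<^bsub>A\<^esub> h)"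
proof -
  have fa: "f \<in> Arr A" by (rule idealD[OF f])
  have fh: "f \<odot>\<^bsub>A\<^esub> h \<in> Arr A" "Dom A (f \<odot>\<^bsub>A\<^esub> h) = Dom A h" "Cod A (f \<odot>\<^bsub>A\<^esub> h) = Cod A f"
    using fa h by simp_all
  obtain Y i w where Y: "A.represents Y (Cod A f) i" and w: "w \<in> fib (SN Y) (Dom A f)"
    "ap (\<sigma> Y) (Dom A f) w = act Y f i" using f unfolding ideal_def by blast
  note YO = A.representsD(1)[OF Y] and i = A.representsD(3)[OF Y]
  have SO: "SN Y \<in> Obj E" using YO by simp
  have hh: "h \<in> hom A (Dom A h) (Dom A f)" using h by (simp add: hom_def)
  have "ap (\<sigma> Y) (Dom A h) (act (SN Y) h w) = act Y (f \<odot>\<^bsub>A\<^esub> h) i"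
    using A.ap_nat[OF \<sigma>_hom[OF YO] hh w(1)] w(2) A.act_comp[OF YO h(1) fa h(2) i] by simp
  moreover have "act (SN Y) h w \<in> fib (SN Y) (Dom A h)" using A.act_in[OF SO h(1)] w(1) h(2) by simp
  ultimately show ?thesis unfolding ideal_def fh using fh(1) Y by blast
qed

text \<open>\<open>ideal_image\<close> is applied to the element of a representable that
  \<open>g\<close> names. Composition on the other side, in \<open>ideal_right\<close>, only uses
  that the image of the counit is a subpresheaf.\<close>

lemma ideal_left:
  assumes f: "ideal f" and g: "g \<in> Arr A" "Dom A g = Cod A f"
  shows "ideal (g \<odot>\<^bsub>A\<^esub> f)"
proof -
  have fa: "f \<in> Arr A" by (rule idealD[OF f])
  have gf: "g \<odot>\<^bsub>A\<^esub> f \<in> Arr A" "Dom A (g \<odot>\<^bsub>A\<^esub> f) = Dom A f" "Cod A (g \<odot>\<^bsub>A\<^esub> f) = Cod A g"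
    using fa g by simp_all
  obtain Y :: "('o, 'a, 'u) psh" and i where Y: "A.represents Y (Cod A g) i"
    using A.representable_exists[of "Cod A g"] g by auto
  note YO = A.representsD(1)[OF Y] and i = A.representsD(3)[OF Y]
  have "act Y g i \<in> fib Y (Cod A f)" using A.act_in[OF YO g(1) i] g(2) by simp
  from ideal_image[OF f YO this] obtain w where w: "w \<in> fib (SN Y) (Dom A f)"
    "ap (\<sigma> Y) (Dom A f) w = act Y f (act Y g i)" by blast
  have "act Y f (act Y g i) = act Y (g \<odot>\<^bsub>A\<^esub> f) i"
    using A.act_comp[OF YO fa g(1) g(2)[symmetric] i] by simp
  then show ?thesis unfolding ideal_def gf using gf(1) Y w by auto
qed

text \<open>By a triangle identity the counit at \<open>on_obj S z\<close> has a section, so it is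
  surjective, and \<open>image_ideal\<close> describes its image.\<close>

lemma S_generated_ideal:
  assumes z: "z \<in> Obj M" and c: "c \<in> Obj A" and x: "x \<in> fib (on_obj S z) c"
  shows "\<exists>f y. ideal f \<and> Dom A f = c \<and> y \<in> fib (on_obj S z) (Cod A f) \<and> x = act (on_obj S z) f y"
proof -
  have SO: "on_obj S z \<in> Obj E" using z by simp
  have h: "on_arr S (\<eta> z) \<in> hom E (on_obj S z) (SN (on_obj S z))"
    by (rule P.L.F_hom[OF P.unit_hom[OF z]])
  have "ap (\<sigma> (on_obj S z)) c (ap (on_arr S (\<eta> z)) c x) = x"
    using A.ap_comp[OF h c x, of "\<sigma> (on_obj S z)"] P.tri1[OF z] c x by simp
  then show ?thesis using image_ideal[OF SO c A.ap_in[OF h c x]] by auto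
qed

text \<open>The arrow \<open>f\<close> comes from an element \<open>w\<close> of
  \<open>SN Y\<close>, and \<open>w\<close> in turn is the restriction of some \<open>w'\<close>
  along a member \<open>h\<close> of the ideal. The arrow that \<open>w'\<close> gives is the other
  factor.\<close>

lemma ideal_idempotent:
  assumes f: "ideal f"
  shows "\<exists>g h. ideal g \<and> ideal h \<and> Dom A h = Dom A f \<and> Cod A h = Dom A g \<and> Cod A g = Cod A f \<and> f = g \<odot>\<^bsub>A\<^esub> h"
proof -
  have fa: "f \<in> Arr A" and D: "Dom A f \<in> Obj A" using idealD[OF f] by auto
  obtain Y i w where Y: "A.represents Y (Cod A f) i" and w: "w \<in> fib (SN Y) (Dom A f)"
    "ap (\<sigma> Y) (Dom A f) w = act Y f i" using f unfolding ideal_def by blast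
  note YO = A.representsD(1)[OF Y] and i = A.representsD(3)[OF Y]
  have NO: "on_obj N Y \<in> Obj M" using YO by simp
  obtain h w' where h: "ideal h" "Dom A h = Dom A f" and w': "w' \<in> fib (SN Y) (Cod A h)" "w = act (SN Y) h w'"
    using S_generated_ideal[OF NO D w(1)] by blast
  have ha: "h \<in> Arr A" and hC: "Cod A h \<in> Obj A" using idealD[OF h(1)] by auto
  have hh: "h \<in> hom A (Dom A f) (Cod A h)" using ha h(2) by (simp add: hom_def)
  obtain g where g: "g \<in> hom A (Cod A h) (Cod A f)" "ap (\<sigma> Y) (Cod A h) w' = act Y g i"
    using A.representsD(4)[OF Y hC A.ap_in[OF \<sigma>_hom[OF YO] hC w'(1)]] by blast
  have gs: "g \<in> Arr A" "Dom A g = Cod A h" "Cod A g = Cod A f" using g(1) by (auto simp: hom_def)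
  have gI: "ideal g" unfolding ideal_def gs using gs(1) Y w'(1) g(2) by blast
  have fe: "f = g \<odot>\<^bsub>A\<^esub> h"
  proof (rule A.representsD(5)[OF Y])
    show "f \<in> hom A (Dom A f) (Cod A f)" using fa by (simp add: hom_def)
    show "g \<odot>\<^bsub>A\<^esub> h \<in> hom A (Dom A f) (Cod A f)" by (rule A.comp_hom[OF hh g(1)])
    show "act Y f i = act Y (g \<odot>\<^bsub>A\<^esub> h) i"
      using A.ap_nat[OF \<sigma>_hom[OF YO] hh w'(1)] w(2) w'(2) g(2) A.act_comp[OF YO ha gs(1)] gs i by simp
  qed
  show ?thesis
    by (intro exI[of _ g] exI[of _ h] conjI gI fe h gs(3) gs(2)[symmetric])
qed

text \<open>The mono part is \<open>f\<close> composed with a section of the split epi, and the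
  ideal absorbs composition.\<close>

lemma ideal_mono:
  assumes f: "ideal f"
  shows "\<exists>m e. mono_arr A m \<and> ideal m \<and> e \<in> hom A (Dom A f) (Dom A m) \<and> Cod A m = Cod A f \<and> f = m \<odot>\<^bsub>A\<^esub> e"
proof -
  have fa: "f \<in> Arr A" by (rule idealD[OF f])
  obtain e m where e: "split_epi_arr A e" and m: "mono_arr A m" and em: "Cod A e = Dom A m" "f = m \<odot>\<^bsub>A\<^esub> e"
    using factorizations fa unfolding split_epi_mono_factorizations_def by blast
  have ea: "e \<in> Arr A" and ma: "m \<in> Arr A" using e m by (auto simp: split_epi_arr_def mono_arr_def)
  have D: "Dom A f = Dom A e" "Cod A f = Cod A m" using em ea ma by simp_all
  obtain s where s: "s \<in> hom A (Cod A e) (Dom A e)" "e \<odot>\<^bsub>A\<^esub> s = Idn A (Cod A e)"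
    using e by (auto simp: split_epi_arr_def)
  have ss: "s \<in> Arr A" "Dom A s = Dom A m" "Cod A s = Dom A e" using s em by (auto simp: hom_def)
  have "f \<odot>\<^bsub>A\<^esub> s = m" using em ea ma ss s(2) by simp
  then have "ideal m" using ideal_right[OF f ss(1)] ss D by simp
  then show ?thesis using m em D ea by (intro exI[of _ m] exI[of _ e]) (simp add: hom_def)
qed

text \<open>The chain ascends among the subobjects of \<open>?c\<close>: when a mono of the ideal is
  written as \<open>g \<odot> h\<close> in the ideal, the mono part \<open>g'\<close> of
  \<open>g\<close> is a larger subobject. The step at which the chain stops is an isomorphism that
  lies in the ideal.\<close>

lemma ideal_factors_through_identity:
  assumes f: "ideal f"
  shows "\<exists>b m h. b \<in> Obj A \<and> ideal (Idn A b) \<and> m \<in> hom A b (Cod A f) \<and> h \<in> hom A (Dom A f) b \<and> f = m \<odot>\<^bsub>A\<^esub> h"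
proof -
  let ?c = "Cod A f"
  \<comment> \<open>Not only the stages but also the steps between them are kept in the ideal; the
    step that turns out invertible then puts an identity into the ideal.\<close>
  let ?P = "\<lambda>m. mono_arr A m \<and> ideal m \<and> Cod A m = ?c"
  let ?Q = "\<lambda>m m'. \<exists>h. h \<in> hom A (Dom A m) (Dom A m') \<and> mono_arr A h \<and> ideal h \<and> m = m' \<odot>\<^bsub>A\<^esub> h"
  have step: "\<exists>m'. ?P m' \<and> ?Q m m'" if m: "?P m" for m
  proof -
    obtain g h where g: "ideal g" "ideal h" "Dom A h = Dom A m" "Cod A h = Dom A g" "Cod A g = ?c" "m = g \<odot>\<^bsub>A\<^esub> h"
      using ideal_idempotent[of m] m by auto
    obtain g' e where g': "mono_arr A g'" "ideal g'" "e \<in> hom A (Dom A g) (Dom A g')" "Cod A g' = Cod A g" "g = g' \<odot>\<^bsub>A\<^esub> e"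
      using ideal_mono[OF g(1)] by blast
    have a: "h \<in> Arr A" "g' \<in> Arr A" "m \<in> Arr A" using idealD g(2) g'(2) m by auto
    have es: "e \<in> Arr A" "Dom A e = Dom A g" "Cod A e = Dom A g'" using g'(3) by (auto simp: hom_def)
    have eh: "e \<odot>\<^bsub>A\<^esub> h \<in> hom A (Dom A m) (Dom A g')" using es a g by (simp add: hom_def)
    have "(g' \<odot>\<^bsub>A\<^esub> e) \<odot>\<^bsub>A\<^esub> h = g' \<odot>\<^bsub>A\<^esub> (e \<odot>\<^bsub>A\<^esub> h)"
      using es a g(4) by (intro A.assoc) auto
    then have mm: "m = g' \<odot>\<^bsub>A\<^esub> (e \<odot>\<^bsub>A\<^esub> h)" unfolding g'(5)[symmetric] g(6)[symmetric] .
    \<comment> \<open>The step is the first factor of the mono \<open>m\<close>, hence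
      monic.\<close>
    have "mono_arr A (e \<odot>\<^bsub>A\<^esub> h)"
      unfolding mono_arr_def
    proof (intro conjI allI ballI impI)
      show "e \<odot>\<^bsub>A\<^esub> h \<in> Arr A" using eh by (simp add: hom_def)
      fix x u v assume "u \<in> hom A x (Dom A (e \<odot>\<^bsub>A\<^esub> h))" "v \<in> hom A x (Dom A (e \<odot>\<^bsub>A\<^esub> h))"
        and eq: "(e \<odot>\<^bsub>A\<^esub> h) \<odot>\<^bsub>A\<^esub> u = (e \<odot>\<^bsub>A\<^esub> h) \<odot>\<^bsub>A\<^esub> v"
      then have uv: "u \<in> hom A x (Dom A m)" "v \<in> hom A x (Dom A m)" using eh by (auto simp: hom_def)
      have ehs: "e \<odot>\<^bsub>A\<^esub> h \<in> Arr A" "Dom A (e \<odot>\<^bsub>A\<^esub> h) = Dom A m" "Cod A (e \<odot>\<^bsub>A\<^esub> h) = Dom A g'"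
        using eh unfolding hom_def by blast+
      have mt: "m \<odot>\<^bsub>A\<^esub> t = g' \<odot>\<^bsub>A\<^esub> ((e \<odot>\<^bsub>A\<^esub> h) \<odot>\<^bsub>A\<^esub> t)" if "t \<in> hom A x (Dom A m)" for t
        unfolding mm using that a ehs by (intro A.assoc) (auto simp: hom_def)
      have "m \<odot>\<^bsub>A\<^esub> u = m \<odot>\<^bsub>A\<^esub> v" unfolding mt[OF uv(1)] mt[OF uv(2)] eq ..
      then show "u = v" using m uv unfolding mono_arr_def by blast
    qed
    moreover have "ideal (e \<odot>\<^bsub>A\<^esub> h)" by (rule ideal_left[OF g(2)]) (use es g in auto)
    ultimately show ?thesis using g' g(5) eh mm by auto
  qed
  obtain m0 e0 where m0: "mono_arr A m0" "ideal m0" "e0 \<in> hom A (Dom A f) (Dom A m0)" "Cod A m0 = ?c" "f = m0 \<odot>\<^bsub>A\<^esub> e0"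
    using ideal_mono[OF f] by blast
  \<comment> \<open>The clause on \<open>n = 0\<close> pins the start of the chain to
    \<open>m0\<close>, since \<open>f\<close> is to factor through its stages.\<close>
  have "\<exists>F. \<forall>n. (?P (F n) \<and> (n = 0 \<longrightarrow> F n = m0)) \<and> ?Q (F n) (F (Suc n))"
  proof (rule dependent_nat_choice)
    show "\<exists>m. ?P m \<and> (0 = (0 :: nat) \<longrightarrow> m = m0)" using m0 by auto
    show "\<exists>m'. (?P m' \<and> (Suc n = 0 \<longrightarrow> m' = m0)) \<and> ?Q m m'" if "?P m \<and> (n = 0 \<longrightarrow> m = m0)" for m n
      using step[of m] that by auto
  qed
  then obtain F where "\<forall>n. (?P (F n) \<and> (n = 0 \<longrightarrow> F n = m0)) \<and> ?Q (F n) (F (Suc n))" ..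
  then have FP: "mono_arr A (F n)" "ideal (F n)" "Cod A (F n) = ?c" and F0: "F 0 = m0" and FQ: "?Q (F n) (F (Suc n))" for n
    by auto
  from FQ have "\<forall>n. \<exists>h. h \<in> hom A (Dom A (F n)) (Dom A (F (Suc n))) \<and> mono_arr A h \<and> ideal h \<and> F n = F (Suc n) \<odot>\<^bsub>A\<^esub> h"
    by blast
  then obtain h where h: "h n \<in> hom A (Dom A (F n)) (Dom A (F (Suc n)))" "mono_arr A (h n)" "ideal (h n)"
    "F n = F (Suc n) \<odot>\<^bsub>A\<^esub> h n" for n by metis
  have Fa: "F n \<in> Arr A" for n using idealD FP(2) by blast
  have hs: "h n \<in> Arr A" "Dom A (h n) = Dom A (F n)" "Cod A (h n) = Dom A (F (Suc n))" for n
    using h(1)[of n] by (auto simp: hom_def)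
  have c: "?c \<in> Obj A" using idealD[OF f] by simp
  have "\<exists>t. iso_arr A (h t)"
  proof (rule acc[unfolded ascending_chain_condition_def, rule_format, OF c, of "\<lambda>n. Dom A (F n)" h F])
    fix n show "Dom A (F n) \<in> Obj A \<and> h n \<in> hom A (Dom A (F n)) (Dom A (F (Suc n))) \<and> mono_arr A (h n) \<and>
      F n \<in> hom A (Dom A (F n)) ?c \<and> mono_arr A (F n) \<and> F (Suc n) \<odot>\<^bsub>A\<^esub> h n = F n"
      using h[of n] FP[of n] Fa[of n] by (simp add: hom_def)
  qed
  then obtain t where t: "iso_arr A (h t)" ..
  \<comment> \<open>The initial mono factors through every later stage, so \<open>f\<close> can be
    rewritten at the stage where the chain stops.\<close>
  have fac: "\<exists>k. k \<in> hom A (Dom A m0) (Dom A (F n)) \<and> m0 = F n \<odot>\<^bsub>A\<^esub> k" for n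
  proof (induction n)
    case 0
    have "Idn A (Dom A m0) \<in> hom A (Dom A m0) (Dom A m0)" using Fa[of 0] F0 by (simp add: hom_def)
    then show ?case using Fa[of 0] F0 by (intro exI[of _ "Idn A (Dom A m0)"]) simp
  next
    case (Suc n)
    then obtain k where k: "k \<in> hom A (Dom A m0) (Dom A (F n))" "m0 = F n \<odot>\<^bsub>A\<^esub> k" by blast
    have ks: "k \<in> Arr A" "Cod A k = Dom A (F n)" using k(1) by (auto simp: hom_def)
    have "(F (Suc n) \<odot>\<^bsub>A\<^esub> h n) \<odot>\<^bsub>A\<^esub> k = F (Suc n) \<odot>\<^bsub>A\<^esub> (h n \<odot>\<^bsub>A\<^esub> k)"
      using ks hs Fa by (intro A.assoc) auto
    then have "m0 = F (Suc n) \<odot>\<^bsub>A\<^esub> (h n \<odot>\<^bsub>A\<^esub> k)" using k(2) h(4)[of n] by simp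
    then show ?case using A.comp_hom[OF k(1) h(1)] by blast
  qed
  let ?b = "Dom A (F (Suc t))"
  obtain k where k: "k \<in> hom A (Dom A m0) ?b" "m0 = F (Suc t) \<odot>\<^bsub>A\<^esub> k" using fac by blast
  have ks: "k \<in> Arr A" "Dom A k = Dom A m0" "Cod A k = ?b" using k(1) by (auto simp: hom_def)
  have e0s: "e0 \<in> Arr A" "Cod A e0 = Dom A m0" using m0(3) by (auto simp: hom_def)
  \<comment> \<open>The ideal contains the invertible step \<open>h t\<close>, hence its composite
    with the inverse, which is the identity of the codomain of the step; this is why the object sits
    at \<open>Suc t\<close>.\<close>
  have "ideal (h t \<odot>\<^bsub>A\<^esub> inv_arr A (h t))" by (rule ideal_right[OF h(3)]) (use t in auto)
  then have "ideal (Idn A ?b)" using t hs(3)[of t] by simp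
  moreover have "(F (Suc t) \<odot>\<^bsub>A\<^esub> k) \<odot>\<^bsub>A\<^esub> e0 = F (Suc t) \<odot>\<^bsub>A\<^esub> (k \<odot>\<^bsub>A\<^esub> e0)"
    using ks e0s Fa by (intro A.assoc) auto
  then have "f = F (Suc t) \<odot>\<^bsub>A\<^esub> (k \<odot>\<^bsub>A\<^esub> e0)"
    unfolding k(2)[symmetric] m0(5)[symmetric] .
  moreover have "F (Suc t) \<in> hom A ?b ?c" "?b \<in> Obj A" using Fa FP(3) by (auto simp: hom_def)
  ultimately show ?thesis using A.comp_hom[OF m0(3) k(1)] by blast
qed

section \<open>Objects whose identity lies in the ideal\<close>

definition good :: "'o \<Rightarrow> bool" where
  "good b \<longleftrightarrow> b \<in> Obj A \<and> ideal (Idn A b)"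

text \<open>An element of \<open>SN Y\<close> over the universal element \<open>i\<close> is, by the
  Yoneda lemma, a section of the counit. This makes the representable a retract of
  \<open>SN Y\<close> and lets maps of \<open>M\<close> be studied on it.\<close>

lemma good_section:
  assumes b: "good b" and Y: "A.represents Y b i"
  obtains s where "s \<in> hom E Y (SN Y)" "\<sigma> Y \<odot>\<^bsub>E\<^esub> s = Idn E Y"
proof -
  note YO = A.representsD(1)[OF Y] and i = A.representsD(3)[OF Y]
  have bO: "b \<in> Obj A" using b by (simp add: good_def)
  have SO: "SN Y \<in> Obj E" using YO by simp
  obtain w where w: "w \<in> fib (SN Y) b" "ap (\<sigma> Y) b w = i"
    using ideal_image[of "Idn A b" Y i] b bO YO i by (auto simp: good_def)
  obtain s where s: "s \<in> hom E Y (SN Y)" "ap s b i = w" by (rule A.yoneda_exists[OF Y SO w(1)])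
  have "\<sigma> Y \<odot>\<^bsub>E\<^esub> s = Idn E Y"
    by (rule A.yoneda_eq[OF Y A.psh_comp_hom[OF s(1) \<sigma>_hom[OF YO]] P.L.B.idn_hom[OF YO]])
       (use w(2) s(2) bO i in \<open>simp add: A.ap_comp[OF s(1)]\<close>)
  with s(1) show ?thesis by (rule that)
qed

lemma N_\<sigma>: "Y \<in> Obj E \<Longrightarrow> on_arr N (\<sigma> Y) = inv_arr M (\<eta> (on_obj N Y))"
proof -
  assume Y: "Y \<in> Obj E"
  then have NO: "on_obj N Y \<in> Obj M" by simp
  note iso = eta_iso[OF NO]
  have "(on_arr N (\<sigma> Y) \<odot>\<^bsub>M\<^esub> \<eta> (on_obj N Y)) \<odot>\<^bsub>M\<^esub> inv_arr M (\<eta> (on_obj N Y)) = on_arr N (\<sigma> Y)"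
    using Y NO iso by simp
  then show ?thesis using P.tri2[OF Y] iso NO by simp
qed

text \<open>\<open>N\<close> sends the counit to the inverse of the unit, so it must send any
  section of the counit to the unit.\<close>

lemma N_section:
  assumes Y: "Y \<in> Obj E" and s: "s \<in> hom E Y (SN Y)" "\<sigma> Y \<odot>\<^bsub>E\<^esub> s = Idn E Y"
  shows "on_arr N s = \<eta> (on_obj N Y)"
proof -
  have ss: "s \<in> Arr E" "Dom E s = Y" "Cod E s = SN Y" using s(1) by (auto simp: hom_def)
  have NO: "on_obj N Y \<in> Obj M" using Y by simp
  note iso = eta_iso[OF NO]
  have "inv_arr M (\<eta> (on_obj N Y)) \<odot>\<^bsub>M\<^esub> on_arr N s = Idn M (on_obj N Y)"
    using P.R.F_comp[of s "\<sigma> Y"] ss s(2) Y N_\<sigma>[OF Y] by simp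
  then have "\<eta> (on_obj N Y) \<odot>\<^bsub>M\<^esub> (inv_arr M (\<eta> (on_obj N Y)) \<odot>\<^bsub>M\<^esub> on_arr N s) = \<eta> (on_obj N Y)"
    using NO by simp
  then show ?thesis using ss Y NO iso by simp
qed

text \<open>\<open>S\<close> preserves epis, epis of presheaves are surjective, and a representable
  lifts along surjections. The lift returns to \<open>M\<close> by applying \<open>N\<close> and
  cancelling the invertible unit.\<close>

lemma good_projective:
  assumes b: "good b" and Y: "A.represents Y b i" and e: "epi_arr M e" "e \<in> hom M z1 z2"
    and h: "h \<in> hom M (on_obj N Y) z2"
  obtains l where "l \<in> hom M (on_obj N Y) z1" "e \<odot>\<^bsub>M\<^esub> l = h"
proof -
  note YO = A.representsD(1)[OF Y] and i = A.representsD(3)[OF Y]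
  have bO: "b \<in> Obj A" using b by (simp add: good_def)
  have es: "e \<in> Arr M" "Dom M e = z1" "Cod M e = z2" using e(2) by (auto simp: hom_def)
  have hs: "h \<in> Arr M" "Dom M h = on_obj N Y" "Cod M h = z2" using h by (auto simp: hom_def)
  have zO: "z1 \<in> Obj M" "z2 \<in> Obj M" "on_obj N Y \<in> Obj M" using es P.L.A.dom_obj[OF es(1)] P.L.A.cod_obj[OF es(1)] YO by auto
  obtain s where s: "s \<in> hom E Y (SN Y)" "\<sigma> Y \<odot>\<^bsub>E\<^esub> s = Idn E Y" by (rule good_section[OF b Y])
  have ss: "s \<in> Arr E" "Dom E s = Y" "Cod E s = SN Y" using s(1) by (auto simp: hom_def)
  have Se: "on_arr S e \<in> hom E (on_obj S z1) (on_obj S z2)" by (rule P.L.F_hom[OF e(2)])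
  have Sh: "on_arr S h \<in> hom E (SN Y) (on_obj S z2)" by (rule P.L.F_hom[OF h])
  have "ap (on_arr S h) b (ap s b i) \<in> ap (on_arr S e) b ` fib (on_obj S z1) b"
    unfolding A.psh_epi_surj[OF P.left_adjoint_epi[OF e(1)] Se bO]
    by (rule A.ap_in[OF Sh bO A.ap_in[OF s(1) bO i]])
  then obtain x where x: "ap (on_arr S h) b (ap s b i) = ap (on_arr S e) b x" "x \<in> fib (on_obj S z1) b"
    by (rule imageE)
  obtain l where l: "l \<in> hom E Y (on_obj S z1)" "ap l b i = x"
    by (rule A.yoneda_exists[OF Y A.psh_arrD(1)[OF Se] x(2)])
  have ls: "l \<in> Arr E" "Dom E l = Y" "Cod E l = on_obj S z1" using l(1) by (auto simp: hom_def)
  have eq: "on_arr S e \<odot>\<^bsub>E\<^esub> l = on_arr S h \<odot>\<^bsub>E\<^esub> s"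
    by (rule A.yoneda_eq[OF Y A.psh_comp_hom[OF l(1) Se] A.psh_comp_hom[OF s(1) Sh]])
       (use l(2) x(1) bO i in \<open>simp add: A.ap_comp[OF l(1)] A.ap_comp[OF s(1)]\<close>)
  note iso = eta_iso[OF zO(1)] eta_iso[OF zO(2)]
  \<comment> \<open>The lift found in presheaves ends, after \<open>N\<close>, in the object
    \<open>N\<close> of \<open>S\<close> of \<open>z1\<close>; the inverse unit brings it to
    \<open>z1\<close>.\<close>
  define k where "k = inv_arr M (\<eta> z1) \<odot>\<^bsub>M\<^esub> on_arr N l"
  have ks: "k \<in> Arr M" "Dom M k = on_obj N Y" "Cod M k = z1" using iso ls zO by (auto simp: k_def)
  have "\<eta> z2 \<odot>\<^bsub>M\<^esub> (e \<odot>\<^bsub>M\<^esub> k) = (\<eta> z2 \<odot>\<^bsub>M\<^esub> e) \<odot>\<^bsub>M\<^esub> k" using ks es zO by simp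
  also have "\<dots> = on_arr N (on_arr S e) \<odot>\<^bsub>M\<^esub> (\<eta> z1 \<odot>\<^bsub>M\<^esub> k)" using P.unit_nat[OF es(1)] ks es zO by simp
  also have "\<dots> = on_arr N (on_arr S e \<odot>\<^bsub>E\<^esub> l)" using iso ls es zO by (simp add: k_def)
  also have "\<dots> = on_arr N (on_arr S h) \<odot>\<^bsub>M\<^esub> \<eta> (on_obj N Y)"
    unfolding eq using hs ss N_section[OF YO s] by simp
  also have "\<dots> = \<eta> z2 \<odot>\<^bsub>M\<^esub> h" using P.unit_nat[OF hs(1)] hs by simp
  finally have "e \<odot>\<^bsub>M\<^esub> k = h"
    by (rule P.L.A.iso_cancel_left[OF iso(2)]) (use ks es hs zO in auto)
  moreover have "k \<in> hom M (on_obj N Y) z1" using ks by (simp add: hom_def)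
  ultimately show ?thesis by (intro that)
qed

text \<open>The map \<open>h\<close> is the image under \<open>N\<close> of a map \<open>k\<close>
  from the representable, and \<open>k\<close> is given by a single element of \<Delta>. That
  element lies on a global point, so \<open>k\<close>, and with it \<open>h\<close>, factors through
  a terminal object.\<close>

lemma good_constant:
  assumes b: "good b" and Y: "A.represents Y b i" and D: "\<Delta> \<in> Obj E"
    and const: "\<And>w. w \<in> fib \<Delta> b \<Longrightarrow> \<exists>T s pt. terminal_obj E T \<and> s \<in> fib T b \<and> pt \<in> hom E T \<Delta> \<and> ap pt b s = w"
    and h: "h \<in> hom M (on_obj N Y) (on_obj N \<Delta>)"
    and u: "u \<in> hom M x (on_obj N Y)" and v: "v \<in> hom M x (on_obj N Y)"
  shows "h \<odot>\<^bsub>M\<^esub> u = h \<odot>\<^bsub>M\<^esub> v"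
proof -
  note YO = A.representsD(1)[OF Y] and i = A.representsD(3)[OF Y]
  have bO: "b \<in> Obj A" using b by (simp add: good_def)
  have hs: "h \<in> Arr M" "Dom M h = on_obj N Y" "Cod M h = on_obj N \<Delta>" using h by (auto simp: hom_def)
  have us: "u \<in> Arr M" "Dom M u = x" "Cod M u = on_obj N Y" "v \<in> Arr M" "Dom M v = x" "Cod M v = on_obj N Y"
    using u v by (auto simp: hom_def)
  have zO: "on_obj N Y \<in> Obj M" "on_obj N \<Delta> \<in> Obj M" "x \<in> Obj M" using YO D us P.L.A.dom_obj[OF us(1)] by auto
  obtain s where s: "s \<in> hom E Y (SN Y)" "\<sigma> Y \<odot>\<^bsub>E\<^esub> s = Idn E Y" by (rule good_section[OF b Y])
  have ss: "s \<in> Arr E" "Dom E s = Y" "Cod E s = SN Y" using s(1) by (auto simp: hom_def)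
  \<comment> \<open>The transpose of \<open>h\<close> precomposed with the section \<open>s\<close>;
    since \<open>N\<close> takes \<open>s\<close> to the unit, it takes \<open>k\<close> back to
    \<open>h\<close>.\<close>
  define k where "k = \<sigma> \<Delta> \<odot>\<^bsub>E\<^esub> (on_arr S h \<odot>\<^bsub>E\<^esub> s)"
  have k: "k \<in> hom E Y \<Delta>"
    unfolding k_def by (intro A.psh_comp_hom[of _ _ "SN \<Delta>"] A.psh_comp_hom[of _ _ "SN Y"] s(1) P.L.F_hom[OF h] \<sigma>_hom[OF D])
  have "on_arr N k = on_arr N (\<sigma> \<Delta>) \<odot>\<^bsub>M\<^esub> (on_arr N (on_arr S h) \<odot>\<^bsub>M\<^esub> \<eta> (on_obj N Y))"
    using hs ss D N_section[OF YO s] by (simp add: k_def)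
  also have "\<dots> = (on_arr N (\<sigma> \<Delta>) \<odot>\<^bsub>M\<^esub> \<eta> (on_obj N \<Delta>)) \<odot>\<^bsub>M\<^esub> h"
    using P.unit_nat[OF hs(1)] hs D zO by simp
  also have "\<dots> = h" unfolding P.tri2[OF D] using hs by simp
  finally have kh: "on_arr N k = h" .
  obtain T w pt where T: "terminal_obj E T" "w \<in> fib T b" "pt \<in> hom E T \<Delta>" "ap pt b w = ap k b i"
    using const[OF A.ap_in[OF k bO i]] by blast
  have TO: "T \<in> Obj E" using T(1) by (simp add: terminal_obj_def)
  obtain w' where w': "w' \<in> hom E Y T" "ap w' b i = w" by (rule A.yoneda_exists[OF Y TO T(2)])
  have "pt \<odot>\<^bsub>E\<^esub> w' = k"
    by (rule A.yoneda_eq[OF Y A.psh_comp_hom[OF w'(1) T(3)] k])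
       (use T(4) w'(2) bO i in \<open>simp add: A.ap_comp[OF w'(1)]\<close>)
  moreover have ws: "w' \<in> Arr E" "Dom E w' = Y" "Cod E w' = T" "pt \<in> Arr E" "Dom E pt = T" "Cod E pt = \<Delta>"
    using w'(1) T(3) by (auto simp: hom_def)
  ultimately have hh: "h = on_arr N pt \<odot>\<^bsub>M\<^esub> on_arr N w'" using kh by auto
  have "terminal_obj M (on_obj N T)"
    by (rule lex_terminal[OF right_adjoint_lex[OF P.adjoint] T(1)])
  then have "\<exists>!t. t \<in> hom M x (on_obj N T)" using zO(3) unfolding terminal_obj_def by blast
  moreover have "on_arr N w' \<odot>\<^bsub>M\<^esub> u \<in> hom M x (on_obj N T)" "on_arr N w' \<odot>\<^bsub>M\<^esub> v \<in> hom M x (on_obj N T)"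
    using us ws by (simp_all add: hom_def)
  ultimately have "on_arr N w' \<odot>\<^bsub>M\<^esub> u = on_arr N w' \<odot>\<^bsub>M\<^esub> v" by blast
  then show ?thesis using us ws unfolding hh by simp
qed

text \<open>After splitting the quotient map, \<open>m \<odot> l\<close> embeds \<open>g\<close>
  over \<open>G\<close> into a product. Its component in the constant object equalizes
  \<open>u\<close> and \<open>v\<close> by \<open>good_constant\<close>, and its component in
  \<open>G\<close> is \<open>g\<close>, which equalizes them by assumption.\<close>

lemma good_mono:
  assumes b: "good b" and Y: "A.represents Y b i" and g: "g \<in> hom M (on_obj N Y) G"
    and u: "u \<in> hom M x (on_obj N Y)" and v: "v \<in> hom M x (on_obj N Y)" and eq: "g \<odot>\<^bsub>M\<^esub> u = g \<odot>\<^bsub>M\<^esub> v"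
  shows "u = v"
proof -
  note YO = A.representsD(1)[OF Y]
  have bO: "b \<in> Obj A" using b by (simp add: good_def)
  have gs: "g \<in> Arr M" "Dom M g = on_obj N Y" "Cod M g = G" using g by (auto simp: hom_def)
  have us: "u \<in> Arr M" "Dom M u = x" "Cod M u = on_obj N Y" "v \<in> Arr M" "Dom M v = x" "Cod M v = on_obj N Y"
    using u v by (auto simp: hom_def)
  have xO: "x \<in> Obj M" using P.L.A.dom_obj[OF us(1)] us by simp
  have "g \<in> Obj (slice M G)" using gs by simp
  from localic[OF this] obtain W j \<Delta> where W: "W \<in> Obj M"
    and sub: "subquotient (slice M G) g (on_obj (inverse_image q) W)"
    and D: "\<Delta> \<in> Obj E" and j: "j \<in> hom M W (on_obj N \<Delta>)" "iso_arr M j"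
    and const: "\<forall>b \<in> Obj A. \<forall>w \<in> fib \<Delta> b. \<exists>T s pt. terminal_obj E T \<and> s \<in> fib T b \<and>
          pt \<in> hom E T \<Delta> \<and> ap pt b s = w" by blast
  obtain m' e' where m': "mono_arr (slice M G) m'" and e': "epi_arr (slice M G) e'"
    and me: "Dom (slice M G) m' = Dom (slice M G) e'" "Cod (slice M G) m' = on_obj (inverse_image q) W" "Cod (slice M G) e' = g"
    using sub unfolding subquotient_def by blast
  obtain s m r where ms: "m' = (s, m, r)" by (cases m') auto
  obtain e where es: "e' = (s, e, g)" and r: "r = on_obj (inverse_image q) W" using me ms by (cases e') auto
  have mA: "(s, m, r) \<in> Arr (slice M G)" using m' ms by (simp add: mono_arr_def)
  have eA: "(s, e, g) \<in> Arr (slice M G)" using e' es by (simp add: epi_arr_def)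
  have ss: "s \<in> Arr M" "Cod M s = G" "r \<in> Arr M" "Cod M r = G" "m \<in> Arr M" "Dom M m = Dom M s" "Cod M m = Dom M r" "r \<odot>\<^bsub>M\<^esub> m = s"
    "e \<in> Arr M" "Dom M e = Dom M s" "Cod M e = on_obj N Y" "g \<odot>\<^bsub>M\<^esub> e = s"
    using mA eA gs by (auto simp: hom_def)
  obtain \<pi> where prod: "is_product M W G (Dom M r) \<pi> r"
    using slice_geom W r unfolding slice_geom_def Let_def by blast
  have \<pi>: "\<pi> \<in> Arr M" "Dom M \<pi> = Dom M r" "Cod M \<pi> = W" using prod by (auto simp: is_product_def hom_def)
  have NYO: "on_obj N Y \<in> Obj M" using YO by simp
  have idY: "Idn M (on_obj N Y) \<in> hom M (on_obj N Y) (on_obj N Y)" by (rule P.L.A.idn_hom[OF NYO])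
  \<comment> \<open>Projectivity is a statement in \<open>M\<close>, so the quotient map has to be
    epic there and not just in the slice.\<close>
  have "epi_arr M e" by (rule epi_slice_imp_epi[OF P.L.A.category_axioms slice_geom e'[unfolded es]])
  moreover have "e \<in> hom M (Dom M s) (on_obj N Y)" using ss by (simp add: hom_def)
  ultimately obtain l where l: "l \<in> hom M (on_obj N Y) (Dom M s)" "e \<odot>\<^bsub>M\<^esub> l = Idn M (on_obj N Y)"
    using good_projective[OF b Y _ _ idY] by blast
  have ls: "l \<in> Arr M" "Dom M l = on_obj N Y" "Cod M l = Dom M s" using l(1) by (auto simp: hom_def)
  have js: "j \<in> Arr M" "Dom M j = W" "Cod M j = on_obj N \<Delta>" using j by (auto simp: hom_def)
  let ?p = "m \<odot>\<^bsub>M\<^esub> l"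
  have ps: "?p \<in> Arr M" "Dom M ?p = on_obj N Y" "Cod M ?p = Dom M r" using ls ss by simp_all
  have jp: "j \<odot>\<^bsub>M\<^esub> (\<pi> \<odot>\<^bsub>M\<^esub> ?p) \<in> hom M (on_obj N Y) (on_obj N \<Delta>)" using js \<pi> ps by (simp add: hom_def)
  have "(j \<odot>\<^bsub>M\<^esub> (\<pi> \<odot>\<^bsub>M\<^esub> ?p)) \<odot>\<^bsub>M\<^esub> u = (j \<odot>\<^bsub>M\<^esub> (\<pi> \<odot>\<^bsub>M\<^esub> ?p)) \<odot>\<^bsub>M\<^esub> v"
    by (rule good_constant[OF b Y D _ jp u v]) (use const bO in blast)
  then have "j \<odot>\<^bsub>M\<^esub> ((\<pi> \<odot>\<^bsub>M\<^esub> ?p) \<odot>\<^bsub>M\<^esub> u) = j \<odot>\<^bsub>M\<^esub> ((\<pi> \<odot>\<^bsub>M\<^esub> ?p) \<odot>\<^bsub>M\<^esub> v)"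
    using js \<pi> ls ss us by simp
  then have "(\<pi> \<odot>\<^bsub>M\<^esub> ?p) \<odot>\<^bsub>M\<^esub> u = (\<pi> \<odot>\<^bsub>M\<^esub> ?p) \<odot>\<^bsub>M\<^esub> v"
    by (rule P.L.A.iso_cancel_left[OF j(2)]) (use js \<pi> ls ss us in auto)
  then have 1: "\<pi> \<odot>\<^bsub>M\<^esub> (?p \<odot>\<^bsub>M\<^esub> u) = \<pi> \<odot>\<^bsub>M\<^esub> (?p \<odot>\<^bsub>M\<^esub> v)" using \<pi> ls ss us by simp
  have "(r \<odot>\<^bsub>M\<^esub> m) \<odot>\<^bsub>M\<^esub> l = r \<odot>\<^bsub>M\<^esub> ?p" "(g \<odot>\<^bsub>M\<^esub> e) \<odot>\<^bsub>M\<^esub> l = g \<odot>\<^bsub>M\<^esub> (e \<odot>\<^bsub>M\<^esub> l)"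
    using ls ss gs by (intro P.L.A.assoc; simp)+
  then have rp: "r \<odot>\<^bsub>M\<^esub> ?p = g" unfolding ss(8,12) l(2) using gs by simp
  have "(r \<odot>\<^bsub>M\<^esub> ?p) \<odot>\<^bsub>M\<^esub> u = (r \<odot>\<^bsub>M\<^esub> ?p) \<odot>\<^bsub>M\<^esub> v" using eq rp by simp
  then have 2: "r \<odot>\<^bsub>M\<^esub> (?p \<odot>\<^bsub>M\<^esub> u) = r \<odot>\<^bsub>M\<^esub> (?p \<odot>\<^bsub>M\<^esub> v)" using ls ss us by simp
  have pu: "?p \<odot>\<^bsub>M\<^esub> u \<in> hom M x (Dom M r)" "?p \<odot>\<^bsub>M\<^esub> v \<in> hom M x (Dom M r)"
    using ls ss us by (auto simp: hom_def)
  then have "\<pi> \<odot>\<^bsub>M\<^esub> (?p \<odot>\<^bsub>M\<^esub> u) \<in> hom M x W" "r \<odot>\<^bsub>M\<^esub> (?p \<odot>\<^bsub>M\<^esub> u) \<in> hom M x G"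
    using \<pi> ss by (auto simp: hom_def)
  then have "\<exists>!h. h \<in> hom M x (Dom M r) \<and> \<pi> \<odot>\<^bsub>M\<^esub> h = \<pi> \<odot>\<^bsub>M\<^esub> (?p \<odot>\<^bsub>M\<^esub> u) \<and> r \<odot>\<^bsub>M\<^esub> h = r \<odot>\<^bsub>M\<^esub> (?p \<odot>\<^bsub>M\<^esub> u)"
    using prod xO unfolding is_product_def by blast
  then have puv: "?p \<odot>\<^bsub>M\<^esub> u = ?p \<odot>\<^bsub>M\<^esub> v" using pu 1 2 by metis
  have sl: "s \<odot>\<^bsub>M\<^esub> l = g" using \<open>(r \<odot>\<^bsub>M\<^esub> m) \<odot>\<^bsub>M\<^esub> l = r \<odot>\<^bsub>M\<^esub> ?p\<close> rp unfolding ss(8) by simp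
  let ?y = "g \<odot>\<^bsub>M\<^esub> u"
  \<comment> \<open>\<open>m\<close> is monic only against maps over \<open>G\<close>. Since
    \<open>u\<close> and \<open>v\<close> agree after \<open>g\<close>, both composites with
    \<open>l\<close> are maps from \<open>?y\<close> to \<open>s\<close> in the slice.\<close>
  have mono: "s1 = s2" if "s1 \<in> hom (slice M G) ?y s" "s2 \<in> hom (slice M G) ?y s"
    "(s, m, r) \<odot>\<^bsub>slice M G\<^esub> s1 = (s, m, r) \<odot>\<^bsub>slice M G\<^esub> s2" for s1 s2
    using m' that unfolding ms mono_arr_def slice_simps(3) by blast
  have "s \<odot>\<^bsub>M\<^esub> (l \<odot>\<^bsub>M\<^esub> u) = ?y" "s \<odot>\<^bsub>M\<^esub> (l \<odot>\<^bsub>M\<^esub> v) = ?y"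
    using P.L.A.assoc[of u l s] P.L.A.assoc[of v l s] sl eq ls ss us by simp_all
  then have "(?y, l \<odot>\<^bsub>M\<^esub> u, s) \<in> hom (slice M G) ?y s" "(?y, l \<odot>\<^bsub>M\<^esub> v, s) \<in> hom (slice M G) ?y s"
    using gs us ls ss by (auto simp: slice_hom_iff hom_def)
  moreover have "(s, m, r) \<odot>\<^bsub>slice M G\<^esub> (?y, l \<odot>\<^bsub>M\<^esub> u, s) = (s, m, r) \<odot>\<^bsub>slice M G\<^esub> (?y, l \<odot>\<^bsub>M\<^esub> v, s)"
    using puv ls ss us by simp
  ultimately have "(?y, l \<odot>\<^bsub>M\<^esub> u, s) = (?y, l \<odot>\<^bsub>M\<^esub> v, s)"
    by (rule mono)
  then have "l \<odot>\<^bsub>M\<^esub> u = l \<odot>\<^bsub>M\<^esub> v" by simp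
  then have "(e \<odot>\<^bsub>M\<^esub> l) \<odot>\<^bsub>M\<^esub> u = (e \<odot>\<^bsub>M\<^esub> l) \<odot>\<^bsub>M\<^esub> v" using ls ss us by simp
  then show ?thesis using l(2) us by simp
qed

text \<open>Write \<open>f\<close> as a mono after a split epi \<open>e\<close> with section
  \<open>s\<close>. What has to be shown is that the idempotent \<open>s \<odot> e\<close> is the
  identity. After passing to \<open>M\<close>, the two have the same composite with a suitable map
  to \<open>G\<close>, and \<open>good_mono\<close> cancels that map.\<close>

lemma good_minimal:
  assumes b: "good b" shows "minimal_obj A b"
  unfolding minimal_obj_def
proof (intro conjI ballI impI)
  show bO: "b \<in> Obj A" using b by (simp add: good_def)
  fix f assume f: "f \<in> Arr A" "Dom A f = b"
  obtain e m where e: "split_epi_arr A e" and m: "mono_arr A m" and em: "Cod A e = Dom A m" "f = m \<odot>\<^bsub>A\<^esub> e"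
    using factorizations f unfolding split_epi_mono_factorizations_def by blast
  have ea: "e \<in> Arr A" and ma: "m \<in> Arr A" using e m by (auto simp: split_epi_arr_def mono_arr_def)
  have eb: "Dom A e = b" using em ea ma f by simp
  define b' where "b' = Cod A e"
  obtain s where s: "s \<in> hom A b' b" "e \<odot>\<^bsub>A\<^esub> s = Idn A b'"
    using e eb by (auto simp: split_epi_arr_def b'_def)
  have eh: "e \<in> hom A b b'" using ea eb by (simp add: hom_def b'_def)
  have ss: "s \<in> Arr A" "Dom A s = b'" "Cod A s = b" using s by (auto simp: hom_def)
  have b'O: "b' \<in> Obj A" using ea by (simp add: b'_def)
  \<comment> \<open>The codomain of \<open>e\<close> is good too: \<open>e\<close> lies in the
    ideal, and then so does \<open>e \<odot> s\<close>, an identity.\<close>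
  have "ideal (e \<odot>\<^bsub>A\<^esub> Idn A b)" by (rule ideal_left) (use b ea eb bO in \<open>auto simp: good_def\<close>)
  then have "ideal e" using ea eb by simp
  then have "ideal (e \<odot>\<^bsub>A\<^esub> s)" by (rule ideal_right) (use ss eb in auto)
  then have b': "good b'" using s(2) b'O by (simp add: good_def)
  obtain Y :: "('o, 'a, 'u) psh" and i where Y: "A.represents Y b i" by (rule A.representable_exists[OF bO])
  obtain Y' :: "('o, 'a, 'u) psh" and i' where Y': "A.represents Y' b' i'" by (rule A.representable_exists[OF b'O])
  note YO = A.representsD(1)[OF Y] and i = A.representsD(3)[OF Y]
  note Y'O = A.representsD(1)[OF Y'] and i' = A.representsD(3)[OF Y']
  have "act Y' e i' \<in> fib Y' b" using A.act_in[OF Y'O ea] i' eb by (simp add: b'_def)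
  then obtain E' where E': "E' \<in> hom E Y Y'" "ap E' b i = act Y' e i'" by (rule A.yoneda_exists[OF Y Y'O])
  have "act Y s i \<in> fib Y b'" using A.act_in[OF YO ss(1)] i ss by simp
  then obtain S' where S': "S' \<in> hom E Y' Y" "ap S' b' i' = act Y s i" by (rule A.yoneda_exists[OF Y' YO])
  have Es: "E' \<in> Arr E" "Dom E E' = Y" "Cod E E' = Y'" "S' \<in> Arr E" "Dom E S' = Y'" "Cod E S' = Y"
    using E'(1) S'(1) by (auto simp: hom_def)
  have ES: "E' \<odot>\<^bsub>E\<^esub> S' = Idn E Y'"
  proof (rule A.yoneda_eq[OF Y' A.psh_comp_hom[OF S'(1) E'(1)] P.L.B.idn_hom[OF Y'O]])
    have "act Y' (e \<odot>\<^bsub>A\<^esub> s) i' = act Y' s (act Y' e i')"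
      by (rule A.act_comp[OF Y'O]) (use ss ea eb i' in \<open>auto simp: b'_def\<close>)
    then show "ap (E' \<odot>\<^bsub>E\<^esub> S') b' i' = ap (Idn E Y') b' i'"
      using A.ap_comp[OF S'(1) b'O i', of E'] S'(2) A.ap_nat[OF E'(1) s(1) i] E'(2) s(2) i' b'O Y'O by simp
  qed
  obtain t g0 where t: "terminal_obj M t" "g0 \<in> hom M G t" "epi_arr M g0"
    using well_supported unfolding well_supported_def by blast
  have NO: "on_obj N Y \<in> Obj M" "on_obj N Y' \<in> Obj M" using YO Y'O by auto
  \<comment> \<open>As \<open>G\<close> covers the terminal object, projectivity yields a map to
    \<open>G\<close>. It is taken on \<open>on_obj N Y'\<close> rather than on
    \<open>on_obj N Y\<close>, so that precomposition with the image of \<open>E'\<close> absorbs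
    the idempotent.\<close>
  obtain h where "h \<in> hom M (on_obj N Y') t" using t(1) NO unfolding terminal_obj_def by blast
  then obtain g' where g': "g' \<in> hom M (on_obj N Y') G" by (rule good_projective[OF b' Y' t(3,2)])
  have gs': "g' \<in> Arr M" "Dom M g' = on_obj N Y'" "Cod M g' = G" using g' by (auto simp: hom_def)
  define g where "g = g' \<odot>\<^bsub>M\<^esub> on_arr N E'"
  have g: "g \<in> hom M (on_obj N Y) G" using gs' Es by (simp add: g_def hom_def)
  have gg: "g \<odot>\<^bsub>M\<^esub> on_arr N (S' \<odot>\<^bsub>E\<^esub> E') = g \<odot>\<^bsub>M\<^esub> Idn M (on_obj N Y)"
  proof -
    have "g \<odot>\<^bsub>M\<^esub> on_arr N (S' \<odot>\<^bsub>E\<^esub> E') = g' \<odot>\<^bsub>M\<^esub> (on_arr N (E' \<odot>\<^bsub>E\<^esub> S') \<odot>\<^bsub>M\<^esub> on_arr N E')"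
      using gs' Es NO by (simp add: g_def)
    also have "\<dots> = g" unfolding ES using gs' Es Y'O by (simp add: g_def)
    finally show ?thesis using g NO by (simp add: hom_def)
  qed
  have "on_arr N (S' \<odot>\<^bsub>E\<^esub> E') = Idn M (on_obj N Y)"
    by (rule good_mono[OF b Y g _ _ gg, of "on_obj N Y"]) (use Es NO in \<open>auto simp: hom_def\<close>)
  \<comment> \<open>Back to presheaves: by naturality the idempotent fixes the counit at
    \<open>Y\<close>, and the counit has a section \<open>k\<close>, so the idempotent is the
    identity.\<close>
  then have SN: "on_arr S (on_arr N (S' \<odot>\<^bsub>E\<^esub> E')) = Idn E (SN Y)" using NO by simp
  obtain k where k: "k \<in> hom E Y (SN Y)" "\<sigma> Y \<odot>\<^bsub>E\<^esub> k = Idn E Y" by (rule good_section[OF b Y])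
  have ks: "k \<in> Arr E" "Dom E k = Y" "Cod E k = SN Y" using k(1) by (auto simp: hom_def)
  have SE: "S' \<odot>\<^bsub>E\<^esub> E' \<in> Arr E" "Dom E (S' \<odot>\<^bsub>E\<^esub> E') = Y" "Cod E (S' \<odot>\<^bsub>E\<^esub> E') = Y" using Es by simp_all
  have "(S' \<odot>\<^bsub>E\<^esub> E') \<odot>\<^bsub>E\<^esub> \<sigma> Y = \<sigma> Y"
    using P.counit_nat[OF SE(1)] SN SE YO NO by simp
  then have "((S' \<odot>\<^bsub>E\<^esub> E') \<odot>\<^bsub>E\<^esub> \<sigma> Y) \<odot>\<^bsub>E\<^esub> k = Idn E Y" using k(2) by simp
  then have "(S' \<odot>\<^bsub>E\<^esub> E') \<odot>\<^bsub>E\<^esub> (\<sigma> Y \<odot>\<^bsub>E\<^esub> k) = Idn E Y"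
    using P.L.B.assoc[of k "\<sigma> Y" "S' \<odot>\<^bsub>E\<^esub> E'"] ks SE YO by simp
  then have SEid: "S' \<odot>\<^bsub>E\<^esub> E' = Idn E Y" using k(2) SE P.L.B.idn_comp(2)[OF SE(1,2)] by simp
  have "s \<odot>\<^bsub>A\<^esub> e = Idn A b"
  proof (rule A.representsD(5)[OF Y])
    show "s \<odot>\<^bsub>A\<^esub> e \<in> hom A b b" by (rule A.comp_hom[OF eh s(1)])
    show "Idn A b \<in> hom A b b" by (rule A.idn_hom[OF bO])
    have "act Y (s \<odot>\<^bsub>A\<^esub> e) i = act Y e (act Y s i)"
      by (rule A.act_comp[OF YO]) (use ss ea i in \<open>auto simp: b'_def\<close>)
    also have "\<dots> = ap (S' \<odot>\<^bsub>E\<^esub> E') b i"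
      using A.ap_comp[OF E'(1) bO i, of S'] E'(2) A.ap_nat[OF S'(1) eh i'] S'(2) by simp
    finally show "act Y (s \<odot>\<^bsub>A\<^esub> e) i = act Y (Idn A b) i" using SEid bO i YO by simp
  qed
  then show "mono_arr A f"
    unfolding em(2) by (intro A.split_epi_mono_iso[OF eh s(1) s(2) _ m]) (simp_all add: em b'_def)
qed

section \<open>Generation by minimal objects, and the maps inverted by the level\<close>

lemma S_generated_minimal:
  assumes z: "z \<in> Obj M" and c: "c \<in> Obj A" and x: "x \<in> fib (on_obj S z) c"
  shows "\<exists>b f y. minimal_obj A b \<and> f \<in> hom A c b \<and> y \<in> fib (on_obj S z) b \<and> x = act (on_obj S z) f y"
proof -
  obtain f y where f: "ideal f" "Dom A f = c" "y \<in> fib (on_obj S z) (Cod A f)" "x = act (on_obj S z) f y"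
    using S_generated_ideal[OF assms] by blast
  obtain b m h where b: "b \<in> Obj A" "ideal (Idn A b)" "m \<in> hom A b (Cod A f)" "h \<in> hom A (Dom A f) b" "f = m \<odot>\<^bsub>A\<^esub> h"
    using ideal_factors_through_identity[OF f(1)] by blast
  have SO: "on_obj S z \<in> Obj E" using z by simp
  have s: "m \<in> Arr A" "Dom A m = b" "Cod A m = Cod A f" "h \<in> Arr A" "Cod A h = b" "Dom A h = Dom A f"
    using b(3,4) by (auto simp: hom_def)
  have "y \<in> fib (on_obj S z) (Cod A m)" using f(3) s(3) by simp
  from A.act_comp[OF SO s(4) s(1) _ this]
  have "x = act (on_obj S z) h (act (on_obj S z) m y)"
    using s(2,5) unfolding f(4) b(5)[symmetric] by simp
  moreover have "act (on_obj S z) m y \<in> fib (on_obj S z) b" using A.act_in[OF SO s(1)] s f(3) by simp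
  ultimately show ?thesis using good_minimal[of b] b f(2) by (auto simp: good_def)
qed

text \<open>\<open>SN Y\<close> is generated at minimal objects, where \<open>Z\<close> is
  everything, so the counit factors through the inclusion. As \<open>N\<close> inverts the counit,
  it turns the inclusion into a split epi; as a right adjoint, it also keeps it monic.\<close>

lemma inverts_sub:
  assumes Y: "Y \<in> Obj E" and cl: "A.closed_under_act Y Z" and full: "\<And>b. minimal_obj A b \<Longrightarrow> Z b = fib Y b"
  defines "\<iota> \<equiv> A.mk_map (A.mk_psh Z (act Y)) Y (\<lambda>c x. x)"
  shows "iso_arr M (on_arr N \<iota>)"
proof -
  let ?Z = "A.mk_psh Z (act Y)"
  have ZO: "?Z \<in> Obj E" and \<iota>: "\<iota> \<in> hom E ?Z Y" using A.subpsh[OF Y cl] by (auto simp: \<iota>_def)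
  have \<iota>s: "\<iota> \<in> Arr E" "Dom E \<iota> = ?Z" "Cod E \<iota> = Y" using \<iota> by (auto simp: hom_def)
  have NO: "on_obj N Y \<in> Obj M" using Y by simp
  have SO: "SN Y \<in> Obj E" using NO by simp
  have \<sigma>Z: "ap (\<sigma> Y) c w \<in> Z c" if c: "c \<in> Obj A" and w: "w \<in> fib (SN Y) c" for c w
  proof -
    obtain b f y where b: "minimal_obj A b" "f \<in> hom A c b" "y \<in> fib (SN Y) b" "w = act (SN Y) f y"
      using S_generated_minimal[OF NO c w] by blast
    have bO: "b \<in> Obj A" using b(1) by (simp add: minimal_obj_def)
    have "ap (\<sigma> Y) b y \<in> Z b" using A.ap_in[OF \<sigma>_hom[OF Y] bO b(3)] full[OF b(1)] by simp
    then have "act Y f (ap (\<sigma> Y) b y) \<in> Z c"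
      using cl b(2) unfolding A.closed_under_act_def hom_def by auto
    then show ?thesis using A.ap_nat[OF \<sigma>_hom[OF Y] b(2,3)] b(4) by simp
  qed
  define \<rho> where "\<rho> = A.mk_map (SN Y) ?Z (ap (\<sigma> Y))"
  have \<rho>: "\<rho> \<in> hom E (SN Y) ?Z"
    unfolding \<rho>_def
  proof (rule A.mk_map[OF SO ZO])
    fix f x assume f: "f \<in> Arr A" and x: "x \<in> fib (SN Y) (Cod A f)"
    have fh: "f \<in> hom A (Dom A f) (Cod A f)" using f by (simp add: hom_def)
    show "ap (\<sigma> Y) (Dom A f) (act (SN Y) f x) = act ?Z f (ap (\<sigma> Y) (Cod A f) x)"
      using A.ap_nat[OF \<sigma>_hom[OF Y] fh x] \<sigma>Z[OF _ x] f by simp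
  qed (use \<sigma>Z in auto)
  have \<rho>s: "\<rho> \<in> Arr E" "Dom E \<rho> = SN Y" "Cod E \<rho> = ?Z" using \<rho> by (auto simp: hom_def)
  have "\<iota> \<odot>\<^bsub>E\<^esub> \<rho> = \<sigma> Y"
    by (rule A.psh_arr_eqI[OF A.psh_comp_hom[OF \<rho> \<iota>] \<sigma>_hom[OF Y]])
       (simp add: A.ap_comp[OF \<rho>], use \<sigma>Z in \<open>simp add: \<rho>_def \<iota>_def\<close>)
  then have N\<iota>: "on_arr N \<iota> \<odot>\<^bsub>M\<^esub> on_arr N \<rho> = inv_arr M (\<eta> (on_obj N Y))"
    using P.R.F_comp[of \<rho> \<iota>] \<iota>s \<rho>s N_\<sigma>[OF Y] by simp
  note iso = eta_iso[OF NO]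
  define k where "k = on_arr N \<rho> \<odot>\<^bsub>M\<^esub> \<eta> (on_obj N Y)"
  have ks: "k \<in> Arr M" "Dom M k = on_obj N Y" "Cod M k = on_obj N ?Z" using \<rho>s NO by (auto simp: k_def)
  have "on_arr N \<iota> \<odot>\<^bsub>M\<^esub> k = (on_arr N \<iota> \<odot>\<^bsub>M\<^esub> on_arr N \<rho>) \<odot>\<^bsub>M\<^esub> \<eta> (on_obj N Y)"
    using \<rho>s \<iota>s NO by (simp add: k_def)
  then have 1: "on_arr N \<iota> \<odot>\<^bsub>M\<^esub> k = Idn M (on_obj N Y)" unfolding N\<iota> using iso NO by simp
  have "mono_arr E \<iota>"
    unfolding mono_arr_def
  proof (intro conjI allI ballI impI)
    fix a u v assume "u \<in> hom E a (Dom E \<iota>)" "v \<in> hom E a (Dom E \<iota>)" and eq: "\<iota> \<odot>\<^bsub>E\<^esub> u = \<iota> \<odot>\<^bsub>E\<^esub> v"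
    then have u: "u \<in> hom E a ?Z" and v: "v \<in> hom E a ?Z" using \<iota>s by auto
    show "u = v"
    proof (rule A.psh_arr_eqI[OF u v])
      fix c x assume c: "c \<in> Obj A" and x: "x \<in> fib a c"
      show "ap u c x = ap v c x"
        using A.ap_comp[OF u c x, of \<iota>] A.ap_comp[OF v c x, of \<iota>] eq A.ap_in[OF u c x] A.ap_in[OF v c x] c
        by (simp add: \<iota>_def)
    qed
  qed (rule \<iota>s)
  then have m: "mono_arr M (on_arr N \<iota>)" by (rule P.right_adjoint_mono)
  have "on_arr N \<iota> \<odot>\<^bsub>M\<^esub> (k \<odot>\<^bsub>M\<^esub> on_arr N \<iota>) = (on_arr N \<iota> \<odot>\<^bsub>M\<^esub> k) \<odot>\<^bsub>M\<^esub> on_arr N \<iota>"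
    using ks \<iota>s by simp
  also have "\<dots> = on_arr N \<iota> \<odot>\<^bsub>M\<^esub> Idn M (on_obj N ?Z)" unfolding 1 using \<iota>s by simp
  finally have "on_arr N \<iota> \<odot>\<^bsub>M\<^esub> (k \<odot>\<^bsub>M\<^esub> on_arr N \<iota>) = on_arr N \<iota> \<odot>\<^bsub>M\<^esub> Idn M (on_obj N ?Z)" .
  moreover have "k \<odot>\<^bsub>M\<^esub> on_arr N \<iota> \<in> hom M (on_obj N ?Z) (Dom M (on_arr N \<iota>))"
    "Idn M (on_obj N ?Z) \<in> hom M (on_obj N ?Z) (Dom M (on_arr N \<iota>))"
    using ks \<iota>s ZO by (auto simp: hom_def)
  ultimately have 2: "k \<odot>\<^bsub>M\<^esub> on_arr N \<iota> = Idn M (on_obj N ?Z)" using m unfolding mono_arr_def by blast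
  show ?thesis by (rule iso_arrI[OF P.R.F_hom[OF \<iota>] _ 1 2]) (use ks in \<open>simp add: hom_def\<close>)
qed

text \<open>Factor \<open>\<phi>\<close> through its image. For the epimorphic part, two elements identified by \<open>\<phi>\<close> agree on a sieve
  that contains all maps from minimal objects.\<close>

lemma inverts:
  assumes \<phi>: "\<phi> \<in> hom E Y Y'" and bij: "\<And>b. minimal_obj A b \<Longrightarrow> bij_betw (ap \<phi> b) (fib Y b) (fib Y' b)"
  shows "iso_arr M (on_arr N \<phi>)"
proof -
  have O: "Y \<in> Obj E" "Y' \<in> Obj E" using A.psh_arrD[OF \<phi>] by auto
  define Z where "Z = (\<lambda>c. ap \<phi> c ` fib Y c)"
  have cl: "A.closed_under_act Y' Z"
    unfolding A.closed_under_act_def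
  proof (intro conjI ballI)
    show "Z c \<subseteq> fib Y' c" if "c \<in> Obj A" for c using A.ap_in[OF \<phi> that] by (auto simp: Z_def)
    fix f x assume f: "f \<in> Arr A" and "x \<in> Z (Cod A f)"
    then obtain y where y: "y \<in> fib Y (Cod A f)" "x = ap \<phi> (Cod A f) y" by (auto simp: Z_def)
    have fh: "f \<in> hom A (Dom A f) (Cod A f)" using f by (simp add: hom_def)
    show "act Y' f x \<in> Z (Dom A f)"
      unfolding y(2) A.ap_nat[OF \<phi> fh y(1), symmetric] Z_def using A.act_in[OF O(1) f y(1)] by blast
  qed
  let ?Z = "A.mk_psh Z (act Y')"
  define \<iota> where "\<iota> = A.mk_map ?Z Y' (\<lambda>c x. x)"
  have ZO: "?Z \<in> Obj E" and \<iota>: "\<iota> \<in> hom E ?Z Y'" using A.subpsh[OF O(2) cl] by (auto simp: \<iota>_def)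
  have iso\<iota>: "iso_arr M (on_arr N \<iota>)"
    unfolding \<iota>_def by (rule inverts_sub[OF O(2) cl]) (use bij in \<open>auto simp: Z_def bij_betw_def\<close>)
  define p where "p = A.mk_map Y ?Z (ap \<phi>)"
  have p: "p \<in> hom E Y ?Z"
    unfolding p_def
  proof (rule A.mk_map[OF O(1) ZO])
    fix f x assume f: "f \<in> Arr A" and x: "x \<in> fib Y (Cod A f)"
    have fh: "f \<in> hom A (Dom A f) (Cod A f)" using f by (simp add: hom_def)
    show "ap \<phi> (Dom A f) (act Y f x) = act ?Z f (ap \<phi> (Cod A f) x)"
      using A.ap_nat[OF \<phi> fh x] x f by (simp add: Z_def)
  qed (auto simp: Z_def)
  have \<phi>eq: "\<phi> = \<iota> \<odot>\<^bsub>E\<^esub> p"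
    by (rule A.psh_arr_eqI[OF \<phi> A.psh_comp_hom[OF p \<iota>]]) (simp add: A.ap_comp[OF p], simp add: p_def \<iota>_def Z_def)
  have ap_p: "ap p c y = ap \<phi> c y" if "c \<in> Obj A" "y \<in> fib Y c" for c y using that by (simp add: p_def)
  have epi: "epi_arr E p"
    unfolding epi_arr_def
  proof (intro conjI allI ballI impI)
    show "p \<in> Arr E" using p by (simp add: hom_def)
    fix W u v assume "u \<in> hom E (Cod E p) W" "v \<in> hom E (Cod E p) W" and eq: "u \<odot>\<^bsub>E\<^esub> p = v \<odot>\<^bsub>E\<^esub> p"
    then have u: "u \<in> hom E ?Z W" and v: "v \<in> hom E ?Z W" using p by (auto simp: hom_def)
    show "u = v"
    proof (rule A.psh_arr_eqI[OF u v])
      fix c x assume c: "c \<in> Obj A" and "x \<in> fib ?Z c"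
      then obtain y where y: "y \<in> fib Y c" "x = ap p c y" using ap_p by (auto simp: Z_def)
      show "ap u c x = ap v c x"
        using A.ap_comp[OF p c y(1), of u] A.ap_comp[OF p c y(1), of v] eq y(2) by simp
    qed
  qed
  \<comment> \<open>\<open>N\<close> inverts the inclusion of the sieve \<open>K\<close>, hence
    equates \<open>t1\<close> and \<open>t2\<close>, and maps into an object
    \<open>on_obj R z\<close> depend only on what \<open>N\<close> sees.\<close>
  have sep: "ap h a y1 = ap h a y2"
    if z: "z \<in> Obj M" and h: "h \<in> hom E Y (on_obj R z)" and a: "a \<in> Obj A"
      and y: "y1 \<in> fib Y a" "y2 \<in> fib Y a" and eq: "ap \<phi> a y1 = ap \<phi> a y2" for z h a y1 y2
  proof -
    obtain V :: "('o, 'a, 'u) psh" and i where V: "A.represents V a i" by (rule A.representable_exists[OF a])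
    note VO = A.representsD(1)[OF V] and i = A.representsD(3)[OF V]
    obtain t1 where t1: "t1 \<in> hom E V Y" "ap t1 a i = y1" by (rule A.yoneda_exists[OF V O(1) y(1)])
    obtain t2 where t2: "t2 \<in> hom E V Y" "ap t2 a i = y2" by (rule A.yoneda_exists[OF V O(1) y(2)])
    define K where "K = (\<lambda>c. {v \<in> fib V c. ap t1 c v = ap t2 c v})"
    have clK: "A.closed_under_act V K"
      unfolding A.closed_under_act_def
    proof (intro conjI ballI)
      show "K c \<subseteq> fib V c" for c by (auto simp: K_def)
      fix f v assume f: "f \<in> Arr A" and v: "v \<in> K (Cod A f)"
      have fh: "f \<in> hom A (Dom A f) (Cod A f)" using f by (simp add: hom_def)
      show "act V f v \<in> K (Dom A f)"
        using v A.act_in[OF VO f] A.ap_nat[OF t1(1) fh] A.ap_nat[OF t2(1) fh] by (auto simp: K_def)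
    qed
    have \<phi>t: "\<phi> \<odot>\<^bsub>E\<^esub> t1 = \<phi> \<odot>\<^bsub>E\<^esub> t2"
      by (rule A.yoneda_eq[OF V A.psh_comp_hom[OF t1(1) \<phi>] A.psh_comp_hom[OF t2(1) \<phi>]])
         (use a i eq t1(2) t2(2) in \<open>simp add: A.ap_comp[OF t1(1)] A.ap_comp[OF t2(1)]\<close>)
    have K: "K b = fib V b" if b: "minimal_obj A b" for b
    proof -
      have bO: "b \<in> Obj A" using b by (simp add: minimal_obj_def)
      have "ap t1 b v = ap t2 b v" if v: "v \<in> fib V b" for v
      proof -
        have "ap \<phi> b (ap t1 b v) = ap \<phi> b (ap t2 b v)"
          using A.ap_comp[OF t1(1) bO v, of \<phi>] A.ap_comp[OF t2(1) bO v, of \<phi>] \<phi>t by simp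
        then show ?thesis
          using bij[OF b] A.ap_in[OF t1(1) bO v] A.ap_in[OF t2(1) bO v] by (auto simp: bij_betw_def dest: inj_onD)
      qed
      then show ?thesis by (auto simp: K_def)
    qed
    let ?K = "A.mk_psh K (act V)"
    define \<kappa> where "\<kappa> = A.mk_map ?K V (\<lambda>c x. x)"
    have \<kappa>: "\<kappa> \<in> hom E ?K V" using A.subpsh[OF VO clK] by (simp add: \<kappa>_def)
    have iso\<kappa>: "iso_arr M (on_arr N \<kappa>)" unfolding \<kappa>_def by (rule inverts_sub[OF VO clK K])
    have t\<kappa>: "t1 \<odot>\<^bsub>E\<^esub> \<kappa> = t2 \<odot>\<^bsub>E\<^esub> \<kappa>"
      by (rule A.psh_arr_eqI[OF A.psh_comp_hom[OF \<kappa> t1(1)] A.psh_comp_hom[OF \<kappa> t2(1)]])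
         (simp add: A.ap_comp[OF \<kappa>], simp add: \<kappa>_def K_def)
    have s: "\<kappa> \<in> Arr E" "Dom E \<kappa> = ?K" "Cod E \<kappa> = V" "t1 \<in> Arr E" "Dom E t1 = V" "Cod E t1 = Y"
      "t2 \<in> Arr E" "Dom E t2 = V" "Cod E t2 = Y" using \<kappa> t1(1) t2(1) by (auto simp: hom_def)
    have "on_arr N t1 \<odot>\<^bsub>M\<^esub> on_arr N \<kappa> = on_arr N t2 \<odot>\<^bsub>M\<^esub> on_arr N \<kappa>"
      using P.R.F_comp[of \<kappa> t1] P.R.F_comp[of \<kappa> t2] s t\<kappa> by simp
    then have "(on_arr N t1 \<odot>\<^bsub>M\<^esub> on_arr N \<kappa>) \<odot>\<^bsub>M\<^esub> inv_arr M (on_arr N \<kappa>) =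
        (on_arr N t2 \<odot>\<^bsub>M\<^esub> on_arr N \<kappa>) \<odot>\<^bsub>M\<^esub> inv_arr M (on_arr N \<kappa>)" by simp
    then have Nt: "on_arr N t1 = on_arr N t2" using s iso\<kappa> by simp
    have ht: "h \<odot>\<^bsub>E\<^esub> t1 \<in> hom E V (on_obj R z)" "h \<odot>\<^bsub>E\<^esub> t2 \<in> hom E V (on_obj R z)"
      using A.psh_comp_hom[OF t1(1) h] A.psh_comp_hom[OF t2(1) h] by auto
    have hs: "h \<in> Arr E" "Dom E h = Y" using h by (auto simp: hom_def)
    have "h \<odot>\<^bsub>E\<^esub> t1 = h \<odot>\<^bsub>E\<^esub> t2"
      by (rule couniversal_eq[OF Q.couniversal[OF z] P.R.ftr_axioms ht]) (use s hs Nt in simp)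
    then show ?thesis
      using A.ap_comp[OF t1(1) a i, of h] A.ap_comp[OF t2(1) a i, of h] t1(2) t2(2) by simp
  qed
  have "iso_arr M (on_arr N p)"
  proof (rule Q.left_adjoint_inverts[OF p epi])
    fix z h assume z: "z \<in> Obj M" and h: "h \<in> hom E Y (on_obj R z)"
    \<comment> \<open>The extension of \<open>h\<close> along the surjection \<open>p\<close>; by
      \<open>sep\<close> the choice of a preimage does not matter.\<close>
    define k where "k = (\<lambda>c x. ap h c (SOME y. y \<in> fib Y c \<and> ap \<phi> c y = x))"
    have k: "k c (ap \<phi> c y) = ap h c y" if c: "c \<in> Obj A" and y: "y \<in> fib Y c" for c y
    proof -
      have "\<exists>y'. y' \<in> fib Y c \<and> ap \<phi> c y' = ap \<phi> c y" using y by blast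
      from someI_ex[OF this] show ?thesis unfolding k_def using sep[OF z h c _ y] by blast
    qed
    have km: "A.mk_map ?Z (on_obj R z) k \<in> hom E ?Z (on_obj R z)"
    proof (rule A.mk_map[OF ZO A.psh_arrD(2)[OF h]])
      fix c x assume c: "c \<in> Obj A" and "x \<in> fib ?Z c"
      then obtain y where y: "y \<in> fib Y c" "x = ap \<phi> c y" by (auto simp: Z_def)
      show "k c x \<in> fib (on_obj R z) c" unfolding y(2) k[OF c y(1)] by (rule A.ap_in[OF h c y(1)])
    next
      fix f x assume f: "f \<in> Arr A" and x: "x \<in> fib ?Z (Cod A f)"
      then obtain y where y: "y \<in> fib Y (Cod A f)" "x = ap \<phi> (Cod A f) y" by (auto simp: Z_def)
      have fh: "f \<in> hom A (Dom A f) (Cod A f)" using f by (simp add: hom_def)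
      have "act ?Z f x = ap \<phi> (Dom A f) (act Y f y)"
        using A.ap_nat[OF \<phi> fh y(1)] f x y(2) by simp
      then show "k (Dom A f) (act ?Z f x) = act (on_obj R z) f (k (Cod A f) x)"
        using k[of "Dom A f" "act Y f y"] k[of "Cod A f" y] A.act_in[OF O(1) f y(1)] f y A.ap_nat[OF h fh y(1)] by simp
    qed
    have "A.mk_map ?Z (on_obj R z) k \<odot>\<^bsub>E\<^esub> p = h"
      by (rule A.psh_arr_eqI[OF A.psh_comp_hom[OF p km] h])
         (simp add: A.ap_comp[OF p] ap_p, simp add: k Z_def)
    with km show "\<exists>k \<in> hom E ?Z (on_obj R z). k \<odot>\<^bsub>E\<^esub> p = h" by blast
  qed
  then have "iso_arr M (on_arr N \<iota> \<odot>\<^bsub>M\<^esub> on_arr N p)"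
    using iso\<iota> p \<iota> by (intro P.L.A.iso_comp) (auto simp: hom_def)
  moreover have "on_arr N \<phi> = on_arr N \<iota> \<odot>\<^bsub>M\<^esub> on_arr N p"
    unfolding \<phi>eq using p \<iota> by (intro P.R.F_comp) (auto simp: hom_def)
  ultimately show ?thesis by simp
qed

end

section \<open>The level of minimal objects\<close>

lemma comp_ftor_id [simp]: "F \<circ>\<^sub>F id_ftor = F" "id_ftor \<circ>\<^sub>F F = F"
  by (simp_all add: comp_ftor_def id_ftor_def)

lemma nat_trans_whisker_left:
  assumes t: "nat_trans A B F G t" and H: "is_functor B D H"
  shows "nat_trans A D (H \<circ>\<^sub>F F) (H \<circ>\<^sub>F G) (\<lambda>a. on_arr H (t a))"
proof -
  interpret F: ftr A B F by (rule ftrI) (rule nat_transE(1)[OF t])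
  interpret G: ftr A B G by (rule ftrI) (rule nat_transE(2)[OF t])
  interpret H: ftr B D H by (rule ftrI) fact
  note s = nat_transE(3-5)[OF t]
  have "on_arr H (t (Cod A f)) \<odot>\<^bsub>D\<^esub> on_arr H (on_arr F f) = on_arr H (on_arr G f) \<odot>\<^bsub>D\<^esub> on_arr H (t (Dom A f))"
    if f: "f \<in> Arr A" for f
  proof -
    have "on_arr H (t (Cod A f)) \<odot>\<^bsub>D\<^esub> on_arr H (on_arr F f) = on_arr H (t (Cod A f) \<odot>\<^bsub>B\<^esub> on_arr F f)"
      using f s by simp
    also have "\<dots> = on_arr H (on_arr G f \<odot>\<^bsub>B\<^esub> t (Dom A f))" by (simp only: nat_transE(6)[OF t f])
    finally show ?thesis using f s by simp
  qed
  then show ?thesis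
    using functor_comp[OF F.func H.func] functor_comp[OF G.func H.func] s
    by (simp add: nat_trans_def hom_def)
qed

lemma nat_trans_whisker_right:
  assumes t: "nat_trans A B F G t" and K: "is_functor Z A K"
  shows "nat_trans Z B (F \<circ>\<^sub>F K) (G \<circ>\<^sub>F K) (\<lambda>z. t (on_obj K z))"
proof -
  interpret K: ftr Z A K by (rule ftrI) fact
  have "t (on_obj K (Cod Z f)) \<odot>\<^bsub>B\<^esub> on_arr F (on_arr K f) = on_arr G (on_arr K f) \<odot>\<^bsub>B\<^esub> t (on_obj K (Dom Z f))"
    if f: "f \<in> Arr Z" for f using nat_transE(6)[OF t, of "on_arr K f"] f by simp
  then show ?thesis
    using functor_comp[OF K nat_transE(1)[OF t]] functor_comp[OF K nat_transE(2)[OF t]] nat_transE(3-5)[OF t]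
    by (simp add: nat_trans_def hom_def)
qed

lemma nat_trans_comp:
  assumes t: "nat_trans A B F G t" and s: "nat_trans A B G H s"
  shows "nat_trans A B F H (\<lambda>a. s a \<odot>\<^bsub>B\<^esub> t a)"
proof -
  interpret F: ftr A B F by (rule ftrI) (rule nat_transE(1)[OF t])
  interpret G: ftr A B G by (rule ftrI) (rule nat_transE(2)[OF t])
  interpret H: ftr A B H by (rule ftrI) (rule nat_transE(2)[OF s])
  note [simp] = nat_transE(3-5)[OF t] nat_transE(3-5)[OF s]
  have "(s (Cod A f) \<odot>\<^bsub>B\<^esub> t (Cod A f)) \<odot>\<^bsub>B\<^esub> on_arr F f = on_arr H f \<odot>\<^bsub>B\<^esub> (s (Dom A f) \<odot>\<^bsub>B\<^esub> t (Dom A f))"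
    if f [simp]: "f \<in> Arr A" for f
  proof -
    have "(s (Cod A f) \<odot>\<^bsub>B\<^esub> t (Cod A f)) \<odot>\<^bsub>B\<^esub> on_arr F f = s (Cod A f) \<odot>\<^bsub>B\<^esub> (on_arr G f \<odot>\<^bsub>B\<^esub> t (Dom A f))"
      using nat_transE(6)[OF t f] by simp
    also have "\<dots> = (s (Cod A f) \<odot>\<^bsub>B\<^esub> on_arr G f) \<odot>\<^bsub>B\<^esub> t (Dom A f)" by simp
    also have "\<dots> = on_arr H f \<odot>\<^bsub>B\<^esub> (s (Dom A f) \<odot>\<^bsub>B\<^esub> t (Dom A f))"
      unfolding nat_transE(6)[OF s f] by simp
    finally show ?thesis .
  qed
  then show ?thesis by (simp add: nat_trans_def F.func H.func hom_def)
qed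

context adjunction
begin

lemma unit_nat_trans: "nat_trans A A id_ftor (R \<circ>\<^sub>F L) \<eta>"
  using unit_nat functor_id[OF L.A.category_axioms] functor_comp[OF L.func R.func]
  by (simp add: nat_trans_def hom_def)

text \<open>By a triangle identity \<open>on_arr L (\<eta> a)\<close> is a right inverse of an
  invertible counit.\<close>

lemma left_inverts_unit:
  assumes "a \<in> Obj A" "iso_arr B (\<epsilon> (on_obj L a))"
  shows "iso_arr B (on_arr L (\<eta> a))"
proof -
  have "inv_arr B (\<epsilon> (on_obj L a)) = on_arr L (\<eta> a)"
    using tri1[OF assms(1)] assms by - (rule L.B.iso_cancel_left[OF assms(2)], auto)
  then show ?thesis using iso_inv_arr[OF assms(2)] by simp
qed

end

lemma iso_factor_right:
  assumes "category C" "iso_arr C e" "f \<in> Arr C" "Cod C f = Dom C e" "iso_arr C (e \<odot>\<^bsub>C\<^esub> f)"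
  shows "iso_arr C f"
proof -
  interpret category C by fact
  have "iso_arr C (inv_arr C e \<odot>\<^bsub>C\<^esub> (e \<odot>\<^bsub>C\<^esub> f))"
    by (rule iso_comp[OF assms(5) iso_inv_arr[OF assms(2)]])
       (use assms(2-4) iso_arrD[OF assms(2)] in simp)
  then show ?thesis unfolding inv_comp(2)[OF assms(2,3,4)] .
qed

text \<open>As \<open>K\<close> is fully faithful, the unit for \<open>Lan\<close> and the counit
  for \<open>Ran\<close> are invertible. The comparison \<tau> is the transpose of the inverse unit,
  so both \<tau> and the unit \<rho> for \<open>Ran\<close> become invertible on restriction. With
  these two families a level is compared to that of the subcategory.\<close>

lemma (in site_functor) kan_extensions:
  fixes PA :: "(('o, 'a, 'u) psh, ('o, 'a, 'u) psh_arr) cat" and PB :: "(('p, 'b, 'u) psh, ('p, 'b, 'u) psh_arr) cat"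
  assumes ff: "full_faithful B A K"
  defines "PA \<equiv> Psh A" and "PB \<equiv> Psh B"
  obtains Lan Ran \<tau> \<rho> where "adjoint PB PA Lan (pull B K)" "adjoint PA PB (pull B K) Ran"
    "full_faithful PB PA Ran"
    "nat_trans PB PA Lan Ran \<tau>" "\<And>W. W \<in> Obj PB \<Longrightarrow> iso_arr PB (on_arr (pull B K) (\<tau> W))"
    "nat_trans PA PA id_ftor (Ran \<circ>\<^sub>F pull B K) \<rho>"
    "\<And>Y. Y \<in> Obj PA \<Longrightarrow> iso_arr PB (on_arr (pull B K) (\<rho> Y))"
proof -
  let ?res = "pull B K :: (('o, 'a, 'u) psh, _, _, _) ftor"
  have F: "is_functor PA PB ?res" unfolding PA_def PB_def by (rule pull_functor)
  have "\<exists>R E. couniversal PA PB ?res Z R E \<and> iso_arr PB E" if "Z \<in> Obj PB" for Z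
    using pull_couniversal[of Z] ff that unfolding PA_def PB_def by metis
  then have cu: "\<And>Z. Z \<in> Obj PB \<Longrightarrow> \<exists>R E. couniversal PA PB ?res Z R E \<and> iso_arr PB E" .
  have "\<exists>Ran. adjoint PA PB ?res Ran" by (rule right_adjoint_exists[OF F]) (use cu in blast)
  then obtain Ran where Ran: "adjoint PA PB ?res Ran" ..
  have "\<exists>L n. universal PA PB ?res Z L n" if "Z \<in> Obj PB" for Z
    using pull_universal[of Z] that unfolding PA_def PB_def by metis
  then have "\<exists>Lan. adjoint PB PA Lan ?res" by (rule left_adjoint_exists[OF F])
  then obtain Lan where Lan: "adjoint PB PA Lan ?res" ..
  obtain \<rho> \<epsilon> where "adjunction PA PB ?res Ran \<rho> \<epsilon>" using Ran by (rule adjointE)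
  then interpret R: adjunction PA PB ?res Ran \<rho> \<epsilon> .
  obtain \<eta> \<kappa> where "adjunction PB PA Lan ?res \<eta> \<kappa>" using Lan by (rule adjointE)
  then interpret L: adjunction PB PA Lan ?res \<eta> \<kappa> .
  have ffR: "full_faithful PB PA Ran" by (rule R.full_faithful_rightI(1)[OF cu])
  have \<epsilon>iso: "iso_arr PB (\<epsilon> W)" if "W \<in> Obj PB" for W by (rule R.counit_iso[OF ffR that])
  have \<eta>iso: "iso_arr PB (\<eta> W)" if "W \<in> Obj PB" for W
    by (rule unit_iso_of_ff_right[OF L.adjunction_axioms R.adjunction_axioms \<epsilon>iso that])
  define \<tau> where "\<tau> = (\<lambda>W. on_arr Ran (inv_arr PB (\<eta> W)) \<odot>\<^bsub>PA\<^esub> \<rho> (on_obj Lan W))"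
  have n1: "nat_trans PB PA Lan (Ran \<circ>\<^sub>F ?res \<circ>\<^sub>F Lan) (\<lambda>W. \<rho> (on_obj Lan W))"
    using nat_trans_whisker_right[OF R.unit_nat_trans L.L.func] by simp
  have "nat_trans PB PB (?res \<circ>\<^sub>F Lan) id_ftor (\<lambda>W. inv_arr PB (\<eta> W))"
    by (rule nat_trans_inv[OF L.unit_nat_trans \<eta>iso])
  from nat_trans_whisker_left[OF this R.R.func]
  have n2: "nat_trans PB PA (Ran \<circ>\<^sub>F ?res \<circ>\<^sub>F Lan) Ran (\<lambda>W. on_arr Ran (inv_arr PB (\<eta> W)))"
    by (simp add: comp_ftor_assoc)
  have n3: "nat_trans PB PA Lan Ran \<tau>" unfolding \<tau>_def by (rule nat_trans_comp[OF n1 n2])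
  show ?thesis
  proof (rule that[OF Lan Ran ffR n3 _ R.unit_nat_trans])
    fix W assume W: "W \<in> Obj PB"
    have LW: "on_obj Lan W \<in> Obj PA" using W by (rule L.L.F_obj)
    have h: "inv_arr PB (\<eta> W) \<in> hom PB (on_obj ?res (on_obj Lan W)) W"
      using \<eta>iso[OF W] W by (simp add: hom_def)
    \<comment> \<open>\<tau> arose by transposition, so the counit turns its restriction back into
      the inverse unit.\<close>
    have eq: "\<epsilon> W \<odot>\<^bsub>PB\<^esub> on_arr ?res (\<tau> W) = inv_arr PB (\<eta> W)"
      unfolding \<tau>_def by (rule R.transpose_left[OF LW h])
    show "iso_arr PB (on_arr ?res (\<tau> W))"
    proof (rule iso_factor_right[OF R.L.B.category_axioms \<epsilon>iso[OF W]])
      show "iso_arr PB (\<epsilon> W \<odot>\<^bsub>PB\<^esub> on_arr ?res (\<tau> W))"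
        unfolding eq by (rule iso_inv_arr[OF \<eta>iso[OF W]])
    qed (use W nat_transE(3-5)[OF n3 W] in simp_all)
  next
    fix Y assume Y: "Y \<in> Obj PA"
    show "iso_arr PB (on_arr ?res (\<rho> Y))"
      by (rule R.left_inverts_unit[OF Y \<epsilon>iso]) (use Y in simp)
  qed
qed

text \<open>Arrows out of a minimal object are monic, and a full subcategory has fewer maps to test
  them against.\<close>

lemma (in category) minimal_subcat_mono:
  assumes f: "f \<in> Arr (minimal_subcat C)"
  shows "mono_arr (minimal_subcat C) f"
proof -
  have "mono_arr C f" using f by (auto simp: minimal_subcat_def minimal_obj_def)
  then show ?thesis using f by (auto simp: mono_arr_def minimal_subcat_def hom_full_subcat)
qed

section \<open>The level \<open>D X\<close> and its maximality\<close>

context slice_site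
begin

abbreviation "B \<equiv> minimal_subcat (elements C X)"

abbreviation "PE \<equiv> Psh (elements C X) :: (('u \<times> 'o, ('u \<times> 'o) \<times> 'a \<times> ('u \<times> 'o), 'u) psh, _) cat"

abbreviation "PB \<equiv> Psh B :: (('u \<times> 'o, ('u \<times> 'o) \<times> 'a \<times> ('u \<times> 'o), 'u) psh, _) cat"

lemma site_minimal: "site TYPE('u) B"
  unfolding minimal_subcat_def by (rule El.site_full_subcat)

lemma minimal_inclusion: "full_faithful B (elements C X) id_ftor"
  unfolding minimal_subcat_def by (rule El.full_subcat_inclusion)

lemma site_functor_minimal: "site_functor TYPE('u) (elements C X) B id_ftor"
proof -
  have "ftr B (elements C X) id_ftor"
    using minimal_inclusion by (intro ftrI) (simp add: full_faithful_def)
  then show ?thesis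
    using El.site_axioms site_minimal by (simp add: site_functor_def)
qed

text \<open>The further left adjoint is the left Kan extension followed by the inverse of the
  equivalence. Since \<open>is_D\<close> fixes only the inverse image, full faithfulness is proved
  for the constructed direct image and then passed to an arbitrary right adjoint.\<close>

lemma minimal_level:
  shows is_D_exists: "\<exists>d. is_D C X d"
    and level_D: "is_D C X d \<Longrightarrow> level PB (slice (Psh C) X) d"
proof -
  let ?S = "slice (Psh C) X :: (('o, 'a, 'u) psh_arr, _) cat"
  let ?H = "fibres_ftor C X" and ?res = "restriction_ftor B"
  interpret J: site_functor U "elements C X" B id_ftor by (rule site_functor_minimal)
  obtain Lan Ran where Lan: "adjoint PB PE Lan ?res" and Ran: "adjoint PE PB ?res Ran"
    and ffR: "full_faithful PB PE Ran"
    using J.kan_extensions[OF minimal_inclusion] unfolding restriction_ftor_pull by metis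
  obtain K where HK: "adjoint ?S PE ?H K" and KH: "adjoint PE ?S K ?H" and ffK: "full_faithful PE ?S K"
    using equivalence_inverse[OF fibres_full_faithful fibres_ess_surj] by metis
  have r: "adjoint ?S PB (?res \<circ>\<^sub>F ?H) (K \<circ>\<^sub>F Ran)" by (rule adjoint_comp[OF HK Ran])
  have l: "adjoint PB ?S (K \<circ>\<^sub>F Lan) (?res \<circ>\<^sub>F ?H)" by (rule adjoint_comp[OF Lan KH])
  have "is_D C X \<lparr>inverse_image = ?res \<circ>\<^sub>F ?H, direct_image = K \<circ>\<^sub>F Ran\<rparr>"
    using r right_adjoint_lex[OF l] by (simp add: is_D_def geometric_morphism_def)
  then show "\<exists>d. is_D C X d" by blast
  have ff: "full_faithful PB ?S (K \<circ>\<^sub>F Ran)" by (rule full_faithful_comp[OF ffR ffK])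
  obtain \<eta> \<epsilon> where "adjunction ?S PB (?res \<circ>\<^sub>F ?H) (K \<circ>\<^sub>F Ran) \<eta> \<epsilon>" using r by (rule adjointE)
  then interpret R: adjunction ?S PB "?res \<circ>\<^sub>F ?H" "K \<circ>\<^sub>F Ran" \<eta> \<epsilon> .
  have cu: "\<exists>r e. couniversal ?S PB (?res \<circ>\<^sub>F ?H) b r e \<and> iso_arr PB e" if "b \<in> Obj PB" for b
    using R.couniversal[OF that] R.counit_iso[OF ff that] by blast
  assume d: "is_D C X d"
  have di: "inverse_image d = ?res \<circ>\<^sub>F ?H" and dg: "geometric_morphism PB ?S d"
    using d by (auto simp: is_D_def)
  have "adjoint ?S PB (?res \<circ>\<^sub>F ?H) (direct_image d)" using dg di by (simp add: geometric_morphism_def)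
  then obtain \<eta>' \<epsilon>' where adj: "adjunction ?S PB (?res \<circ>\<^sub>F ?H) (direct_image d) \<eta>' \<epsilon>'" by (rule adjointE)
  have "full_faithful PB ?S (direct_image d)" by (rule adjunction.full_faithful_rightI(1)[OF adj cu])
  then show "level PB ?S d" using dg l di by (auto simp: level_def subtopos_def)
qed

text \<open>The inverse image of \<open>m\<close> inverts every map that is bijective at minimal
  objects. Applied to \<tau> this yields the geometric morphism \<open>k\<close>; applied to \<rho>
  it shows that \<open>d\<close> after \<open>k\<close> is \<open>m\<close> up to
  isomorphism.\<close>

lemma level_D_largest:
  fixes M :: "('mo, 'ma) cat"
  assumes fact: "split_epi_mono_factorizations C" and acc: "ascending_chain_condition C"
    and f: "geometric_morphism (slice (Psh C) X) (Sets :: ('u set, _) cat) f"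
    and m: "level M (slice (Psh C) X) m" and et: "etendue M Sets (f \<circ>\<^sub>G m)" and d: "is_D C X d"
  shows "factors_through M PB (slice (Psh C) X) m d"
proof -
  let ?S = "slice (Psh C) X :: (('o, 'a, 'u) psh_arr, _) cat"
  let ?H = "fibres_ftor C X" and ?res = "pull B id_ftor"
  interpret J: site_functor U "elements C X" B id_ftor by (rule site_functor_minimal)
  obtain Lan Ran \<tau> \<rho> where Lan: "adjoint PB PE Lan ?res" and Ran: "adjoint PE PB ?res Ran"
    and \<tau>: "nat_trans PB PE Lan Ran \<tau>" and \<tau>i: "\<And>W. W \<in> Obj PB \<Longrightarrow> iso_arr PB (on_arr ?res (\<tau> W))"
    and \<rho>: "nat_trans PE PE id_ftor (Ran \<circ>\<^sub>F ?res) \<rho>" and \<rho>i: "\<And>Y. Y \<in> Obj PE \<Longrightarrow> iso_arr PB (on_arr ?res (\<rho> Y))"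
    using J.kan_extensions[OF minimal_inclusion] by metis
  obtain K \<theta> where HK: "adjoint ?S PE ?H K" and KH: "adjoint PE ?S K ?H"
    and \<theta>: "nat_trans ?S ?S id_ftor (K \<circ>\<^sub>F ?H) \<theta>" and \<theta>i: "\<And>e. e \<in> Obj ?S \<Longrightarrow> iso_arr ?S (\<theta> e)"
    using equivalence_inverse[OF fibres_full_faithful fibres_ess_surj] by metis
  let ?m = "inverse_image m"
  obtain ms where ms: "adjoint M ?S ms ?m" using m by (auto simp: level_def)
  have mg: "geometric_morphism M ?S m" and ffm: "full_faithful M ?S (direct_image m)"
    using m by (auto simp: level_def subtopos_def)
  have mm: "adjoint ?S M ?m (direct_image m)" and mlex: "lex_functor ?S M ?m"
    using mg by (auto simp: geometric_morphism_def)
  have mf: "is_functor ?S M ?m" using mlex by (simp add: lex_functor_def)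
  \<comment> \<open>The level is transported to presheaves on the category of elements, the setting
    of \<open>etendue_level\<close>.\<close>
  let ?N = "?m \<circ>\<^sub>F K" and ?R = "?H \<circ>\<^sub>F direct_image m"
  have SN: "adjoint M PE (?H \<circ>\<^sub>F ms) ?N" by (rule adjoint_comp[OF ms HK])
  have NR: "adjoint PE M ?N ?R" by (rule adjoint_comp[OF KH mm])
  have ffR: "full_faithful M PE ?R" by (rule full_faithful_comp[OF ffm fibres_full_faithful])
  obtain \<eta> \<sigma> where a1: "adjunction M PE (?H \<circ>\<^sub>F ms) ?N \<eta> \<sigma>" using SN by (rule adjointE)
  obtain \<eta>' \<epsilon> where a2: "adjunction PE M ?N ?R \<eta>' \<epsilon>" using NR by (rule adjointE)
  obtain G q where G: "well_supported M G" "slice_geom M G q" and loc: "localic (slice M G) Sets (f \<circ>\<^sub>G m \<circ>\<^sub>G q)"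
    using et unfolding etendue_def by blast
  let ?f = "inverse_image f"
  have fL: "adjoint Sets ?S ?f (direct_image f)" and flex: "lex_functor Sets ?S ?f"
    using f by (auto simp: geometric_morphism_def)
  have L0: "adjoint Sets PE (?H \<circ>\<^sub>F ?f) (direct_image f \<circ>\<^sub>F K)" by (rule adjoint_comp[OF fL HK])
  have "lex_functor Sets PE (?H \<circ>\<^sub>F ?f)" by (rule lex_comp[OF flex right_adjoint_lex[OF KH]])
  then have T0: "terminal_obj PE (on_obj (?H \<circ>\<^sub>F ?f) {undefined})"
    by (rule lex_terminal) (rule terminal_point[OF gu])
  interpret E: etendue_level "elements C X" U M "?H \<circ>\<^sub>F ms" ?N ?R \<eta> \<sigma> \<eta>' \<epsilon> G q
    unfolding etendue_level_def etendue_level_axioms_def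
  proof (intro conjI allI impI)
    show "site TYPE('u) (elements C X)" by (rule El.site_axioms)
    show "adjunction M PE (?H \<circ>\<^sub>F ms) ?N \<eta> \<sigma>" "adjunction PE M ?N ?R \<eta>' \<epsilon>" by (rule a1 a2)+
    show "iso_arr M (\<epsilon> z)" if "z \<in> Obj M" for z by (rule adjunction.counit_iso[OF a2 ffR that])
    show "split_epi_mono_factorizations (elements C X)" by (rule elements_factorizations[OF fact])
    show "ascending_chain_condition (elements C X)" by (rule elements_acc[OF acc])
    show "well_supported M G" "slice_geom M G q" by (rule G)+
    \<comment> \<open>The localic condition provides the inverse image in \<open>M\<close> of some
      set. By \<theta> it is isomorphic to \<open>?N\<close> of the presheaf
      \<open>on_obj ?H ?V\<close>, and each element of that presheaf lies on a global point because
      a set is covered by its points.\<close>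
    fix g assume "g \<in> Obj (slice M G)"
    then obtain A :: "'u set" where A: "A \<in> Obj Sets" and
      sub: "subquotient (slice M G) g (on_obj (inverse_image (f \<circ>\<^sub>G m \<circ>\<^sub>G q)) A)"
      using loc unfolding localic_def by blast
    let ?V = "on_obj ?f A"
    have VO: "?V \<in> Obj ?S" using flex A unfolding lex_functor_def is_functor_def by blast
    interpret mF: ftr ?S M ?m by (rule ftrI[OF mf])
    interpret HF: ftr ?S PE ?H by (rule ftrI[OF fibres_functor])
    have \<theta>V: "\<theta> ?V \<in> Arr ?S" "Dom ?S (\<theta> ?V) = ?V" "Cod ?S (\<theta> ?V) = on_obj K (on_obj ?H ?V)"
      using nat_transE(3-5)[OF \<theta> VO] by (simp_all del: slice_simps)
    have j: "on_arr ?m (\<theta> ?V) \<in> hom M (on_obj ?m ?V) (on_obj ?N (on_obj ?H ?V))"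
      using mF.F_arr[OF \<theta>V(1)] \<theta>V by (simp add: hom_def)
    have const: "\<exists>T s pt. terminal_obj PE T \<and> s \<in> fib T b \<and> pt \<in> hom PE T (on_obj ?H ?V) \<and> ap pt b s = w"
      if b: "b \<in> Obj (elements C X)" and w: "w \<in> fib (on_obj ?H ?V) b" for b w
    proof -
      have "w \<in> fib (on_obj (?H \<circ>\<^sub>F ?f) A) b" using w by simp
      from El.constant_psh_surj[OF L0 A b this] obtain a s where a: "a \<in> A"
        and s: "s \<in> fib (on_obj (?H \<circ>\<^sub>F ?f) {undefined}) b" "ap (on_arr (?H \<circ>\<^sub>F ?f) (point A a)) b s = w" by blast
      interpret L0: ftr Sets PE "?H \<circ>\<^sub>F ?f" using L0 by (intro ftrI) (simp add: adjoint_def)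
      have "on_arr (?H \<circ>\<^sub>F ?f) (point A a) \<in> hom PE (on_obj (?H \<circ>\<^sub>F ?f) {undefined}) (on_obj (?H \<circ>\<^sub>F ?f) A)"
        by (rule L0.F_hom[OF point_hom[OF gu A a]])
      then have "on_arr (?H \<circ>\<^sub>F ?f) (point A a) \<in> hom PE (on_obj (?H \<circ>\<^sub>F ?f) {undefined}) (on_obj ?H ?V)"
        by simp
      with T0 s show ?thesis by blast
    qed
    have "on_obj (inverse_image (f \<circ>\<^sub>G m \<circ>\<^sub>G q)) A = on_obj (inverse_image q) (on_obj ?m ?V)"
      by (simp add: comp_geom_def)
    with sub have sub': "subquotient (slice M G) g (on_obj (inverse_image q) (on_obj ?m ?V))" by simp
    show "\<exists>W j \<Delta>. W \<in> Obj M \<and> subquotient (slice M G) g (on_obj (inverse_image q) W) \<and>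
       \<Delta> \<in> Obj PE \<and> j \<in> hom M W (on_obj ?N \<Delta>) \<and> iso_arr M j \<and>
       (\<forall>b \<in> Obj (elements C X). \<forall>w \<in> fib \<Delta> b. \<exists>T s pt. terminal_obj PE T \<and> s \<in> fib T b \<and>
          pt \<in> hom PE T \<Delta> \<and> ap pt b s = w)"
    proof (rule exI[of _ "on_obj ?m ?V"], rule exI[of _ "on_arr ?m (\<theta> ?V)"], rule exI[of _ "on_obj ?H ?V"],
        intro conjI ballI)
      show "on_obj ?m ?V \<in> Obj M" by (rule mF.F_obj[OF VO])
      show "subquotient (slice M G) g (on_obj (inverse_image q) (on_obj ?m ?V))" by (rule sub')
      show "on_obj ?H ?V \<in> Obj PE" by (rule HF.F_obj[OF VO])
      show "on_arr ?m (\<theta> ?V) \<in> hom M (on_obj ?m ?V) (on_obj ?N (on_obj ?H ?V))" by (rule j)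
      show "iso_arr M (on_arr ?m (\<theta> ?V))" by (rule mF.F_iso[OF \<theta>i[OF VO]])
    qed (rule const)
  qed
  \<comment> \<open>For presheaves, invertibility after restriction is bijectivity at the minimal
    objects.\<close>
  have inv: "iso_arr M (on_arr ?N t)" if t: "t \<in> hom PE Y Y'" and i: "iso_arr PB (on_arr ?res t)" for t Y Y'
  proof (rule E.inverts[OF t])
    fix b assume "minimal_obj (elements C X) b"
    then have b: "b \<in> Obj B" by (simp add: minimal_subcat_def minimal_obj_def)
    show "bij_betw (ap t b) (fib Y b) (fib Y' b)"
      using J.B.psh_iso_bij[OF i J.pull_hom[OF t] b] b by simp
  qed
  have resf: "is_functor PE PB ?res" by (rule J.pull_functor)
  have Nf: "is_functor PE M ?N" using NR by (simp add: adjoint_def)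
  have Ranf: "is_functor PB PE Ran" using Ran by (simp add: adjoint_def)
  \<comment> \<open>\<open>?N \<circ>\<^sub>F Ran\<close> is a composite of right adjoints, hence
    lex; its own right adjoint is inherited from \<open>?N \<circ>\<^sub>F Lan\<close>, to which
    \<tau> makes it isomorphic.\<close>
  define k where "k = \<lparr>inverse_image = ?N \<circ>\<^sub>F Ran, direct_image = ?res \<circ>\<^sub>F ?R\<rparr>"
  have "nat_trans PB M (?N \<circ>\<^sub>F Lan) (?N \<circ>\<^sub>F Ran) (\<lambda>W. on_arr ?N (\<tau> W))"
    by (rule nat_trans_whisker_left[OF \<tau> Nf])
  moreover have "iso_arr M (on_arr ?N (\<tau> W))" if W: "W \<in> Obj PB" for W
    using nat_transE(3-5)[OF \<tau> W] by (intro inv[OF _ \<tau>i[OF W]]) (simp add: hom_def)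
  ultimately have "nat_isomorphic PB M (?N \<circ>\<^sub>F Lan) (?N \<circ>\<^sub>F Ran)"
    unfolding nat_isomorphic_def by blast
  then have "adjoint PB M (?N \<circ>\<^sub>F Ran) (?res \<circ>\<^sub>F ?R)"
    by (rule adjoint_nat_iso[OF adjoint_comp[OF Lan NR]])
  moreover have "lex_functor PB M (?N \<circ>\<^sub>F Ran)"
    by (rule lex_comp[OF right_adjoint_lex[OF Ran] right_adjoint_lex[OF SN]])
  ultimately have kg: "geometric_morphism M PB k" by (simp add: geometric_morphism_def k_def)
  \<comment> \<open>From the inverse image of \<open>m\<close> to that of the composite in two
    steps: around the equivalence by \<theta>, then into the right Kan extension by \<rho>.\<close>
  have n1: "nat_trans ?S M ?m (?N \<circ>\<^sub>F ?H) (\<lambda>V. on_arr ?m (\<theta> V))"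
    using nat_trans_whisker_left[OF \<theta> mf] by (simp add: comp_ftor_assoc)
  have n2: "nat_trans ?S M (?N \<circ>\<^sub>F ?H) (?N \<circ>\<^sub>F Ran \<circ>\<^sub>F (?res \<circ>\<^sub>F ?H)) (\<lambda>V. on_arr ?N (\<rho> (on_obj ?H V)))"
    using nat_trans_whisker_left[OF nat_trans_whisker_right[OF \<rho> fibres_functor] Nf] by (simp add: comp_ftor_assoc)
  note n3 = nat_trans_comp[OF n1 n2]
  have i1: "iso_arr M (on_arr ?m (\<theta> V))" if "V \<in> Obj ?S" for V
    by (rule ftr.F_iso[OF ftrI[OF mf] \<theta>i[OF that]])
  have i2: "iso_arr M (on_arr ?N (\<rho> (on_obj ?H V)))" if V: "V \<in> Obj ?S" for V
  proof -
    have HV: "on_obj ?H V \<in> Obj PE" by (rule ftr.F_obj[OF ftrI[OF fibres_functor] V])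
    show ?thesis using nat_transE(3-5)[OF \<rho> HV] by (intro inv[OF _ \<rho>i[OF HV]]) (simp add: hom_def)
  qed
  have "iso_arr M (on_arr ?N (\<rho> (on_obj ?H V)) \<odot>\<^bsub>M\<^esub> on_arr ?m (\<theta> V))" if V: "V \<in> Obj ?S" for V
    using nat_transE(5)[OF n1 V] nat_transE(4)[OF n2 V] by (intro E.P.L.A.iso_comp i1[OF V] i2[OF V]) (simp del: slice_simps)
  then have "nat_isomorphic ?S M ?m (?N \<circ>\<^sub>F Ran \<circ>\<^sub>F (?res \<circ>\<^sub>F ?H))"
    using n3 unfolding nat_isomorphic_def by blast
  moreover have "inverse_image (d \<circ>\<^sub>G k) = ?N \<circ>\<^sub>F Ran \<circ>\<^sub>F (?res \<circ>\<^sub>F ?H)"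
    using d by (simp add: is_D_def comp_geom_def k_def restriction_ftor_pull)
  ultimately have "nat_isomorphic ?S M (inverse_image (d \<circ>\<^sub>G k)) ?m"
    using nat_isomorphic_sym by metis
  then show ?thesis using kg unfolding factors_through_def by blast
qed

end

theorem theorem6p6:
  fixes C :: "('o, 'a) cat"
    and X :: "('o, 'a, 'u) psh"
    and p :: "(('o, 'a, 'u) psh_arr,
               ('o, 'a, 'u) psh_arr \<times> ('o, 'a, 'u) psh_arr \<times> ('o, 'a, 'u) psh_arr,
               ('o, 'a, 'u) psh, ('o, 'a, 'u) psh_arr) geom"
    and \<gamma> :: "(('o, 'a, 'u) psh, ('o, 'a, 'u) psh_arr,
               'u set, 'u set \<times> ('u \<Rightarrow> 'u) \<times> 'u set) geom"
  assumes "grothendieck_universe TYPE('u)"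
    and "small_category TYPE('u) C"
    and "split_epi_mono_factorizations C"
    and "ascending_chain_condition C"
    and "X \<in> Obj (Psh C)"
    and "slice_geom (Psh C) X p"
    and "geometric_morphism (Psh C) Sets \<gamma>"
  shows "(\<exists>d. is_D C X d) \<and>
    (\<forall>d. is_D C X d \<longrightarrow>
       is_level_e TYPE('mo) TYPE('ma)
         (slice (Psh C) X) Sets (\<gamma> \<circ>\<^sub>G p)
         (Psh (minimal_subcat (elements C X))) d)"
proof -
  interpret site C "TYPE('u)" by (rule siteI) fact+
  interpret slice_site C "TYPE('u)" X by unfold_locales fact
  have f: "geometric_morphism (slice (Psh C) X) Sets (\<gamma> \<circ>\<^sub>G p)"
    using assms(6) by (intro geometric_comp[OF assms(7)]) (simp add: slice_geom_def)
  interpret B: site B "TYPE('u)" by (rule site_minimal)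
  \<comment> \<open>Between minimal objects all arrows are monic, which is the condition under which
    presheaves form an etendue over sets.\<close>
  have "etendue PB Sets (\<gamma> \<circ>\<^sub>G p \<circ>\<^sub>G d)" if d: "is_D C X d" for d
  proof (rule B.etendue_of_monos)
    show "mono_arr B f" if "f \<in> Arr B" for f by (rule El.minimal_subcat_mono[OF that])
    show "geometric_morphism PB Sets (\<gamma> \<circ>\<^sub>G p \<circ>\<^sub>G d)"
      using d by (intro geometric_comp[OF f]) (simp add: is_D_def)
  qed
  then show ?thesis
    unfolding is_level_e_def
    using is_D_exists level_D level_D_largest[OF assms(3,4) f] by blast
qed

end
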